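(* Let $\mathbb H$ be a homogeneous group. Let $N>0$, $\gamma/N<p,q<\infty$, $q\geq 1$ and $w \in A_{pN/\gamma}$. Let $\varphi^{(\ell)} \in \mathscr S$ with $\int \varphi^{(\ell)}\, dx=0$, $1\leq \ell\leq M$. Suppose that there exist $\eta^{(\ell)} \in \mathscr S$, $1\leq \ell\leq M$, for which $$\sum_{\ell=1}^M \int_{0}^\infty \varphi^{(\ell)}_{t}*\eta^{(\ell)}_{t}\,\frac{dt}{t} = \lim_{\epsilon\to 0,\; B\to \infty}\ \sum_{\ell=1}^M \int_{\epsilon}^B \varphi^{(\ell)}_{t}*\eta^{(\ell)}_{t}\,\frac{dt}{t}=\delta \quad \text{in } \mathscr S'.$$ Also suppose that $(\eta^{(m)}, X_k\varphi^{(\ell)})\in \mathscr C_{N+\epsilon, N}^{(1)}$ with some $\epsilon>0$ for $k=1, \dots, n$ and $\ell, m=1, \dots, M$. Let $\psi\in \mathscr S$ with $\int \psi \, dx=0$, and suppose that $(\eta^{(\ell)}, \psi) \in \mathscr C_{N+\epsilon, N}^{(1)}$ for some $\epsilon>0$ for $1\leq \ell\leq M$. Then there is a positive constant $C$ such that for all $f\in \mathscr S$ $$\left\|\left(\int_0^\infty\left((f*\psi_t)_{N,t^{-1}}^{**}\right)^q \frac{dt}{t}\right)^{1/q}\right\|_{L^p_w} \leq C\sum_{\ell=1}^M \left\|\left(\int_0^\infty|f*\varphi^{(\ell)}_t|^q\,\frac{dt}{t}\right)^{1/q}\right\|_{L^p_w},$$ with $C$ independent of $f$.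
   Context: Homogeneous group: $n\ge 2$ and $\mathbb H$ is $\mathbb R^n$ equipped with dilations $A_tx=(t^{a_1}x_1,\dots,t^{a_n}x_n)$, $t>0$, where $1=a_1\le a_2\le\dots\le a_n$ are real numbers, and with a nilpotent Lie group multiplication such that: Lebesgue measure $dx$ is a bi-invariant Haar measure; the identity is $0$ and $x^{-1}=-x$; $(\alpha x)(\beta x)=\alpha x+\beta x$ for $\alpha,\beta\in\mathbb R$; $A_t(xy)=(A_tx)(A_ty)$; and if $z=xy$ then $z_1=x_1+y_1$ and, for $k\ge2$, $z_k=x_k+y_k+R_k(x,y)$ with $R_k$ a polynomial in $x_1,\dots,x_{k-1},y_1,\dots,y_{k-1}$ of the form $\sum_{|I|\ne0,|J|\ne0,\,a(I)+a(J)=a_k}c^{(k)}_{I,J}x^Iy^J$, where for $I\in\mathbb N_0^n$, $|I|=i_1+\dots+i_n$, $a(I)=a_1i_1+\dots+a_ni_n$, $x^I=x_1^{i_1}\cdots x_n^{i_n}$. Put $\gamma=a_1+\dots+a_n$. $\rho$ is a fixed norm function on $\mathbb H$: $\rho$ is continuous on $\mathbb R^n$, smooth off $0$, $\rho(A_tx)=t\rho(x)$, $\rho(x+y)\le\rho(x)+\rho(y)$, $\rho(xy)\le c_0(\rho(x)+\rho(y))$ with a constant $c_0\ge1$, $\rho(x^{-1})=\rho(x)$; $\rho(x)\le1$ iff $|x|\le1$ and $\rho(x)=1$ iff $|x|=1$; and $\rho$ is bounded above and below by constant multiples of positive powers of $|x|$, both on $\{\rho\ge1\}$ and on $\{\rho\le1\}$.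 $\mathscr S$, $\mathscr S'$: usual Schwartz space and tempered distributions on $\mathbb R^n$; $\delta$: Dirac delta at $0$. Convolution: $F*G(x)=\int F(xy^{-1})G(y)\,dy$. $\varphi_t(x)=t^{-\gamma}\varphi(A_t^{-1}x)$. Left-invariant derivatives: $X_jf(x)=\left[\frac{d}{dt}f(x(te_j))\right]_{t=0}$, $e_j$ the standard basis vectors. Peetre maximal function: $F^{**}_{N,R}(x)=\sup_{y\in\mathbb H}\dfrac{|F(xy^{-1})|}{(1+R\rho(y))^N}$. For $\eta,\psi\in\mathscr S$, $t>0$, $L\ge0$: $C(\eta,\psi,t,L)=\int_{\mathbb H}(1+\rho(x))^L|\eta*\psi_t(x)|\,dx$. For $a,L\ge0$: $\mathscr C^{(1)}_{a,L}=\{(\eta,\psi)\in\mathscr S\times\mathscr S:\sup_{t\ge1}t^aC(\eta,\psi,t,L)<\infty\}$. Weights: balls are $B(x,t)=\{y\in\mathbb H:\rho(y^{-1}x)<t\}$. For $1<s<\infty$ a weight $w$ is in the Muckenhoupt class $A_s$ if $\sup_B\left(|B|^{-1}\int_Bw\,dx\right)\left(|B|^{-1}\int_Bw^{-1/(s-1)}dx\right)^{s-1}<\infty$, the supremum being over all balls $B$. $\|f\|_{L^p_w}=\left(\int_{\mathbb H}|f|^pw\,dx\right)^{1/p}$. *)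

theory Defs
  imports "HOL-Analysis.Analysis"
begin

definition partial_deriv :: "'n \<Rightarrow> (real^'n::finite \<Rightarrow> 'b::real_normed_vector) \<Rightarrow> real^'n \<Rightarrow> 'b" where
  "partial_deriv i f x = frechet_derivative f (at x) (axis i 1)"

definition iter_partial :: "'n list \<Rightarrow> (real^'n::finite \<Rightarrow> 'b::real_normed_vector) \<Rightarrow> real^'n \<Rightarrow> 'b" where
  "iter_partial is f = foldr partial_deriv is f"

text \<open>Intended for open \<open>S\<close>: partial derivatives of all orders exist and are differentiable on \<open>S\<close>.\<close>

definition smooth_on :: "(real^'n::finite) set \<Rightarrow> (real^'n \<Rightarrow> 'b::real_normed_vector) \<Rightarrow> bool" where
  "smooth_on S f \<longleftrightarrow> (\<forall>is. \<forall>x\<in>S. iter_partial is f differentiable (at x))"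

definition schwartz :: "(real^'n::finite \<Rightarrow> complex) set" where
  "schwartz = {f. smooth_on UNIV f \<and>
     (\<forall>k::nat. \<forall>is. \<exists>C. \<forall>x. norm x ^ k * cmod (iter_partial is f x) \<le> C)}"

definition function_distr :: "(real^'n::finite \<Rightarrow> complex) \<Rightarrow> (real^'n \<Rightarrow> complex) \<Rightarrow> complex" where
  "function_distr u \<theta> = (LINT x|lborel. u x * \<theta> x)"

definition dirac_delta :: "(real^'n::finite \<Rightarrow> complex) \<Rightarrow> complex" where
  "dirac_delta \<theta> = \<theta> 0"

text \<open>Convergence in the space of tempered distributions is taken in its usual weak-star sense.\<close>

definition tendsto_tempered ::
  "('e \<Rightarrow> (real^'n::finite \<Rightarrow> complex) \<Rightarrow> complex) \<Rightarrow> ((real^'n \<Rightarrow> complex) \<Rightarrow> complex) \<Rightarrow> 'e filter \<Rightarrow> bool" where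
  "tendsto_tempered T U F \<longleftrightarrow> (\<forall>\<theta>\<in>schwartz. ((\<lambda>e. T e \<theta>) \<longlongrightarrow> U \<theta>) F)"

text \<open>Only \<open>t > 0\<close> is meaningful.\<close>

definition dilation :: "('n::finite \<Rightarrow> real) \<Rightarrow> real \<Rightarrow> real^'n \<Rightarrow> real^'n" where
  "dilation a t x = (\<chi> i. t powr a i * x $ i)"

definition hom_dim :: "('n::finite \<Rightarrow> real) \<Rightarrow> real" where
  "hom_dim a = (\<Sum>i\<in>UNIV. a i)"

definition multi_length :: "('n::finite \<Rightarrow> nat) \<Rightarrow> nat" where
  "multi_length I = (\<Sum>i\<in>UNIV. I i)"

definition multi_weight :: "('n::finite \<Rightarrow> real) \<Rightarrow> ('n \<Rightarrow> nat) \<Rightarrow> real" where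
  "multi_weight a I = (\<Sum>i\<in>UNIV. a i * real (I i))"

definition monomial :: "real^'n::finite \<Rightarrow> ('n \<Rightarrow> nat) \<Rightarrow> real" where
  "monomial x I = (\<Prod>i\<in>UNIV. (x $ i) ^ I i)"

text \<open>The pairs of multi-indices occurring in \<open>R\<^sub>k\<close>; the vanishing condition says that \<open>R\<^sub>k\<close> involves
  only the coordinates preceding \<open>k\<close>. For the least \<open>k\<close> the set is empty, so that \<open>R\<^sub>k = 0\<close> there.\<close>

definition index_pairs :: "('n::{finite,linorder} \<Rightarrow> real) \<Rightarrow> 'n \<Rightarrow> (('n \<Rightarrow> nat) \<times> ('n \<Rightarrow> nat)) set" where
  "index_pairs a k = {(I, J). (\<forall>i\<ge>k. I i = 0 \<and> J i = 0) \<and> multi_length I \<noteq> 0 \<and> multi_length J \<noteq> 0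
     \<and> multi_weight a I + multi_weight a J = a k}"

text \<open>The group inverse is written as negation, as it is in every homogeneous group.\<close>

definition is_subgroup :: "(real^'n \<Rightarrow> real^'n \<Rightarrow> real^'n) \<Rightarrow> (real^'n::finite) set \<Rightarrow> bool" where
  "is_subgroup mul H \<longleftrightarrow> 0 \<in> H \<and> (\<forall>x\<in>H. \<forall>y\<in>H. mul x y \<in> H) \<and> (\<forall>x\<in>H. - x \<in> H)"

definition commutator :: "(real^'n \<Rightarrow> real^'n \<Rightarrow> real^'n) \<Rightarrow> real^'n::finite \<Rightarrow> real^'n \<Rightarrow> real^'n" where
  "commutator mul x y = mul (mul (mul x y) (- x)) (- y)"

primrec lower_central :: "(real^'n \<Rightarrow> real^'n \<Rightarrow> real^'n) \<Rightarrow> nat \<Rightarrow> (real^'n::finite) set" where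
  "lower_central mul 0 = UNIV"
| "lower_central mul (Suc k) = is_subgroup mul hull {commutator mul x y | x y. x \<in> lower_central mul k}"

text \<open>Smoothness of the multiplication is implied by its polynomial form.\<close>

locale homogeneous_group = group mul "0 :: real^'n::{finite,linorder}" uminus
  for mul :: "real^'n::{finite,linorder} \<Rightarrow> real^'n::{finite,linorder} \<Rightarrow> real^'n::{finite,linorder}" (infixl "\<odot>" 70) +
  fixes a :: "'n \<Rightarrow> real"
  assumes dim_ge_2: "CARD('n) \<ge> 2"
    and exponent_first: "a (Min UNIV) = 1"
    and exponents_mono: "mono a"
    and nilpotent: "\<exists>k. lower_central (\<odot>) k = {0}"
    and haar_left: "\<And>x. distr lborel borel (\<lambda>y. x \<odot> y) = lborel"
    and haar_right: "\<And>x. distr lborel borel (\<lambda>y. y \<odot> x) = lborel"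
    and one_parameter: "\<And>\<alpha> \<beta> x. (\<alpha> *\<^sub>R x) \<odot> (\<beta> *\<^sub>R x) = \<alpha> *\<^sub>R x + \<beta> *\<^sub>R x"
    and dilation_mult: "\<And>t x y. t > 0 \<Longrightarrow> dilation a t (x \<odot> y) = dilation a t x \<odot> dilation a t y"
    and polynomial_mult: "\<exists>c :: 'n \<Rightarrow> ('n \<Rightarrow> nat) \<Rightarrow> ('n \<Rightarrow> nat) \<Rightarrow> real. \<forall>k x y.
      (x \<odot> y) $ k = x $ k + y $ k
        + (\<Sum>(I, J)\<in>index_pairs a k. c k I J * monomial x I * monomial y J)"
begin

lemma exponent_ge_1: "a i \<ge> 1"
  using monoD[OF exponents_mono, of "Min UNIV" i] exponent_first by (simp add: Min_le)

text \<open>The sum over \<^term>\<open>index_pairs a k\<close> is a genuine finite sum.\<close>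

lemma finite_index_pairs: "finite (index_pairs a k)"
proof -
  define m where "m = nat \<lceil>a k\<rceil>"
  have S: "finite (Pi\<^sub>E UNIV (\<lambda>_ :: 'n. {..m}))"
    by (simp add: finite_PiE)
  have nn: "a i * real (I i) \<ge> 0" for I i
    using exponent_ge_1[of i] by simp
  have *: "real (I i) \<le> multi_weight a I" for I i
  proof -
    have "real (I i) \<le> a i * real (I i)"
      using mult_right_mono[OF exponent_ge_1[of i], of "real (I i)"] by simp
    also have "\<dots> \<le> multi_weight a I"
      unfolding multi_weight_def by (rule member_le_sum) (auto simp: nn)
    finally show ?thesis .
  qed
  have "I i \<le> m \<and> J i \<le> m" if "(I, J) \<in> index_pairs a k" for I J i
  proof -
    have "multi_weight a I + multi_weight a J = a k"
      using that by (simp add: index_pairs_def)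
    moreover have "multi_weight a I \<ge> 0" "multi_weight a J \<ge> 0"
      unfolding multi_weight_def by (auto intro!: sum_nonneg simp: nn)
    ultimately have "real (I i) \<le> a k" "real (J i) \<le> a k"
      using *[of I i] *[of J i] by linarith+
    then show ?thesis
      unfolding m_def by linarith
  qed
  then have "index_pairs a k \<subseteq> Pi\<^sub>E UNIV (\<lambda>_. {..m}) \<times> Pi\<^sub>E UNIV (\<lambda>_. {..m})"
    by auto
  then show ?thesis
    using S finite_subset by blast
qed

end

locale homogeneous_group_norm = homogeneous_group mul a
  for mul :: "real^'n::{finite,linorder} \<Rightarrow> real^'n::{finite,linorder} \<Rightarrow> real^'n::{finite,linorder}" (infixl "\<odot>" 70)
    and a :: "'n \<Rightarrow> real" +
  fixes \<rho> :: "real^'n::{finite,linorder} \<Rightarrow> real"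
  assumes rho_continuous: "continuous_on UNIV \<rho>"
    and rho_smooth: "smooth_on (- {0}) \<rho>"
    and rho_dilation: "\<And>t x. t > 0 \<Longrightarrow> \<rho> (dilation a t x) = t * \<rho> x"
    and rho_add: "\<And>x y. \<rho> (x + y) \<le> \<rho> x + \<rho> y"
    and rho_mult: "\<exists>c\<^sub>0\<ge>1. \<forall>x y. \<rho> (x \<odot> y) \<le> c\<^sub>0 * (\<rho> x + \<rho> y)"
    and rho_inverse: "\<And>x. \<rho> (- x) = \<rho> x"
    and rho_le_1_iff: "\<And>x. \<rho> x \<le> 1 \<longleftrightarrow> norm x \<le> 1"
    and rho_eq_1_iff: "\<And>x. \<rho> x = 1 \<longleftrightarrow> norm x = 1"
    and rho_bounds_large: "\<exists>c\<^sub>1>0. \<exists>c\<^sub>2>0. \<exists>\<alpha>\<^sub>1>0. \<exists>\<alpha>\<^sub>2>0. \<forall>x. \<rho> x \<ge> 1 \<longrightarrow>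
      c\<^sub>1 * norm x powr \<alpha>\<^sub>1 \<le> \<rho> x \<and> \<rho> x \<le> c\<^sub>2 * norm x powr \<alpha>\<^sub>2"
    and rho_bounds_small: "\<exists>c\<^sub>1>0. \<exists>c\<^sub>2>0. \<exists>\<alpha>\<^sub>1>0. \<exists>\<alpha>\<^sub>2>0. \<forall>x. \<rho> x \<le> 1 \<longrightarrow>
      c\<^sub>1 * norm x powr \<alpha>\<^sub>1 \<le> \<rho> x \<and> \<rho> x \<le> c\<^sub>2 * norm x powr \<alpha>\<^sub>2"

definition convolve ::
  "(real^'n \<Rightarrow> real^'n \<Rightarrow> real^'n) \<Rightarrow> (real^'n \<Rightarrow> complex) \<Rightarrow> (real^'n \<Rightarrow> complex) \<Rightarrow> real^'n::finite \<Rightarrow> complex" where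
  "convolve mul F G x = (LINT y|lborel. F (mul x (- y)) * G y)"

definition dilate :: "('n::finite \<Rightarrow> real) \<Rightarrow> (real^'n \<Rightarrow> complex) \<Rightarrow> real \<Rightarrow> real^'n \<Rightarrow> complex" where
  "dilate a \<phi> t x = of_real (t powr (- hom_dim a)) * \<phi> (dilation a (inverse t) x)"

definition left_deriv ::
  "(real^'n \<Rightarrow> real^'n \<Rightarrow> real^'n) \<Rightarrow> 'n::finite \<Rightarrow> (real^'n \<Rightarrow> complex) \<Rightarrow> real^'n \<Rightarrow> complex" where
  "left_deriv mul j f x = vector_derivative (\<lambda>t. f (mul x (t *\<^sub>R axis j 1))) (at 0)"

definition peetre_max ::
  "(real^'n \<Rightarrow> real^'n \<Rightarrow> real^'n) \<Rightarrow> (real^'n \<Rightarrow> real) \<Rightarrow> real \<Rightarrow> real \<Rightarrow> (real^'n \<Rightarrow> complex) \<Rightarrow> real^'n::finite \<Rightarrow> ennreal" where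
  "peetre_max mul \<rho> N R F x =
     (SUP y. ennreal (cmod (F (mul x (- y))) / (1 + R * \<rho> y) powr N))"

definition conv_moment ::
  "(real^'n::finite \<Rightarrow> real^'n \<Rightarrow> real^'n) \<Rightarrow> ('n \<Rightarrow> real) \<Rightarrow> (real^'n \<Rightarrow> real) \<Rightarrow>
   (real^'n \<Rightarrow> complex) \<Rightarrow> (real^'n \<Rightarrow> complex) \<Rightarrow> real \<Rightarrow> real \<Rightarrow> ennreal" where
  "conv_moment mul a \<rho> \<eta> \<psi> t L =
     (\<integral>\<^sup>+x. ennreal ((1 + \<rho> x) powr L * cmod (convolve mul \<eta> (dilate a \<psi> t) x)) \<partial>lborel)"

definition class_C1 ::
  "(real^'n::finite \<Rightarrow> real^'n \<Rightarrow> real^'n) \<Rightarrow> ('n \<Rightarrow> real) \<Rightarrow> (real^'n \<Rightarrow> real) \<Rightarrow>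
   real \<Rightarrow> real \<Rightarrow> ((real^'n \<Rightarrow> complex) \<times> (real^'n \<Rightarrow> complex)) set" where
  "class_C1 mul a \<rho> b L = {(\<eta>, \<psi>). \<eta> \<in> schwartz \<and> \<psi> \<in> schwartz \<and>
     (SUP t\<in>{1..}. ennreal (t powr b) * conv_moment mul a \<rho> \<eta> \<psi> t L) < \<infinity>}"

text \<open>Real powers on \<open>[0, \<infinity>]\<close>, for exponents \<open>r > 0\<close> only.\<close>

definition epowr :: "ennreal \<Rightarrow> real \<Rightarrow> ennreal" where
  "epowr u r = (if u = \<infinity> then \<infinity> else ennreal (enn2real u powr r))"

definition gball ::
  "(real^'n \<Rightarrow> real^'n \<Rightarrow> real^'n) \<Rightarrow> (real^'n \<Rightarrow> real) \<Rightarrow> real^'n \<Rightarrow> real \<Rightarrow> (real^'n::finite) set" where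
  "gball mul \<rho> x t = {y. \<rho> (mul (- y) x) < t}"

definition average :: "(real^'n::finite) set \<Rightarrow> (real^'n \<Rightarrow> ennreal) \<Rightarrow> ennreal" where
  "average B u = (\<integral>\<^sup>+x\<in>B. u x \<partial>lebesgue) / emeasure lebesgue B"

definition weight :: "(real^'n::finite \<Rightarrow> real) \<Rightarrow> bool" where
  "weight w \<longleftrightarrow> (\<forall>x. 0 \<le> w x) \<and> w \<in> borel_measurable lebesgue \<and>
     (\<forall>K. compact K \<longrightarrow> set_integrable lebesgue K w)"

text \<open>The inverse is taken in \<^typ>\<open>ennreal\<close>, so \<open>w\<^bsup>-1/(s-1)\<^esup>\<close> is \<open>\<infinity>\<close> where \<open>w\<close> vanishes (a real
  power would give \<open>0\<close> there).\<close>

definition muckenhoupt ::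
  "(real^'n::finite \<Rightarrow> real^'n \<Rightarrow> real^'n) \<Rightarrow> (real^'n \<Rightarrow> real) \<Rightarrow> real \<Rightarrow> (real^'n \<Rightarrow> real) set" where
  "muckenhoupt mul \<rho> s = {w. weight w \<and>
     (SUP B\<in>{gball mul \<rho> x t | x t. t > 0}.
        average B (\<lambda>x. ennreal (w x)) *
        epowr (average B (\<lambda>x. inverse (ennreal (w x powr (1 / (s - 1)))))) (s - 1)) < \<infinity>}"

definition Lp_weighted :: "real \<Rightarrow> (real^'n::finite \<Rightarrow> real) \<Rightarrow> (real^'n \<Rightarrow> ennreal) \<Rightarrow> ennreal" where
  "Lp_weighted p w g = epowr (\<integral>\<^sup>+x. epowr (g x) p * ennreal (w x) \<partial>lebesgue) (1 / p)"

definition Lq_dt_over_t :: "real \<Rightarrow> (real \<Rightarrow> ennreal) \<Rightarrow> ennreal" where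
  "Lq_dt_over_t q h = epowr (\<integral>\<^sup>+t\<in>{0<..}. epowr (h t) q * ennreal (1 / t) \<partial>lborel) (1 / q)"

end

theory Submission
  imports Defs
begin

text \<open>The weight enters only at the end. Before that, the Peetre functions of \<open>f * \<psi>\<^sub>t\<close> are estimated
  pointwise in \<open>x\<close>, in two steps.

  Testing the identity for the Dirac distribution against \<open>y \<mapsto> f (x y\<^sup>-\<^sup>1)\<close> gives the Calderon
  reproducing formula \<open>f = \<Sum>\<^sub>l \<integral> (f * \<phi>\<^sup>l\<^sub>t) * \<eta>\<^sup>l\<^sub>t dt/t\<close>, which converges absolutely because \<open>\<phi>\<^sup>l\<close> has
  mean zero. Convolving it with \<open>\<psi>\<^sub>s\<close> writes \<open>f * \<psi>\<^sub>s\<close> as a superposition of the \<open>f * \<phi>\<^sup>l\<^sub>t\<close> with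
  kernels \<open>\<eta>\<^sup>l\<^sub>t * \<psi>\<^sub>s\<close>. Their moments of order \<open>N\<close> decay like a power of \<open>min(s/t, t/s)\<close>: for \<open>s \<ge> t\<close>
  by the hypothesis on \<open>(\<eta>\<^sup>l, \<psi>)\<close>, whose exponent \<open>N + \<epsilon>\<close> also pays for the change of scale in the
  Peetre weight, and for \<open>s \<le> t\<close> because \<open>\<psi>\<close> has mean zero. Schur's test then bounds the \<open>L\<^sup>q(dt/t)\<close>
  norm of the Peetre functions of \<open>f * \<psi>\<^sub>t\<close> by those of the \<open>f * \<phi>\<^sup>l\<^sub>t\<close> (lemma
  \<open>Pm_norm_le_superposition\<close>).

  The Peetre functions of \<open>f * \<phi>\<^sup>l\<^sub>t\<close> are removed by comparing \<open>f * \<phi>\<^sup>l\<^sub>t\<close> at a point with its average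
  over a ball of radius \<open>\<delta> t\<close>. With \<open>r = \<gamma>/N\<close>, the average of the \<open>r\<close>-th power is at most a power of
  \<open>\<delta>\<^sup>-\<^sup>1\<close> times the Hardy-Littlewood maximal function of \<open>|f * \<phi>\<^sup>l\<^sub>t|\<^sup>r\<close>, and the oscillation is \<open>\<delta>\<close>
  times a Peetre function of \<open>f * (X\<^sub>k \<phi>\<^sup>l)\<^sub>t\<close>. Here the hypothesis on \<open>(\<eta>\<^sup>m, X\<^sub>k \<phi>\<^sup>l)\<close> is used: the first
  step, applied to \<open>X\<^sub>k \<phi>\<^sup>l\<close> in place of \<open>\<psi>\<close>, bounds the oscillation by the quantity under
  consideration. For a Schwartz function \<open>f\<close> that quantity is finite at each point, so for small \<open>\<delta>\<close>
  it can be absorbed (lemma \<open>Pm_norm_le_maxop\<close>).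

  What remains is a vector-valued weighted maximal inequality with the exponents \<open>p/r > 1\<close> and
  \<open>q/r > 1\<close> and a weight in \<open>A\<close> of index \<open>p/r = pN/\<gamma>\<close>. It is proved on any space of homogeneous type
  (theorem \<open>Fefferman_Stein_weighted\<close>): Muckenhoupt's theorem follows from Lerner's pointwise
  estimate, which only needs the maximal operators of the doubling measures given by the weight and
  its dual, and the vector-valued case is extrapolated from the exponents \<open>P = Q\<close> by the Rubio de
  Francia algorithm. A weight in the Muckenhoupt class vanishes almost everywhere, and then both
  sides are zero, or it is positive almost everywhere (lemma \<open>muckenhoupt_cases\<close>).\<close>

section \<open>Real powers on the extended half-line\<close>

lemma epowr_ennreal [simp]: "x \<ge> 0 \<Longrightarrow> epowr (ennreal x) r = ennreal (x powr r)"
  by (simp add: epowr_def)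

lemma epowr_top [simp]: "epowr top r = top"
  by (simp add: epowr_def)

lemma epowr_0 [simp]: "epowr 0 r = 0"
  by (simp add: epowr_def)

lemma epowr_one_right [simp]: "epowr u 1 = u"
  by (cases u) auto

lemma epowr_mono: "u \<le> v \<Longrightarrow> r \<ge> 0 \<Longrightarrow> epowr u r \<le> epowr v r"
  by (cases u; cases v) (auto simp: powr_mono2 top_unique ennreal_leI)

lemma epowr_epowr [simp]: "epowr (epowr u r) s = epowr u (r * s)"
  by (cases u) (auto simp: powr_powr)

lemma epowr_add_exponent: "epowr u r * epowr u s = epowr u (r + s)"
  by (cases u) (auto simp: powr_add ennreal_mult ennreal_top_mult)

lemma epowr_mult:
  assumes "r > 0"
  shows "epowr (u * v) r = epowr u r * epowr v r"
proof (cases "u = 0 \<or> v = 0")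
  case False
  show ?thesis
  proof (cases u)
    case (real x)
    show ?thesis
    proof (cases v)
      case (real y)
      then show ?thesis using \<open>u = ennreal x\<close> \<open>0 \<le> x\<close>
        by (simp add: ennreal_mult[symmetric] powr_mult)
    next
      case top
      have "x > 0" using False real by (cases "x = 0") auto
      then show ?thesis using top real
        by (simp add: ennreal_mult_top)
    qed
  next
    case top
    then show ?thesis using False
      by (cases v) (auto simp: ennreal_top_mult)
  qed
qed auto

lemma epowr_le_iff: "r > 0 \<Longrightarrow> epowr u r \<le> v \<longleftrightarrow> u \<le> epowr v (1 / r)"
  using epowr_mono[of u "epowr v (1 / r)" r] epowr_mono[of "epowr u r" v "1 / r"]
  by auto

lemma epowr_SUP:
  assumes "r > 0"
  shows "epowr (SUP i\<in>I. f i) r = (SUP i\<in>I. epowr (f i) r)"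
proof (rule antisym)
  show "epowr (SUP i\<in>I. f i) r \<le> (SUP i\<in>I. epowr (f i) r)"
    unfolding epowr_le_iff[OF assms] SUP_le_iff
    by (auto simp: epowr_le_iff[OF assms, symmetric] intro!: SUP_upper)
  show "(SUP i\<in>I. epowr (f i) r) \<le> epowr (SUP i\<in>I. f i) r"
    using assms by (intro SUP_least epowr_mono SUP_upper) auto
qed

lemma epowr_eq_0_iff [simp]: "epowr u r = 0 \<longleftrightarrow> u = 0"
  by (cases u) (auto simp: ennreal_eq_0_iff)

lemma epowr_eq_top_iff [simp]: "epowr u r = top \<longleftrightarrow> u = top"
  by (cases u) auto

lemma epowr_less_top_iff [simp]: "epowr u r < top \<longleftrightarrow> u < top"
  by (cases u) auto

lemma measurable_epowr [measurable (raw)]: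
  assumes "f \<in> borel_measurable M"
  shows "(\<lambda>x. epowr (f x) r) \<in> borel_measurable M"
proof (rule measurable_compose[OF assms])
  have "{u :: ennreal. u = top} \<in> sets borel"
    by simp
  then show "(\<lambda>u. epowr u r) \<in> borel_measurable borel"
    unfolding epowr_def infinity_ennreal_def by (intro measurable_If) auto
qed

lemma epowr_sum_le:
  assumes "finite A" "r > 0"
  shows "epowr (\<Sum>i\<in>A. f i) r \<le> ennreal (real (card A) powr r) * (\<Sum>i\<in>A. epowr (f i) r)"
proof (cases "A = {}")
  case False
  define c where "c = Max (f ` A)"
  have "c \<in> f ` A"
    unfolding c_def using False assms by (intro Max_in) auto
  then obtain j where j: "j \<in> A" "c = f j"
    by blast
  have "(\<Sum>i\<in>A. f i) \<le> of_nat (card A) * c"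
    by (rule sum_bounded_above) (use assms in \<open>auto simp: c_def\<close>)
  then have "epowr (\<Sum>i\<in>A. f i) r \<le> epowr (ennreal (real (card A)) * c) r"
    using assms by (intro epowr_mono) (auto simp: ennreal_of_nat_eq_real_of_nat)
  also have "\<dots> = ennreal (real (card A) powr r) * epowr (f j) r"
    using assms j by (simp add: epowr_mult)
  also have "\<dots> \<le> ennreal (real (card A) powr r) * (\<Sum>i\<in>A. epowr (f i) r)"
    using assms j by (intro mult_left_mono member_le_sum) auto
  finally show ?thesis .
qed auto

lemma epowr_add_le:
  assumes "r > 0"
  shows "epowr (u + v) r \<le> ennreal (2 powr r) * (epowr u r + epowr v r)"
  using epowr_sum_le[of "UNIV :: bool set" r "\<lambda>b. if b then u else v"] assms
  by (simp add: UNIV_bool add.commute)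

text \<open>Either side of a Young inequality dominates outright, so the constants \<open>1/P\<close> and \<open>1/Q\<close> can be
  dropped. This is used in place of sharp forms throughout.\<close>

lemma Young_ennreal:
  assumes "P > 1" "Q > 1" "1 / P + 1 / Q = 1"
  shows "u * v \<le> epowr u P + epowr v Q"
proof -
  have PQ: "P = 1 + P / Q" "Q = 1 + Q / P"
    using assms by (simp_all add: field_simps)
  show ?thesis
  proof (cases "v \<le> epowr u (P / Q)")
    case True
    have "u * v \<le> epowr u 1 * epowr u (P / Q)"
      using True by (simp add: mult_left_mono)
    also have "\<dots> = epowr u P"
      using PQ by (subst epowr_add_exponent) simp
    finally show ?thesis by (simp add: add_increasing2)
  next
    case False
    then have "epowr u (P / Q) \<le> v" by simp
    then have "u \<le> epowr v (Q / P)"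
      using assms epowr_le_iff[of "P / Q" u v] by simp
    then have "u * v \<le> epowr v (Q / P) * epowr v 1"
      by (simp add: mult_right_mono)
    also have "\<dots> = epowr v Q"
      using PQ by (subst epowr_add_exponent) (simp add: add.commute)
    finally show ?thesis by (simp add: add_increasing)
  qed
qed

text \<open>For \<open>u > v\<close> the second term alone exceeds \<open>u\<close>. With an \<open>A\<^sub>1\<close> weight in place of \<open>v\<close>, the power
  \<open>v\<^sup>1\<^sup>-\<^sup>Q\<close> becomes part of an \<open>A\<^sub>Q\<close> weight.\<close>

lemma le_add_epowr:
  assumes "v > 0" "Q \<ge> 1"
  shows "u \<le> ennreal v + epowr u Q * ennreal (v powr (1 - Q))"
proof (cases "u \<le> ennreal v")
  case True
  then show ?thesis by (simp add: add_increasing2)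
next
  case False
  show ?thesis
  proof (cases u)
    case (real x)
    with False assms have x: "x > v" by (simp add: not_le ennreal_less_iff)
    have "x = x powr Q * x powr (1 - Q)"
      using x assms by (simp add: powr_add[symmetric])
    also have "\<dots> \<le> x powr Q * v powr (1 - Q)"
      using x assms by (intro mult_left_mono powr_mono2') auto
    finally have "u \<le> epowr u Q * ennreal (v powr (1 - Q))"
      using real by (simp add: ennreal_mult[symmetric])
    then show ?thesis by (simp add: add_increasing)
  qed (use assms in \<open>auto simp: ennreal_top_mult\<close>)
qed

text \<open>The constant \<open>2\<close> comes from the Young inequality without the factors \<open>1/P\<close> and \<open>1/Q\<close>.\<close>

lemma Holder_nn_integral:
  assumes PQ: "P > 1" "Q > 1" "1 / P + 1 / Q = 1"
    and [measurable]: "f \<in> borel_measurable M" "g \<in> borel_measurable M"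
  shows "(\<integral>\<^sup>+x. f x * g x \<partial>M) \<le>
    2 * epowr (\<integral>\<^sup>+x. epowr (f x) P \<partial>M) (1 / P) * epowr (\<integral>\<^sup>+x. epowr (g x) Q \<partial>M) (1 / Q)"
    (is "_ \<le> 2 * epowr ?A _ * epowr ?B _")
proof -
  have zero: ?thesis if "?A = 0 \<or> ?B = 0"
  proof -
    have "AE x in M. f x * g x = 0"
      using that by (subst (asm) (1 2) nn_integral_0_iff_AE) (auto elim!: AE_mp)
    then have "(\<integral>\<^sup>+x. f x * g x \<partial>M) = 0"
      by (subst nn_integral_0_iff_AE) auto
    then show ?thesis by simp
  qed
  have infinite: ?thesis if "?A = top \<or> ?B = top" "?A \<noteq> 0" "?B \<noteq> 0"
    using that by (auto simp: ennreal_top_mult ennreal_mult_top ennreal_mult_eq_top_iff)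
  have ?thesis if fin: "?A \<noteq> 0" "?B \<noteq> 0" "?A \<noteq> top" "?B \<noteq> top"
  proof -
    obtain A B where AB: "?A = ennreal A" "A > 0" "?B = ennreal B" "B > 0"
      using fin by (metis ennreal_cases ennreal_0 less_eq_real_def)
    define \<alpha> \<beta> where "\<alpha> = A powr (- (1 / P))" and "\<beta> = B powr (- (1 / Q))"
    have pos: "\<alpha> > 0" "\<beta> > 0" using AB by (auto simp: \<alpha>_def \<beta>_def)
    have inv: "\<alpha> powr P * A = 1" "\<beta> powr Q * B = 1"
      using AB PQ unfolding \<alpha>_def \<beta>_def powr_powr by (simp_all add: powr_minus)
    have "ennreal (\<alpha> * \<beta>) * (\<integral>\<^sup>+x. f x * g x \<partial>M) = (\<integral>\<^sup>+x. (ennreal \<alpha> * f x) * (ennreal \<beta> * g x) \<partial>M)"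
      using pos by (subst nn_integral_cmult[symmetric]) (auto simp: ennreal_mult' mult_ac)
    also have "\<dots> \<le> (\<integral>\<^sup>+x. epowr (ennreal \<alpha> * f x) P + epowr (ennreal \<beta> * g x) Q \<partial>M)"
      by (intro nn_integral_mono Young_ennreal PQ)
    also have "\<dots> = ennreal (\<alpha> powr P) * ?A + ennreal (\<beta> powr Q) * ?B"
      using PQ pos by (simp add: epowr_mult nn_integral_add nn_integral_cmult)
    also have "\<dots> = 2"
      unfolding AB(1,3) using inv pos AB(2,4)
      by (subst (1 2) ennreal_mult[symmetric]) (simp_all add: one_add_one)
    finally have le2: "ennreal (\<alpha> * \<beta>) * (\<integral>\<^sup>+x. f x * g x \<partial>M) \<le> 2" .
    have "A powr (1 / P) * \<alpha> = 1" "B powr (1 / Q) * \<beta> = 1"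
      using AB by (auto simp: \<alpha>_def \<beta>_def powr_add[symmetric])
    then have one: "(A powr (1 / P) * B powr (1 / Q)) * (\<alpha> * \<beta>) = 1"
      by (metis mult.assoc mult.commute mult.right_neutral)
    have "(\<integral>\<^sup>+x. f x * g x \<partial>M)
        = ennreal ((A powr (1 / P) * B powr (1 / Q)) * (\<alpha> * \<beta>)) * (\<integral>\<^sup>+x. f x * g x \<partial>M)"
      by (simp only: one) simp
    also have "\<dots> = ennreal (A powr (1 / P) * B powr (1 / Q)) * (ennreal (\<alpha> * \<beta>) * (\<integral>\<^sup>+x. f x * g x \<partial>M))"
      using pos by (subst ennreal_mult) (auto simp: mult_ac)
    also have "\<dots> \<le> ennreal (A powr (1 / P) * B powr (1 / Q)) * 2"
      by (intro mult_left_mono le2) auto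
    also have "\<dots> = 2 * epowr ?A (1 / P) * epowr ?B (1 / Q)"
      using AB by (simp add: ennreal_mult mult_ac)
    finally show ?thesis .
  qed
  then show ?thesis using zero infinite by blast
qed

text \<open>The layer cake formula for a single value \<open>u\<close>, which may be infinite.\<close>

lemma nn_integral_less_than_powr:
  assumes "b > -1"
  shows "(\<integral>\<^sup>+t\<in>{0<..}. indicator {t. ennreal t < u} t * ennreal (t powr b) \<partial>lborel)
    = epowr u (b + 1) * ennreal (1 / (b + 1))" (is "?I = _")
proof -
  have fin: "(\<integral>\<^sup>+t\<in>{0<..}. indicator {t. ennreal t < ennreal x} t * ennreal (t powr b) \<partial>lborel)
    = ennreal (x powr (b + 1) / (b + 1))" if "x \<ge> 0" for x
  proof -
    have "(\<integral>\<^sup>+t\<in>{0<..}. indicator {t. ennreal t < ennreal x} t * ennreal (t powr b) \<partial>lborel)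
      = (\<integral>\<^sup>+t. ennreal (t powr b) * indicator {0..x} t \<partial>lborel)"
    proof (rule nn_integral_cong_AE)
      have "AE t in lborel. t \<noteq> (0::real)" "AE t in lborel. t \<noteq> x"
        by (rule AE_lborel_singleton)+
      then show "AE t in lborel. indicator {t. ennreal t < ennreal x} t * ennreal (t powr b) * indicator {0<..} t
          = ennreal (t powr b) * indicator {0..x} t"
        by eventually_elim (use that in \<open>auto simp: ennreal_less_iff split: split_indicator\<close>)
    qed
    also have "\<dots> = ennreal (x powr (b + 1) / (b + 1))"
      using nn_integral_has_integral_lebesgue[OF _ has_integral_powr_from_0[OF assms that]]
      by (simp add: ennreal_mult' ennreal_indicator mult.commute)
    finally show ?thesis .
  qed
  show ?thesis
  proof (cases u)
    case (real x)
    then show ?thesis using fin[of x] assms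
      by (simp add: ennreal_mult[symmetric])
  next
    case top
    have "ennreal (x powr (b + 1) / (b + 1)) \<le>
      (\<integral>\<^sup>+t\<in>{0<..}. indicator {t. ennreal t < u} t * ennreal (t powr b) \<partial>lborel)" if "x \<ge> 0" for x
      unfolding fin[OF that, symmetric]
      by (intro nn_integral_mono mult_right_mono) (auto simp: top split: split_indicator)
    note le = this
    have "?I = top"
    proof (rule ccontr)
      assume "?I \<noteq> top"
      then obtain y where y: "?I = ennreal y" "y \<ge> 0"
        by (cases ?I) auto
      define x where "x = ((y + 1) * (b + 1)) powr (1 / (b + 1))"
      have "x powr (b + 1) / (b + 1) = y + 1"
        using assms y by (simp add: x_def powr_powr)
      then show False
        using le[of x] y by (simp add: x_def)
    qed
    then show ?thesis using top assms by (simp add: ennreal_top_mult)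
  qed
qed

section \<open>Maximal functions on spaces of homogeneous type\<close>

definition qball :: "('a \<Rightarrow> 'a \<Rightarrow> real) \<Rightarrow> 'a \<Rightarrow> real \<Rightarrow> 'a set" where
  "qball d x t = {y. d x y < t}"

text \<open>Dyadic radii make this a countable supremum; by doubling, arbitrary radii would only change it by a
  bounded factor.\<close>

definition maxop :: "('a \<Rightarrow> 'a \<Rightarrow> real) \<Rightarrow> 'a measure \<Rightarrow> ('a \<Rightarrow> ennreal) \<Rightarrow> 'a \<Rightarrow> ennreal" where
  "maxop d m g x = (SUP k::int. (\<integral>\<^sup>+y\<in>qball d x (2 powr k). g y \<partial>m) / emeasure m (qball d x (2 powr k)))"

text \<open>Greedy selection from the largest radius downwards: at each radius a maximal disjoint
  subfamily of the balls that avoid those already chosen exists by Zorn's lemma. Having only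
  finitely many radii replaces the usual boundedness assumption and makes an induction possible.\<close>

lemma Vitali_finitely_many_radii:
  fixes S :: "('a \<times> real) set"
  assumes "finite R" "S \<subseteq> UNIV \<times> R" and ne: "\<And>x r. (x, r) \<in> S \<Longrightarrow> x \<in> qball d x r"
  shows "\<exists>C\<subseteq>S. pairwise (\<lambda>s t. disjnt (qball d (fst s) (snd s)) (qball d (fst t) (snd t))) C \<and>
    (\<forall>s\<in>S. \<exists>c\<in>C. snd s \<le> snd c \<and> qball d (fst s) (snd s) \<inter> qball d (fst c) (snd c) \<noteq> {})"
  using assms
proof (induction R arbitrary: S rule: finite_linorder_min_induct)
  case empty
  then show ?case by auto
next
  case (insert r R)
  let ?B = "\<lambda>s :: 'a \<times> real. qball d (fst s) (snd s)"
  define S' where "S' = {s\<in>S. snd s \<in> R}"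
  have "\<exists>C\<subseteq>S'. pairwise (\<lambda>s t. disjnt (?B s) (?B t)) C \<and>
    (\<forall>s\<in>S'. \<exists>c\<in>C. snd s \<le> snd c \<and> ?B s \<inter> ?B c \<noteq> {})"
    by (rule insert.IH) (use insert.prems in \<open>auto simp: S'_def\<close>)
  then obtain C' where C': "C' \<subseteq> S'" "pairwise (\<lambda>s t. disjnt (?B s) (?B t)) C'"
    "\<And>s. s \<in> S' \<Longrightarrow> \<exists>c\<in>C'. snd s \<le> snd c \<and> ?B s \<inter> ?B c \<noteq> {}"
    by blast
  define S'' where "S'' = {s\<in>S. snd s = r \<and> (\<forall>c\<in>C'. disjnt (?B s) (?B c))}"
  define A where "A = {C. C \<subseteq> S'' \<and> pairwise (\<lambda>s t. disjnt (?B s) (?B t)) C}"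
  have "\<exists>M\<in>A. \<forall>X\<in>A. M \<subseteq> X \<longrightarrow> X = M"
  proof (rule subset_Zorn')
    fix C assume C: "subset.chain A C"
    show "\<Union>C \<in> A"
      unfolding A_def mem_Collect_eq
    proof (intro conjI)
      show "\<Union>C \<subseteq> S''"
        using C by (auto simp: subset_chain_def A_def)
      show "pairwise (\<lambda>s t. disjnt (?B s) (?B t)) (\<Union>C)"
        unfolding pairwise_def
      proof (intro ballI impI)
        fix s t assume "s \<in> \<Union>C" "t \<in> \<Union>C" "s \<noteq> t"
        then obtain X Y where XY: "X \<in> C" "Y \<in> C" "s \<in> X" "t \<in> Y" by auto
        then have "X \<subseteq> Y \<or> Y \<subseteq> X" using C by (auto simp: subset_chain_def)
        then obtain Z where "Z \<in> C" "s \<in> Z" "t \<in> Z" using XY by auto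
        moreover have "Z \<in> A" using C \<open>Z \<in> C\<close> by (auto simp: subset_chain_def)
        ultimately show "disjnt (?B s) (?B t)"
          using \<open>s \<noteq> t\<close> by (auto simp: A_def pairwise_def)
      qed
    qed
  qed
  then obtain C'' where C'': "C'' \<in> A" "\<And>X. X \<in> A \<Longrightarrow> C'' \<subseteq> X \<Longrightarrow> X = C''" by blast
  have max: "\<exists>c\<in>C''. \<not> disjnt (?B s) (?B c)" if s: "s \<in> S''" for s
  proof (rule ccontr)
    assume n: "\<not> ?thesis"
    have "disjnt (?B s) (?B c)" "disjnt (?B c) (?B s)" if "c \<in> C''" for c
      using n that disjnt_sym by blast+
    then have "insert s C'' \<in> A"
      using C''(1) s by (simp add: A_def pairwise_insert)
    then have "s \<in> C''" using C''(2)[of "insert s C''"] by auto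
    moreover have "fst s \<in> ?B s"
      using insert.prems(2)[of "fst s" "snd s"] s by (auto simp: S''_def)
    ultimately show False using n by (auto simp: disjnt_def)
  qed
  show ?case
  proof (intro exI[of _ "C' \<union> C''"] conjI ballI)
    show "C' \<union> C'' \<subseteq> S"
      using C' C'' by (auto simp: S'_def S''_def A_def)
    show "pairwise (\<lambda>s t. disjnt (?B s) (?B t)) (C' \<union> C'')"
      unfolding pairwise_def
    proof (intro ballI impI)
      fix s t assume st: "s \<in> C' \<union> C''" "t \<in> C' \<union> C''" "s \<noteq> t"
      have "disjnt (?B s) (?B t)" if "s \<in> C'" "t \<in> C'"
        using that C'(2) st by (auto simp: pairwise_def)
      moreover have "disjnt (?B s) (?B t)" if "s \<in> C''" "t \<in> C''"
        using that C''(1) st by (auto simp: pairwise_def A_def)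
      moreover have "disjnt (?B s) (?B t)" if "s \<in> C''" "t \<in> C'"
        using that C''(1) by (auto simp: A_def S''_def)
      moreover have "disjnt (?B s) (?B t)" if "s \<in> C'" "t \<in> C''"
        using that C''(1) disjnt_sym unfolding A_def S''_def by blast
      ultimately show "disjnt (?B s) (?B t)" using st by blast
    qed
    fix s assume s: "s \<in> S"
    show "\<exists>c\<in>C' \<union> C''. snd s \<le> snd c \<and> ?B s \<inter> ?B c \<noteq> {}"
    proof (cases "s \<in> S'")
      case True
      then show ?thesis using C'(3) by blast
    next
      case False
      then have r: "snd s = r"
        using s insert.prems(1) by (cases s) (auto simp: S'_def)
      show ?thesis
      proof (cases "s \<in> S''")
        case True
        obtain c where c: "c \<in> C''" "\<not> disjnt (?B s) (?B c)"
          using max[OF True] by blast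
        moreover have "snd c = r" using c C''(1) by (auto simp: A_def S''_def)
        ultimately show ?thesis using r by (auto simp: disjnt_def)
      next
        case False
        then obtain c where c: "c \<in> C'" "\<not> disjnt (?B s) (?B c)"
          using s r by (auto simp: S''_def)
        moreover have "snd c \<in> R" using c C'(1) by (auto simp: S'_def)
        then have "r < snd c" using insert.hyps by auto
        ultimately show ?thesis using r unfolding disjnt_def by (intro bexI[of _ c]) auto
      qed
    qed
  qed
qed

text \<open>A quasi-metric with a doubling Borel measure. Balls are required to be open, so that the
  maximal operator is measurable.\<close>

locale homogeneous_type =
  fixes d :: "'a::second_countable_topology \<Rightarrow> 'a \<Rightarrow> real" and m :: "'a measure" and \<kappa> D :: real
  assumes sets_m [measurable_cong]: "sets m = sets borel"
    and d_sym: "d x y = d y x" and d_self: "d x x = 0"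
    and kappa_ge_1: "\<kappa> \<ge> 1" and D_ge_1: "D \<ge> 1"
    and quasi_triangle: "d x z \<le> \<kappa> * (d x y + d y z)"
    and open_qball: "open (qball d x t)"
    and measurable_d [measurable]: "(\<lambda>(x, y). d x y) \<in> borel_measurable (borel \<Otimes>\<^sub>M borel)"
    and qball_pos: "t > 0 \<Longrightarrow> emeasure m (qball d x t) \<noteq> 0"
    and qball_finite: "emeasure m (qball d x t) \<noteq> top"
    and doubling: "t > 0 \<Longrightarrow> emeasure m (qball d x (2 * t)) \<le> ennreal D * emeasure m (qball d x t)"
begin

lemma space_m [simp]: "space m = UNIV"
  using sets_eq_imp_space_eq[OF sets_m] by simp

lemma sets_qball [measurable]: "qball d x t \<in> sets borel"
  using open_qball by auto

lemma centre_in_qball: "t > 0 \<Longrightarrow> x \<in> qball d x t"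
  by (simp add: qball_def d_self)

lemma qball_mono: "s \<le> t \<Longrightarrow> qball d x s \<subseteq> qball d x t"
  by (auto simp: qball_def)

lemma Union_qball: "(\<Union>n::nat. qball d x (real n)) = UNIV"
  using reals_Archimedean2 by (auto simp: qball_def)

sublocale sigma_finite_measure m
proof
  show "\<exists>A. countable A \<and> A \<subseteq> sets m \<and> \<Union>A = space m \<and> (\<forall>a\<in>A. emeasure m a \<noteq> \<infinity>)"
    by (intro exI[of _ "range (\<lambda>n::nat. qball d undefined (real n))"])
       (use Union_qball qball_finite in \<open>auto simp: sets_m\<close>)
qed

text \<open>Enlarging a radius by the factor \<open>2\<^sup>J\<close> makes up for a change of centre; a power of two keeps
  dyadic radii dyadic.\<close>

definition J :: nat where "J = nat \<lceil>\<kappa>\<rceil> + 1"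

lemma two_kappa_le: "2 * \<kappa> \<le> 2 ^ J"
proof -
  have "\<kappa> \<le> real (nat \<lceil>\<kappa>\<rceil>)" by (rule real_nat_ceiling_ge)
  also have "\<dots> \<le> 2 ^ nat \<lceil>\<kappa>\<rceil>" by (rule less_imp_le[OF of_nat_less_two_power])
  finally show ?thesis by (simp add: J_def)
qed

lemma doubling_power:
  assumes "t > 0"
  shows "emeasure m (qball d x (2 ^ n * t)) \<le> ennreal (D ^ n) * emeasure m (qball d x t)"
proof (induction n)
  case (Suc n)
  have "emeasure m (qball d x (2 ^ Suc n * t)) \<le> ennreal D * emeasure m (qball d x (2 ^ n * t))"
    using doubling[of "2 ^ n * t" x] assms by (simp add: mult_ac)
  also have "\<dots> \<le> ennreal D * (ennreal (D ^ n) * emeasure m (qball d x t))"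
    by (intro mult_left_mono Suc) auto
  finally show ?case
    using D_ge_1 by (simp add: ennreal_mult' mult_ac)
qed auto

lemma meeting_qballs_subset:
  assumes "qball d x s \<inter> qball d y t \<noteq> {}" "s \<le> t" "t > 0"
  shows "x \<in> qball d y (2 ^ J * t)"
proof -
  obtain z where z: "d x z < s" "d y z < t"
    using assms(1) by (auto simp: qball_def)
  have "d y x \<le> \<kappa> * (d y z + d z x)" by (rule quasi_triangle)
  also have "\<dots> < \<kappa> * (t + t)"
    using z assms kappa_ge_1 by (intro mult_strict_left_mono) (auto simp: d_sym)
  also have "\<dots> \<le> 2 ^ J * t"
    using mult_right_mono[OF two_kappa_le, of t] assms by (simp add: algebra_simps)
  finally show ?thesis by (simp add: qball_def)
qed

lemma qball_subset_other_centre: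
  assumes "y \<in> qball d x t" "t > 0"
  shows "qball d x t \<subseteq> qball d y (2 ^ J * t)" "qball d y (2 ^ J * t) \<subseteq> qball d x (2 ^ (2 * J) * t)"
proof -
  show "qball d x t \<subseteq> qball d y (2 ^ J * t)"
  proof
    fix z assume "z \<in> qball d x t"
    then have z: "d x z < t" by (simp add: qball_def)
    have "d y z \<le> \<kappa> * (d y x + d x z)" by (rule quasi_triangle)
    also have "\<dots> < \<kappa> * (t + t)"
      using z assms kappa_ge_1 by (intro mult_strict_left_mono) (auto simp: d_sym qball_def)
    also have "\<dots> \<le> 2 ^ J * t"
      using mult_right_mono[OF two_kappa_le, of t] assms by (simp add: algebra_simps)
    finally show "z \<in> qball d y (2 ^ J * t)" by (simp add: qball_def)
  qed
  show "qball d y (2 ^ J * t) \<subseteq> qball d x (2 ^ (2 * J) * t)"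
  proof
    fix z assume "z \<in> qball d y (2 ^ J * t)"
    then have z: "d y z < 2 ^ J * t" by (simp add: qball_def)
    have ge: "t \<le> 2 ^ J * t" using assms mult_right_mono[of 1 "2 ^ J" t] by simp
    have "d x z \<le> \<kappa> * (d x y + d y z)" by (rule quasi_triangle)
    also have "d x y + d y z < 2 ^ J * t + 2 ^ J * t"
      using z ge assms(1) by (intro add_strict_mono) (auto simp: qball_def)
    then have "\<kappa> * (d x y + d y z) < \<kappa> * (2 ^ J * t + 2 ^ J * t)"
      using kappa_ge_1 by (intro mult_strict_left_mono) auto
    also have "\<dots> = (2 * \<kappa>) * (2 ^ J * t)" by simp
    also have "\<dots> \<le> 2 ^ J * (2 ^ J * t)"
      using two_kappa_le assms by (intro mult_right_mono) auto
    also have "\<dots> = 2 ^ (2 * J) * t" by (simp add: power_add[symmetric] mult_2)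
    finally show "z \<in> qball d x (2 ^ (2 * J) * t)" by (simp add: qball_def)
  qed
qed

lemma measurable_nn_integral_qball:
  assumes [measurable]: "g \<in> borel_measurable (N \<Otimes>\<^sub>M borel)" "h \<in> measurable N borel"
  shows "(\<lambda>x. \<integral>\<^sup>+y\<in>qball d (h x) t. g (x, y) \<partial>m) \<in> borel_measurable N"
proof -
  have [measurable]: "Measurable.pred (N \<Otimes>\<^sub>M borel) (\<lambda>z. d (h (fst z)) (snd z) < t)"
  proof -
    have "(\<lambda>z. (h (fst z), snd z)) \<in> measurable (N \<Otimes>\<^sub>M borel) (borel \<Otimes>\<^sub>M borel)"
      by measurable
    from measurable_compose[OF this measurable_d]
    have [measurable]: "(\<lambda>z. d (h (fst z)) (snd z)) \<in> borel_measurable (N \<Otimes>\<^sub>M borel)"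
      by simp
    show ?thesis by measurable
  qed
  have "(\<lambda>z. g z * (if d (h (fst z)) (snd z) < t then 1 else 0)) \<in> borel_measurable (N \<Otimes>\<^sub>M borel)"
    by measurable
  then have "(\<lambda>x. \<integral>\<^sup>+y. g (x, y) * (if d (h x) y < t then 1 else 0) \<partial>m) \<in> borel_measurable N"
    by (intro borel_measurable_nn_integral) (simp add: split_beta' cong: measurable_cong_sets)
  also have "(\<lambda>x. \<integral>\<^sup>+y. g (x, y) * (if d (h x) y < t then 1 else 0) \<partial>m)
      = (\<lambda>x. \<integral>\<^sup>+y\<in>qball d (h x) t. g (x, y) \<partial>m)"
    by (auto intro!: nn_integral_cong ext simp: qball_def indicator_def)
  finally show ?thesis .
qed

lemma measurable_emeasure_qball [measurable]:
  assumes "h \<in> measurable N borel"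
  shows "(\<lambda>x. emeasure m (qball d (h x) t)) \<in> borel_measurable N"
  using measurable_nn_integral_qball[OF borel_measurable_const assms, of 1 t]
  by (simp only: mult_1 nn_integral_indicator sets_m sets_qball)

lemma measurable_nn_integral_qball_const [measurable]:
  assumes [measurable]: "g \<in> borel_measurable borel"
  shows "(\<lambda>x. \<integral>\<^sup>+y\<in>qball d x t. g y \<partial>m) \<in> borel_measurable borel"
proof -
  have "(\<lambda>z. g (snd z)) \<in> borel_measurable (borel \<Otimes>\<^sub>M borel)"
    by measurable
  from measurable_nn_integral_qball[OF this measurable_ident] show ?thesis
    by (simp only: snd_conv id_apply)
qed

lemma measurable_maxop_pair:
  assumes [measurable]: "g \<in> borel_measurable (N \<Otimes>\<^sub>M borel)"
  shows "(\<lambda>z. maxop d m (\<lambda>y. g (snd z, y)) (fst z)) \<in> borel_measurable (borel \<Otimes>\<^sub>M N)"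
proof -
  have [measurable]: "(\<lambda>z. g (snd (fst z), snd z)) \<in> borel_measurable ((borel \<Otimes>\<^sub>M N) \<Otimes>\<^sub>M borel)"
    by (rule measurable_compose[OF _ assms]) measurable
  have [measurable]: "(\<lambda>z. \<integral>\<^sup>+y\<in>qball d (fst z) t. g (snd z, y) \<partial>m) \<in> borel_measurable (borel \<Otimes>\<^sub>M N)" for t
    using measurable_nn_integral_qball[of "\<lambda>z. g (snd (fst z), snd z)" "borel \<Otimes>\<^sub>M N" fst t] by simp
  show ?thesis
    unfolding maxop_def by measurable
qed

lemma measurable_maxop [measurable]:
  assumes [measurable]: "g \<in> borel_measurable borel"
  shows "maxop d m g \<in> borel_measurable borel"
  unfolding maxop_def by measurable

lemma average_le_maxop:
  "(\<integral>\<^sup>+y\<in>qball d x (2 powr real_of_int k). g y \<partial>m)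
    \<le> maxop d m g x * emeasure m (qball d x (2 powr real_of_int k))"
proof -
  let ?I = "\<integral>\<^sup>+y\<in>qball d x (2 powr real_of_int k). g y \<partial>m" and ?V = "emeasure m (qball d x (2 powr real_of_int k))"
  have "?I = ?I / ?V * ?V"
    using qball_pos[of "2 powr real_of_int k" x] qball_finite[of x "2 powr real_of_int k"]
    by (simp add: ennreal_divide_times ennreal_divide_self less_top)
  also have "?I / ?V \<le> maxop d m g x"
    unfolding maxop_def by (rule SUP_upper) simp
  finally show ?thesis by (simp add: mult_right_mono)
qed

lemma maxop_leI:
  assumes "\<And>k::int. (\<integral>\<^sup>+y\<in>qball d x (2 powr real_of_int k). g y \<partial>m) \<le> c * emeasure m (qball d x (2 powr real_of_int k))"
  shows "maxop d m g x \<le> c"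
  unfolding maxop_def
proof (rule SUP_least)
  fix k :: int
  show "(\<integral>\<^sup>+y\<in>qball d x (2 powr k). g y \<partial>m) / emeasure m (qball d x (2 powr k)) \<le> c"
    using assms[of k] qball_pos[of "2 powr real_of_int k" x]
    by (intro divide_le_posI_ennreal) (auto simp: zero_less_iff_neq_zero mult.commute)
qed

lemma maxop_mono: "(\<And>y. g y \<le> h y) \<Longrightarrow> maxop d m g x \<le> maxop d m h x"
  unfolding maxop_def by (intro SUP_mono' divide_right_mono_ennreal nn_integral_mono mult_right_mono) auto

text \<open>The standard covering argument: the enlargements by \<open>2\<^sup>J\<close> of the selected disjoint balls
  contain the centres of all balls with large average.\<close>

lemma weak_type_finitely_many_radii:
  assumes [measurable]: "g \<in> borel_measurable borel" and "finite ks" "l > 0"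
  defines "E \<equiv> {x. \<exists>k\<in>ks. ennreal l * emeasure m (qball d x (2 powr real_of_int k)) \<le> (\<integral>\<^sup>+y\<in>qball d x (2 powr real_of_int k). g y \<partial>m)}"
  shows "ennreal l * emeasure m E \<le> ennreal (D ^ J) * (\<integral>\<^sup>+x. g x \<partial>m)"
proof -
  let ?B = "\<lambda>s. qball d (fst s) (snd s)"
  define S where "S = {(x, 2 powr real_of_int k) | x k. k \<in> ks \<and>
    ennreal l * emeasure m (qball d x (2 powr real_of_int k)) \<le> (\<integral>\<^sup>+y\<in>qball d x (2 powr real_of_int k). g y \<partial>m)}"
  have "\<exists>C\<subseteq>S. pairwise (\<lambda>s t. disjnt (?B s) (?B t)) C \<and>
    (\<forall>s\<in>S. \<exists>c\<in>C. snd s \<le> snd c \<and> ?B s \<inter> ?B c \<noteq> {})"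
    by (rule Vitali_finitely_many_radii[of "(\<lambda>k. 2 powr real_of_int k) ` ks"])
       (use assms in \<open>auto simp: S_def intro!: centre_in_qball\<close>)
  then obtain C where C: "C \<subseteq> S" "pairwise (\<lambda>s t. disjnt (?B s) (?B t)) C"
    "\<And>s. s \<in> S \<Longrightarrow> \<exists>c\<in>C. snd s \<le> snd c \<and> ?B s \<inter> ?B c \<noteq> {}"
    by blast
  have pos: "snd c > 0" if "c \<in> C" for c using that C(1) by (auto simp: S_def)
  have ne: "?B c \<noteq> {}" if "c \<in> C" for c
    using centre_in_qball[OF pos[OF that], of "fst c"] by auto
  have "inj_on ?B C"
  proof (rule inj_onI, rule ccontr)
    fix s t assume st: "s \<in> C" "t \<in> C" "?B s = ?B t" "s \<noteq> t"
    then have "disjnt (?B s) (?B t)"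
      using C(2) unfolding pairwise_def by blast
    then show False using ne[OF st(1)] st(3) unfolding disjnt_def by simp
  qed
  moreover have "disjoint (?B ` C)"
  proof (rule disjointI)
    fix X Y assume "X \<in> ?B ` C" "Y \<in> ?B ` C" "X \<noteq> Y"
    then obtain s t where "s \<in> C" "t \<in> C" "s \<noteq> t" "X = ?B s" "Y = ?B t" by blast
    then show "X \<inter> Y = {}"
      using C(2) unfolding pairwise_def disjnt_def by blast
  qed
  then have "countable (?B ` C)"
    by (intro countable_disjoint_open_subsets) (use open_qball in auto)
  ultimately have cC: "countable C"
    by (rule countable_image_inj_on[rotated])
  define F where "F n = {c\<in>C. to_nat_on C c = n}" for n
  have F: "F n = {} \<or> (\<exists>c\<in>C. F n = {c})" for n
  proof (cases "F n = {}")
    case False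
    then obtain c where c: "c \<in> F n" by blast
    then have "F n = {c}"
      using inj_onD[OF inj_on_to_nat_on[OF cC]] unfolding F_def by blast
    then show ?thesis using c unfolding F_def by blast
  qed blast
  define A where "A n = (\<Union>c\<in>F n. ?B c)" for n
  define A' where "A' n = (\<Union>c\<in>F n. qball d (fst c) (2 ^ J * snd c))" for n
  have A [measurable]: "A n \<in> sets borel" "A' n \<in> sets borel" for n
    unfolding A_def A'_def by (auto intro!: borel_open open_qball open_UN)
  have disj: "disjoint_family A"
    using C(2) unfolding disjoint_family_on_def A_def F_def
    by (fastforce simp: pairwise_def disjnt_def)
  have A_le: "ennreal l * emeasure m (A' n) \<le> ennreal (D ^ J) * emeasure (density m g) (A n)" for n
    using F[of n]
  proof
    assume "\<exists>c\<in>C. F n = {c}"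
    then obtain c where c: "c \<in> C" "F n = {c}" by blast
    have "ennreal l * emeasure m (A' n) \<le> ennreal l * (ennreal (D ^ J) * emeasure m (?B c))"
      unfolding A'_def c(2) by (intro mult_left_mono) (use doubling_power pos[OF c(1)] in auto)
    also have "\<dots> = ennreal (D ^ J) * (ennreal l * emeasure m (?B c))" by (simp add: mult_ac)
    also have "\<dots> \<le> ennreal (D ^ J) * (\<integral>\<^sup>+y\<in>?B c. g y \<partial>m)"
      by (rule mult_left_mono) (use c C(1) in \<open>auto simp: S_def\<close>)
    also have "(\<integral>\<^sup>+y\<in>?B c. g y \<partial>m) = emeasure (density m g) (A n)"
      unfolding A_def c(2) by (subst emeasure_density) (auto simp: sets_m)
    finally show ?thesis .
  qed (simp add: A'_def)
  have "E \<subseteq> (\<Union>n. A' n)"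
  proof
    fix x assume "x \<in> E"
    then obtain k where k: "(x, 2 powr real_of_int k) \<in> S" unfolding E_def S_def by blast
    then obtain c where c: "c \<in> C" "2 powr real_of_int k \<le> snd c"
        "qball d x (2 powr real_of_int k) \<inter> ?B c \<noteq> {}"
      using C(3)[OF k] by auto
    then have "x \<in> qball d (fst c) (2 ^ J * snd c)"
      using meeting_qballs_subset pos by blast
    then have "x \<in> A' (to_nat_on C c)" using c by (auto simp: A'_def F_def)
    then show "x \<in> (\<Union>n. A' n)" by blast
  qed
  then have "ennreal l * emeasure m E \<le> ennreal l * emeasure m (\<Union>n. A' n)"
    by (intro mult_left_mono emeasure_mono) (auto simp: sets_m)
  also have "\<dots> \<le> ennreal l * (\<Sum>n. emeasure m (A' n))"
    by (intro mult_left_mono emeasure_subadditive_countably) (auto simp: sets_m)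
  also have "\<dots> = (\<Sum>n. ennreal l * emeasure m (A' n))" by simp
  also have "\<dots> \<le> (\<Sum>n. ennreal (D ^ J) * emeasure (density m g) (A n))"
    by (intro suminf_le A_le summableI)
  also have "\<dots> = ennreal (D ^ J) * emeasure (density m g) (\<Union>n. A n)"
    by (simp add: suminf_emeasure[OF _ disj] image_subset_iff sets_m)
  also have "\<dots> \<le> ennreal (D ^ J) * (\<integral>\<^sup>+x. g x \<partial>m)"
    by (intro mult_left_mono)
       (auto simp: emeasure_density sets_m intro!: nn_integral_mono split: split_indicator)
  finally show ?thesis .
qed

text \<open>Truncating to finitely many radii makes the greedy selection possible; monotone convergence then
  removes the truncation.\<close>

lemma maxop_weak_type:
  assumes [measurable]: "g \<in> borel_measurable borel" and "l > 0"
  shows "ennreal l * emeasure m {x. ennreal l < maxop d m g x} \<le> ennreal (D ^ J) * (\<integral>\<^sup>+x. g x \<partial>m)"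
proof -
  define E where "E n = {x. \<exists>k\<in>{- int n..int n}. ennreal l * emeasure m (qball d x (2 powr real_of_int k)) \<le> (\<integral>\<^sup>+y\<in>qball d x (2 powr real_of_int k). g y \<partial>m)}" for n
  have m2 [measurable]: "E n \<in> sets borel" for n
  proof -
    have "E n = (\<Union>k\<in>{- int n..int n}. {x \<in> space borel. ennreal l * emeasure m (qball d x (2 powr real_of_int k))
        \<le> (\<integral>\<^sup>+y\<in>qball d x (2 powr real_of_int k). g y \<partial>m)})"
      by (auto simp: E_def)
    also have "\<dots> \<in> sets borel"
      by (intro sets.finite_UN borel_measurable_le) auto
    finally show ?thesis .
  qed
  have "incseq E"
    unfolding incseq_def E_def by (force simp: le_fun_def)
  have "{x. ennreal l < maxop d m g x} \<subseteq> (\<Union>n. E n)"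
  proof
    fix x assume "x \<in> {x. ennreal l < maxop d m g x}"
    then obtain k :: int where k: "ennreal l < (\<integral>\<^sup>+y\<in>qball d x (2 powr k). g y \<partial>m) / emeasure m (qball d x (2 powr k))"
      unfolding maxop_def less_SUP_iff by auto
    have "ennreal l * emeasure m (qball d x (2 powr k)) \<le> (\<integral>\<^sup>+y\<in>qball d x (2 powr k). g y \<partial>m)"
    proof (rule ccontr)
      assume "\<not> ?thesis"
      then show False
        using k divide_less_ennreal[of "emeasure m (qball d x (2 powr k))"
          "\<integral>\<^sup>+y\<in>qball d x (2 powr k). g y \<partial>m" "ennreal l"] qball_pos[of "2 powr k" x] qball_finite[of x "2 powr k"]
        by (auto simp: not_le less_top)
    qed
    then have "x \<in> E (nat \<bar>k\<bar>)" unfolding E_def by force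
    then show "x \<in> (\<Union>n. E n)" by blast
  qed
  then have "ennreal l * emeasure m {x. ennreal l < maxop d m g x} \<le> ennreal l * emeasure m (\<Union>n. E n)"
    by (intro mult_left_mono emeasure_mono) (auto simp: sets_m)
  also have "\<dots> = (SUP n. ennreal l * emeasure m (E n))"
    by (subst SUP_emeasure_incseq[symmetric])
       (auto simp: sets_m SUP_mult_left_ennreal \<open>incseq E\<close>)
  also have "\<dots> \<le> ennreal (D ^ J) * (\<integral>\<^sup>+x. g x \<partial>m)"
    unfolding E_def by (intro SUP_least weak_type_finitely_many_radii assms) auto
  finally show ?thesis .
qed

lemma maxop_truncate:
  assumes [measurable]: "g \<in> borel_measurable borel"
  shows "maxop d m g x \<le> maxop d m (\<lambda>y. g y * indicator {y. s < g y} y) x + s"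
proof (rule maxop_leI)
  fix k :: int
  let ?B = "qball d x (2 powr real_of_int k)"
  let ?h = "\<lambda>y. g y * indicator {y. s < g y} y"
  have "(\<integral>\<^sup>+y\<in>?B. g y \<partial>m) \<le> (\<integral>\<^sup>+y. ?h y * indicator ?B y + s * indicator ?B y \<partial>m)"
    by (intro nn_integral_mono) (auto split: split_indicator)
  also have "\<dots> = (\<integral>\<^sup>+y\<in>?B. ?h y \<partial>m) + s * emeasure m ?B"
    by (subst nn_integral_add) (auto simp: nn_integral_cmult)
  also have "\<dots> \<le> maxop d m ?h x * emeasure m ?B + s * emeasure m ?B"
    by (intro add_right_mono average_le_maxop)
  finally show "(\<integral>\<^sup>+y\<in>?B. g y \<partial>m) \<le> (maxop d m ?h x + s) * emeasure m ?B"
    by (simp add: distrib_right)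
qed

text \<open>The part of \<open>g\<close> below \<open>t/2\<close> contributes at most \<open>t/2\<close> to the maximal function, so the weak
  type bound is needed only for the rest.\<close>

lemma maxop_level_set:
  assumes [measurable]: "g \<in> borel_measurable borel" and "t > 0"
  shows "ennreal t * emeasure m {x. ennreal t < maxop d m g x}
    \<le> ennreal (2 * D ^ J) * (\<integral>\<^sup>+x. g x * indicator {x. ennreal t < 2 * g x} x \<partial>m)"
proof -
  let ?h = "\<lambda>y. g y * indicator {y. ennreal (t / 2) < g y} y"
  have half: "ennreal (t / 2) < u \<longleftrightarrow> ennreal t < 2 * u" for u
    using assms by (cases u) (auto simp: ennreal_less_iff ennreal_mult_top simp flip: ennreal_numeral ennreal_mult')
  have sub: "{x. ennreal t < maxop d m g x} \<subseteq> {x. ennreal (t / 2) < maxop d m ?h x}"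
  proof safe
    fix x assume "ennreal t < maxop d m g x"
    also have "\<dots> \<le> maxop d m ?h x + ennreal (t / 2)" by (rule maxop_truncate) fact
    finally have "ennreal (t / 2) + ennreal (t / 2) < ennreal (t / 2) + maxop d m ?h x"
      using assms by (simp add: add.commute flip: ennreal_plus)
    then show "ennreal (t / 2) < maxop d m ?h x"
      by (metis add_left_mono not_le)
  qed
  have "ennreal t * emeasure m {x. ennreal t < maxop d m g x}
      \<le> ennreal t * emeasure m {x. ennreal (t / 2) < maxop d m ?h x}"
    by (intro mult_left_mono emeasure_mono sub) (auto simp: sets_m)
  also have "\<dots> = 2 * (ennreal (t / 2) * emeasure m {x. ennreal (t / 2) < maxop d m ?h x})"
    using assms by (simp add: mult.assoc[symmetric] flip: ennreal_numeral ennreal_mult')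
  also have "\<dots> \<le> 2 * (ennreal (D ^ J) * (\<integral>\<^sup>+x. ?h x \<partial>m))"
    by (intro mult_left_mono maxop_weak_type) (use assms in auto)
  also have "\<dots> = ennreal (2 * D ^ J) * (\<integral>\<^sup>+x. ?h x \<partial>m)"
    using D_ge_1 by (simp add: ennreal_mult' mult.assoc)
  finally show ?thesis by (simp add: half)
qed

text \<open>Marcinkiewicz interpolation with the trivial bound at infinity, in its layer cake form.\<close>

lemma maxop_strong_type:
  assumes [measurable]: "g \<in> borel_measurable borel" and "P > 1"
  shows "(\<integral>\<^sup>+x. epowr (maxop d m g x) P \<partial>m) \<le> ennreal (P * 2 powr P * D ^ J / (P - 1)) * (\<integral>\<^sup>+x. epowr (g x) P \<partial>m)"
proof -
  interpret pair_sigma_finite m "lborel :: real measure" ..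
  let ?M = "maxop d m g"
  have [measurable]: "Measurable.pred (borel \<Otimes>\<^sub>M borel) (\<lambda>z. ennreal (snd z) < ?M (fst z))"
    "Measurable.pred (borel \<Otimes>\<^sub>M borel) (\<lambda>z. ennreal (snd z) < 2 * g (fst z))"
    by measurable
  have "(\<integral>\<^sup>+x. epowr (?M x) P \<partial>m)
    = (\<integral>\<^sup>+x. ennreal P * (\<integral>\<^sup>+t\<in>{0<..}. indicator {t. ennreal t < ?M x} t * ennreal (t powr (P - 1)) \<partial>lborel) \<partial>m)"
    using assms by (subst nn_integral_less_than_powr)
      (auto simp: mult.left_commute[of "ennreal P"] ennreal_mult[symmetric])
  also have "\<dots> = ennreal P * (\<integral>\<^sup>+x. (\<integral>\<^sup>+t\<in>{0<..}. indicator {t. ennreal t < ?M x} t * ennreal (t powr (P - 1)) \<partial>lborel) \<partial>m)"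
    by (rule nn_integral_cmult) (simp add: indicator_def)
  also have "(\<integral>\<^sup>+x. (\<integral>\<^sup>+t\<in>{0<..}. indicator {t. ennreal t < ?M x} t * ennreal (t powr (P - 1)) \<partial>lborel) \<partial>m)
    = (\<integral>\<^sup>+t. (\<integral>\<^sup>+x. indicator {t. ennreal t < ?M x} t * ennreal (t powr (P - 1)) * indicator {0<..} t \<partial>m) \<partial>lborel)"
    by (rule Fubini'[symmetric]) (simp add: indicator_def split_beta')
  also have "\<dots> = (\<integral>\<^sup>+t\<in>{0<..}. ennreal (t powr (P - 2)) * (ennreal t * emeasure m {x. ennreal t < ?M x}) \<partial>lborel)"
  proof (intro nn_integral_cong)
    fix t :: real
    show "(\<integral>\<^sup>+x. indicator {t. ennreal t < ?M x} t * ennreal (t powr (P - 1)) * indicator {0<..} t \<partial>m)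
      = ennreal (t powr (P - 2)) * (ennreal t * emeasure m {x. ennreal t < ?M x}) * indicator {0<..} t"
    proof (cases "t > 0")
      case True
      have "(\<integral>\<^sup>+x. indicator {t. ennreal t < ?M x} t * ennreal (t powr (P - 1)) * indicator {0<..} t \<partial>m)
        = (\<integral>\<^sup>+x. ennreal (t powr (P - 1)) * indicator {x. ennreal t < ?M x} x \<partial>m)"
        using True by (intro nn_integral_cong) (auto split: split_indicator)
      also have "\<dots> = ennreal (t powr (P - 1)) * emeasure m {x. ennreal t < ?M x}"
        by (rule nn_integral_cmult_indicator) (simp add: sets_m)
      also have "\<dots> = ennreal (t powr (P - 2)) * (ennreal t * emeasure m {x. ennreal t < ?M x})"
        using True powr_add[of t "P - 2" 1] by (simp add: ennreal_mult mult.assoc)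
      finally show ?thesis using True by simp
    qed auto
  qed
  also have "\<dots> \<le> (\<integral>\<^sup>+t\<in>{0<..}. ennreal (t powr (P - 2)) * (ennreal (2 * D ^ J) *
      (\<integral>\<^sup>+x. g x * indicator {x. ennreal t < 2 * g x} x \<partial>m)) \<partial>lborel)"
    by (intro nn_integral_mono) (auto split: split_indicator intro!: mult_left_mono maxop_level_set)
  also have "\<dots> = (\<integral>\<^sup>+t. (\<integral>\<^sup>+x. ennreal (2 * D ^ J) * (g x * (indicator {t. ennreal t < 2 * g x} t
       * ennreal (t powr (P - 2)) * indicator {0<..} t)) \<partial>m) \<partial>lborel)"
  proof (intro nn_integral_cong)
    fix t :: real
    have "(\<integral>\<^sup>+x. ennreal (2 * D ^ J) * (g x * (indicator {t. ennreal t < 2 * g x} t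
       * ennreal (t powr (P - 2)) * indicator {0<..} t)) \<partial>m)
      = (\<integral>\<^sup>+x. (ennreal (t powr (P - 2)) * ennreal (2 * D ^ J) * indicator {0<..} t) * (g x * indicator {x. ennreal t < 2 * g x} x) \<partial>m)"
      by (intro nn_integral_cong) (auto simp: mult_ac split: split_indicator)
    also have "\<dots> = (ennreal (t powr (P - 2)) * ennreal (2 * D ^ J) * indicator {0<..} t) * (\<integral>\<^sup>+x. (g x * indicator {x. ennreal t < 2 * g x} x) \<partial>m)"
      by (rule nn_integral_cmult) measurable
    finally show "ennreal (t powr (P - 2)) * (ennreal (2 * D ^ J) *
      (\<integral>\<^sup>+x. g x * indicator {x. ennreal t < 2 * g x} x \<partial>m)) * indicator {0<..} t = (\<integral>\<^sup>+x. ennreal (2 * D ^ J) * (g x * (indicator {t. ennreal t < 2 * g x} t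
       * ennreal (t powr (P - 2)) * indicator {0<..} t)) \<partial>m)"
      by (simp add: mult_ac)
  qed
  also have "\<dots> = (\<integral>\<^sup>+x. (\<integral>\<^sup>+t. ennreal (2 * D ^ J) * (g x * (indicator {t. ennreal t < 2 * g x} t
       * ennreal (t powr (P - 2)) * indicator {0<..} t)) \<partial>lborel) \<partial>m)"
    by (rule Fubini') (simp add: indicator_def split_beta')
  also have "\<dots> = (\<integral>\<^sup>+x. ennreal (2 powr P * D ^ J / (P - 1)) * epowr (g x) P \<partial>m)"
  proof (intro nn_integral_cong)
    fix x
    have "(\<integral>\<^sup>+t. ennreal (2 * D ^ J) * (g x * (indicator {t. ennreal t < 2 * g x} t
       * ennreal (t powr (P - 2)) * indicator {0<..} t)) \<partial>lborel)
      = ennreal (2 * D ^ J) * (g x * (\<integral>\<^sup>+t. (indicator {t. ennreal t < 2 * g x} t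
       * ennreal (t powr (P - 2)) * indicator {0<..} t) \<partial>lborel))"
      by (simp add: nn_integral_cmult)
    also have "\<dots> = ennreal (2 * D ^ J) * (g x * (epowr (2 * g x) (P - 1) * ennreal (1 / (P - 1))))"
      using assms by (subst nn_integral_less_than_powr) auto
    also have "epowr (2 * g x) (P - 1) = ennreal (2 powr (P - 1)) * epowr (g x) (P - 1)"
      using assms by (simp add: epowr_mult flip: ennreal_numeral)
    also have "ennreal (2 * D ^ J) * (g x * (ennreal (2 powr (P - 1)) * epowr (g x) (P - 1) * ennreal (1 / (P - 1))))
       = ennreal (2 * D ^ J) * ennreal (2 powr (P - 1)) * ennreal (1 / (P - 1)) * (epowr (g x) 1 * epowr (g x) (P - 1))"
      by (simp add: mult_ac)
    also have "epowr (g x) 1 * epowr (g x) (P - 1) = epowr (g x) P"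
      by (subst epowr_add_exponent) simp
    also have "ennreal (2 * D ^ J) * ennreal (2 powr (P - 1)) * ennreal (1 / (P - 1)) = ennreal (2 powr P * D ^ J / (P - 1))"
      using assms D_ge_1 by (simp add: ennreal_mult[symmetric] powr_diff)
    finally show "(\<integral>\<^sup>+t. ennreal (2 * D ^ J) * (g x * (indicator {t. ennreal t < 2 * g x} t
       * ennreal (t powr (P - 2)) * indicator {0<..} t)) \<partial>lborel) = ennreal (2 powr P * D ^ J / (P - 1)) * epowr (g x) P" .
  qed
  also have "\<dots> = ennreal (2 powr P * D ^ J / (P - 1)) * (\<integral>\<^sup>+x. epowr (g x) P \<partial>m)"
    by (rule nn_integral_cmult) measurable
  finally have "(\<integral>\<^sup>+x. epowr (?M x) P \<partial>m) \<le> ennreal P * (ennreal (2 powr P * D ^ J / (P - 1)) * (\<integral>\<^sup>+x. epowr (g x) P \<partial>m))"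
    by (simp add: mult_left_mono)
  also have "\<dots> = ennreal (P * 2 powr P * D ^ J / (P - 1)) * (\<integral>\<^sup>+x. epowr (g x) P \<partial>m)"
    using assms D_ge_1 by (simp add: ennreal_mult'[symmetric] mult.assoc[symmetric])
  finally show ?thesis .
qed

end

section \<open>Muckenhoupt weights\<close>

lemma epowr_mult_indicator: "epowr (u * indicator A x) r = epowr u r * indicator A x"
  by (simp split: split_indicator)

definition dual_weight :: "real \<Rightarrow> ('a \<Rightarrow> real) \<Rightarrow> 'a \<Rightarrow> real" where
  "dual_weight P w x = w x powr (- 1 / (P - 1))"

lemma dual_weight_pos: "w x > 0 \<Longrightarrow> dual_weight P w x > 0"
  by (simp add: dual_weight_def)

lemma dual_weight_dual:
  assumes "P > 1" "\<And>x. w x > 0"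
  shows "dual_weight (P / (P - 1)) (dual_weight P w) = w"
proof
  fix x
  have "P / (P - 1) - 1 = 1 / (P - 1)" using assms by (simp add: field_simps)
  then have "- 1 / (P - 1) * (- 1 / (P / (P - 1) - 1)) = 1" using assms(1) by (simp only:) (simp add: field_simps)
  then show "dual_weight (P / (P - 1)) (dual_weight P w) x = w x"
    using assms(2)[of x] unfolding dual_weight_def powr_powr by simp
qed

lemma conjugate_exponent:
  fixes P :: real
  assumes "P > 1"
  shows "P / (P - 1) > 1" "1 / P + 1 / (P / (P - 1)) = 1" "P / (P - 1) - 1 = 1 / (P - 1)"
  using assms by (auto simp: field_simps)

lemma measurable_dual_weight [measurable]:
  "w \<in> borel_measurable M \<Longrightarrow> dual_weight P w \<in> borel_measurable M"
  unfolding dual_weight_def by measurable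

context homogeneous_type
begin

abbreviation ball_mass :: "('a \<Rightarrow> real) \<Rightarrow> 'a \<Rightarrow> real \<Rightarrow> ennreal" where
  "ball_mass w x t \<equiv> \<integral>\<^sup>+y\<in>qball d x t. ennreal (w y) \<partial>m"

definition Ap :: "real \<Rightarrow> real \<Rightarrow> ('a \<Rightarrow> real) \<Rightarrow> bool" where
  "Ap P K w \<longleftrightarrow> w \<in> borel_measurable borel \<and> (\<forall>x. 0 < w x) \<and>
    (\<forall>x t. t > 0 \<longrightarrow> ball_mass w x t \<noteq> top \<and> ball_mass (dual_weight P w) x t \<noteq> top \<and>
      ball_mass w x t * epowr (ball_mass (dual_weight P w) x t) (P - 1)
        \<le> ennreal K * epowr (emeasure m (qball d x t)) P)"

lemma ApD:
  assumes "Ap P K w"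
  shows "w \<in> borel_measurable borel" "0 < w x"
    "t > 0 \<Longrightarrow> ball_mass w x t \<noteq> top" "t > 0 \<Longrightarrow> ball_mass (dual_weight P w) x t \<noteq> top"
    "t > 0 \<Longrightarrow> ball_mass w x t * epowr (ball_mass (dual_weight P w) x t) (P - 1)
        \<le> ennreal K * epowr (emeasure m (qball d x t)) P"
  using assms by (auto simp: Ap_def)

text \<open>The condition is symmetric under \<open>P \<mapsto> P/(P-1)\<close> and \<open>w \<mapsto> \<sigma>\<close>: the inequality for one pair is a
  power of that for the other.\<close>

lemma Ap_dual:
  assumes P: "P > 1" "K \<ge> 0" and Ap: "Ap P K w"
  shows "Ap (P / (P - 1)) (K powr (1 / (P - 1))) (dual_weight P w)"
  unfolding Ap_def
proof (intro conjI allI impI)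
  show "dual_weight P w \<in> borel_measurable borel"
    using ApD(1)[OF Ap] by measurable
  show "dual_weight P w x > 0" for x
    using ApD(2)[OF Ap] by (rule dual_weight_pos)
  have dd: "dual_weight (P / (P - 1)) (dual_weight P w) = w"
    by (rule dual_weight_dual) (use P ApD(2)[OF Ap] in auto)
  fix x and t :: real assume t: "t > 0"
  show "ball_mass (dual_weight P w) x t \<noteq> top"
    "ball_mass (dual_weight (P / (P - 1)) (dual_weight P w)) x t \<noteq> top"
    unfolding dd using ApD(3,4)[OF Ap t] by auto
  let ?W = "ball_mass w x t" and ?S = "ball_mass (dual_weight P w) x t"
  have "epowr (?W * epowr ?S (P - 1)) (1 / (P - 1))
      \<le> epowr (ennreal K * epowr (emeasure m (qball d x t)) P) (1 / (P - 1))"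
    using P by (intro epowr_mono ApD[OF Ap] t) auto
  then show "?S * epowr (ball_mass (dual_weight (P / (P - 1)) (dual_weight P w)) x t) (P / (P - 1) - 1)
      \<le> ennreal (K powr (1 / (P - 1))) * epowr (emeasure m (qball d x t)) (P / (P - 1))"
    unfolding dd conjugate_exponent(3)[OF P(1)]
    using P by (simp add: epowr_mult mult.commute)
qed

text \<open>Hoelder's inequality bounds the measure of a ball by its \<open>w\<close>- and \<open>\<sigma>\<close>-masses; comparing with
  the double ball and cancelling leaves the doubling property of \<open>w\<close>.\<close>

lemma Ap_doubling:
  assumes P: "P > 1" "K \<ge> 0" and Ap: "Ap P K w" and t: "t > 0"
  shows "ball_mass w x (2 * t) \<le> ennreal (K * (2 * D) powr P) * ball_mass w x t"
proof -
  note [measurable] = ApD(1)[OF Ap]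
  note wpos = ApD(2)[OF Ap]
  let ?P' = "P / (P - 1)" and ?E = "qball d x t" and ?B = "qball d x (2 * t)"
  let ?b = "emeasure m ?E"
  have sub: "?E \<subseteq> ?B" using t by (intro qball_mono) auto
  have "?b = (\<integral>\<^sup>+y. (ennreal (w y powr (1 / P)) * indicator ?E y) * (ennreal (w y powr (- 1 / P)) * indicator ?E y) \<partial>m)"
  proof -
    have "?b = (\<integral>\<^sup>+y. indicator ?E y \<partial>m)" by (simp add: sets_m)
    also have "\<dots> = (\<integral>\<^sup>+y. (ennreal (w y powr (1 / P)) * indicator ?E y) * (ennreal (w y powr (- 1 / P)) * indicator ?E y) \<partial>m)"
      using less_imp_neq[OF wpos] by (intro nn_integral_cong)
        (auto simp: powr_add[symmetric] ennreal_mult[symmetric] split: split_indicator)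
    finally show ?thesis .
  qed
  also have "\<dots> \<le> 2 * epowr (\<integral>\<^sup>+y. epowr (ennreal (w y powr (1 / P)) * indicator ?E y) P \<partial>m) (1 / P)
      * epowr (\<integral>\<^sup>+y. epowr (ennreal (w y powr (- 1 / P)) * indicator ?E y) ?P' \<partial>m) (1 / ?P')"
    by (rule Holder_nn_integral) (use P conjugate_exponent[OF P(1)] in auto)
  also have "(\<integral>\<^sup>+y. epowr (ennreal (w y powr (1 / P)) * indicator ?E y) P \<partial>m) = ball_mass w x t"
    using P less_imp_le[OF wpos] wpos by (simp add: epowr_mult_indicator powr_powr)
  also have "(\<integral>\<^sup>+y. epowr (ennreal (w y powr (- 1 / P)) * indicator ?E y) ?P' \<partial>m) = ball_mass (dual_weight P w) x t"
    using P by (simp add: epowr_mult_indicator powr_powr dual_weight_def)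
  finally have "epowr ?b P \<le> epowr (2 * epowr (ball_mass w x t) (1 / P) * epowr (ball_mass (dual_weight P w) x t) (1 / ?P')) P"
    using P by (intro epowr_mono) auto
  also have "\<dots> = ennreal (2 powr P) * ball_mass w x t * epowr (ball_mass (dual_weight P w) x t) (P - 1)"
  proof -
    have "1 / ?P' * P = P - 1" using P by (simp add: field_simps)
    then show ?thesis using P unfolding epowr_mult[OF order.strict_trans[OF zero_less_one P(1)]] epowr_epowr
      by (simp flip: ennreal_numeral)
  qed
  finally have 1: "epowr ?b P \<le> ennreal (2 powr P) * ball_mass w x t * epowr (ball_mass (dual_weight P w) x t) (P - 1)" .
  have mono: "ball_mass (dual_weight P w) x t \<le> ball_mass (dual_weight P w) x (2 * t)"
    using sub by (intro nn_integral_mono) (auto split: split_indicator)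
  have "epowr ?b P * ball_mass w x (2 * t)
    \<le> ennreal (2 powr P) * ball_mass w x t * epowr (ball_mass (dual_weight P w) x (2 * t)) (P - 1) * ball_mass w x (2 * t)"
    using P by (intro mult_right_mono order.trans[OF 1] mult_left_mono epowr_mono mono) auto
  also have "\<dots> = ennreal (2 powr P) * ball_mass w x t * (ball_mass w x (2 * t) * epowr (ball_mass (dual_weight P w) x (2 * t)) (P - 1))"
    by (simp add: mult_ac)
  also have "\<dots> \<le> ennreal (2 powr P) * ball_mass w x t * (ennreal K * epowr (emeasure m ?B) P)"
    by (intro mult_left_mono ApD[OF Ap]) (use t in auto)
  also have "\<dots> \<le> ennreal (2 powr P) * ball_mass w x t * (ennreal K * epowr (ennreal D * ?b) P)"
    using P by (intro mult_left_mono epowr_mono doubling t) auto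
  also have "\<dots> = epowr ?b P * (ennreal (K * (2 * D) powr P) * ball_mass w x t)"
    using P D_ge_1 by (simp add: epowr_mult ennreal_mult powr_mult mult_ac)
  finally show ?thesis
    using qball_pos[OF t] qball_finite by (subst (asm) ennreal_mult_le_mult_iff) auto
qed

definition weight_doubling :: "real \<Rightarrow> real \<Rightarrow> real" where
  "weight_doubling P K = max 1 (K * (2 * D) powr P)"

lemma Ap_homogeneous_type:
  assumes P: "P > 1" "K \<ge> 0" and Ap: "Ap P K w"
  shows "homogeneous_type d (density m (\<lambda>x. ennreal (w x))) \<kappa> (weight_doubling P K)"
proof
  note [measurable] = ApD(1)[OF Ap]
  note wpos = ApD(2)[OF Ap]
  have em: "emeasure (density m (\<lambda>x. ennreal (w x))) (qball d x t) = ball_mass w x t" for x t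
    by (subst emeasure_density) (auto simp: sets_m)
  show "sets (density m (\<lambda>x. ennreal (w x))) = sets borel" by (simp add: sets_m)
  show "d x y = d y x" "d x x = 0" "\<kappa> \<ge> 1" "d x z \<le> \<kappa> * (d x y + d y z)" "open (qball d x t)"
    "(\<lambda>(x, y). d x y) \<in> borel_measurable (borel \<Otimes>\<^sub>M borel)" for x y z t
    by (rule d_sym d_self kappa_ge_1 quasi_triangle open_qball measurable_d)+
  show "1 \<le> weight_doubling P K" by (simp add: weight_doubling_def)
  fix x and t :: real
  show "emeasure (density m (\<lambda>x. ennreal (w x))) (qball d x t) \<noteq> top"
    unfolding em
  proof (cases "t > 0")
    case False
    then have "ball_mass w x t \<le> ball_mass w x 1"
      by (intro nn_integral_mono) (auto split: split_indicator simp: qball_def)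
    then show "ball_mass w x t \<noteq> top" using ApD(3)[OF Ap, of 1 x] by (auto simp: top_unique)
  qed (rule ApD(3)[OF Ap])
  assume t: "t > 0"
  show "emeasure (density m (\<lambda>x. ennreal (w x))) (qball d x t) \<noteq> 0"
  proof
    assume "emeasure (density m (\<lambda>x. ennreal (w x))) (qball d x t) = 0"
    then have "AE y in m. ennreal (w y) * indicator (qball d x t) y = 0"
      unfolding em by (subst (asm) nn_integral_0_iff_AE) auto
    moreover have "\<not> w y \<le> 0" for y using wpos[of y] by simp
    ultimately have "AE y in m. y \<notin> qball d x t"
      by (auto elim!: AE_mp simp: ennreal_eq_0_iff split: split_indicator_asm)
    then have "emeasure m (qball d x t) = 0"
      by (subst (asm) AE_iff_measurable[OF _ refl]) (auto simp: sets_m)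
    then show False using qball_pos[OF t] by auto
  qed
  show "emeasure (density m (\<lambda>x. ennreal (w x))) (qball d x (2 * t))
      \<le> ennreal (weight_doubling P K) * emeasure (density m (\<lambda>x. ennreal (w x))) (qball d x t)"
    unfolding em weight_doubling_def
    by (rule order.trans[OF Ap_doubling[OF P Ap t]]) (intro mult_right_mono ennreal_leI, auto)
qed

text \<open>Lerner's pointwise estimate. On a ball \<open>B\<close> the unweighted average of \<open>g\<close> factors as the \<open>A\<^sub>P\<close>
  quantity of \<open>B\<close> times a \<open>w\<close>-average of a power of a \<open>\<sigma>\<close>-average, where \<open>\<sigma>\<close> is the dual weight; each
  weighted average is controlled by the maximal operator of the corresponding doubling measure. This gives
  the weighted inequality without reverse Hoelder inequalities.\<close>

lemma maxop_pointwise_weighted: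
  assumes P: "P > 1" "K \<ge> 0" and Ap: "Ap P K w" and [measurable]: "g \<in> borel_measurable borel"
  defines "\<sigma> \<equiv> dual_weight P w"
  defines "D\<^sub>\<sigma> \<equiv> weight_doubling (P / (P - 1)) (K powr (1 / (P - 1)))"
  defines "h \<equiv> maxop d (density m (\<lambda>y. ennreal (\<sigma> y))) (\<lambda>y. g y * ennreal (1 / \<sigma> y))"
  shows "epowr (maxop d m g x) (P - 1) \<le> ennreal (K * D\<^sub>\<sigma> powr (real (2 * J) * (P - 1))) *
    maxop d (density m (\<lambda>y. ennreal (w y))) (\<lambda>y. epowr (h y) (P - 1) * ennreal (1 / w y)) x"
    (is "_ \<le> ennreal ?c * ?N")
proof -
  note [measurable] = ApD(1)[OF Ap]
  note wpos = ApD(2)[OF Ap]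
  have \<sigma>pos: "\<sigma> x > 0" for x unfolding \<sigma>_def using wpos by (rule dual_weight_pos)
  have [measurable]: "\<sigma> \<in> borel_measurable borel" unfolding \<sigma>_def by measurable
  interpret W: homogeneous_type d "density m (\<lambda>x. ennreal (w x))" \<kappa> "weight_doubling P K"
    by (rule Ap_homogeneous_type[OF P Ap])
  interpret S: homogeneous_type d "density m (\<lambda>x. ennreal (\<sigma> x))" \<kappa> D\<^sub>\<sigma>
    unfolding D\<^sub>\<sigma>_def \<sigma>_def
    by (rule Ap_homogeneous_type[OF _ _ Ap_dual[OF P Ap]]) (use conjugate_exponent[OF P(1)] in auto)
  have [measurable]: "h \<in> borel_measurable borel" unfolding h_def by measurable
  have emW: "emeasure (density m (\<lambda>x. ennreal (w x))) (qball d x t) = ball_mass w x t" for x t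
    by (subst emeasure_density) (auto simp: sets_m)
  have emS: "emeasure (density m (\<lambda>x. ennreal (\<sigma> x))) (qball d x t) = ball_mass \<sigma> x t" for x t
    by (subst emeasure_density) (auto simp: sets_m)
  have cancel: "ennreal v * u * ennreal (1 / v) = u" if "v > 0" for u v
    using that by (simp add: mult.commute[of _ u] mult.assoc ennreal_mult[symmetric])
  have "maxop d m g x \<le> epowr (ennreal ?c * ?N) (1 / (P - 1))"
  proof (rule maxop_leI)
    fix k :: int
    define t where "t = 2 powr real_of_int k"
    let ?B = "qball d x t" and ?b = "emeasure m (qball d x t)"
    let ?I = "\<integral>\<^sup>+y\<in>?B. g y \<partial>m" and ?S = "ball_mass \<sigma> x t" and ?W = "ball_mass w x t"
    have t: "t > 0" by (simp add: t_def)
    have "?I \<le> h y * (ennreal (D\<^sub>\<sigma> ^ (2 * J)) * ?S)" if y: "y \<in> ?B" for y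
    proof -
      have rad: "2 ^ J * t = 2 powr real_of_int (k + int J)"
        by (simp add: t_def powr_add powr_realpow mult.commute)
      have "?I \<le> (\<integral>\<^sup>+z\<in>qball d y (2 ^ J * t). g z \<partial>m)"
        using qball_subset_other_centre(1)[OF y t]
        by (intro nn_integral_mono) (auto split: split_indicator)
      also have "\<dots> = (\<integral>\<^sup>+z\<in>qball d y (2 ^ J * t). g z * ennreal (1 / \<sigma> z) \<partial>density m (\<lambda>x. ennreal (\<sigma> x)))"
        by (subst nn_integral_density)
           (auto simp: sets_m cancel[OF \<sigma>pos] mult.assoc[symmetric] intro!: nn_integral_cong)
      also have "\<dots> \<le> h y * ball_mass \<sigma> y (2 ^ J * t)"
        using S.average_le_maxop[where x = y and k = "k + int J" and g = "\<lambda>z. g z * ennreal (1 / \<sigma> z)"]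
        unfolding h_def rad emS .
      also have "ball_mass \<sigma> y (2 ^ J * t) \<le> ball_mass \<sigma> x (2 ^ (2 * J) * t)"
        using qball_subset_other_centre(2)[OF y t]
        by (intro nn_integral_mono) (auto split: split_indicator)
      also have "\<dots> \<le> ennreal (D\<^sub>\<sigma> ^ (2 * J)) * ?S"
        using S.doubling_power[OF t, of x "2 * J"] unfolding emS .
      finally show ?thesis by (simp add: mult_left_mono)
    qed
    then have I_le: "epowr ?I (P - 1) \<le> epowr (h y) (P - 1) * epowr (ennreal (D\<^sub>\<sigma> ^ (2 * J)) * ?S) (P - 1)" if "y \<in> ?B" for y
      using that P by (subst epowr_mult[symmetric]) (auto intro!: epowr_mono)
    have "(\<integral>\<^sup>+y\<in>?B. epowr (h y) (P - 1) \<partial>m)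
       = (\<integral>\<^sup>+y\<in>?B. epowr (h y) (P - 1) * ennreal (1 / w y) \<partial>density m (\<lambda>x. ennreal (w x)))"
      by (subst nn_integral_density)
         (auto simp: sets_m cancel[OF wpos] mult.assoc[symmetric] intro!: nn_integral_cong)
    also have "\<dots> \<le> ?N * ?W"
      using W.average_le_maxop[where x = x and k = k and g = "\<lambda>y. epowr (h y) (P - 1) * ennreal (1 / w y)"]
      unfolding t_def emW .
    finally have h_le: "(\<integral>\<^sup>+y\<in>?B. epowr (h y) (P - 1) \<partial>m) \<le> ?N * ?W" .
    have "epowr ?I (P - 1) * ?b = (\<integral>\<^sup>+y\<in>?B. epowr ?I (P - 1) \<partial>m)"
      by (simp add: nn_integral_cmult_indicator sets_m)
    also have "\<dots> \<le> (\<integral>\<^sup>+y. epowr (ennreal (D\<^sub>\<sigma> ^ (2 * J)) * ?S) (P - 1) * (epowr (h y) (P - 1) * indicator ?B y) \<partial>m)"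
      using I_le by (intro nn_integral_mono) (auto split: split_indicator simp: mult.commute)
    also have "\<dots> = epowr (ennreal (D\<^sub>\<sigma> ^ (2 * J)) * ?S) (P - 1) * (\<integral>\<^sup>+y\<in>?B. epowr (h y) (P - 1) \<partial>m)"
      by (rule nn_integral_cmult) measurable
    also have "\<dots> \<le> epowr (ennreal (D\<^sub>\<sigma> ^ (2 * J)) * ?S) (P - 1) * (?N * ?W)"
      by (intro mult_left_mono h_le) auto
    also have "\<dots> = ennreal (D\<^sub>\<sigma> powr (real (2 * J) * (P - 1))) * ?N * (?W * epowr ?S (P - 1))"
    proof -
      have "(D\<^sub>\<sigma> ^ (2 * J)) powr (P - 1) = D\<^sub>\<sigma> powr (real (2 * J) * (P - 1))"
        using S.D_ge_1 by (simp add: powr_powr flip: powr_realpow)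
      then show ?thesis
        using P S.D_ge_1 by (simp add: epowr_mult mult_ac)
    qed
    also have "\<dots> \<le> ennreal (D\<^sub>\<sigma> powr (real (2 * J) * (P - 1))) * ?N * (ennreal K * epowr ?b P)"
      unfolding \<sigma>_def by (intro mult_left_mono ApD[OF Ap] t) auto
    also have "epowr ?b P = epowr ?b (P - 1) * epowr ?b 1"
      by (subst epowr_add_exponent) simp
    finally have "?b * epowr ?I (P - 1) \<le> ?b * (ennreal ?c * ?N * epowr ?b (P - 1))"
      using P by (simp add: ennreal_mult mult_ac)
    then have "epowr ?I (P - 1) \<le> ennreal ?c * ?N * epowr ?b (P - 1)"
      using qball_pos[OF t] qball_finite by (subst (asm) ennreal_mult_le_mult_iff) auto
    then have "?I \<le> epowr (ennreal ?c * ?N * epowr ?b (P - 1)) (1 / (P - 1))"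
      using P by (subst (asm) epowr_le_iff) auto
    also have "\<dots> = epowr (ennreal ?c * ?N) (1 / (P - 1)) * ?b"
      using P by (subst epowr_mult) auto
    finally show "(\<integral>\<^sup>+y\<in>qball d x (2 powr real_of_int k). g y \<partial>m)
        \<le> epowr (ennreal ?c * ?N) (1 / (P - 1)) * emeasure m (qball d x (2 powr real_of_int k))"
      by (simp only: t_def)
  qed
  then show ?thesis using P by (subst epowr_le_iff) auto
qed

text \<open>In the pointwise estimate the outer maximal operator is bounded on \<open>L\<close> of index \<open>P/(P-1)\<close> for
  the measure \<open>w\<close>, and the inner one on \<open>L\<^sup>P\<close> for the measure \<open>\<sigma>\<close>; the exponents combine to \<open>P\<close>. The
  constant depends on the weight only through \<open>K\<close>, as extrapolation requires.\<close>

theorem Muckenhoupt_maximal: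
  assumes P: "P > 1" "K \<ge> 0"
  shows "\<exists>C\<ge>0. \<forall>w g. Ap P K w \<longrightarrow> g \<in> borel_measurable borel \<longrightarrow>
    (\<integral>\<^sup>+x. epowr (maxop d m g x) P * ennreal (w x) \<partial>m) \<le> ennreal C * (\<integral>\<^sup>+x. epowr (g x) P * ennreal (w x) \<partial>m)"
proof -
  define P' where "P' = P / (P - 1)"
  have P': "P' > 1" "(P - 1) * P' = P" using P by (auto simp: P'_def field_simps)
  define D\<^sub>\<sigma> where "D\<^sub>\<sigma> = weight_doubling P' (K powr (1 / (P - 1)))"
  define c where "c = K * D\<^sub>\<sigma> powr (real (2 * J) * (P - 1))"
  define C1 where "C1 = P' * 2 powr P' * weight_doubling P K ^ J / (P' - 1)"
  define C2 where "C2 = P * 2 powr P * D\<^sub>\<sigma> ^ J / (P - 1)"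
  have nn: "c \<ge> 0" "C1 \<ge> 0" "C2 \<ge> 0"
    using P P' by (auto simp: c_def C1_def C2_def weight_doubling_def D\<^sub>\<sigma>_def intro!: divide_nonneg_nonneg mult_nonneg_nonneg)
  show ?thesis
  proof (intro exI[of _ "c powr P' * C1 * C2"] conjI allI impI)
    show "0 \<le> c powr P' * C1 * C2" using nn by auto
    fix w and g :: "'a \<Rightarrow> ennreal"
    assume Ap: "Ap P K w" and [measurable]: "g \<in> borel_measurable borel"
    define \<sigma> where "\<sigma> = dual_weight P w"
    note [measurable] = ApD(1)[OF Ap]
    note wpos = ApD(2)[OF Ap]
    have \<sigma>pos: "\<sigma> x > 0" for x unfolding \<sigma>_def using wpos by (rule dual_weight_pos)
    have [measurable]: "\<sigma> \<in> borel_measurable borel" unfolding \<sigma>_def by measurable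
    interpret W: homogeneous_type d "density m (\<lambda>x. ennreal (w x))" \<kappa> "weight_doubling P K"
      by (rule Ap_homogeneous_type[OF P Ap])
    interpret S: homogeneous_type d "density m (\<lambda>x. ennreal (\<sigma> x))" \<kappa> D\<^sub>\<sigma>
      unfolding D\<^sub>\<sigma>_def \<sigma>_def P'_def
      by (rule Ap_homogeneous_type[OF _ _ Ap_dual[OF P Ap]]) (use conjugate_exponent[OF P(1)] in auto)
    define h where "h = maxop d (density m (\<lambda>y. ennreal (\<sigma> y))) (\<lambda>y. g y * ennreal (1 / \<sigma> y))"
    define N where "N = maxop d (density m (\<lambda>y. ennreal (w y))) (\<lambda>y. epowr (h y) (P - 1) * ennreal (1 / w y))"
    have [measurable]: "h \<in> borel_measurable borel" unfolding h_def by measurable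
    have [measurable]: "N \<in> borel_measurable borel" unfolding N_def by measurable
    have pt: "epowr (maxop d m g x) P \<le> ennreal (c powr P') * epowr (N x) P'" for x
    proof -
      have "epowr (maxop d m g x) (P - 1) \<le> ennreal c * N x"
        using maxop_pointwise_weighted[OF P Ap, of g x]
        unfolding c_def N_def h_def \<sigma>_def D\<^sub>\<sigma>_def P'_def by simp
      then have "epowr (epowr (maxop d m g x) (P - 1)) P' \<le> epowr (ennreal c * N x) P'"
        using P' by (intro epowr_mono) auto
      then show ?thesis using P' nn by (simp add: epowr_mult)
    qed
    have "(\<integral>\<^sup>+x. epowr (maxop d m g x) P * ennreal (w x) \<partial>m)
        \<le> (\<integral>\<^sup>+x. ennreal (c powr P') * epowr (N x) P' * ennreal (w x) \<partial>m)"
      by (intro nn_integral_mono mult_right_mono pt) auto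
    also have "\<dots> = (\<integral>\<^sup>+x. ennreal (c powr P') * (ennreal (w x) * epowr (N x) P') \<partial>m)"
      by (simp add: mult_ac)
    also have "\<dots> = ennreal (c powr P') * (\<integral>\<^sup>+x. ennreal (w x) * epowr (N x) P' \<partial>m)"
      by (rule nn_integral_cmult) measurable
    also have "(\<integral>\<^sup>+x. ennreal (w x) * epowr (N x) P' \<partial>m) = (\<integral>\<^sup>+x. epowr (N x) P' \<partial>density m (\<lambda>x. ennreal (w x)))"
      by (subst nn_integral_density) auto
    also have "\<dots> \<le> ennreal C1 * (\<integral>\<^sup>+x. epowr (epowr (h x) (P - 1) * ennreal (1 / w x)) P' \<partial>density m (\<lambda>x. ennreal (w x)))"
      unfolding N_def C1_def by (rule W.maxop_strong_type) (use P' in auto)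
    also have "(\<integral>\<^sup>+x. epowr (epowr (h x) (P - 1) * ennreal (1 / w x)) P' \<partial>density m (\<lambda>x. ennreal (w x)))
       = (\<integral>\<^sup>+x. ennreal (w x) * epowr (epowr (h x) (P - 1) * ennreal (1 / w x)) P' \<partial>m)"
      by (subst nn_integral_density) auto
    also have "\<dots> = (\<integral>\<^sup>+x. ennreal (\<sigma> x) * epowr (h x) P \<partial>m)"
    proof (intro nn_integral_cong)
      fix x
      have "w x * (1 / w x) powr P' = w x powr (1 - P')"
        using wpos[of x] by (simp add: powr_diff powr_divide)
      also have "1 - P' = - 1 / (P - 1)" using P by (simp add: P'_def field_simps)
      finally have "w x * (1 / w x) powr P' = \<sigma> x" by (simp add: \<sigma>_def dual_weight_def)
      then have "ennreal (w x) * ennreal ((1 / w x) powr P') = ennreal (\<sigma> x)"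
        using less_imp_le[OF wpos[of x]] by (simp flip: ennreal_mult)
      then show "ennreal (w x) * epowr (epowr (h x) (P - 1) * ennreal (1 / w x)) P' = ennreal (\<sigma> x) * epowr (h x) P"
        using P' less_imp_le[OF wpos[of x]] by (simp add: epowr_mult mult.left_commute[of "ennreal (w x)"] mult.commute)
    qed
    also have "\<dots> = (\<integral>\<^sup>+x. epowr (h x) P \<partial>density m (\<lambda>x. ennreal (\<sigma> x)))"
      by (subst nn_integral_density) auto
    also have "\<dots> \<le> ennreal C2 * (\<integral>\<^sup>+x. epowr (g x * ennreal (1 / \<sigma> x)) P \<partial>density m (\<lambda>x. ennreal (\<sigma> x)))"
      unfolding h_def C2_def by (rule S.maxop_strong_type) (use P in auto)
    also have "(\<integral>\<^sup>+x. epowr (g x * ennreal (1 / \<sigma> x)) P \<partial>density m (\<lambda>x. ennreal (\<sigma> x)))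
       = (\<integral>\<^sup>+x. ennreal (\<sigma> x) * epowr (g x * ennreal (1 / \<sigma> x)) P \<partial>m)"
      by (subst nn_integral_density) auto
    also have "\<dots> = (\<integral>\<^sup>+x. epowr (g x) P * ennreal (w x) \<partial>m)"
    proof (intro nn_integral_cong)
      fix x
      have "\<sigma> x * (1 / \<sigma> x) powr P = \<sigma> x powr (1 - P)"
        using \<sigma>pos[of x] by (simp add: powr_diff powr_divide)
      also have "\<dots> = w x"
      proof -
        have "- 1 / (P - 1) * (1 - P) = 1" using P by (simp add: field_simps)
        then show ?thesis
          using wpos[of x] unfolding \<sigma>_def dual_weight_def powr_powr by simp
      qed
      finally have "ennreal (\<sigma> x) * ennreal ((1 / \<sigma> x) powr P) = ennreal (w x)"
        using less_imp_le[OF \<sigma>pos[of x]] by (simp flip: ennreal_mult)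
      then show "ennreal (\<sigma> x) * epowr (g x * ennreal (1 / \<sigma> x)) P = epowr (g x) P * ennreal (w x)"
        using P less_imp_le[OF \<sigma>pos[of x]] by (simp add: epowr_mult mult.left_commute[of "ennreal (\<sigma> x)"])
    qed
    finally have "(\<integral>\<^sup>+x. epowr (maxop d m g x) P * ennreal (w x) \<partial>m)
      \<le> ennreal (c powr P') * (ennreal C1 * (ennreal C2 * (\<integral>\<^sup>+x. epowr (g x) P * ennreal (w x) \<partial>m)))"
      by (simp add: mult_left_mono)
    then show "(\<integral>\<^sup>+x. epowr (maxop d m g x) P * ennreal (w x) \<partial>m)
      \<le> ennreal (c powr P' * C1 * C2) * (\<integral>\<^sup>+x. epowr (g x) P * ennreal (w x) \<partial>m)"
      using nn by (simp add: ennreal_mult mult_ac)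
  qed
qed

end

section \<open>The vector-valued weighted maximal inequality\<close>

text \<open>A substitute for Minkowski's inequality: geometric factors allow the power to be taken
  termwise.\<close>

lemma epowr_suminf_le:
  fixes a :: "nat \<Rightarrow> ennreal"
  assumes "P > 0"
  shows "epowr (\<Sum>n. a n) P \<le> (\<Sum>n. ennreal (2 powr (P * (real n + 1))) * epowr (a n) P)"
proof -
  let ?b = "\<lambda>n. ennreal (2 ^ (n + 1)) * a n"
  let ?S = "SUP n. ?b n"
  have "a n \<le> ennreal ((1/2) ^ Suc n) * ?S" for n
  proof -
    have "a n = ennreal ((1/2) ^ Suc n) * ?b n"
      by (simp add: mult.assoc[symmetric] ennreal_mult[symmetric] power_mult_distrib[symmetric] del: power_Suc)
    also have "\<dots> \<le> ennreal ((1/2) ^ Suc n) * ?S"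
      by (intro mult_left_mono SUP_upper) auto
    finally show ?thesis .
  qed
  then have "(\<Sum>n. a n) \<le> (\<Sum>n. ennreal ((1/2) ^ Suc n) * ?S)"
    by (intro suminf_le summableI) auto
  also have "\<dots> = (\<Sum>n. ennreal ((1/2) ^ Suc n)) * ?S"
    by (rule ennreal_suminf_multc)
  also have "(\<Sum>n. ennreal ((1/2) ^ Suc n)) = ennreal 1"
    by (rule suminf_ennreal_eq[OF _ power_half_series]) simp
  finally have "epowr (\<Sum>n. a n) P \<le> (SUP n. epowr (?b n) P)"
    using assms by (subst epowr_SUP[symmetric]) (auto intro!: epowr_mono)
  also have "\<dots> \<le> (\<Sum>n. epowr (?b n) P)"
  proof (rule SUP_least)
    fix n
    show "epowr (?b n) P \<le> (\<Sum>n. epowr (?b n) P)"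
      using sum_le_suminf[of "\<lambda>n. epowr (?b n) P" "{n}"] by (simp add: summableI)
  qed
  also have "\<dots> = (\<Sum>n. ennreal (2 powr (P * (real n + 1))) * epowr (a n) P)"
  proof -
    have "(2 ^ (n + 1)) powr P = 2 powr (P * (real n + 1))" for n :: nat
    proof -
      have "(2::real) ^ (n + 1) = 2 powr (real n + 1)" by (simp add: powr_add powr_realpow)
      then show ?thesis by (simp only: powr_powr mult.commute[of P])
    qed
    then show ?thesis using assms by (simp add: epowr_mult)
  qed
  finally show ?thesis .
qed

context homogeneous_type
begin

lemma maxop_suminf_le:
  assumes [measurable]: "\<And>n. g n \<in> borel_measurable borel"
  shows "maxop d m (\<lambda>y. \<Sum>n. g n y) x \<le> (\<Sum>n. maxop d m (g n) x)"
proof (rule maxop_leI)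
  fix k :: int
  let ?B = "qball d x (2 powr real_of_int k)"
  have "(\<integral>\<^sup>+y\<in>?B. (\<Sum>n. g n y) \<partial>m) = (\<integral>\<^sup>+y. (\<Sum>n. g n y * indicator ?B y) \<partial>m)"
    by (simp add: ennreal_suminf_multc)
  also have "\<dots> = (\<Sum>n. \<integral>\<^sup>+y\<in>?B. g n y \<partial>m)"
    by (rule nn_integral_suminf) measurable
  also have "\<dots> \<le> (\<Sum>n. maxop d m (g n) x * emeasure m ?B)"
    by (intro suminf_le average_le_maxop summableI)
  also have "\<dots> = (\<Sum>n. maxop d m (g n) x) * emeasure m ?B"
    by (rule ennreal_suminf_multc)
  finally show "(\<integral>\<^sup>+y\<in>?B. (\<Sum>n. g n y) \<partial>m) \<le> (\<Sum>n. maxop d m (g n) x) * emeasure m ?B" .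
qed

lemma maxop_cmult:
  assumes [measurable]: "g \<in> borel_measurable borel"
  shows "maxop d m (\<lambda>y. c * g y) x \<le> c * maxop d m g x"
proof (rule maxop_leI)
  fix k :: int
  let ?B = "qball d x (2 powr real_of_int k)"
  have "(\<integral>\<^sup>+y\<in>?B. c * g y \<partial>m) = c * (\<integral>\<^sup>+y\<in>?B. g y \<partial>m)"
    by (subst nn_integral_cmult[symmetric]) (auto simp: mult.assoc)
  also have "\<dots> \<le> c * (maxop d m g x * emeasure m ?B)"
    by (intro mult_left_mono average_le_maxop) auto
  finally show "(\<integral>\<^sup>+y\<in>?B. c * g y \<partial>m) \<le> c * maxop d m g x * emeasure m ?B"
    by (simp add: mult.assoc)
qed

lemma maxop_cong_AE:
  assumes "AE y in m. g y = h y"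
  shows "maxop d m g x = maxop d m h x"
proof -
  have "(\<integral>\<^sup>+y\<in>qball d x (2 powr k). g y \<partial>m) = (\<integral>\<^sup>+y\<in>qball d x (2 powr k). h y \<partial>m)" for k
    by (rule nn_integral_cong_AE) (use assms in eventually_elim, simp)
  then show ?thesis by (simp add: maxop_def)
qed

lemma ex_dyadic_ge: "\<exists>k::int. (r::real) \<le> 2 powr k"
proof -
  obtain n :: nat where "r < real n" using reals_Archimedean2 by blast
  also have "real n \<le> 2 ^ n" using of_nat_less_two_power[of n, where 'a = real] by simp
  finally have "r \<le> 2 powr real_of_int (int n)" by (simp add: powr_realpow)
  then show ?thesis by blast
qed

lemma maxop_ball_pos:
  assumes "c > 0"
  shows "maxop d m (\<lambda>y. c * indicator (qball d z 1) y) x > 0"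
proof -
  obtain k :: int where k: "\<kappa> * (d x z + 1) \<le> 2 powr k" using ex_dyadic_ge by blast
  have sub: "qball d z 1 \<subseteq> qball d x (2 powr k)"
  proof
    fix y assume "y \<in> qball d z 1"
    then have y: "d z y < 1" by (simp add: qball_def)
    have "d x y \<le> \<kappa> * (d x z + d z y)" by (rule quasi_triangle)
    also have "\<dots> < \<kappa> * (d x z + 1)"
      using y kappa_ge_1 by (intro mult_strict_left_mono) auto
    finally show "y \<in> qball d x (2 powr k)" using k by (simp add: qball_def)
  qed
  have "0 < c * emeasure m (qball d z 1)"
    using assms qball_pos[of 1 z] by (simp add: ennreal_zero_less_mult_iff zero_less_iff_neq_zero)
  also have "\<dots> = (\<integral>\<^sup>+y. c * indicator (qball d z 1) y \<partial>m)"
    by (simp add: nn_integral_cmult_indicator sets_m)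
  also have "\<dots> = (\<integral>\<^sup>+y\<in>qball d x (2 powr k). c * indicator (qball d z 1) y \<partial>m)"
    using sub by (intro nn_integral_cong) (auto split: split_indicator)
  also have "\<dots> \<le> maxop d m (\<lambda>y. c * indicator (qball d z 1) y) x * emeasure m (qball d x (2 powr k))"
    by (rule average_le_maxop)
  finally show ?thesis by (auto simp: ennreal_zero_less_mult_iff)
qed

text \<open>The Rubio de Francia algorithm: every \<open>g \<in> L\<^sup>P(w)\<close> has a positive majorant \<open>V\<close> of comparable
  norm that is an \<open>A\<^sub>1\<close> weight, namely a geometric series of iterated maximal functions. The small bump
  added to \<open>g\<close>, of norm at most \<open>e\<close>, keeps \<open>V\<close> strictly positive.\<close>

lemma Rubio_de_Francia:
  assumes P: "P > 1" "K \<ge> 0" and Ap: "Ap P K w"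
  shows "\<exists>A>0. \<forall>g e. g \<in> borel_measurable borel \<longrightarrow> (\<integral>\<^sup>+x. epowr (g x) P * ennreal (w x) \<partial>m) \<noteq> top \<longrightarrow> e > 0 \<longrightarrow>
    (\<exists>V :: 'a \<Rightarrow> real. V \<in> borel_measurable borel \<and> (\<forall>x. V x > 0) \<and> (AE x in m. g x \<le> ennreal (V x)) \<and>
      (AE x in m. maxop d m (\<lambda>y. ennreal (V y)) x \<le> ennreal A * ennreal (V x)) \<and>
      (\<integral>\<^sup>+x. epowr (ennreal (V x)) P * ennreal (w x) \<partial>m)
        \<le> ennreal A * ((\<integral>\<^sup>+x. epowr (g x) P * ennreal (w x) \<partial>m) + ennreal e))"
proof -
  note [measurable] = ApD(1)[OF Ap]
  note wpos = ApD(2)[OF Ap]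
  obtain C where C: "C \<ge> 0" "\<And>g. g \<in> borel_measurable borel \<Longrightarrow>
    (\<integral>\<^sup>+x. epowr (maxop d m g x) P * ennreal (w x) \<partial>m) \<le> ennreal C * (\<integral>\<^sup>+x. epowr (g x) P * ennreal (w x) \<partial>m)"
    using Muckenhoupt_maximal[OF P] Ap by blast
  \<comment> \<open>Chosen so that the norms of the terms of the series sum even against the factors \<open>2\<^sup>n\<close> that
    replace Minkowski's inequality.\<close>
  define \<epsilon> where "\<epsilon> = (1 / (2 * (C + 1))) powr (1 / P) / 2"
  have \<epsilon>: "\<epsilon> > 0" "(2 * \<epsilon>) powr P * C \<le> 1 / 2"
    using C P by (auto simp: \<epsilon>_def powr_powr field_simps)
  define A where "A = max (1 / \<epsilon>) (2 powr P * 2 * 2 powr P)"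
  have A: "A > 0" "1 / \<epsilon> \<le> A" "2 powr P * 2 * 2 powr P \<le> A" using \<epsilon>(1) by (auto simp: A_def less_max_iff_disj)
  show ?thesis
  proof (intro exI[of _ A] conjI allI impI A)
    fix g :: "'a \<Rightarrow> ennreal" and e :: real
    assume [measurable]: "g \<in> borel_measurable borel" and e: "e > 0"
      and fin: "(\<integral>\<^sup>+x. epowr (g x) P * ennreal (w x) \<partial>m) \<noteq> top"
    let ?I = "\<integral>\<^sup>+x. epowr (g x) P * ennreal (w x) \<partial>m"
    define z :: 'a where "z = undefined"
    obtain W where W: "ball_mass w z 1 = ennreal W" "W \<ge> 0"
      using ApD(3)[OF Ap, of 1 z] by (cases "ball_mass w z 1") auto
    define c where "c = (e / (W + 1)) powr (1 / P)"
    have c: "c > 0" "c powr P * W \<le> e"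
      using e W P by (auto simp: c_def powr_powr field_simps)
    define g1 where "g1 x = g x + ennreal c * indicator (qball d z 1) x" for x
    have [measurable]: "g1 \<in> borel_measurable borel" unfolding g1_def by measurable
    have g1_norm: "(\<integral>\<^sup>+x. epowr (g1 x) P * ennreal (w x) \<partial>m) \<le> ennreal (2 powr P) * (?I + ennreal e)"
    proof -
      have "(\<integral>\<^sup>+x. epowr (g1 x) P * ennreal (w x) \<partial>m) \<le> (\<integral>\<^sup>+x. ennreal (2 powr P) *
         (epowr (g x) P * ennreal (w x) + ennreal (c powr P) * (ennreal (w x) * indicator (qball d z 1) x)) \<partial>m)"
      proof (rule nn_integral_mono)
        fix x
        have "epowr (g1 x) P * ennreal (w x) \<le> ennreal (2 powr P) * (epowr (g x) P + ennreal (c powr P) * indicator (qball d z 1) x) * ennreal (w x)"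
          using epowr_add_le[of P "g x" "ennreal c * indicator (qball d z 1) x"] P c
          unfolding g1_def epowr_mult_indicator by (intro mult_right_mono) auto
        then show "epowr (g1 x) P * ennreal (w x) \<le> ennreal (2 powr P) *
         (epowr (g x) P * ennreal (w x) + ennreal (c powr P) * (ennreal (w x) * indicator (qball d z 1) x))"
          by (simp add: distrib_left distrib_right mult_ac)
      qed
      also have "\<dots> = ennreal (2 powr P) * (?I + ennreal (c powr P) * ball_mass w z 1)"
        by (simp add: nn_integral_cmult nn_integral_add)
      also have "\<dots> \<le> ennreal (2 powr P) * (?I + ennreal e)"
        using c W by (intro mult_left_mono add_left_mono) (auto simp: ennreal_mult[symmetric] intro!: ennreal_leI)
      finally show ?thesis .
    qed
    define it where "it n = (maxop d m ^^ n) g1" for n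
    have it_Suc: "it (Suc n) = maxop d m (it n)" and it_0: "it 0 = g1" for n
      by (simp_all add: it_def)
    have it_meas [measurable]: "it n \<in> borel_measurable borel" for n
      by (induction n) (auto simp: it_Suc it_0)
    have it_norm: "(\<integral>\<^sup>+x. epowr (it n x) P * ennreal (w x) \<partial>m) \<le> ennreal (C ^ n) * (\<integral>\<^sup>+x. epowr (g1 x) P * ennreal (w x) \<partial>m)" for n
    proof (induction n)
      case (Suc n)
      have "(\<integral>\<^sup>+x. epowr (it (Suc n) x) P * ennreal (w x) \<partial>m) \<le> ennreal C * (\<integral>\<^sup>+x. epowr (it n x) P * ennreal (w x) \<partial>m)"
        unfolding it_Suc by (rule C) measurable
      also have "\<dots> \<le> ennreal C * (ennreal (C ^ n) * (\<integral>\<^sup>+x. epowr (g1 x) P * ennreal (w x) \<partial>m))"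
        by (intro mult_left_mono Suc) auto
      finally show ?case using C(1) by (simp add: ennreal_mult mult.assoc)
    qed (simp add: it_0)
    \<comment> \<open>Applying the maximal operator shifts the series by one term, at the cost of a factor \<open>1/\<epsilon>\<close>.\<close>
    define V' where "V' x = (\<Sum>n. ennreal (\<epsilon> ^ n) * it n x)" for x
    have [measurable]: "V' \<in> borel_measurable borel" unfolding V'_def by measurable
    have term_le: "ennreal (\<epsilon> ^ n) * it n x \<le> V' x" for n x
      unfolding V'_def using sum_le_suminf[of "\<lambda>n. ennreal (\<epsilon> ^ n) * it n x" "{n}"] by (simp add: summableI)
    have V'_ge: "g x \<le> V' x" for x
      using term_le[of 0 x] by (simp add: it_0 g1_def add_increasing2 order.trans[rotated])
    have V'_pos: "V' x > 0" for x
    proof -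
      have "0 < maxop d m (\<lambda>y. ennreal c * indicator (qball d z 1) y) x"
        using c by (intro maxop_ball_pos) auto
      also have "\<dots> \<le> it 1 x"
        unfolding One_nat_def it_Suc it_0 by (intro maxop_mono) (simp add: g1_def add_increasing)
      finally have "0 < ennreal (\<epsilon> ^ 1) * it 1 x" using \<epsilon> by (simp add: ennreal_zero_less_mult_iff)
      also have "\<dots> \<le> V' x" by (rule term_le)
      finally show ?thesis .
    qed
    have V'_max: "maxop d m V' x \<le> ennreal (1 / \<epsilon>) * V' x" for x
    proof -
      have "maxop d m V' x \<le> (\<Sum>n. maxop d m (\<lambda>y. ennreal (\<epsilon> ^ n) * it n y) x)"
        unfolding V'_def by (rule maxop_suminf_le) measurable
      also have "\<dots> \<le> (\<Sum>n. ennreal (\<epsilon> ^ n) * it (Suc n) x)"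
        unfolding it_Suc by (intro suminf_le maxop_cmult summableI) measurable
      also have "\<dots> = (\<Sum>n. ennreal (1 / \<epsilon>) * (ennreal (\<epsilon> ^ Suc n) * it (Suc n) x))"
        using \<epsilon> by (simp add: mult.assoc[symmetric] ennreal_mult[symmetric])
      also have "\<dots> = ennreal (1 / \<epsilon>) * (\<Sum>n. ennreal (\<epsilon> ^ Suc n) * it (Suc n) x)"
        by (rule ennreal_suminf_cmult)
      also have "\<dots> \<le> ennreal (1 / \<epsilon>) * V' x"
        unfolding V'_def by (intro mult_left_mono)
          (auto simp: suminf_offset[of "\<lambda>n. ennreal (\<epsilon> ^ n) * it n x" 1, OF summableI] add_increasing)
      finally show ?thesis .
    qed
    have V'_norm: "(\<integral>\<^sup>+x. epowr (V' x) P * ennreal (w x) \<partial>m) \<le> ennreal (2 powr P * 2) * (\<integral>\<^sup>+x. epowr (g1 x) P * ennreal (w x) \<partial>m)"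
      (is "_ \<le> _ * ?G")
    proof -
      have "(\<integral>\<^sup>+x. epowr (V' x) P * ennreal (w x) \<partial>m)
        \<le> (\<integral>\<^sup>+x. (\<Sum>n. ennreal (2 powr (P * (real n + 1))) * epowr (ennreal (\<epsilon> ^ n) * it n x) P) * ennreal (w x) \<partial>m)"
        unfolding V'_def using P by (intro nn_integral_mono mult_right_mono epowr_suminf_le) auto
      also have "\<dots> = (\<integral>\<^sup>+x. (\<Sum>n. ennreal (2 powr (P * (real n + 1)) * (\<epsilon> ^ n) powr P) * (epowr (it n x) P * ennreal (w x))) \<partial>m)"
        using P \<epsilon> by (simp add: ennreal_suminf_multc[symmetric] epowr_mult ennreal_mult mult.assoc)
      also have "\<dots> = (\<Sum>n. \<integral>\<^sup>+x. ennreal (2 powr (P * (real n + 1)) * (\<epsilon> ^ n) powr P) * (epowr (it n x) P * ennreal (w x)) \<partial>m)"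
        by (rule nn_integral_suminf) measurable
      also have "\<dots> = (\<Sum>n. ennreal (2 powr (P * (real n + 1)) * (\<epsilon> ^ n) powr P) * (\<integral>\<^sup>+x. epowr (it n x) P * ennreal (w x) \<partial>m))"
        by (simp add: nn_integral_cmult)
      also have "\<dots> \<le> (\<Sum>n. ennreal (2 powr P) * ennreal ((1/2) ^ n) * ?G)"
      proof (intro suminf_le summableI)
        fix n
        have "2 powr (P * (real n + 1)) * (\<epsilon> ^ n) powr P * C ^ n = 2 powr P * ((2 * \<epsilon>) powr P * C) ^ n"
        proof -
          have "2 powr (P * (real n + 1)) = 2 powr P * (2 powr P) ^ n"
            by (simp add: powr_add algebra_simps powr_power)
          moreover have "(\<epsilon> ^ n) powr P = (\<epsilon> powr P) ^ n"
            using \<epsilon> by (simp add: powr_power powr_realpow[symmetric] powr_powr mult.commute)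
          ultimately show ?thesis using \<epsilon> by (simp add: powr_mult power_mult_distrib)
        qed
        also have "\<dots> \<le> 2 powr P * (1 / 2) ^ n"
          using \<epsilon> C by (intro mult_left_mono power_mono) auto
        finally have le: "2 powr (P * (real n + 1)) * (\<epsilon> ^ n) powr P * C ^ n \<le> 2 powr P * (1 / 2) ^ n" .
        have "ennreal (2 powr (P * (real n + 1)) * (\<epsilon> ^ n) powr P) * (\<integral>\<^sup>+x. epowr (it n x) P * ennreal (w x) \<partial>m)
          \<le> ennreal (2 powr (P * (real n + 1)) * (\<epsilon> ^ n) powr P) * (ennreal (C ^ n) * ?G)"
          by (intro mult_left_mono it_norm) auto
        also have "\<dots> = ennreal (2 powr (P * (real n + 1)) * (\<epsilon> ^ n) powr P * C ^ n) * ?G"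
          using C by (simp add: ennreal_mult mult.assoc)
        also have "\<dots> \<le> ennreal (2 powr P * (1 / 2) ^ n) * ?G"
          by (intro mult_right_mono ennreal_leI le) auto
        finally show "ennreal (2 powr (P * (real n + 1)) * (\<epsilon> ^ n) powr P) * (\<integral>\<^sup>+x. epowr (it n x) P * ennreal (w x) \<partial>m)
          \<le> ennreal (2 powr P) * ennreal ((1/2) ^ n) * ?G"
          by (simp add: ennreal_mult)
      qed
      also have "\<dots> = ennreal (2 powr P) * (\<Sum>n. ennreal ((1/2) ^ n)) * ?G"
        by (simp add: ennreal_suminf_multc)
      also have "(\<Sum>n. ennreal ((1/2) ^ n)) = ennreal 2"
      proof (rule suminf_ennreal_eq)
        show "(\<lambda>n. (1/2 :: real) ^ n) sums 2"
          using geometric_sums[of "1/2 :: real"] by simp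
      qed simp
      also have "ennreal (2 powr P) * ennreal 2 * ?G = ennreal (2 powr P * 2) * ?G"
        by (simp add: ennreal_mult)
      finally show ?thesis .
    qed
    also have "\<dots> \<le> ennreal (2 powr P * 2) * (ennreal (2 powr P) * (?I + ennreal e))"
      by (intro mult_left_mono g1_norm) auto
    also have "\<dots> = ennreal (2 powr P * 2 * 2 powr P) * (?I + ennreal e)"
      by (simp add: ennreal_mult mult.assoc)
    also have "\<dots> \<le> ennreal A * (?I + ennreal e)"
      by (intro mult_right_mono ennreal_leI A) auto
    finally have norm: "(\<integral>\<^sup>+x. epowr (V' x) P * ennreal (w x) \<partial>m) \<le> ennreal A * (?I + ennreal e)" .
    also have "\<dots> < top"
      using fin by (auto simp: ennreal_mult_less_top less_top)
    finally have fin': "(\<integral>\<^sup>+x. epowr (V' x) P * ennreal (w x) \<partial>m) \<noteq> \<infinity>" by simp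
    have AEfin: "AE x in m. V' x \<noteq> top"
    proof -
      have "AE x in m. epowr (V' x) P * ennreal (w x) \<noteq> \<infinity>"
        by (rule nn_integral_PInf_AE[OF _ fin']) measurable
      then show ?thesis
        by eventually_elim (use wpos[THEN not_le[THEN iffD2]] in \<open>auto simp: ennreal_top_mult ennreal_eq_0_iff\<close>)
    qed
    define V where "V x = (if V' x = top then 1 else enn2real (V' x))" for x
    have [measurable]: "V \<in> borel_measurable borel"
    proof -
      have "{x. V' x = top} \<in> sets borel"
        using measurable_sets[of V' borel borel "{top}"] by (simp add: vimage_def)
      then show ?thesis unfolding V_def by (intro measurable_If) auto
    qed
    have VV': "AE x in m. ennreal (V x) = V' x"
      using AEfin by eventually_elim (simp add: V_def less_top)
    show "\<exists>V. V \<in> borel_measurable borel \<and> (\<forall>x. V x > 0) \<and> (AE x in m. g x \<le> ennreal (V x)) \<and>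
      (AE x in m. maxop d m (\<lambda>y. ennreal (V y)) x \<le> ennreal A * ennreal (V x)) \<and>
      (\<integral>\<^sup>+x. epowr (ennreal (V x)) P * ennreal (w x) \<partial>m) \<le> ennreal A * (?I + ennreal e)"
    proof (intro exI[of _ V] conjI allI)
      show "V x > 0" for x
        using V'_pos[of x] by (auto simp: V_def enn2real_positive_iff less_top)
      show "AE x in m. g x \<le> ennreal (V x)"
        using VV' by eventually_elim (simp add: V'_ge)
      show "AE x in m. maxop d m (\<lambda>y. ennreal (V y)) x \<le> ennreal A * ennreal (V x)"
        using VV'
      proof eventually_elim
        case (elim x)
        have "maxop d m (\<lambda>y. ennreal (V y)) x = maxop d m V' x" by (rule maxop_cong_AE[OF VV'])
        also have "\<dots> \<le> ennreal (1 / \<epsilon>) * V' x" by (rule V'_max)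
        also have "\<dots> \<le> ennreal A * V' x" by (intro mult_right_mono ennreal_leI A) auto
        finally show ?case by (simp add: elim)
      qed
      have "(\<integral>\<^sup>+x. epowr (ennreal (V x)) P * ennreal (w x) \<partial>m) = (\<integral>\<^sup>+x. epowr (V' x) P * ennreal (w x) \<partial>m)"
        by (rule nn_integral_cong_AE) (use VV' in eventually_elim, simp)
      then show "(\<integral>\<^sup>+x. epowr (ennreal (V x)) P * ennreal (w x) \<partial>m) \<le> ennreal A * (?I + ennreal e)"
        using norm by simp
    qed measurable
  qed
qed

text \<open>Passes from dyadic balls centred at \<open>y\<close>, as in the maximal operator, to any ball containing
  \<open>y\<close>.\<close>

lemma A1_ball:
  assumes [measurable]: "V \<in> borel_measurable borel" and A: "A > 0"
    and A1: "AE x in m. maxop d m (\<lambda>y. ennreal (V y)) x \<le> ennreal A * ennreal (V x)" and t: "t > 0"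
  shows "ball_mass V x t \<noteq> top"
    and "AE y in m. y \<in> qball d x t \<longrightarrow> ball_mass V x t \<le> ennreal (A * D ^ (2 * J + 1)) * ennreal (V y) * emeasure m (qball d x t)"
proof -
  define k where "k = \<lceil>log 2 (2 ^ J * t)\<rceil>"
  have "2 powr log 2 (2 ^ J * t) = 2 ^ J * t" using t by simp
  moreover have "log 2 (2 ^ J * t) \<le> k" "k \<le> log 2 (2 ^ J * t) + 1" by (auto simp: k_def)
  then have "2 powr log 2 (2 ^ J * t) \<le> 2 powr k" "2 powr k \<le> 2 powr (log 2 (2 ^ J * t) + 1)"
    by (auto intro!: powr_mono)
  ultimately have k: "2 ^ J * t \<le> 2 powr k" "2 powr k \<le> 2 * (2 ^ J * t)"
    by (auto simp: powr_add)
  show ae: "AE y in m. y \<in> qball d x t \<longrightarrow> ball_mass V x t \<le> ennreal (A * D ^ (2 * J + 1)) * ennreal (V y) * emeasure m (qball d x t)"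
    using A1
  proof eventually_elim
    case (elim y)
    show ?case
    proof
      assume y: "y \<in> qball d x t"
      have "qball d x t \<subseteq> qball d y (2 powr k)"
        using qball_subset_other_centre(1)[OF y t] qball_mono[OF k(1), of y] by blast
      then have "ball_mass V x t \<le> ball_mass V y (2 powr k)"
        by (intro nn_integral_mono) (auto split: split_indicator)
      also have "\<dots> \<le> maxop d m (\<lambda>y. ennreal (V y)) y * emeasure m (qball d y (2 powr k))"
        by (rule average_le_maxop)
      also have "\<dots> \<le> (ennreal A * ennreal (V y)) * (ennreal (D ^ (2 * J + 1)) * emeasure m (qball d x t))"
      proof (intro mult_mono elim)
        have "emeasure m (qball d y (2 powr k)) \<le> emeasure m (qball d y (2 * (2 ^ J * t)))"
          by (intro emeasure_mono qball_mono k) (simp add: sets_m)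
        also have "\<dots> \<le> ennreal D * emeasure m (qball d y (2 ^ J * t))"
          by (rule doubling) (use t in auto)
        also have "\<dots> \<le> ennreal D * emeasure m (qball d x (2 ^ (2 * J) * t))"
          by (intro mult_left_mono emeasure_mono qball_subset_other_centre(2)[OF y t]) (auto simp: sets_m)
        also have "\<dots> \<le> ennreal D * (ennreal (D ^ (2 * J)) * emeasure m (qball d x t))"
          by (intro mult_left_mono doubling_power t) auto
        finally show "emeasure m (qball d y (2 powr k)) \<le> ennreal (D ^ (2 * J + 1)) * emeasure m (qball d x t)"
          using D_ge_1 by (simp add: ennreal_mult mult.assoc)
      qed auto
      also have "\<dots> = ennreal (A * D ^ (2 * J + 1)) * ennreal (V y) * emeasure m (qball d x t)"
        using A D_ge_1 by (simp add: ennreal_mult mult_ac)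
      finally show "ball_mass V x t \<le> ennreal (A * D ^ (2 * J + 1)) * ennreal (V y) * emeasure m (qball d x t)" .
    qed
  qed
  show "ball_mass V x t \<noteq> top"
  proof
    assume top: "ball_mass V x t = top"
    have "AE y in m. y \<notin> qball d x t"
      using ae by eventually_elim
         (use top qball_finite[of x t] in \<open>auto simp: top_unique ennreal_mult_eq_top_iff\<close>)
    then have "emeasure m (qball d x t) = 0"
      by (subst (asm) AE_iff_measurable[OF _ refl]) (auto simp: sets_m)
    then show False using qball_pos[OF t] by auto
  qed
qed

text \<open>The easy half of the Jones factorization theorem: on a ball an \<open>A\<^sub>1\<close> weight is bounded below by
  a multiple of its average, which bounds the factor with a negative exponent in each of the two
  integrals.\<close>

lemma Ap_factorization:
  assumes Q: "Q > 1" and A: "A > 0" "A' > 0"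
    and [measurable]: "V \<in> borel_measurable borel" "U \<in> borel_measurable borel"
    and pos: "\<And>x. V x > 0" "\<And>x. U x > 0"
    and A1: "AE x in m. maxop d m (\<lambda>y. ennreal (V y)) x \<le> ennreal A * ennreal (V x)"
      "AE x in m. maxop d m (\<lambda>y. ennreal (U y)) x \<le> ennreal A' * ennreal (U x)"
  shows "Ap Q ((A * D ^ (2 * J + 1)) powr (Q - 1) * (A' * D ^ (2 * J + 1))) (\<lambda>x. V x powr (1 - Q) * U x)"
    (is "Ap Q (?A powr (Q - 1) * ?A') ?w")
  unfolding Ap_def
proof (intro conjI allI impI)
  show "?w \<in> borel_measurable borel" by measurable
  show "0 < ?w x" for x using pos[of x] by simp
  fix x and t :: real assume t: "t > 0"
  let ?B = "qball d x t"
  have A': "?A > 0" "?A' > 0" using A D_ge_1 by auto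
  have massnz: "ball_mass X x t \<noteq> 0" if [measurable]: "X \<in> borel_measurable borel" and "\<And>x. X x > 0" for X
  proof
    assume "ball_mass X x t = 0"
    then have "AE y in m. ennreal (X y) * indicator ?B y = 0"
      by (subst (asm) nn_integral_0_iff_AE) auto
    moreover have "\<not> X y \<le> 0" for y using that(2)[of y] by simp
    ultimately have "AE y in m. y \<notin> ?B"
      by (auto elim!: AE_mp simp: ennreal_eq_0_iff split: split_indicator_asm)
    then have "emeasure m ?B = 0"
      by (subst (asm) AE_iff_measurable[OF _ refl]) (auto simp: sets_m)
    then show False using qball_pos[OF t] by auto
  qed
  obtain b where b: "emeasure m ?B = ennreal b" "b > 0"
    using qball_pos[OF t, of x] qball_finite[of x t] by (cases "emeasure m ?B") (auto simp: less_le)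
  obtain v where v: "ball_mass V x t = ennreal v" "v > 0"
    using massnz[of V] A1_ball(1)[OF _ A(1) A1(1) t, of x] pos by (cases "ball_mass V x t") (auto simp: less_le)
  obtain u where u: "ball_mass U x t = ennreal u" "u > 0"
    using massnz[of U] A1_ball(1)[OF _ A(2) A1(2) t, of x] pos by (cases "ball_mass U x t") (auto simp: less_le)
  have divide: "r / (c * b) \<le> z" if "c > 0" "z > 0" "ennreal r \<le> ennreal c * ennreal z * ennreal b" for r c z
  proof -
    have "r \<le> c * z * b"
      using that b(2) by (simp add: ennreal_mult[symmetric])
    then show ?thesis using that b(2) by (simp add: pos_divide_le_eq mult_ac)
  qed
  have V_ge: "AE y in m. y \<in> ?B \<longrightarrow> v / (?A * b) \<le> V y"
    using A1_ball(2)[OF _ A(1) A1(1) t, of x, unfolded v b, OF assms(4)]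
    by eventually_elim (use divide[OF A'(1) pos(1)] in blast)
  have U_ge: "AE y in m. y \<in> ?B \<longrightarrow> u / (?A' * b) \<le> U y"
    using A1_ball(2)[OF _ A(2) A1(2) t, of x, unfolded u b, OF assms(5)]
    by eventually_elim (use divide[OF A'(2) pos(2)] in blast)
  have W: "ball_mass ?w x t \<le> ennreal ((v / (?A * b)) powr (1 - Q) * u)"
  proof -
    have "ball_mass ?w x t \<le> (\<integral>\<^sup>+y. ennreal ((v / (?A * b)) powr (1 - Q)) * (ennreal (U y) * indicator ?B y) \<partial>m)"
    proof (rule nn_integral_mono_AE)
      show "AE y in m. ennreal (?w y) * indicator ?B y \<le> ennreal ((v / (?A * b)) powr (1 - Q)) * (ennreal (U y) * indicator ?B y)"
        using V_ge
      proof eventually_elim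
        case (elim y)
        show ?case
        proof (cases "y \<in> ?B")
          case True
          then have "V y powr (1 - Q) \<le> (v / (?A * b)) powr (1 - Q)"
            using elim v b A' Q by (intro powr_mono2') auto
          then show ?thesis using True pos(2)[of y]
            by (auto simp: ennreal_mult[symmetric] intro!: ennreal_leI)
        qed auto
      qed
    qed
    also have "\<dots> = ennreal ((v / (?A * b)) powr (1 - Q)) * ennreal u"
      unfolding u(1)[symmetric] by (rule nn_integral_cmult) measurable
    finally show ?thesis using u by (simp add: ennreal_mult)
  qed
  have S: "ball_mass (dual_weight Q ?w) x t \<le> ennreal ((u / (?A' * b)) powr (- 1 / (Q - 1)) * v)"
  proof -
    have "ball_mass (dual_weight Q ?w) x t \<le> (\<integral>\<^sup>+y. ennreal ((u / (?A' * b)) powr (- 1 / (Q - 1))) * (ennreal (V y) * indicator ?B y) \<partial>m)"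
    proof (rule nn_integral_mono_AE)
      show "AE y in m. ennreal (dual_weight Q ?w y) * indicator ?B y \<le> ennreal ((u / (?A' * b)) powr (- 1 / (Q - 1))) * (ennreal (V y) * indicator ?B y)"
        using U_ge
      proof eventually_elim
        case (elim y)
        show ?case
        proof (cases "y \<in> ?B")
          case True
          then have le: "U y powr (- 1 / (Q - 1)) \<le> (u / (?A' * b)) powr (- 1 / (Q - 1))"
            using elim u b A' Q by (intro powr_mono2') auto
          have "(1 - Q) * (- 1 / (Q - 1)) = 1" using Q by (simp add: field_simps)
          then have "dual_weight Q ?w y = V y * U y powr (- 1 / (Q - 1))"
            using pos[of y] unfolding dual_weight_def powr_mult powr_powr by simp
          then show ?thesis using True pos(1)[of y] le
            by (auto simp: ennreal_mult[symmetric] mult.commute intro!: ennreal_leI mult_left_mono)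
        qed auto
      qed
    qed
    also have "\<dots> = ennreal ((u / (?A' * b)) powr (- 1 / (Q - 1))) * ennreal v"
      unfolding v(1)[symmetric] by (rule nn_integral_cmult) measurable
    finally show ?thesis using v by (simp add: ennreal_mult)
  qed
  show "ball_mass ?w x t \<noteq> top" "ball_mass (dual_weight Q ?w) x t \<noteq> top"
    using W S by (auto simp: top_unique)
  have "ball_mass ?w x t * epowr (ball_mass (dual_weight Q ?w) x t) (Q - 1)
     \<le> ennreal ((v / (?A * b)) powr (1 - Q) * u) * epowr (ennreal ((u / (?A' * b)) powr (- 1 / (Q - 1)) * v)) (Q - 1)"
    using Q by (intro mult_mono W epowr_mono S) auto
  also have "\<dots> = ennreal ((v / (?A * b)) powr (1 - Q) * u * ((u / (?A' * b)) powr (- 1 / (Q - 1)) * v) powr (Q - 1))"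
    using v u by (simp add: ennreal_mult[symmetric])
  also have "(v / (?A * b)) powr (1 - Q) * u * ((u / (?A' * b)) powr (- 1 / (Q - 1)) * v) powr (Q - 1)
      = (?A powr (Q - 1) * ?A') * b powr Q"
  proof -
    have "- 1 / (Q - 1) * (Q - 1) = - 1" using Q by simp
    then have "((u / (?A' * b)) powr (- 1 / (Q - 1)) * v) powr (Q - 1) = (u / (?A' * b)) powr (- 1) * v powr (Q - 1)"
      unfolding powr_mult powr_powr by (simp only:)
    also have "(u / (?A' * b)) powr (- 1) = ?A' * b / u"
      using u A' b by (simp add: powr_minus)
    finally have 1: "((u / (?A' * b)) powr (- 1 / (Q - 1)) * v) powr (Q - 1) = ?A' * b / u * v powr (Q - 1)" .
    have 2: "(v / (?A * b)) powr (1 - Q) = v powr (1 - Q) * (?A powr (Q - 1) * b powr (Q - 1))"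
    proof -
      have "(v / (?A * b)) powr (1 - Q) = v powr (1 - Q) / (?A powr (1 - Q) * b powr (1 - Q))"
        by (simp only: powr_divide powr_mult)
      moreover have "?A powr (1 - Q) = inverse (?A powr (Q - 1))" "b powr (1 - Q) = inverse (b powr (Q - 1))"
        using powr_minus[of ?A "Q - 1"] powr_minus[of b "Q - 1"] by simp_all
      ultimately show ?thesis by (simp only: divide_inverse inverse_mult_distrib inverse_inverse_eq)
    qed
    have 3: "v powr (1 - Q) * v powr (Q - 1) = 1" "b powr (Q - 1) * b = b powr Q"
      using v b powr_add[of b "Q - 1" 1] by (auto simp: powr_add[symmetric])
    have "(v / (?A * b)) powr (1 - Q) * u * (?A' * b / u * v powr (Q - 1))
       = (v powr (1 - Q) * v powr (Q - 1)) * (?A powr (Q - 1) * ?A') * (b powr (Q - 1) * b) * (u / u)"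
    proof -
      have "(a1 * (a2 * a3)) * u * (a4 * b / u * a5) = (a1 * a5) * (a2 * a4) * (a3 * b) * (u / u)" for a1 a2 a3 a4 a5 :: real
        by simp
      then show ?thesis unfolding 2 .
    qed
    then show ?thesis unfolding 1 using 3 u by simp
  qed
  finally show "ball_mass ?w x t * epowr (ball_mass (dual_weight Q ?w) x t) (Q - 1)
     \<le> ennreal (?A powr (Q - 1) * ?A') * epowr (emeasure m ?B) Q"
    using A' b by (simp add: ennreal_mult)
qed

text \<open>Extrapolation from the diagonal case \<open>P = Q\<close>, where the inequality is Muckenhoupt's theorem
  integrated in \<open>t\<close>. Let \<open>f\<close> and \<open>g\<close> be the inner norms on the two sides and test \<open>f\<close> against \<open>f\<^sup>P\<^sup>-\<^sup>1 w\<close>.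
  Dominating \<open>g\<close> and the test function by \<open>A\<^sub>1\<close> weights \<open>V\<close> and \<open>U\<close>, the product \<open>V\<^sup>1\<^sup>-\<^sup>Q U\<close> is an \<open>A\<^sub>Q\<close>
  weight, and in it the diagonal case bounds everything by \<open>\<integral> V U\<close>. Truncating \<open>f\<close> makes its own norm
  finite, so that it can be absorbed.\<close>

theorem Fefferman_Stein_weighted:
  fixes \<tau> :: "'b measure"
  assumes P: "P > 1" "K \<ge> 0" and Q: "Q > 1" and Ap: "Ap P K w" and "sigma_finite_measure \<tau>"
  shows "\<exists>C\<ge>0. \<forall>G\<in>borel_measurable (\<tau> \<Otimes>\<^sub>M borel).
    (\<integral>\<^sup>+x. epowr (\<integral>\<^sup>+t. epowr (maxop d m (\<lambda>y. G (t, y)) x) Q \<partial>\<tau>) (P / Q) * ennreal (w x) \<partial>m)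
    \<le> ennreal C * (\<integral>\<^sup>+x. epowr (\<integral>\<^sup>+t. epowr (G (t, x)) Q \<partial>\<tau>) (P / Q) * ennreal (w x) \<partial>m)"
proof -
  interpret \<tau>: sigma_finite_measure \<tau> by fact
  interpret pair_sigma_finite m \<tau> ..
  note [measurable] = ApD(1)[OF Ap]
  note wpos = ApD(2)[OF Ap]
  define P' where "P' = P / (P - 1)"
  have P': "P' > 1" "1 / P + 1 / P' = 1"
    using conjugate_exponent[OF P(1)] by (auto simp: P'_def)
  define \<sigma> where "\<sigma> = dual_weight P w"
  have [measurable]: "\<sigma> \<in> borel_measurable borel" unfolding \<sigma>_def by measurable
  have \<sigma>pos: "\<sigma> x > 0" for x unfolding \<sigma>_def using wpos by (rule dual_weight_pos)
  have Ap': "Ap P' (K powr (1 / (P - 1))) \<sigma>"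
    unfolding P'_def \<sigma>_def by (rule Ap_dual[OF P Ap])
  obtain A1 where A1: "A1 > 0" and RF1: "\<And>g e. g \<in> borel_measurable borel \<Longrightarrow> (\<integral>\<^sup>+x. epowr (g x) P * ennreal (w x) \<partial>m) \<noteq> top \<Longrightarrow> e > 0 \<Longrightarrow>
    (\<exists>V :: 'a \<Rightarrow> real. V \<in> borel_measurable borel \<and> (\<forall>x. V x > 0) \<and> (AE x in m. g x \<le> ennreal (V x)) \<and>
      (AE x in m. maxop d m (\<lambda>y. ennreal (V y)) x \<le> ennreal A1 * ennreal (V x)) \<and>
      (\<integral>\<^sup>+x. epowr (ennreal (V x)) P * ennreal (w x) \<partial>m)
        \<le> ennreal A1 * ((\<integral>\<^sup>+x. epowr (g x) P * ennreal (w x) \<partial>m) + ennreal e))"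
    using Rubio_de_Francia[OF P Ap] by blast
  obtain A2 where A2: "A2 > 0" and RF2: "\<And>g e. g \<in> borel_measurable borel \<Longrightarrow> (\<integral>\<^sup>+x. epowr (g x) P' * ennreal (\<sigma> x) \<partial>m) \<noteq> top \<Longrightarrow> e > 0 \<Longrightarrow>
    (\<exists>V :: 'a \<Rightarrow> real. V \<in> borel_measurable borel \<and> (\<forall>x. V x > 0) \<and> (AE x in m. g x \<le> ennreal (V x)) \<and>
      (AE x in m. maxop d m (\<lambda>y. ennreal (V y)) x \<le> ennreal A2 * ennreal (V x)) \<and>
      (\<integral>\<^sup>+x. epowr (ennreal (V x)) P' * ennreal (\<sigma> x) \<partial>m)
        \<le> ennreal A2 * ((\<integral>\<^sup>+x. epowr (g x) P' * ennreal (\<sigma> x) \<partial>m) + ennreal e))"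
    using Rubio_de_Francia[OF P'(1) _ Ap'] by auto
  define K0 where "K0 = (A1 * D ^ (2 * J + 1)) powr (Q - 1) * (A2 * D ^ (2 * J + 1))"
  have "K0 \<ge> 0" using A2 D_ge_1 by (simp add: K0_def)
  then obtain C0 where C0: "C0 \<ge> 0" "\<And>w g. Ap Q K0 w \<Longrightarrow> g \<in> borel_measurable borel \<Longrightarrow>
    (\<integral>\<^sup>+x. epowr (maxop d m g x) Q * ennreal (w x) \<partial>m) \<le> ennreal C0 * (\<integral>\<^sup>+x. epowr (g x) Q * ennreal (w x) \<partial>m)"
    using Muckenhoupt_maximal[OF Q] by blast
  \<comment> \<open>\<open>l\<close> is chosen so that the term to be absorbed carries the factor \<open>1/2\<close>.\<close>
  define l where "l = (2 * (1 + C0) * A2) powr (1 / P')"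
  have pos: "2 * (1 + C0) * A2 > 0" "1 + C0 > 0" using C0(1) A2 by auto
  have "1 / P' * - P' = - 1" using P' by simp
  then have "l powr (- P') = inverse (2 * (1 + C0) * A2)"
    using pos unfolding l_def powr_powr by (simp add: powr_minus)
  then have l: "l > 0" "(1 + C0) * (l powr (- P') * A2) = 1 / 2"
    using pos A2 by (auto simp: l_def inverse_eq_divide)
  define B where "B = (1 + C0) * (l powr P * A1)"
  have B: "B \<ge> 0" using C0 A1 by (simp add: B_def)
  show ?thesis
  proof (intro exI[of _ "2 * B + 1"] conjI ballI)
    show "0 \<le> 2 * B + 1" using B by simp
    fix G :: "'b \<times> 'a \<Rightarrow> ennreal" assume G [measurable]: "G \<in> borel_measurable (\<tau> \<Otimes>\<^sub>M (borel :: 'a measure))"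
    have MG [measurable]: "(\<lambda>z. maxop d m (\<lambda>y. G (snd z, y)) (fst z)) \<in> borel_measurable (borel \<Otimes>\<^sub>M \<tau>)"
      by (rule measurable_maxop_pair) measurable
    have G' [measurable]: "(\<lambda>z. G (snd z, fst z)) \<in> borel_measurable (borel \<Otimes>\<^sub>M \<tau>)"
      by measurable
    define F where "F x = (\<integral>\<^sup>+t. epowr (maxop d m (\<lambda>y. G (t, y)) x) Q \<partial>\<tau>)" for x
    define gg where "gg x = (\<integral>\<^sup>+t. epowr (G (t, x)) Q \<partial>\<tau>)" for x
    have [measurable]: "F \<in> borel_measurable borel"
      unfolding F_def using MG by (intro \<tau>.borel_measurable_nn_integral) (simp add: split_beta')
    have [measurable]: "gg \<in> borel_measurable borel"
      unfolding gg_def by (intro \<tau>.borel_measurable_nn_integral) (use G' in \<open>simp add: split_beta'\<close>)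
    define f where "f x = epowr (F x) (1 / Q)" for x
    define g where "g x = epowr (gg x) (1 / Q)" for x
    have [measurable]: "f \<in> borel_measurable borel" "g \<in> borel_measurable borel"
      unfolding f_def g_def by measurable
    have fP: "epowr (F x) (P / Q) = epowr (f x) P" "epowr (f x) Q = F x" for x
      using Q by (auto simp: f_def)
    have gP: "epowr (gg x) (P / Q) = epowr (g x) P" "epowr (g x) Q = gg x" for x
      using Q by (auto simp: g_def)
    define Ig where "Ig = (\<integral>\<^sup>+x. epowr (g x) P * ennreal (w x) \<partial>m)"
    define z :: 'a where "z = undefined"
    \<comment> \<open>The truncation in height and support gives \<open>fn n\<close> a finite norm in \<open>L\<^sup>P(w)\<close>, as the absorption
      requires.\<close>
    define fn where "fn n x = min (f x) (of_nat n) * indicator (qball d z (real n + 1)) x" for n x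
    have [measurable]: "fn n \<in> borel_measurable borel" for n
      unfolding fn_def by measurable
    have main: "(\<integral>\<^sup>+x. epowr (fn n x) P * ennreal (w x) \<partial>m) \<le> ennreal (2 * B) * Ig" if Ig: "Ig \<noteq> top" for n
    proof -
      define In where "In = (\<integral>\<^sup>+x. epowr (fn n x) P * ennreal (w x) \<partial>m)"
      have "In \<le> (\<integral>\<^sup>+x. epowr (of_nat n) P * (ennreal (w x) * indicator (qball d z (real n + 1)) x) \<partial>m)"
        unfolding In_def fn_def epowr_mult_indicator using P
        by (intro nn_integral_mono) (auto split: split_indicator intro!: mult_right_mono epowr_mono)
      also have "\<dots> = epowr (of_nat n) P * ball_mass w z (real n + 1)"
        by (rule nn_integral_cmult) measurable
      also have "\<dots> < top"
        using ApD(3)[OF Ap, of "real n + 1" z] by (auto simp: ennreal_mult_less_top less_top ennreal_of_nat_eq_real_of_nat)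
      finally have In: "In \<noteq> top" by simp
      \<comment> \<open>The extremal function in the duality of \<open>L\<^sup>P(w)\<close> with \<open>L\<^sup>P'(\<sigma>)\<close>.\<close>
      define u where "u x = epowr (fn n x) (P - 1) * ennreal (w x)" for x
      have [measurable]: "u \<in> borel_measurable borel" unfolding u_def by measurable
      have u_norm: "(\<integral>\<^sup>+x. epowr (u x) P' * ennreal (\<sigma> x) \<partial>m) = In"
        unfolding In_def
      proof (intro nn_integral_cong)
        fix x
        have e: "(P - 1) * P' = P" "P' + - 1 / (P - 1) = 1"
          using P unfolding P'_def add_divide_distrib[symmetric] by simp_all
        have "w x powr P' * \<sigma> x = w x powr (P' + - 1 / (P - 1))"
          unfolding \<sigma>_def dual_weight_def powr_add ..
        also have "\<dots> = w x" unfolding e using wpos[of x] by simp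
        finally have "ennreal (w x powr P') * ennreal (\<sigma> x) = ennreal (w x)"
          using less_imp_le[OF \<sigma>pos[of x]] by (simp flip: ennreal_mult)
        then show "epowr (u x) P' * ennreal (\<sigma> x) = epowr (fn n x) P * ennreal (w x)"
          using P' e(1) less_imp_le[OF wpos[of x]] by (simp add: u_def epowr_mult mult.assoc)
      qed
      have fu: "epowr (fn n x) P * ennreal (w x) = fn n x * u x" for x
        using epowr_add_exponent[of "fn n x" 1 "P - 1"] by (simp add: u_def flip: mult.assoc)
      have step: "In \<le> ennreal (1 + C0) * (ennreal (l powr P) * (ennreal A1 * (Ig + ennreal e))
           + ennreal (l powr (- P')) * (ennreal A2 * (In + ennreal e)))" if e: "e > 0" for e
      proof -
        obtain V where V [measurable]: "V \<in> borel_measurable borel" and Vpos: "\<And>x. V x > 0"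
          and gV: "AE x in m. g x \<le> ennreal (V x)"
          and VA: "AE x in m. maxop d m (\<lambda>y. ennreal (V y)) x \<le> ennreal A1 * ennreal (V x)"
          and Vn: "(\<integral>\<^sup>+x. epowr (ennreal (V x)) P * ennreal (w x) \<partial>m) \<le> ennreal A1 * (Ig + ennreal e)"
          using RF1[of g e] e Ig unfolding Ig_def by auto
        obtain U where U [measurable]: "U \<in> borel_measurable borel" and Upos: "\<And>x. U x > 0"
          and uU: "AE x in m. u x \<le> ennreal (U x)"
          and UA: "AE x in m. maxop d m (\<lambda>y. ennreal (U y)) x \<le> ennreal A2 * ennreal (U x)"
          and Un: "(\<integral>\<^sup>+x. epowr (ennreal (U x)) P' * ennreal (\<sigma> x) \<partial>m) \<le> ennreal A2 * (In + ennreal e)"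
          using RF2[of u e] e In unfolding u_norm by auto
        define w0 where "w0 x = V x powr (1 - Q) * U x" for x
        have [measurable]: "w0 \<in> borel_measurable borel" unfolding w0_def by measurable
        have w0: "Ap Q K0 w0"
          unfolding K0_def w0_def by (rule Ap_factorization[OF Q A1 A2 V U Vpos Upos VA UA])
        define VU where "VU = (\<integral>\<^sup>+x. ennreal (V x * U x) \<partial>m)"
        have "In = (\<integral>\<^sup>+x. fn n x * u x \<partial>m)"
          by (simp add: In_def fu)
        also have "\<dots> \<le> (\<integral>\<^sup>+x. ennreal (V x * U x) + F x * ennreal (w0 x) \<partial>m)"
        proof (rule nn_integral_mono_AE)
          show "AE x in m. fn n x * u x \<le> ennreal (V x * U x) + F x * ennreal (w0 x)"
            using uU
          proof eventually_elim
            case (elim x)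
            have "fn n x \<le> f x" by (auto simp: fn_def split: split_indicator)
            also have "\<dots> \<le> ennreal (V x) + F x * ennreal (V x powr (1 - Q))"
              using le_add_epowr[of "V x" Q "f x"] Vpos Q by (simp add: fP)
            finally have "fn n x * u x \<le> (ennreal (V x) + F x * ennreal (V x powr (1 - Q))) * ennreal (U x)"
              using elim by (rule mult_mono) auto
            also have "\<dots> = ennreal (V x * U x) + F x * ennreal (w0 x)"
              using less_imp_le[OF Vpos[of x]] less_imp_le[OF Upos[of x]]
              by (simp add: w0_def distrib_right ennreal_mult mult.assoc)
            finally show ?case .
          qed
        qed
        also have "\<dots> = VU + (\<integral>\<^sup>+x. F x * ennreal (w0 x) \<partial>m)"
          unfolding VU_def by (rule nn_integral_add) measurable
        also have "(\<integral>\<^sup>+x. F x * ennreal (w0 x) \<partial>m)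
            = (\<integral>\<^sup>+x. (\<integral>\<^sup>+t. epowr (maxop d m (\<lambda>y. G (t, y)) x) Q * ennreal (w0 x) \<partial>\<tau>) \<partial>m)"
        proof (intro nn_integral_cong)
          fix x
          have "(\<lambda>t. maxop d m (\<lambda>y. G (t, y)) x) \<in> borel_measurable \<tau>"
            using measurable_compose[OF measurable_Pair1'[of x borel \<tau>] MG] by simp
          then show "F x * ennreal (w0 x) = (\<integral>\<^sup>+t. epowr (maxop d m (\<lambda>y. G (t, y)) x) Q * ennreal (w0 x) \<partial>\<tau>)"
            unfolding F_def by (intro nn_integral_multc[symmetric]) measurable
        qed
        also have "\<dots> = (\<integral>\<^sup>+t. (\<integral>\<^sup>+x. epowr (maxop d m (\<lambda>y. G (t, y)) x) Q * ennreal (w0 x) \<partial>m) \<partial>\<tau>)"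
          by (rule Fubini'[symmetric]) (simp add: split_beta')
        also have "\<dots> \<le> (\<integral>\<^sup>+t. ennreal C0 * (\<integral>\<^sup>+x. epowr (G (t, x)) Q * ennreal (w0 x) \<partial>m) \<partial>\<tau>)"
        proof (rule nn_integral_mono)
          fix t assume t: "t \<in> space \<tau>"
          have "(\<lambda>y. G (t, y)) \<in> borel_measurable borel"
            using measurable_compose[OF measurable_Pair1'[OF t, of borel] G] .
          then show "(\<integral>\<^sup>+x. epowr (maxop d m (\<lambda>y. G (t, y)) x) Q * ennreal (w0 x) \<partial>m)
              \<le> ennreal C0 * (\<integral>\<^sup>+x. epowr (G (t, x)) Q * ennreal (w0 x) \<partial>m)"
            by (rule C0(2)[OF w0])
        qed
        also have "\<dots> = ennreal C0 * (\<integral>\<^sup>+t. (\<integral>\<^sup>+x. epowr (G (t, x)) Q * ennreal (w0 x) \<partial>m) \<partial>\<tau>)"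
          by (rule nn_integral_cmult) measurable
        also have "(\<integral>\<^sup>+t. (\<integral>\<^sup>+x. epowr (G (t, x)) Q * ennreal (w0 x) \<partial>m) \<partial>\<tau>)
            = (\<integral>\<^sup>+x. (\<integral>\<^sup>+t. epowr (G (t, x)) Q * ennreal (w0 x) \<partial>\<tau>) \<partial>m)"
          by (rule Fubini') (simp add: split_beta')
        also have "\<dots> = (\<integral>\<^sup>+x. gg x * ennreal (w0 x) \<partial>m)"
        proof (intro nn_integral_cong)
          fix x
          have "(\<lambda>t. G (t, x)) \<in> borel_measurable \<tau>"
            using measurable_compose[OF measurable_Pair1'[of x borel \<tau>] G'] by simp
          then show "(\<integral>\<^sup>+t. epowr (G (t, x)) Q * ennreal (w0 x) \<partial>\<tau>) = gg x * ennreal (w0 x)"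
            unfolding gg_def by (intro nn_integral_multc) measurable
        qed
        \<comment> \<open>Here \<open>gg \<le> V\<^sup>Q\<close>, so that \<open>gg w0 \<le> V\<^sup>Q V\<^sup>1\<^sup>-\<^sup>Q U\<close>.\<close>
        also have "ennreal C0 * \<dots> \<le> ennreal C0 * VU"
          unfolding VU_def
        proof (intro mult_left_mono nn_integral_mono_AE)
          show "AE x in m. gg x * ennreal (w0 x) \<le> ennreal (V x * U x)"
            using gV
          proof eventually_elim
            case (elim x)
            have "gg x \<le> epowr (ennreal (V x)) Q"
              unfolding gP(2)[symmetric] using elim Q by (intro epowr_mono) auto
            then have "gg x * ennreal (w0 x) \<le> ennreal (V x powr Q) * ennreal (w0 x)"
              using less_imp_le[OF Vpos[of x]] by (intro mult_right_mono) auto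
            also have "\<dots> = ennreal ((V x powr Q * V x powr (1 - Q)) * U x)"
              using less_imp_le[OF Upos[of x]] by (simp add: w0_def mult.assoc flip: ennreal_mult)
            also have "V x powr Q * V x powr (1 - Q) = V x"
              using Vpos[of x] by (simp flip: powr_add)
            finally show ?case .
          qed
        qed auto
        finally have "In \<le> VU + ennreal C0 * VU" by simp
        also have "\<dots> = ennreal (1 + C0) * VU"
          using C0 by (simp add: distrib_right)
        \<comment> \<open>Young's inequality for \<open>l V w\<^sup>1\<^sup>/\<^sup>P\<close> and \<open>l\<^sup>-\<^sup>1 U w\<^sup>-\<^sup>1\<^sup>/\<^sup>P\<close>.\<close>
        also have "VU \<le> (\<integral>\<^sup>+x. ennreal (l powr P) * (epowr (ennreal (V x)) P * ennreal (w x))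
            + ennreal (l powr (- P')) * (epowr (ennreal (U x)) P' * ennreal (\<sigma> x)) \<partial>m)"
          unfolding VU_def
        proof (rule nn_integral_mono)
          fix x
          have e: "- 1 / P * P' = - 1 / (P - 1)" "- P' = - 1 * P'"
            using P by (auto simp: P'_def)
          have w1: "w x powr (1 / P) * w x powr (- 1 / P) = 1"
            using wpos[of x] by (simp flip: powr_add)
          have "ennreal (V x * U x) = ennreal (l * V x * w x powr (1 / P)) * ennreal (inverse l * U x * w x powr (- 1 / P))"
          proof -
            have "(l * V x * w x powr (1 / P)) * (inverse l * U x * w x powr (- 1 / P))
              = (l * inverse l) * (V x * U x) * (w x powr (1 / P) * w x powr (- 1 / P))"
              by (simp only: mult_ac)
            also have "\<dots> = V x * U x" using l(1) w1 by simp
            finally have "V x * U x = (l * V x * w x powr (1 / P)) * (inverse l * U x * w x powr (- 1 / P))" ..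
            then show ?thesis
              using l(1) less_imp_le[OF Vpos[of x]] less_imp_le[OF Upos[of x]]
              by (simp only: ennreal_mult mult_nonneg_nonneg powr_ge_zero less_imp_le[of 0] inverse_nonnegative_iff_nonnegative)
          qed
          also have "\<dots> \<le> epowr (ennreal (l * V x * w x powr (1 / P))) P + epowr (ennreal (inverse l * U x * w x powr (- 1 / P))) P'"
            by (rule Young_ennreal[OF P(1) P'])
          also have "epowr (ennreal (l * V x * w x powr (1 / P))) P = ennreal (l powr P) * (epowr (ennreal (V x)) P * ennreal (w x))"
            using l(1) Vpos[of x] wpos[of x] P
            by (simp add: powr_mult powr_powr mult.assoc less_imp_le flip: ennreal_mult)
          also have "epowr (ennreal (inverse l * U x * w x powr (- 1 / P))) P'
            = ennreal (l powr (- P')) * (epowr (ennreal (U x)) P' * ennreal (\<sigma> x))"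
          proof -
            have "(inverse l * U x * w x powr (- 1 / P)) powr P' = l powr (- P') * (U x powr P' * \<sigma> x)"
              using l(1) unfolding powr_mult powr_powr e(1) \<sigma>_def dual_weight_def
              by (simp add: powr_minus inverse_powr mult.assoc)
            then show ?thesis
              using l(1) Upos[of x] \<sigma>pos[of x] by (simp add: less_imp_le flip: ennreal_mult)
          qed
          finally show "ennreal (V x * U x) \<le> ennreal (l powr P) * (epowr (ennreal (V x)) P * ennreal (w x))
            + ennreal (l powr (- P')) * (epowr (ennreal (U x)) P' * ennreal (\<sigma> x))" .
        qed
        also have "(\<integral>\<^sup>+x. ennreal (l powr P) * (epowr (ennreal (V x)) P * ennreal (w x))
            + ennreal (l powr (- P')) * (epowr (ennreal (U x)) P' * ennreal (\<sigma> x)) \<partial>m)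
          = ennreal (l powr P) * (\<integral>\<^sup>+x. epowr (ennreal (V x)) P * ennreal (w x) \<partial>m)
            + ennreal (l powr (- P')) * (\<integral>\<^sup>+x. epowr (ennreal (U x)) P' * ennreal (\<sigma> x) \<partial>m)"
          by (simp add: nn_integral_add nn_integral_cmult)
        also have "\<dots> \<le> ennreal (l powr P) * (ennreal A1 * (Ig + ennreal e))
           + ennreal (l powr (- P')) * (ennreal A2 * (In + ennreal e))"
          by (intro add_mono mult_left_mono Vn Un) auto
        finally show ?thesis by (simp add: mult_left_mono)
      qed
      obtain i where i: "In = ennreal i" "i \<ge> 0" using In by (cases In) auto
      obtain j where j: "Ig = ennreal j" "j \<ge> 0" using Ig by (cases Ig) auto
      have "i \<le> 2 * B * j + e" if e: "e > 0" for e
      proof -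
        define e' where "e' = e / (2 * B + 1)"
        have e': "e' > 0" "(2 * B + 1) * e' = e" using e B by (auto simp: e'_def)
        have "ennreal i \<le> ennreal ((1 + C0) * (l powr P * (A1 * (j + e')) + l powr (- P') * (A2 * (i + e'))))"
          using step[OF e'(1)] i j e' A1 A2 C0 by (simp add: ennreal_mult[symmetric] flip: ennreal_plus)
        then have "i \<le> (1 + C0) * (l powr P * (A1 * (j + e')) + l powr (- P') * (A2 * (i + e')))"
          using i j e' A1 A2 C0 by (subst (asm) ennreal_le_iff) auto
        also have "\<dots> = B * (j + e') + ((1 + C0) * (l powr (- P') * A2)) * (i + e')"
          unfolding B_def by (simp only: ring_distribs mult_ac)
        finally have "i \<le> 2 * (B * j + B * e') + e'"
          unfolding l(2) by (simp add: ring_distribs)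
        also have "\<dots> = 2 * B * j + e"
          unfolding e'(2)[symmetric] by (simp add: ring_distribs)
        finally show ?thesis .
      qed
      then have "i \<le> 2 * B * j" by (rule field_le_epsilon)
      then show ?thesis
        using i j B unfolding In_def[symmetric] by (auto simp: ennreal_mult[symmetric] intro!: ennreal_leI)
    qed
    have inc: "incseq (\<lambda>n x. epowr (fn n x) P * ennreal (w x))"
      unfolding incseq_def le_fun_def
    proof (intro allI impI mult_right_mono epowr_mono)
      fix k n :: nat and x assume "k \<le> n"
      then have "qball d z (real k + 1) \<subseteq> qball d z (real n + 1)" by (intro qball_mono) auto
      moreover have "(of_nat k :: ennreal) \<le> of_nat n" using \<open>k \<le> n\<close> by (rule of_nat_mono)
      ultimately show "fn k x \<le> fn n x"
        unfolding fn_def by (intro mult_mono min.mono) (auto split: split_indicator)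
    qed (use P in auto)
    have sup: "f x = (SUP n. fn n x)" for x
    proof (rule antisym)
      show "(SUP n. fn n x) \<le> f x"
        by (rule SUP_least) (auto simp: fn_def split: split_indicator)
      show "f x \<le> (SUP n. fn n x)"
        unfolding le_SUP_iff
      proof (intro allI impI)
        fix c assume c: "c < f x"
        then obtain r where r: "c = ennreal r" "r \<ge> 0" by (cases c) auto
        obtain n :: nat where n: "max r (d z x) < real n" using reals_Archimedean2 by blast
        have "c < of_nat n" using n r by (simp add: ennreal_of_nat_eq_real_of_nat ennreal_less_iff)
        moreover have "x \<in> qball d z (real n + 1)" using n by (simp add: qball_def)
        ultimately have "c < fn n x" using c by (simp add: fn_def)
        then show "\<exists>n\<in>UNIV. c < fn n x" by blast
      qed
    qed
    have "(\<integral>\<^sup>+x. epowr (F x) (P / Q) * ennreal (w x) \<partial>m) = (\<integral>\<^sup>+x. (SUP n. epowr (fn n x) P * ennreal (w x)) \<partial>m)"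
      unfolding fP sup using P by (simp add: epowr_SUP SUP_mult_right_ennreal)
    also have "\<dots> = (SUP n. \<integral>\<^sup>+x. epowr (fn n x) P * ennreal (w x) \<partial>m)"
      by (rule nn_integral_monotone_convergence_SUP[OF inc]) measurable
    also have "\<dots> \<le> ennreal (2 * B + 1) * Ig"
    proof (cases "Ig = top")
      case True
      then show ?thesis using B by (simp add: ennreal_mult_top)
    next
      case False
      have "ennreal (2 * B) * Ig \<le> ennreal (2 * B + 1) * Ig"
        by (intro mult_right_mono ennreal_leI) auto
      then show ?thesis using main[OF False] by (intro SUP_least) (rule order.trans)
    qed
    finally show "(\<integral>\<^sup>+x. epowr (\<integral>\<^sup>+t. epowr (maxop d m (\<lambda>y. G (t, y)) x) Q \<partial>\<tau>) (P / Q) * ennreal (w x) \<partial>m)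
      \<le> ennreal (2 * B + 1) * (\<integral>\<^sup>+x. epowr (\<integral>\<^sup>+t. epowr (G (t, x)) Q \<partial>\<tau>) (P / Q) * ennreal (w x) \<partial>m)"
      unfolding F_def Ig_def gP(1)[symmetric] gg_def .
  qed
qed

end

section \<open>Homogeneous groups as spaces of homogeneous type\<close>

lemma Basis_vec_real: "(Basis :: (real^'n::finite) set) = range (\<lambda>i. axis i 1)"
  by (auto simp: Basis_vec_def)

lemma power_powr_swap: "((x::real) ^ k) powr c = (x powr c) ^ k"
  by (induction k) (auto simp: powr_mult)

lemma term_le_suminf: "(f :: nat \<Rightarrow> ennreal) n \<le> (\<Sum>n. f n)"
  using sum_le_suminf[of f "{n}"] by (simp add: summableI)

lemma inj_axis_1: "inj (\<lambda>i. axis i (1::real) :: real^'n::finite)"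
  by (auto simp: inj_def axis_eq_axis)

lemma measurable_vec_lambdaI:
  fixes f :: "'a \<Rightarrow> real^'n::finite"
  assumes "\<And>i. (\<lambda>x. f x $ i) \<in> borel_measurable M"
  shows "f \<in> borel_measurable M"
  by (subst borel_measurable_euclidean_space)
     (use assms in \<open>auto simp: Basis_vec_real inner_axis\<close>)

lemma measurable_vec_nth [measurable (raw)]:
  fixes f :: "'a \<Rightarrow> real^'n::finite"
  assumes "f \<in> borel_measurable M"
  shows "(\<lambda>x. f x $ i) \<in> borel_measurable M"
  by (rule borel_measurable_continuous_on[OF _ assms]) (intro continuous_intros)

lemma dilation_nth [simp]: "dilation a t x $ i = t powr a i * x $ i"
  by (simp add: dilation_def)

lemma measurable_dilation [measurable (raw)]:
  fixes x :: "'b \<Rightarrow> real^'n::finite"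
  assumes [measurable]: "t \<in> borel_measurable M" "x \<in> borel_measurable M"
  shows "(\<lambda>z. dilation a (t z) (x z)) \<in> borel_measurable M"
  by (rule measurable_vec_lambdaI) (simp, measurable)

lemma dilation_mult_params:
  "s > 0 \<Longrightarrow> t > 0 \<Longrightarrow> dilation a s (dilation a t x) = dilation a (s * t) x"
  by (simp add: vec_eq_iff powr_mult)

lemma dilation_one [simp]: "dilation a 1 x = x"
  by (simp add: vec_eq_iff)

lemma dilation_zero [simp]: "dilation a t 0 = 0"
  by (simp add: vec_eq_iff)

lemma dilation_minus: "dilation a t (- x) = - dilation a t x"
  by (simp add: vec_eq_iff)

text \<open>The Jacobian of a dilation is \<open>t\<close> to the homogeneous dimension.\<close>

lemma lborel_dilation:
  fixes a :: "'n::finite \<Rightarrow> real"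
  assumes t: "t > 0"
  shows "(lborel :: (real^'n) measure) = density (distr lborel borel (dilation a t)) (\<lambda>_. ennreal (t powr hom_dim a))"
proof -
  define c where "c j = (\<Sum>i\<in>UNIV. t powr a i * j $ i)" for j :: "real^'n"
  have c: "c (axis i 1) = t powr a i" for i
    by (simp add: c_def axis_def if_distrib cong: if_cong)
  have T: "(\<Sum>j\<in>Basis. (c j * (x \<bullet> j)) *\<^sub>R j) = dilation a t x" for x
  proof -
    have "(\<Sum>j\<in>Basis. (c j * (x \<bullet> j)) *\<^sub>R j) = (\<Sum>i\<in>UNIV. (t powr a i * x $ i) *\<^sub>R axis i 1)"
      unfolding Basis_vec_real by (subst sum.reindex[OF inj_axis_1]) (simp add: c inner_axis)
    also have "\<dots> = dilation a t x"
      by (simp add: vec_eq_iff axis_def if_distrib cong: if_cong)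
    finally show ?thesis .
  qed
  have prod: "(\<Prod>j\<in>Basis. \<bar>c j\<bar>) = t powr hom_dim a"
  proof -
    have "(\<Prod>j\<in>Basis. \<bar>c j\<bar>) = (\<Prod>i\<in>UNIV. t powr a i)"
      unfolding Basis_vec_real by (subst prod.reindex[OF inj_axis_1]) (simp add: c)
    then show ?thesis using t by (simp add: hom_dim_def powr_sum)
  qed
  have nz: "c j \<noteq> 0" if "j \<in> Basis" for j
    using that t unfolding Basis_vec_real by (auto simp: c)
  have D: "(\<lambda>x. 0 + (\<Sum>j\<in>Basis. (c j * (x \<bullet> j)) *\<^sub>R j)) = dilation a t"
    by (simp add: T)
  show ?thesis
    using lborel_affine_euclidean[of c 0, OF nz] unfolding D prod by simp
qed

lemma nn_integral_dilation:
  fixes a :: "'n::finite \<Rightarrow> real"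
  assumes t: "t > 0" and [measurable]: "f \<in> borel_measurable borel"
  shows "(\<integral>\<^sup>+x. f x \<partial>lborel) = ennreal (t powr hom_dim a) * (\<integral>\<^sup>+x. f (dilation a t x) \<partial>lborel)"
proof -
  have "(\<integral>\<^sup>+x. f x \<partial>lborel) = (\<integral>\<^sup>+x. ennreal (t powr hom_dim a) * f (dilation a t x) \<partial>lborel)"
    by (subst lborel_dilation[OF t, of a]) (simp add: nn_integral_density nn_integral_distr)
  then show ?thesis by (simp add: nn_integral_cmult)
qed

lemma integral_dilation:
  fixes a :: "'n::finite \<Rightarrow> real" and f :: "real^'n \<Rightarrow> complex"
  assumes t: "t > 0" and [measurable]: "f \<in> borel_measurable borel"
  shows "(LINT x|lborel. f x) = of_real (t powr hom_dim a) * (LINT x|lborel. f (dilation a t x))"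
proof -
  have "(LINT x|lborel. f x) = (LINT x|lborel. (t powr hom_dim a) *\<^sub>R f (dilation a t x))"
    by (subst lborel_dilation[OF t, of a]) (simp add: integral_density integral_distr)
  then show ?thesis by (simp add: scaleR_conv_of_real)
qed

lemma distr_lborel_uminus: "distr lborel borel uminus = (lborel :: 'a::euclidean_space measure)"
  using lborel_affine[of "-1" "0 :: 'a"] by (simp add: density_1)

lemma nn_integral_uminus:
  fixes f :: "'a::euclidean_space \<Rightarrow> ennreal"
  assumes [measurable]: "f \<in> borel_measurable borel"
  shows "(\<integral>\<^sup>+x. f (- x) \<partial>lborel) = (\<integral>\<^sup>+x. f x \<partial>lborel)"
  by (subst (2) distr_lborel_uminus[symmetric]) (simp add: nn_integral_distr)

lemma integral_uminus:
  fixes f :: "'a::euclidean_space \<Rightarrow> complex"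
  assumes [measurable]: "f \<in> borel_measurable borel"
  shows "(LINT x|lborel. f (- x)) = (LINT x|lborel. f x)"
  by (subst (2) distr_lborel_uminus[symmetric]) (simp add: integral_distr)

context homogeneous_group
begin

lemma real_polynomial_function_mul_nth:
  "real_polynomial_function (\<lambda>z. (fst z \<odot> snd z) $ k)"
proof -
  obtain c where c: "\<And>k x y. (x \<odot> y) $ k = x $ k + y $ k
        + (\<Sum>(I, J)\<in>index_pairs a k. c k I J * monomial x I * monomial y J)"
    using polynomial_mult by blast
  have bl: "bounded_linear (\<lambda>z :: (real^'n::{finite,linorder}) \<times> (real^'n::{finite,linorder}). fst z $ i)" "bounded_linear (\<lambda>z :: (real^'n::{finite,linorder}) \<times> (real^'n::{finite,linorder}). snd z $ i)" for i
    by (intro bounded_linear_compose[OF bounded_linear_vec_nth] bounded_linear_fst bounded_linear_snd)+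
  then have nth: "real_polynomial_function (\<lambda>z :: (real^'n::{finite,linorder}) \<times> (real^'n::{finite,linorder}). fst z $ i)"
    "real_polynomial_function (\<lambda>z :: (real^'n::{finite,linorder}) \<times> (real^'n::{finite,linorder}). snd z $ i)" for i
    by (auto intro: real_polynomial_function.intros(1))
  show ?thesis
    unfolding c monomial_def split_beta
    by (intro real_polynomial_function.intros(3) nth real_polynomial_function_sum finite_index_pairs real_polynomial_function.intros(4)
        real_polynomial_function.intros(2) real_polynomial_function_prod real_polynomial_function_power) auto
qed

lemma polynomial_function_mul: "polynomial_function (\<lambda>z. fst z \<odot> snd z)"
  unfolding polynomial_function_iff_Basis_inner Basis_vec_real
  by (auto simp: inner_axis real_polynomial_function_mul_nth)

lemma polynomial_function_mul_compose:
  assumes "polynomial_function f" "polynomial_function g"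
  shows "polynomial_function (\<lambda>x. f x \<odot> g x)"
proof -
  have "polynomial_function (\<lambda>x. (f x, g x))"
    using assms unfolding polynomial_function_iff_Basis_inner Basis_prod_def by auto
  from polynomial_function_compose[OF this polynomial_function_mul] show ?thesis
    by (simp add: o_def)
qed

lemma continuous_on_mul [continuous_intros]:
  assumes "continuous_on S f" "continuous_on S g"
  shows "continuous_on S (\<lambda>x. f x \<odot> g x)"
proof -
  have "continuous_on UNIV (\<lambda>z. fst z \<odot> snd z)"
    by (rule continuous_on_polymonial_function[OF polynomial_function_mul])
  from continuous_on_compose2[OF this continuous_on_Pair[OF assms]] show ?thesis by simp
qed

lemma measurable_mul [measurable (raw)]:
  assumes [measurable]: "f \<in> borel_measurable M" "g \<in> borel_measurable M"
  shows "(\<lambda>x. f x \<odot> g x) \<in> borel_measurable M"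
proof -
  have "(\<lambda>z. fst z \<odot> snd z) \<in> borel_measurable borel"
    by (intro borel_measurable_continuous_onI continuous_intros)
  moreover have "(\<lambda>x. (f x, g x)) \<in> measurable M borel"
    by (intro borel_measurable_Pair) fact+
  ultimately show ?thesis
    using measurable_compose[of "\<lambda>x. (f x, g x)" M borel "\<lambda>z. fst z \<odot> snd z" borel] by simp
qed

lemma minus_mul: "- (x \<odot> y) = (- y) \<odot> (- x)"
  by (rule inverse_distrib_swap)

lemma nn_integral_left_translate:
  assumes [measurable]: "f \<in> borel_measurable borel"
  shows "(\<integral>\<^sup>+y. f (x \<odot> y) \<partial>lborel) = (\<integral>\<^sup>+y. f y \<partial>lborel)"
  by (subst (2) haar_left[of x, symmetric]) (simp add: nn_integral_distr)

lemma nn_integral_right_translate: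
  assumes [measurable]: "f \<in> borel_measurable borel"
  shows "(\<integral>\<^sup>+y. f (y \<odot> x) \<partial>lborel) = (\<integral>\<^sup>+y. f y \<partial>lborel)"
  by (subst (2) haar_right[of x, symmetric]) (simp add: nn_integral_distr)

lemma integral_right_translate:
  fixes f :: "real^'n::{finite,linorder} \<Rightarrow> complex"
  assumes [measurable]: "f \<in> borel_measurable borel"
  shows "(LINT y|lborel. f (y \<odot> x)) = (LINT y|lborel. f y)"
  by (subst (2) haar_right[of x, symmetric]) (simp add: integral_distr)

lemma hom_dim_ge_2: "hom_dim a \<ge> 2"
proof -
  have "real CARD('n) * 1 \<le> (\<Sum>i\<in>(UNIV :: 'n set). a i)"
    using sum_bounded_below[of "UNIV :: 'n set" "1 :: real" a] exponent_ge_1 by simp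
  then show ?thesis using dim_ge_2 unfolding hom_dim_def by linarith
qed

lemma norm_dilation_le:
  assumes "0 < t" "t \<le> 1"
  shows "norm (dilation a t x) \<le> t * norm x"
proof -
  have "norm (dilation a t x) \<le> norm (t *\<^sub>R x)"
  proof (rule norm_le_componentwise_cart)
    fix i
    have "t powr a i \<le> t powr 1"
      using assms exponent_ge_1 by (intro powr_mono') auto
    then show "norm (dilation a t x $ i) \<le> norm ((t *\<^sub>R x) $ i)"
      using assms by (auto simp: abs_mult intro!: mult_right_mono)
  qed
  then show ?thesis using assms by simp
qed

end

context homogeneous_group_norm
begin

lemma measurable_rho [measurable]: "\<rho> \<in> borel_measurable borel"
  using rho_continuous by (rule borel_measurable_continuous_onI)

lemma rho_0 [simp]: "\<rho> 0 = 0"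
  using rho_dilation[of 2 0] by simp

lemma rho_less_1_iff: "\<rho> x < 1 \<longleftrightarrow> norm x < 1"
  using rho_le_1_iff[of x] rho_eq_1_iff[of x] by linarith

definition c0 :: real where
  "c0 = (SOME c. c \<ge> 1 \<and> (\<forall>x y. \<rho> (x \<odot> y) \<le> c * (\<rho> x + \<rho> y)))"

lemma c0: "c0 \<ge> 1" "\<rho> (x \<odot> y) \<le> c0 * (\<rho> x + \<rho> y)"
  using someI_ex[OF rho_mult[unfolded Bex_def]] unfolding c0_def by auto

lemma rho_nonneg [simp]: "\<rho> x \<ge> 0"
proof -
  have "0 \<le> c0 * (\<rho> x + \<rho> (- x))" using c0(2)[of x "- x"] by simp
  then show ?thesis using c0(1) by (simp add: rho_inverse zero_le_mult_iff)
qed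

lemma dilation_inverse: "t > 0 \<Longrightarrow> dilation a t (dilation a (inverse t) x) = x"
  "t > 0 \<Longrightarrow> dilation a (inverse t) (dilation a t x) = x"
  by (simp_all add: dilation_mult_params)

lemma emeasure_rho_ball:
  assumes "t > 0"
  shows "emeasure lborel {x. \<rho> x < t} = ennreal (t powr hom_dim a) * emeasure lborel (ball (0 :: real^'n::{finite,linorder}) 1)"
proof -
  have "emeasure lborel {x. \<rho> x < t} = (\<integral>\<^sup>+x. indicator {x. \<rho> x < t} x \<partial>lborel)"
    by (simp add: nn_integral_indicator)
  also have "\<dots> = ennreal (t powr hom_dim a) * (\<integral>\<^sup>+x. indicator {x. \<rho> x < t} (dilation a t x) \<partial>lborel)"
    by (rule nn_integral_dilation[OF assms]) measurable
  also have "(\<integral>\<^sup>+x. indicator {x. \<rho> x < t} (dilation a t x) \<partial>lborel) = (\<integral>\<^sup>+x. indicator (ball 0 1) x \<partial>(lborel :: (real^'n::{finite,linorder}) measure))"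
    using assms by (intro nn_integral_cong) (auto simp: indicator_def rho_dilation rho_less_1_iff)
  finally show ?thesis by simp
qed

lemma unit_ball_measure: "emeasure lborel (ball (0 :: real^'n::{finite,linorder}) 1) \<noteq> 0" "emeasure lborel (ball (0 :: real^'n::{finite,linorder}) 1) \<noteq> top"
proof -
  show "emeasure lborel (ball (0 :: real^'n::{finite,linorder}) 1) \<noteq> 0"
  proof
    assume "emeasure lborel (ball (0 :: real^'n::{finite,linorder}) 1) = 0"
    then have "ball (0 :: real^'n::{finite,linorder}) 1 \<in> null_sets lebesgue"
      by (intro null_sets_completionI) (simp add: null_sets_def)
    then show False
      using open_not_negligible[of "ball (0 :: real^'n::{finite,linorder}) 1"] by (simp add: negligible_iff_null_sets)
  qed
  show "emeasure lborel (ball (0 :: real^'n::{finite,linorder}) 1) \<noteq> top"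
    using emeasure_lborel_ball_finite[of "0 :: real^'n::{finite,linorder}" 1] by (simp add: less_top)
qed

abbreviation group_dist :: "real^'n::{finite,linorder} \<Rightarrow> real^'n::{finite,linorder} \<Rightarrow> real" where
  "group_dist \<equiv> \<lambda>x y. \<rho> ((- y) \<odot> x)"

lemma gball_eq_qball: "gball (\<odot>) \<rho> x t = qball group_dist x t"
  by (simp add: gball_def qball_def)

lemma emeasure_gball:
  assumes "t > 0"
  shows "emeasure lborel (gball (\<odot>) \<rho> x t) = ennreal (t powr hom_dim a) * emeasure lborel (ball (0 :: real^'n::{finite,linorder}) 1)"
proof -
  have eq: "\<rho> ((- y) \<odot> x) = \<rho> ((- x) \<odot> y)" for y
    using rho_inverse[of "(- y) \<odot> x"] by (simp add: minus_mul)
  have "emeasure lborel (gball (\<odot>) \<rho> x t) = (\<integral>\<^sup>+y. indicator {x. \<rho> x < t} ((- x) \<odot> y) \<partial>lborel)"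
  proof -
    have "emeasure lborel {y. \<rho> ((- x) \<odot> y) < t} = (\<integral>\<^sup>+y. indicator {y. \<rho> ((- x) \<odot> y) < t} y \<partial>lborel)"
      by (rule nn_integral_indicator[symmetric]) measurable
    then show ?thesis unfolding gball_def eq by (simp only: indicator_def mem_Collect_eq)
  qed
  also have "\<dots> = (\<integral>\<^sup>+y. indicator {x. \<rho> x < t} y \<partial>lborel)"
    by (rule nn_integral_left_translate) measurable
  also have "\<dots> = emeasure lborel {x. \<rho> x < t}"
    by (simp add: nn_integral_indicator)
  finally show ?thesis using emeasure_rho_ball[OF assms] by simp
qed

lemma homogeneous_type:
  "homogeneous_type group_dist lborel c0 (2 powr hom_dim a)"
proof
  fix x y z :: "real^'n::{finite,linorder}" and t :: real
  show "\<rho> ((- y) \<odot> x) = \<rho> ((- x) \<odot> y)"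
    using rho_inverse[of "(- y) \<odot> x"] by (simp add: minus_mul)
  have "(- z) \<odot> x = ((- z) \<odot> y) \<odot> ((- y) \<odot> x)"
    by (metis assoc left_neutral right_inverse)
  then show "\<rho> ((- z) \<odot> x) \<le> c0 * (\<rho> ((- y) \<odot> x) + \<rho> ((- z) \<odot> y))"
    using c0(2)[of "(- z) \<odot> y" "(- y) \<odot> x"] by (simp add: add.commute)
  show "open (qball (\<lambda>x y. \<rho> ((- y) \<odot> x)) x t)"
    unfolding qball_def
    by (intro open_Collect_less continuous_on_compose2[OF rho_continuous] continuous_intros) auto
  show "(\<lambda>(x, y). \<rho> ((- y) \<odot> x)) \<in> borel_measurable (borel \<Otimes>\<^sub>M borel)"
    by measurable
  have fin: "emeasure lborel (gball (\<odot>) \<rho> x t) \<noteq> top" if "t > 0" for t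
    using unit_ball_measure by (simp add: emeasure_gball[OF that] ennreal_mult_eq_top_iff)
  show "emeasure lborel (qball (\<lambda>x y. \<rho> ((- y) \<odot> x)) x t) \<noteq> top"
  proof (cases "t > 0")
    case True
    then show ?thesis using fin unfolding gball_eq_qball by blast
  next
    case False
    then have "qball (\<lambda>x y. \<rho> ((- y) \<odot> x)) x t = {}"
      by (auto simp: qball_def not_less intro: order.trans[OF _ rho_nonneg])
    then show ?thesis by simp
  qed
  assume t: "t > 0"
  show "emeasure lborel (qball (\<lambda>x y. \<rho> ((- y) \<odot> x)) x t) \<noteq> 0"
    unfolding gball_eq_qball[symmetric] using unit_ball_measure t by (simp add: emeasure_gball[OF t])
  show "emeasure lborel (qball (\<lambda>x y. \<rho> ((- y) \<odot> x)) x (2 * t))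
      \<le> ennreal (2 powr hom_dim a) * emeasure lborel (qball (\<lambda>x y. \<rho> ((- y) \<odot> x)) x t)"
    unfolding gball_eq_qball[symmetric] using t
    by (simp add: emeasure_gball powr_mult ennreal_mult mult.assoc)
qed (use c0 hom_dim_ge_2 in \<open>auto simp: ge_one_powr_ge_zero\<close>)

text \<open>Dyadic shells: the ball of radius \<open>2\<^sup>n\<close> has measure a multiple of \<open>2\<close> to the \<open>n \<gamma>\<close>.\<close>

lemma nn_integral_rho_decay:
  assumes K: "K > hom_dim a"
  shows "(\<integral>\<^sup>+x. ennreal ((1 + \<rho> x) powr (- K)) \<partial>lborel) < top"
proof -
  let ?b = "emeasure lborel (ball (0 :: real^'n::{finite,linorder}) 1)"
  have pos: "K > 0" using K hom_dim_ge_2 by linarith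
  have "(\<integral>\<^sup>+x. ennreal ((1 + \<rho> x) powr (- K)) \<partial>lborel)
    \<le> (\<integral>\<^sup>+x. (\<Sum>n. ennreal (2 powr K * (2 powr (- K)) ^ n) * indicator {x. \<rho> x < 2 ^ n} x) \<partial>lborel)"
  proof (rule nn_integral_mono)
    fix x
    define n where "n = (LEAST n::nat. \<rho> x < 2 ^ n)"
    have ex: "\<exists>n::nat. \<rho> x < 2 ^ n" using real_arch_pow[of 2 "\<rho> x"] by simp
    have n: "\<rho> x < 2 ^ n" unfolding n_def by (rule LeastI_ex[OF ex])
    have "(1 + \<rho> x) powr (- K) \<le> 2 powr K * (2 powr (- K)) ^ n"
    proof (cases n)
      case 0
      have "(1 + \<rho> x) powr (- K) \<le> 1 powr (- K)" using pos by (intro powr_mono2') auto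
      also have "\<dots> \<le> 2 powr K" using pos by (simp add: ge_one_powr_ge_zero)
      finally show ?thesis using 0 by simp
    next
      case (Suc k)
      then have "\<not> \<rho> x < 2 ^ k" using not_less_Least[of k "\<lambda>n. \<rho> x < 2 ^ n"] by (simp add: n_def)
      then have "(1 + \<rho> x) powr (- K) \<le> (2 ^ k) powr (- K)" using pos by (intro powr_mono2') auto
      also have "\<dots> = 2 powr K * (2 powr (- K)) ^ n"
      proof -
        have "(2 ^ k) powr (- K) = (2 powr (- K)) ^ k"
          by (rule power_powr_swap)
        moreover have "2 powr K * 2 powr (- K) = 1" by (simp flip: powr_add)
        ultimately show ?thesis by (simp add: Suc)
      qed
      finally show ?thesis .
    qed
    then have "ennreal ((1 + \<rho> x) powr (- K)) \<le> ennreal (2 powr K * (2 powr (- K)) ^ n) * indicator {x. \<rho> x < 2 ^ n} x"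
      using n by (auto intro!: ennreal_leI)
    also have "\<dots> \<le> (\<Sum>n. ennreal (2 powr K * (2 powr (- K)) ^ n) * indicator {x. \<rho> x < 2 ^ n} x)"
      by (rule term_le_suminf[of "\<lambda>n. ennreal (2 powr K * (2 powr (- K)) ^ n) * indicator {x. \<rho> x < 2 ^ n} x"])
    finally show "ennreal ((1 + \<rho> x) powr (- K)) \<le> \<dots>" .
  qed
  also have "\<dots> = (\<Sum>n. \<integral>\<^sup>+x. ennreal (2 powr K * (2 powr (- K)) ^ n) * indicator {x. \<rho> x < 2 ^ n} x \<partial>lborel)"
    by (rule nn_integral_suminf) measurable
  also have "\<dots> = (\<Sum>n. ennreal (2 powr K) * ennreal ((2 powr (hom_dim a - K)) ^ n) * ?b)"
  proof (intro suminf_cong)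
    fix n
    have "(2 powr (- K)) ^ n * (2 ^ n) powr hom_dim a = (2 powr (hom_dim a - K)) ^ n"
    proof -
      have "(2 ^ n) powr hom_dim a = (2 powr hom_dim a) ^ n"
        by (rule power_powr_swap)
      then show ?thesis by (simp add: powr_diff powr_minus power_mult_distrib[symmetric] divide_inverse mult.commute)
    qed
    then have e: "2 powr K * (2 powr (- K)) ^ n * (2 ^ n) powr hom_dim a = 2 powr K * (2 powr (hom_dim a - K)) ^ n"
      by (simp add: mult.assoc)
    have "(\<integral>\<^sup>+x. ennreal (2 powr K * (2 powr (- K)) ^ n) * indicator {x. \<rho> x < 2 ^ n} x \<partial>lborel)
      = ennreal (2 powr K * (2 powr (- K)) ^ n) * emeasure lborel {x. \<rho> x < 2 ^ n}"
      by (rule nn_integral_cmult_indicator) measurable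
    also have "\<dots> = ennreal (2 powr K * (2 powr (- K)) ^ n * (2 ^ n) powr hom_dim a) * ?b"
      by (subst emeasure_rho_ball) (simp_all add: ennreal_mult mult.assoc)
    finally show "(\<integral>\<^sup>+x. ennreal (2 powr K * (2 powr (- K)) ^ n) * indicator {x. \<rho> x < 2 ^ n} x \<partial>lborel)
       = ennreal (2 powr K) * ennreal ((2 powr (hom_dim a - K)) ^ n) * ?b"
      unfolding e by (simp add: ennreal_mult)
  qed
  also have "\<dots> = ennreal (2 powr K) * (\<Sum>n. ennreal ((2 powr (hom_dim a - K)) ^ n)) * ?b"
    by simp
  also have "(\<Sum>n. ennreal ((2 powr (hom_dim a - K)) ^ n)) = ennreal (1 / (1 - 2 powr (hom_dim a - K)))"
  proof (rule suminf_ennreal_eq)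
    show "(\<lambda>n. (2 powr (hom_dim a - K)) ^ n) sums (1 / (1 - 2 powr (hom_dim a - K)))"
      using K powr_less_mono[of "hom_dim a - K" 0 2] by (intro geometric_sums) simp
  qed simp
  also have "ennreal (2 powr K) * \<dots> * ?b < top"
    using unit_ball_measure by (simp add: ennreal_mult_less_top less_top)
  finally show ?thesis .
qed

end

section \<open>Schwartz functions\<close>

lemma iter_partial_Nil [simp]: "iter_partial [] f = f"
  by (simp add: iter_partial_def)

lemma iter_partial_Cons [simp]: "iter_partial (i # is) f = partial_deriv i (iter_partial is f)"
  by (simp add: iter_partial_def)

lemma schwartz_differentiable: "f \<in> schwartz \<Longrightarrow> f differentiable (at x)"
  unfolding schwartz_def smooth_on_def by (auto dest: spec[of _ "[]"])

lemma schwartz_partial_deriv: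
  assumes "f \<in> schwartz"
  shows "partial_deriv i f \<in> schwartz"
proof -
  have "iter_partial is (partial_deriv i f) = iter_partial (is @ [i]) f" for "is"
    by (simp add: iter_partial_def)
  then show ?thesis using assms by (simp add: schwartz_def smooth_on_def)
qed

lemma schwartz_has_derivative:
  fixes f :: "real^'n::finite \<Rightarrow> complex"
  assumes "f \<in> schwartz"
  shows "(f has_derivative (\<lambda>h. \<Sum>i\<in>UNIV. h $ i *\<^sub>R partial_deriv i f x)) (at x)"
proof -
  let ?D = "frechet_derivative f (at x)"
  have D: "(f has_derivative ?D) (at x)"
    using schwartz_differentiable[OF assms] by (simp add: frechet_derivative_works)
  have "linear ?D" using has_derivative_linear[OF D] .
  have "?D = (\<lambda>h. \<Sum>i\<in>UNIV. h $ i *\<^sub>R partial_deriv i f x)"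
  proof
    fix h :: "real^'n"
    have "h = (\<Sum>i\<in>UNIV. h $ i *\<^sub>R axis i 1)"
      using basis_expansion[of h] by (simp add: scalar_mult_eq_scaleR)
    then have "?D h = ?D (\<Sum>i\<in>UNIV. h $ i *\<^sub>R axis i 1)" by simp
    also have "\<dots> = (\<Sum>i\<in>UNIV. h $ i *\<^sub>R ?D (axis i 1))"
      by (simp add: linear_sum[OF \<open>linear ?D\<close>] linear_cmul[OF \<open>linear ?D\<close>])
    finally show "?D h = (\<Sum>i\<in>UNIV. h $ i *\<^sub>R partial_deriv i f x)"
      by (simp add: partial_deriv_def)
  qed
  with D show ?thesis by simp
qed

lemma schwartz_continuous: "f \<in> schwartz \<Longrightarrow> continuous_on UNIV f"
  by (meson schwartz_differentiable differentiable_at_imp_differentiable_on differentiable_imp_continuous_on)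

text \<open>Continuous functions of rapid decay. These are the properties of a left-invariant derivative
  of a Schwartz function on which the estimates rest; they can be read off from its expression by
  partial derivatives with polynomial coefficients.\<close>

definition rapid :: "(real^'n::finite \<Rightarrow> complex) \<Rightarrow> bool" where
  "rapid F \<longleftrightarrow> continuous_on UNIV F \<and> (\<forall>k::nat. \<exists>C. \<forall>x. (1 + norm x) ^ k * cmod (F x) \<le> C)"

lemma one_plus_power_le:
  fixes r :: real
  assumes "r \<ge> 0"
  shows "(1 + r) ^ k \<le> 2 ^ k * (1 + r ^ k)"
proof (cases "r \<le> 1")
  case True
  then have "(1 + r) ^ k \<le> 2 ^ k" using assms by (intro power_mono) auto
  also have "\<dots> \<le> 2 ^ k * (1 + r ^ k)" using assms by simp
  finally show ?thesis .
next
  case False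
  then have "(1 + r) ^ k \<le> (2 * r) ^ k" using assms by (intro power_mono) auto
  also have "\<dots> \<le> 2 ^ k * (1 + r ^ k)" using assms by (simp add: power_mult_distrib)
  finally show ?thesis .
qed

lemma schwartz_rapid:
  assumes "f \<in> schwartz"
  shows "rapid f"
  unfolding rapid_def
proof (intro conjI allI schwartz_continuous assms)
  fix k :: nat
  have dec: "\<exists>C. \<forall>x. norm x ^ k * cmod (f x) \<le> C" for k :: nat
    using assms unfolding schwartz_def mem_Collect_eq by (metis iter_partial_Nil)
  obtain C0 where C0: "\<And>x. norm x ^ 0 * cmod (f x) \<le> C0" using dec by blast
  obtain C1 where C1: "\<And>x. norm x ^ k * cmod (f x) \<le> C1" using dec by blast
  have "(1 + norm x) ^ k * cmod (f x) \<le> 2 ^ k * (C0 + C1)" for x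
  proof -
    have "(1 + norm x) ^ k * cmod (f x) \<le> 2 ^ k * (1 + norm x ^ k) * cmod (f x)"
      by (intro mult_right_mono one_plus_power_le) auto
    also have "\<dots> = 2 ^ k * (norm x ^ 0 * cmod (f x) + norm x ^ k * cmod (f x))"
      by (simp add: algebra_simps)
    also have "\<dots> \<le> 2 ^ k * (C0 + C1)"
      by (intro mult_left_mono add_mono C0 C1) auto
    finally show ?thesis .
  qed
  then show "\<exists>C. \<forall>x. (1 + norm x) ^ k * cmod (f x) \<le> C" by blast
qed

lemma rapid_add:
  assumes "rapid F" "rapid G"
  shows "rapid (\<lambda>x. F x + G x)"
  unfolding rapid_def
proof (intro conjI allI)
  show "continuous_on UNIV (\<lambda>x. F x + G x)"
    using assms by (auto simp: rapid_def intro!: continuous_intros)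
  fix k :: nat
  obtain C1 where C1: "\<And>x. (1 + norm x) ^ k * cmod (F x) \<le> C1" using assms(1) by (auto simp: rapid_def)
  obtain C2 where C2: "\<And>x. (1 + norm x) ^ k * cmod (G x) \<le> C2" using assms(2) by (auto simp: rapid_def)
  have "(1 + norm x) ^ k * cmod (F x + G x) \<le> C1 + C2" for x
  proof -
    have "(1 + norm x) ^ k * cmod (F x + G x) \<le> (1 + norm x) ^ k * (cmod (F x) + cmod (G x))"
      by (intro mult_left_mono norm_triangle_ineq) auto
    then show ?thesis using C1[of x] C2[of x] by (simp add: distrib_left)
  qed
  then show "\<exists>C. \<forall>x. (1 + norm x) ^ k * cmod (F x + G x) \<le> C" by blast
qed

lemma rapid_sum: "(\<And>i. i \<in> A \<Longrightarrow> rapid (F i)) \<Longrightarrow> rapid (\<lambda>x. \<Sum>i\<in>A. F i x)"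
proof (induction A rule: infinite_finite_induct)
  case (insert i A)
  then show ?case by (auto intro: rapid_add)
qed (auto simp: rapid_def)

lemma real_polynomial_function_growth:
  fixes P :: "'a::real_normed_vector \<Rightarrow> real"
  assumes "real_polynomial_function P"
  shows "\<exists>C\<ge>0. \<exists>m. \<forall>x. \<bar>P x\<bar> \<le> C * (1 + norm x) ^ m"
  using assms
proof induction
  case (linear f)
  obtain K where K: "K \<ge> 0" "\<And>x. norm (f x) \<le> norm x * K"
    using bounded_linear.nonneg_bounded[OF linear] by blast
  have "\<bar>f x\<bar> \<le> K * (1 + norm x) ^ 1" for x
    using K(2)[of x] K(1) by (simp add: algebra_simps)
  then show ?case using K(1) by blast
next
  case (const c)
  have "\<bar>c\<bar> \<le> \<bar>c\<bar> * (1 + norm x) ^ 0" for x :: 'a by simp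
  then show ?case using abs_ge_zero by blast
next
  case (add f g)
  then obtain C1 m1 C2 m2 where C: "C1 \<ge> 0" "C2 \<ge> 0"
    "\<And>x. \<bar>f x\<bar> \<le> C1 * (1 + norm x) ^ m1" "\<And>x. \<bar>g x\<bar> \<le> C2 * (1 + norm x) ^ m2" by blast
  have "\<bar>f x + g x\<bar> \<le> (C1 + C2) * (1 + norm x) ^ (m1 + m2)" for x
  proof -
    have "\<bar>f x + g x\<bar> \<le> \<bar>f x\<bar> + \<bar>g x\<bar>" by (rule abs_triangle_ineq)
    also have "\<dots> \<le> C1 * (1 + norm x) ^ m1 + C2 * (1 + norm x) ^ m2"
      by (intro add_mono C)
    also have "\<dots> \<le> C1 * (1 + norm x) ^ (m1 + m2) + C2 * (1 + norm x) ^ (m1 + m2)"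
      by (intro add_mono mult_left_mono power_increasing C) auto
    finally show ?thesis by (simp add: distrib_right)
  qed
  then show ?case using C(1,2) by (meson add_nonneg_nonneg)
next
  case (mult f g)
  then obtain C1 m1 C2 m2 where C: "C1 \<ge> 0" "C2 \<ge> 0"
    "\<And>x. \<bar>f x\<bar> \<le> C1 * (1 + norm x) ^ m1" "\<And>x. \<bar>g x\<bar> \<le> C2 * (1 + norm x) ^ m2" by blast
  have "\<bar>f x * g x\<bar> \<le> (C1 * C2) * (1 + norm x) ^ (m1 + m2)" for x
  proof -
    have "\<bar>f x * g x\<bar> \<le> (C1 * (1 + norm x) ^ m1) * (C2 * (1 + norm x) ^ m2)"
      unfolding abs_mult by (intro mult_mono C) (auto intro!: mult_nonneg_nonneg C)
    then show ?thesis by (simp add: power_add mult_ac)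
  qed
  then show ?case using C(1,2) by (meson mult_nonneg_nonneg)
qed

lemma rapid_polynomial_mult:
  assumes P: "real_polynomial_function P" and F: "rapid F"
  shows "rapid (\<lambda>x. P x *\<^sub>R F x)"
  unfolding rapid_def
proof (intro conjI allI)
  have "continuous_on UNIV P"
    using continuous_on_polymonial_function P real_polynomial_function_eq by blast
  then show "continuous_on UNIV (\<lambda>x. P x *\<^sub>R F x)"
    using F by (auto simp: rapid_def intro!: continuous_intros)
  fix k :: nat
  obtain C1 m where C1: "C1 \<ge> 0" "\<And>x. \<bar>P x\<bar> \<le> C1 * (1 + norm x) ^ m"
    using real_polynomial_function_growth[OF P] by blast
  obtain C2 where C2: "\<And>x. (1 + norm x) ^ (k + m) * cmod (F x) \<le> C2"
    using F by (auto simp: rapid_def)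
  have "(1 + norm x) ^ k * cmod (P x *\<^sub>R F x) \<le> C1 * C2" for x
  proof -
    have "(1 + norm x) ^ k * cmod (P x *\<^sub>R F x) = (1 + norm x) ^ k * cmod (F x) * \<bar>P x\<bar>" by simp
    also have "\<dots> \<le> (1 + norm x) ^ k * cmod (F x) * (C1 * (1 + norm x) ^ m)"
      by (intro mult_left_mono C1) auto
    also have "\<dots> = C1 * ((1 + norm x) ^ (k + m) * cmod (F x))" by (simp add: power_add mult_ac)
    also have "\<dots> \<le> C1 * C2" by (intro mult_left_mono C1 C2)
    finally show ?thesis .
  qed
  then show "\<exists>C. \<forall>x. (1 + norm x) ^ k * cmod (P x *\<^sub>R F x) \<le> C" by blast
qed

lemma real_polynomial_function_derivative:
  assumes "real_polynomial_function p"
  shows "\<exists>p'. (\<forall>x. (p has_derivative (\<lambda>h. p' h x)) (at x)) \<and> (\<forall>h. real_polynomial_function (p' h))"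
  using assms
proof induction
  case (linear f)
  then have "(f has_derivative f) (at x)" for x by (rule bounded_linear_imp_has_derivative)
  then show ?case by (intro exI[of _ "\<lambda>h x. f h"]) auto
next
  case (const c)
  then show ?case by (intro exI[of _ "\<lambda>h x. 0"]) auto
next
  case (add f g)
  then obtain f' g' where "\<And>x. (f has_derivative (\<lambda>h. f' h x)) (at x)" "\<And>x. (g has_derivative (\<lambda>h. g' h x)) (at x)"
    "\<And>h. real_polynomial_function (f' h)" "\<And>h. real_polynomial_function (g' h)" by blast
  then show ?case by (intro exI[of _ "\<lambda>h x. f' h x + g' h x"]) (auto intro!: derivative_intros)
next
  case (mult f g)
  then obtain f' g' where "\<And>x. (f has_derivative (\<lambda>h. f' h x)) (at x)" "\<And>x. (g has_derivative (\<lambda>h. g' h x)) (at x)"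
    "\<And>h. real_polynomial_function (f' h)" "\<And>h. real_polynomial_function (g' h)" by blast
  note d = this
  show ?case
  proof (intro exI[of _ "\<lambda>h x. f x * g' h x + f' h x * g x"] conjI allI)
    show "((\<lambda>x. f x * g x) has_derivative (\<lambda>h. f x * g' h x + f' h x * g x)) (at x)" for x
      by (rule has_derivative_mult[OF d(1,2)])
    show "real_polynomial_function (\<lambda>x. f x * g' h x + f' h x * g x)" for h
      using mult.hyps d(3,4) by (intro real_polynomial_function.intros(3,4))
  qed
qed

text \<open>The functions generated from pullbacks of Schwartz functions along \<open>\<Phi>\<close> by polynomial coefficients:
  unlike the pullbacks themselves they are closed under partial derivatives.\<close>

inductive pullback_span :: "(real^'n::finite \<Rightarrow> real^'n) \<Rightarrow> (real^'n \<Rightarrow> complex) \<Rightarrow> bool" for \<Phi> where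
  base: "h \<in> schwartz \<Longrightarrow> real_polynomial_function P \<Longrightarrow> pullback_span \<Phi> (\<lambda>y. P y *\<^sub>R h (\<Phi> y))"
| add: "pullback_span \<Phi> f \<Longrightarrow> pullback_span \<Phi> g \<Longrightarrow> pullback_span \<Phi> (\<lambda>y. f y + g y)"

lemma pullback_span_sum:
  fixes h :: "real^'n::finite \<Rightarrow> complex" and \<Phi> :: "real^'n \<Rightarrow> real^'n"
  assumes "h \<in> schwartz" "finite A" "\<And>i. i \<in> A \<Longrightarrow> pullback_span \<Phi> (f i)"
  shows "pullback_span \<Phi> (\<lambda>y. \<Sum>i\<in>A. f i y)"
  using assms(2,3)
proof (induction A rule: finite_induct)
  case empty
  show ?case using pullback_span.base[OF assms(1) real_polynomial_function.intros(2)[of 0], of \<Phi>] by simp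
next
  case (insert i A)
  then show ?case by (auto intro: pullback_span.add)
qed

lemma pullback_span_derivative:
  fixes \<Phi> :: "real^'n::finite \<Rightarrow> real^'n"
  assumes \<Phi>: "\<And>k. real_polynomial_function (\<lambda>y. \<Phi> y $ k)" and "pullback_span \<Phi> f"
  shows "f differentiable (at y) \<and> pullback_span \<Phi> (partial_deriv i f)"
  using assms(2)
proof (induction arbitrary: y)
  case (base h P)
  obtain P' where P': "\<And>x. (P has_derivative (\<lambda>h. P' h x)) (at x)" "\<And>h. real_polynomial_function (P' h)"
    using real_polynomial_function_derivative[OF base(2)] by blast
  have "\<exists>\<Phi>'. \<forall>k. (\<forall>x. ((\<lambda>y. \<Phi> y $ k) has_derivative (\<lambda>h. \<Phi>' k h x)) (at x)) \<and> (\<forall>h. real_polynomial_function (\<Phi>' k h))"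
    using real_polynomial_function_derivative[OF \<Phi>] by (intro choice allI)
  then obtain \<Phi>' where \<Phi>': "\<And>k x. ((\<lambda>y. \<Phi> y $ k) has_derivative (\<lambda>h. \<Phi>' k h x)) (at x)"
    "\<And>k h. real_polynomial_function (\<Phi>' k h)" by blast
  have d\<Phi>: "(\<Phi> has_derivative (\<lambda>h. \<chi> k. \<Phi>' k h x)) (at x)" for x
    unfolding has_derivative_componentwise_within[of \<Phi>]
    using \<Phi>'(1) by (auto simp: Basis_vec_real inner_axis)
  have dh: "((\<lambda>y. h (\<Phi> y)) has_derivative (\<lambda>v. \<Sum>k\<in>UNIV. \<Phi>' k v x *\<^sub>R partial_deriv k h (\<Phi> x))) (at x)" for x
    using has_derivative_compose[OF d\<Phi> schwartz_has_derivative[OF base(1)]] by simp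
  have d: "((\<lambda>y. P y *\<^sub>R h (\<Phi> y)) has_derivative
      (\<lambda>v. P x *\<^sub>R (\<Sum>k\<in>UNIV. \<Phi>' k v x *\<^sub>R partial_deriv k h (\<Phi> x)) + P' v x *\<^sub>R h (\<Phi> x))) (at x)" for x
    by (rule has_derivative_scaleR[OF P'(1) dh])
  have "partial_deriv i (\<lambda>y. P y *\<^sub>R h (\<Phi> y))
      = (\<lambda>x. (\<Sum>k\<in>UNIV. (P x * \<Phi>' k (axis i 1) x) *\<^sub>R partial_deriv k h (\<Phi> x)) + P' (axis i 1) x *\<^sub>R h (\<Phi> x))"
    unfolding partial_deriv_def frechet_derivative_at[OF d, symmetric]
    by (simp add: scaleR_sum_right)
  moreover have "pullback_span \<Phi> \<dots>"
    using base \<Phi>' P' by (intro pullback_span.add pullback_span_sum pullback_span.base schwartz_partial_deriv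
        real_polynomial_function.intros(4)) auto
  ultimately show ?case using d by (auto simp: differentiable_def)
next
  case (add f g)
  then have fg: "f differentiable (at y)" "g differentiable (at y)" for y by blast+
  have "partial_deriv i (\<lambda>y. f y + g y) = (\<lambda>y. partial_deriv i f y + partial_deriv i g y)"
  proof
    fix y
    have "((\<lambda>y. f y + g y) has_derivative (\<lambda>h. frechet_derivative f (at y) h + frechet_derivative g (at y) h)) (at y)"
      using fg by (intro has_derivative_add) (simp_all add: frechet_derivative_works[symmetric])
    from frechet_derivative_at[OF this, symmetric]
    show "partial_deriv i (\<lambda>y. f y + g y) y = partial_deriv i f y + partial_deriv i g y"
      by (simp add: partial_deriv_def)
  qed
  then show ?case using add by (auto intro: pullback_span.add)
qed

text \<open>Derivatives of the pullback are pullbacks of derivatives with polynomial factors; the growth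
  condition turns decay in \<open>\<Phi> y\<close> into decay in \<open>y\<close>.\<close>

lemma schwartz_pullback:
  fixes \<Phi> :: "real^'n::finite \<Rightarrow> real^'n"
  assumes f: "f \<in> schwartz" and \<Phi>: "\<And>k. real_polynomial_function (\<lambda>y. \<Phi> y $ k)"
    and growth: "\<And>y. norm y \<le> C * (1 + norm (\<Phi> y)) ^ m"
  shows "(\<lambda>y. f (\<Phi> y)) \<in> schwartz"
proof -
  have span: "pullback_span \<Phi> (\<lambda>y. f (\<Phi> y))"
    using pullback_span.base[OF f real_polynomial_function.intros(2)[of 1]] by simp
  have iter: "pullback_span \<Phi> (iter_partial is (\<lambda>y. f (\<Phi> y)))" for "is"
    by (induction "is") (use span pullback_span_derivative[OF \<Phi>] in auto)
  have decay: "\<exists>B. \<forall>y. norm y ^ k * cmod (g y) \<le> B" if "pullback_span \<Phi> g" for g k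
    using that
  proof induction
    case (base h P)
    obtain C1 l where C1: "C1 \<ge> 0" "\<And>x. \<bar>P x\<bar> \<le> C1 * (1 + norm x) ^ l"
      using real_polynomial_function_growth[OF base(2)] by blast
    define C' where "C' = \<bar>C\<bar> + 1"
    have growth': "1 + norm y \<le> C' * (1 + norm (\<Phi> y)) ^ m" for y
    proof -
      have "1 \<le> (1 + norm (\<Phi> y)) ^ m" by (rule one_le_power) simp
      moreover have "C * (1 + norm (\<Phi> y)) ^ m \<le> \<bar>C\<bar> * (1 + norm (\<Phi> y)) ^ m"
        by (intro mult_right_mono) auto
      ultimately show ?thesis using growth[of y] unfolding C'_def distrib_right by linarith
    qed
    obtain C2 where C2: "\<And>x. (1 + norm x) ^ (m * (k + l)) * cmod (h x) \<le> C2"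
      using schwartz_rapid[OF base(1)] by (auto simp: rapid_def)
    have "norm y ^ k * cmod (P y *\<^sub>R h (\<Phi> y)) \<le> C1 * C' ^ (k + l) * C2" for y
    proof -
      have "norm y ^ k * cmod (P y *\<^sub>R h (\<Phi> y)) \<le> (1 + norm y) ^ k * (C1 * (1 + norm y) ^ l * cmod (h (\<Phi> y)))"
        unfolding norm_scaleR using C1(1) by (intro mult_mono power_mono C1(2)) auto
      also have "\<dots> = C1 * (1 + norm y) ^ (k + l) * cmod (h (\<Phi> y))"
        by (simp add: power_add mult_ac)
      also have "\<dots> \<le> C1 * (C' * (1 + norm (\<Phi> y)) ^ m) ^ (k + l) * cmod (h (\<Phi> y))"
        using C1 by (intro mult_right_mono mult_left_mono power_mono growth') auto
      also have "\<dots> = C1 * C' ^ (k + l) * ((1 + norm (\<Phi> y)) ^ (m * (k + l)) * cmod (h (\<Phi> y)))"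
        by (simp add: power_mult_distrib power_mult mult_ac)
      also have "\<dots> \<le> C1 * C' ^ (k + l) * C2"
        using C1 by (intro mult_left_mono C2) (auto simp: C'_def)
      finally show ?thesis .
    qed
    then show ?case by blast
  next
    case (add f g)
    then obtain B1 B2 where B: "\<And>y. norm y ^ k * cmod (f y) \<le> B1" "\<And>y. norm y ^ k * cmod (g y) \<le> B2" by blast
    have "norm y ^ k * cmod (f y + g y) \<le> B1 + B2" for y
    proof -
      have "norm y ^ k * cmod (f y + g y) \<le> norm y ^ k * (cmod (f y) + cmod (g y))"
        by (intro mult_left_mono norm_triangle_ineq) auto
      then show ?thesis using B[of y] by (simp add: distrib_left)
    qed
    then show ?case by blast
  qed
  show ?thesis
    unfolding schwartz_def smooth_on_def
    using iter decay pullback_span_derivative[OF \<Phi>] by blast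
qed

context homogeneous_group
begin

lemma polynomial_function_translate: "polynomial_function (\<lambda>y. x \<odot> y)" "polynomial_function (\<lambda>y. x \<odot> (- y))"
  by (intro polynomial_function_mul_compose polynomial_function_const polynomial_function_id polynomial_function_minus)+

lemma real_polynomial_function_nth:
  fixes f :: "real^'n::{finite,linorder} \<Rightarrow> real^'n::{finite,linorder}"
  assumes "polynomial_function f"
  shows "real_polynomial_function (\<lambda>y. f y $ k)"
  using assms unfolding polynomial_function_iff_Basis_inner Basis_vec_real by (auto simp: inner_axis)

lemma schwartz_translate_reflect:
  assumes "f \<in> schwartz"
  shows "(\<lambda>y. f (x \<odot> (- y))) \<in> schwartz"
proof -
  \<comment> \<open>The inverse map \<open>z \<mapsto> (- z) \<odot> x\<close> is polynomial as well, which bounds \<open>y\<close> by its image.\<close>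
  have "polynomial_function (\<lambda>z. (- z) \<odot> x)"
    by (intro polynomial_function_mul_compose polynomial_function_const polynomial_function_id polynomial_function_minus)
  then have poly: "real_polynomial_function (\<lambda>z. ((- z) \<odot> x) $ k)" for k
    by (rule real_polynomial_function_nth)
  have "\<exists>C. \<exists>m. \<forall>z. C \<ge> 0 \<and> \<bar>((- z) \<odot> x) $ k\<bar> \<le> C * (1 + norm z) ^ m" for k
    using real_polynomial_function_growth[OF poly[of k]] by blast
  then have "\<exists>C m. \<forall>k z. C k \<ge> 0 \<and> \<bar>((- z) \<odot> x) $ k\<bar> \<le> C k * (1 + norm z) ^ m k" by metis
  then obtain C m where C: "\<And>k z. C k \<ge> 0" "\<And>k z. \<bar>((- z) \<odot> x) $ k\<bar> \<le> C k * (1 + norm z) ^ m k" by blast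
  define M where "M = Max (range m)"
  have M: "m k \<le> M" for k unfolding M_def by (intro Max_ge) auto
  have "norm y \<le> (\<Sum>k\<in>UNIV. C k) * (1 + norm (x \<odot> (- y))) ^ M" for y
  proof -
    have "norm y \<le> (\<Sum>k\<in>UNIV. \<bar>y $ k\<bar>)" by (rule norm_le_l1_cart)
    also have "\<dots> \<le> (\<Sum>k\<in>UNIV. C k * (1 + norm (x \<odot> (- y))) ^ M)"
    proof (rule sum_mono)
      fix k
      have "(- (x \<odot> (- y))) \<odot> x = y"
        by (simp add: minus_mul assoc)
      then have "\<bar>y $ k\<bar> \<le> C k * (1 + norm (x \<odot> (- y))) ^ m k"
        using C(2)[of "x \<odot> (- y)" k] by simp
      also have "\<dots> \<le> C k * (1 + norm (x \<odot> (- y))) ^ M"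
        by (intro mult_left_mono power_increasing M C) auto
      finally show "\<bar>y $ k\<bar> \<le> C k * (1 + norm (x \<odot> (- y))) ^ M" .
    qed
    finally show ?thesis by (simp add: sum_distrib_right)
  qed
  then show ?thesis
    by (intro schwartz_pullback[OF assms] real_polynomial_function_nth polynomial_function_translate)
qed

text \<open>As derivatives of the polynomial multiplication, the coefficients of the left-invariant vector
  fields are polynomials.\<close>

lemma left_translation_derivative:
  "\<exists>X. (\<forall>k j. real_polynomial_function (X k j)) \<and>
    (\<forall>z. ((\<lambda>v. z \<odot> v) has_derivative (\<lambda>h. \<chi> k. \<Sum>j\<in>UNIV. h $ j * X k j z)) (at 0))"
proof -
  have "\<exists>p'. \<forall>k. (\<forall>x. ((\<lambda>z. (fst z \<odot> snd z) $ k) has_derivative (\<lambda>h. p' k h x)) (at x)) \<and> (\<forall>h. real_polynomial_function (p' k h))"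
    using real_polynomial_function_derivative[OF real_polynomial_function_mul_nth] by (intro choice allI)
  then obtain p' where p': "\<And>k x. ((\<lambda>z. (fst z \<odot> snd z) $ k) has_derivative (\<lambda>h. p' k h x)) (at x)"
    "\<And>k h. real_polynomial_function (p' k h)" by blast
  define X where "X k j z = p' k (0, axis j 1) (z, 0)" for k j z
  have "real_polynomial_function (X k j)" for k j
  proof -
    have "polynomial_function (\<lambda>z :: real^'n::{finite,linorder}. (z, 0 :: real^'n::{finite,linorder}))"
      by (intro polynomial_function_bounded_linear bounded_linear_Pair bounded_linear_ident bounded_linear_zero)
    from real_polynomial_function_compose[OF this p'(2)[of k "(0, axis j 1)"]]
    show ?thesis by (simp add: X_def[abs_def] o_def)
  qed
  moreover have "((\<lambda>v. z \<odot> v) has_derivative (\<lambda>h. \<chi> k. \<Sum>j\<in>UNIV. h $ j * X k j z)) (at 0)" for z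
  proof -
    have d: "((\<lambda>v. (z \<odot> v) $ k) has_derivative (\<lambda>h. p' k (0, h) (z, 0))) (at 0)" for k
    proof -
      have "((\<lambda>v. (z, v)) has_derivative (\<lambda>h. (0, h))) (at 0)"
        by (intro derivative_intros)
      from has_derivative_compose[OF this p'(1)] show ?thesis by simp
    qed
    have lin: "p' k (0, h) (z, 0) = (\<Sum>j\<in>UNIV. h $ j * X k j z)" for k h
    proof -
      have l: "linear (\<lambda>h. p' k (0, h) (z, 0))" by (rule has_derivative_linear[OF d])
      have "h = (\<Sum>i\<in>UNIV. h $ i *\<^sub>R axis i 1)"
        using basis_expansion[of h] by (simp add: scalar_mult_eq_scaleR)
      then have "p' k (0, h) (z, 0) = p' k (0, \<Sum>i\<in>UNIV. h $ i *\<^sub>R axis i 1) (z, 0)" by simp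
      also have "\<dots> = (\<Sum>i\<in>UNIV. h $ i *\<^sub>R p' k (0, axis i 1) (z, 0))"
        using linear_sum[OF l, of "\<lambda>i. h $ i *\<^sub>R axis i 1" UNIV] by (simp add: linear_cmul[OF l])
      finally show ?thesis by (simp add: X_def)
    qed
    show ?thesis
      unfolding has_derivative_componentwise_within[of "\<lambda>v. z \<odot> v"]
      using d[unfolded lin] by (auto simp: Basis_vec_real inner_axis)
  qed
  ultimately show ?thesis by blast
qed

text \<open>Along \<open>s \<mapsto> x (s y)\<close>, a translate of a one-parameter subgroup, the velocity at every time is
  the same left-invariant vector field \<open>\<Sum>\<^sub>j y\<^sub>j X\<^sub>j\<close>.\<close>

lemma left_deriv_path:
  fixes f :: "real^'n::{finite,linorder} \<Rightarrow> complex"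
  assumes f: "f \<in> schwartz"
  shows "rapid (left_deriv (\<odot>) j f)"
    and "((\<lambda>s. f (x \<odot> (s *\<^sub>R y))) has_vector_derivative
      (\<Sum>j\<in>UNIV. y $ j *\<^sub>R left_deriv (\<odot>) j f (x \<odot> (s *\<^sub>R y)))) (at s)"
proof -
  obtain X where X: "\<And>k j. real_polynomial_function (X k j)"
    and dX: "\<And>z. ((\<lambda>v. z \<odot> v) has_derivative (\<lambda>h. \<chi> k. \<Sum>j\<in>UNIV. h $ j * X k j z)) (at 0)"
    using left_translation_derivative by blast
  have D: "((\<lambda>t. f (z \<odot> (t *\<^sub>R y))) has_vector_derivative
      (\<Sum>k\<in>UNIV. (\<Sum>j\<in>UNIV. y $ j * X k j z) *\<^sub>R partial_deriv k f z)) (at 0)" for z y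
  proof -
    have "((\<lambda>t. t *\<^sub>R y) has_derivative (\<lambda>t. t *\<^sub>R y)) (at (0 :: real))"
      by (rule bounded_linear_imp_has_derivative[OF bounded_linear_scaleR_left])
    moreover have "((\<lambda>v. z \<odot> v) has_derivative (\<lambda>h. \<chi> k. \<Sum>j\<in>UNIV. h $ j * X k j z)) (at ((0::real) *\<^sub>R y))"
      using dX by simp
    ultimately have "((\<lambda>t. z \<odot> (t *\<^sub>R y)) has_derivative (\<lambda>t. \<chi> k. \<Sum>j\<in>UNIV. (t *\<^sub>R y) $ j * X k j z)) (at (0 :: real))"
      by (rule has_derivative_compose)
    moreover have "(f has_derivative (\<lambda>h. \<Sum>i\<in>UNIV. h $ i *\<^sub>R partial_deriv i f z)) (at (z \<odot> ((0::real) *\<^sub>R y)))"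
      using schwartz_has_derivative[OF f, of z] by simp
    ultimately have "((\<lambda>t. f (z \<odot> (t *\<^sub>R y))) has_derivative
        (\<lambda>t. \<Sum>i\<in>UNIV. (\<chi> k. \<Sum>j\<in>UNIV. (t *\<^sub>R y) $ j * X k j z) $ i *\<^sub>R partial_deriv i f z)) (at (0 :: real))"
      by (rule has_derivative_compose)
    then show ?thesis
      unfolding has_vector_derivative_def
      by (rule has_derivative_eq_rhs) (simp add: fun_eq_iff scaleR_sum_right mult.assoc flip: sum_distrib_left)
  qed
  have left: "left_deriv (\<odot>) j f z = (\<Sum>k\<in>UNIV. X k j z *\<^sub>R partial_deriv k f z)" for j z
    unfolding left_deriv_def
    using vector_derivative_at[OF D[of z "axis j 1"]]
    by (simp add: axis_def if_distrib if_distribR cong: if_cong)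
  show "rapid (left_deriv (\<odot>) j f)"
  proof -
    have "rapid (\<lambda>z. \<Sum>k\<in>UNIV. X k j z *\<^sub>R partial_deriv k f z)"
      by (intro rapid_sum rapid_polynomial_mult X schwartz_rapid schwartz_partial_deriv f)
    then show ?thesis by (simp add: left[symmetric])
  qed
  show "((\<lambda>s. f (x \<odot> (s *\<^sub>R y))) has_vector_derivative
      (\<Sum>j\<in>UNIV. y $ j *\<^sub>R left_deriv (\<odot>) j f (x \<odot> (s *\<^sub>R y)))) (at s)"
  proof -
    let ?z = "x \<odot> (s *\<^sub>R y)"
    have "((\<lambda>t. f (?z \<odot> ((t - s) *\<^sub>R y))) has_vector_derivative
      (\<Sum>k\<in>UNIV. (\<Sum>j\<in>UNIV. y $ j * X k j ?z) *\<^sub>R partial_deriv k f ?z)) (at s)"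
    proof -
      have 1: "((\<lambda>t. t - s) has_vector_derivative 1) (at s)"
        by (auto intro!: derivative_eq_intros)
      have 2: "((\<lambda>t. f (?z \<odot> (t *\<^sub>R y))) has_vector_derivative
        (\<Sum>k\<in>UNIV. (\<Sum>j\<in>UNIV. y $ j * X k j ?z) *\<^sub>R partial_deriv k f ?z)) (at (s - s))"
        using D[of ?z y] by simp
      from vector_diff_chain_at[OF 1 2] show ?thesis by (simp add: o_def)
    qed
    moreover have "?z \<odot> ((t - s) *\<^sub>R y) = x \<odot> (t *\<^sub>R y)" for t
      using one_parameter[of s y "t - s"] by (simp add: assoc scaleR_left_diff_distrib)
    moreover have "(\<Sum>k\<in>UNIV. (\<Sum>j\<in>UNIV. y $ j * X k j ?z) *\<^sub>R partial_deriv k f ?z)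
        = (\<Sum>j\<in>UNIV. y $ j *\<^sub>R left_deriv (\<odot>) j f ?z)"
      unfolding left by (simp add: scaleR_sum_left scaleR_sum_right) (rule sum.swap)
    ultimately show ?thesis by simp
  qed
qed

lemma left_difference_integral:
  fixes f :: "real^'n::{finite,linorder} \<Rightarrow> complex"
  assumes f: "f \<in> schwartz"
  shows "(LINT s|lborel. indicator {0..1} s *\<^sub>R (\<Sum>j\<in>UNIV. y $ j *\<^sub>R left_deriv (\<odot>) j f (x \<odot> (s *\<^sub>R y))))
      = f (x \<odot> y) - f x"
    and "integrable lborel (\<lambda>s. indicator {0..1} s *\<^sub>R (\<Sum>j\<in>UNIV. y $ j *\<^sub>R left_deriv (\<odot>) j f (x \<odot> (s *\<^sub>R y))))"
proof -
  have cont: "continuous_on {0..1} (\<lambda>s. \<Sum>j\<in>UNIV. y $ j *\<^sub>R left_deriv (\<odot>) j f (x \<odot> (s *\<^sub>R y)))"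
  proof -
    have "continuous_on UNIV (left_deriv (\<odot>) j f)" for j
      using left_deriv_path(1)[OF f] by (simp add: rapid_def)
    then have "continuous_on {0..1} (\<lambda>s. left_deriv (\<odot>) j f (x \<odot> (s *\<^sub>R y)))" for j
      by (rule continuous_on_compose2) (auto intro!: continuous_intros)
    then show ?thesis by (intro continuous_intros)
  qed
  show "integrable lborel (\<lambda>s. indicator {0..1} s *\<^sub>R (\<Sum>j\<in>UNIV. y $ j *\<^sub>R left_deriv (\<odot>) j f (x \<odot> (s *\<^sub>R y))))"
    using borel_integrable_compact[OF compact_Icc cont] by simp
  have "(LINT s|lborel. indicator {0..1} s *\<^sub>R (\<Sum>j\<in>UNIV. y $ j *\<^sub>R left_deriv (\<odot>) j f (x \<odot> (s *\<^sub>R y))))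
      = f (x \<odot> (1 *\<^sub>R y)) - f (x \<odot> (0 *\<^sub>R y))"
    by (rule integral_FTC_atLeastAtMost[OF _ _ cont])
       (auto intro: has_vector_derivative_at_within left_deriv_path(2)[OF f])
  then show "(LINT s|lborel. indicator {0..1} s *\<^sub>R (\<Sum>j\<in>UNIV. y $ j *\<^sub>R left_deriv (\<odot>) j f (x \<odot> (s *\<^sub>R y))))
      = f (x \<odot> y) - f x" by simp
qed

definition left_gradient_size :: "(real^'n::{finite,linorder} \<Rightarrow> complex) \<Rightarrow> real^'n::{finite,linorder} \<Rightarrow> real" where
  "left_gradient_size f z = (\<Sum>j\<in>UNIV. cmod (left_deriv (\<odot>) j f z))"

text \<open>The mean value inequality along one-parameter subgroups.\<close>

lemma left_difference_le:
  assumes f: "f \<in> schwartz"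
  shows "ennreal (cmod (f (x \<odot> y) - f x)) \<le> ennreal (norm y) *
    (\<integral>\<^sup>+s\<in>{0..1}. ennreal (left_gradient_size f (x \<odot> (s *\<^sub>R y))) \<partial>lborel)"
proof -
  have [measurable]: "left_deriv (\<odot>) j f \<in> borel_measurable borel" for j
    using left_deriv_path(1)[OF f] by (auto simp: rapid_def intro: borel_measurable_continuous_onI)
  have "ennreal (cmod (f (x \<odot> y) - f x)) \<le>
    (\<integral>\<^sup>+s. ennreal (cmod (indicator {0..1} s *\<^sub>R (\<Sum>j\<in>UNIV. y $ j *\<^sub>R left_deriv (\<odot>) j f (x \<odot> (s *\<^sub>R y))))) \<partial>lborel)"
    unfolding left_difference_integral(1)[OF f, of y x, symmetric]
    by (rule integral_norm_bound_ennreal[OF left_difference_integral(2)[OF f]])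
  also have "\<dots> \<le> (\<integral>\<^sup>+s. ennreal (norm y) * (ennreal (left_gradient_size f (x \<odot> (s *\<^sub>R y))) * indicator {0..1} s) \<partial>lborel)"
  proof (rule nn_integral_mono)
    fix s :: real
    have "cmod (\<Sum>j\<in>UNIV. y $ j *\<^sub>R left_deriv (\<odot>) j f (x \<odot> (s *\<^sub>R y)))
        \<le> (\<Sum>j\<in>UNIV. \<bar>y $ j\<bar> * cmod (left_deriv (\<odot>) j f (x \<odot> (s *\<^sub>R y))))"
      by (rule order.trans[OF norm_sum]) simp
    also have "\<dots> \<le> (\<Sum>j\<in>UNIV. norm y * cmod (left_deriv (\<odot>) j f (x \<odot> (s *\<^sub>R y))))"
      by (intro sum_mono mult_right_mono component_le_norm_cart) auto
    also have "\<dots> = norm y * left_gradient_size f (x \<odot> (s *\<^sub>R y))"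
      by (simp add: left_gradient_size_def sum_distrib_left)
    finally have "ennreal (cmod (\<Sum>j\<in>UNIV. y $ j *\<^sub>R left_deriv (\<odot>) j f (x \<odot> (s *\<^sub>R y))))
        \<le> ennreal (norm y) * ennreal (left_gradient_size f (x \<odot> (s *\<^sub>R y)))"
      by (simp add: ennreal_mult'[symmetric] ennreal_leI)
    then show "ennreal (cmod (indicator {0..1} s *\<^sub>R (\<Sum>j\<in>UNIV. y $ j *\<^sub>R left_deriv (\<odot>) j f (x \<odot> (s *\<^sub>R y)))))
      \<le> ennreal (norm y) * (ennreal (left_gradient_size f (x \<odot> (s *\<^sub>R y))) * indicator {0..1} s)"
      by (auto split: split_indicator)
  qed
  also have "\<dots> = ennreal (norm y) * (\<integral>\<^sup>+s\<in>{0..1}. ennreal (left_gradient_size f (x \<odot> (s *\<^sub>R y))) \<partial>lborel)"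
    unfolding left_gradient_size_def by (rule nn_integral_cmult) measurable
  finally show ?thesis .
qed

end

context homogeneous_group_norm
begin

lemma rho_growth: "\<exists>C\<ge>1. \<exists>m. \<forall>x. 1 + \<rho> x \<le> C * (1 + norm x) ^ m"
proof -
  obtain c \<alpha> where c: "c > 0" "\<And>x. \<rho> x \<ge> 1 \<Longrightarrow> \<rho> x \<le> c * norm x powr \<alpha>" "\<alpha> > 0"
    using rho_bounds_large by blast
  define m where "m = nat \<lceil>\<alpha>\<rceil>"
  have "1 + \<rho> x \<le> (2 + c) * (1 + norm x) ^ m" for x
  proof -
    have one: "1 \<le> (1 + norm x) ^ m" by (rule one_le_power) simp
    show ?thesis
    proof (cases "\<rho> x \<ge> 1")
      case True
      have "norm x powr \<alpha> \<le> (1 + norm x) powr \<alpha>" using c by (intro powr_mono2) auto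
      also have "\<dots> \<le> (1 + norm x) powr real m"
        by (intro powr_mono) (auto simp: m_def real_nat_ceiling_ge)
      also have "\<dots> = (1 + norm x) ^ m"
        by (rule powr_realpow) (simp add: add_pos_nonneg)
      finally have "c * norm x powr \<alpha> \<le> c * (1 + norm x) ^ m" using c by simp
      then have "1 + \<rho> x \<le> 1 + c * (1 + norm x) ^ m" using c(2)[OF True] by linarith
      then show ?thesis using one unfolding distrib_right by linarith
    next
      case False
      have "1 + \<rho> x \<le> 2 * 1 + c * 0" using False by simp
      also have "\<dots> \<le> 2 * (1 + norm x) ^ m + c * (1 + norm x) ^ m"
        using one c by (intro add_mono mult_left_mono) auto
      finally show ?thesis unfolding distrib_right .
    qed
  qed
  moreover have "2 + c \<ge> 1" using c by simp
  ultimately show ?thesis by blast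
qed

lemma rapid_rho_decay:
  fixes F :: "real^'n::{finite,linorder} \<Rightarrow> complex"
  assumes "rapid F" "K \<ge> 0"
  shows "\<exists>C\<ge>0. \<forall>x. (1 + norm x) ^ k * (1 + \<rho> x) powr K * cmod (F x) \<le> C"
proof -
  obtain C m where C: "C \<ge> 1" "\<And>x. 1 + \<rho> x \<le> C * (1 + norm x) ^ m" using rho_growth by blast
  define l where "l = nat \<lceil>real m * K\<rceil>"
  obtain B where B: "\<And>x. (1 + norm x) ^ (k + l) * cmod (F x) \<le> B"
    using assms(1) by (auto simp: rapid_def)
  have "(1 + norm x) ^ k * (1 + \<rho> x) powr K * cmod (F x) \<le> C powr K * B" for x
  proof -
    have pos: "1 + norm x > 0" by (simp add: add_pos_nonneg)
    have "(1 + \<rho> x) powr K \<le> (C * (1 + norm x) ^ m) powr K"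
      using assms(2) C by (intro powr_mono2) auto
    also have "\<dots> = C powr K * (1 + norm x) powr (real m * K)"
      using pos by (simp add: powr_mult powr_powr flip: powr_realpow)
    also have "\<dots> \<le> C powr K * (1 + norm x) powr real l"
      by (intro mult_left_mono powr_mono) (auto simp: l_def real_nat_ceiling_ge)
    finally have "(1 + \<rho> x) powr K \<le> C powr K * (1 + norm x) ^ l"
      using pos by (simp add: powr_realpow)
    then have "(1 + norm x) ^ k * (1 + \<rho> x) powr K * cmod (F x)
        \<le> (1 + norm x) ^ k * (C powr K * (1 + norm x) ^ l) * cmod (F x)"
      by (intro mult_right_mono mult_left_mono) auto
    also have "\<dots> = C powr K * ((1 + norm x) ^ (k + l) * cmod (F x))"
      by (simp add: power_add mult_ac)
    also have "\<dots> \<le> C powr K * B" by (intro mult_left_mono B) auto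
    finally show ?thesis .
  qed
  moreover have "B \<ge> 0" using order.trans[OF _ B[of 0]] by simp
  then have "C powr K * B \<ge> 0" by simp
  ultimately show ?thesis by blast
qed

lemma rapid_nn_integral:
  fixes F :: "real^'n::{finite,linorder} \<Rightarrow> complex"
  assumes "rapid F" "L \<ge> 0"
  shows "(\<integral>\<^sup>+x. ennreal ((1 + norm x) ^ k * (1 + \<rho> x) powr L * cmod (F x)) \<partial>lborel) < top"
proof -
  define K where "K = hom_dim a + 1"
  have K: "K > hom_dim a" "K \<ge> 0" using hom_dim_ge_2 by (auto simp: K_def)
  obtain C where C: "C \<ge> 0" "\<And>x. (1 + norm x) ^ k * (1 + \<rho> x) powr (L + K) * cmod (F x) \<le> C"
    using rapid_rho_decay[of F "L + K" k] assms K by auto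
  have "(\<integral>\<^sup>+x. ennreal ((1 + norm x) ^ k * (1 + \<rho> x) powr L * cmod (F x)) \<partial>lborel)
      \<le> (\<integral>\<^sup>+x. ennreal C * ennreal ((1 + \<rho> x) powr (- K)) \<partial>lborel)"
  proof (rule nn_integral_mono)
    fix x
    have pos: "1 + \<rho> x > 0" by (simp add: add_pos_nonneg)
    have "(1 + norm x) ^ k * (1 + \<rho> x) powr L * cmod (F x)
      = ((1 + norm x) ^ k * (1 + \<rho> x) powr (L + K) * cmod (F x)) * (1 + \<rho> x) powr (- K)"
      using pos by (simp add: powr_add powr_minus field_simps)
    also have "\<dots> \<le> C * (1 + \<rho> x) powr (- K)"
      by (intro mult_right_mono C) auto
    finally show "ennreal ((1 + norm x) ^ k * (1 + \<rho> x) powr L * cmod (F x)) \<le> ennreal C * ennreal ((1 + \<rho> x) powr (- K))"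
      using C(1) by (simp add: ennreal_mult'[symmetric] ennreal_leI)
  qed
  also have "\<dots> = ennreal C * (\<integral>\<^sup>+x. ennreal ((1 + \<rho> x) powr (- K)) \<partial>lborel)"
    by (rule nn_integral_cmult) measurable
  also have "\<dots> < top"
    using nn_integral_rho_decay[OF K(1)] by (simp add: ennreal_mult_less_top)
  finally show ?thesis .
qed

lemma rapid_measurable: "rapid F \<Longrightarrow> F \<in> borel_measurable borel"
  by (auto simp: rapid_def intro: borel_measurable_continuous_onI)

lemma rapid_integrable:
  fixes F :: "real^'n::{finite,linorder} \<Rightarrow> complex"
  assumes "rapid F"
  shows "integrable lborel F"
proof (rule integrableI_bounded)
  show "F \<in> borel_measurable lborel" using rapid_measurable[OF assms] by simp
  show "(\<integral>\<^sup>+x. ennreal (norm (F x)) \<partial>lborel) < \<infinity>"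
    using rapid_nn_integral[OF assms order_refl, where k = 0]
    by (simp add: add_nonneg_eq_0_iff)
qed

lemma rapid_bounded:
  fixes F :: "real^'n::{finite,linorder} \<Rightarrow> complex"
  assumes "rapid F"
  shows "\<exists>C\<ge>0. \<forall>x. cmod (F x) \<le> C"
proof -
  have "1 + \<rho> x \<noteq> 0" for x using rho_nonneg[of x] by linarith
  then show ?thesis using rapid_rho_decay[OF assms order_refl, where k = 0] by simp
qed

end

section \<open>Convolutions and the reproducing formula\<close>

lemma norm_integral_le_nn_integral:
  fixes f :: "'a \<Rightarrow> complex"
  shows "ennreal (cmod (LINT x|M. f x)) \<le> (\<integral>\<^sup>+x. ennreal (cmod (f x)) \<partial>M)"
proof (cases "integrable M f")
  case True
  then show ?thesis by (rule integral_norm_bound_ennreal)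
next
  case False
  then show ?thesis by (simp add: not_integrable_integral_eq)
qed

text \<open>The Haar measure of the multiplicative half-line, extended by zero.\<close>

definition dt_over_t :: "real measure" where
  "dt_over_t = density lborel (\<lambda>t. ennreal (indicator {0<..} t / t))"

lemma sets_dt_over_t [measurable_cong, simp]: "sets dt_over_t = sets borel"
  by (simp add: dt_over_t_def)

lemma sigma_finite_dt_over_t: "sigma_finite_measure dt_over_t"
  unfolding dt_over_t_def
  by (subst sigma_finite_measure.sigma_finite_iff_density_finite)
     (auto intro: lborel.sigma_finite_measure_axioms)

interpretation dt_over_t: sigma_finite_measure dt_over_t
  by (rule sigma_finite_dt_over_t)

lemma indicator_div_pos: "indicator {0<..} (t :: real) / t \<ge> 0"
  by (auto split: split_indicator)

lemma nn_integral_dt_over_t: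
  assumes [measurable]: "h \<in> borel_measurable borel"
  shows "(\<integral>\<^sup>+t. h t \<partial>dt_over_t) = (\<integral>\<^sup>+t\<in>{0<..}. h t * ennreal (1 / t) \<partial>lborel)"
  unfolding dt_over_t_def
  by (subst nn_integral_density) (auto intro!: nn_integral_cong simp: mult.commute split: split_indicator)

lemma AE_dt_over_t_pos: "AE t in dt_over_t. t > 0"
  unfolding dt_over_t_def by (subst AE_density) (auto split: split_indicator simp: ennreal_eq_0_iff)

lemma nn_integral_dt_over_t_scale:
  assumes [measurable]: "h \<in> borel_measurable borel" and c: "c > 0"
  shows "(\<integral>\<^sup>+t. h (c * t) \<partial>dt_over_t) = (\<integral>\<^sup>+t. h t \<partial>dt_over_t)"
proof -
  have "(\<integral>\<^sup>+t. h t \<partial>dt_over_t) = (\<integral>\<^sup>+t. h t * ennreal (1 / t) * indicator {0<..} t \<partial>lborel)"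
    by (rule nn_integral_dt_over_t) measurable
  also have "\<dots> = ennreal c * (\<integral>\<^sup>+t. h (0 + c * t) * ennreal (1 / (0 + c * t)) * indicator {0<..} (0 + c * t) \<partial>lborel)"
    using nn_integral_real_affine[of "\<lambda>t. h t * ennreal (1 / t) * indicator {0<..} t" c 0] c by simp
  also have "\<dots> = (\<integral>\<^sup>+t. ennreal c * (h (0 + c * t) * ennreal (1 / (0 + c * t)) * indicator {0<..} (0 + c * t)) \<partial>lborel)"
    by (rule nn_integral_cmult[symmetric]) measurable
  also have "\<dots> = (\<integral>\<^sup>+t. h (c * t) * ennreal (1 / t) * indicator {0<..} t \<partial>lborel)"
  proof (intro nn_integral_cong)
    fix t :: real
    show "ennreal c * (h (0 + c * t) * ennreal (1 / (0 + c * t)) * indicator {0<..} (0 + c * t))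
        = h (c * t) * ennreal (1 / t) * indicator {0<..} t"
    proof (cases "t > 0")
      case True
      have "ennreal c * ennreal (1 / (c * t)) = ennreal (1 / t)"
        using c True by (simp flip: ennreal_mult)
      then show ?thesis using c True by (simp add: mult.left_commute[of "ennreal c"])
    next
      case False
      then show ?thesis using c by (auto simp: zero_less_mult_iff)
    qed
  qed
  also have "\<dots> = (\<integral>\<^sup>+t. h (c * t) \<partial>dt_over_t)"
    by (rule nn_integral_dt_over_t[symmetric]) measurable
  finally show ?thesis ..
qed

text \<open>Exponential decay in \<open>|log u|\<close>; on the multiplicative half-line it is an integrable
  convolution kernel.\<close>

definition log_decay :: "real \<Rightarrow> real \<Rightarrow> real" where
  "log_decay \<epsilon> u = min u (1 / u) powr \<epsilon>"

lemma log_decay_nonneg [simp]: "log_decay \<epsilon> u \<ge> 0"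
  by (simp add: log_decay_def)

lemma measurable_log_decay [measurable (raw)]:
  "f \<in> borel_measurable M \<Longrightarrow> (\<lambda>x. log_decay \<epsilon> (f x)) \<in> borel_measurable M"
  unfolding log_decay_def by measurable

lemma nn_integral_log_decay:
  assumes "\<epsilon> > 0"
  shows "(\<integral>\<^sup>+t. ennreal (log_decay \<epsilon> t) \<partial>dt_over_t) < top"
proof -
  have "(\<integral>\<^sup>+t. ennreal (log_decay \<epsilon> t) \<partial>dt_over_t) = (\<integral>\<^sup>+t\<in>{0<..}. ennreal (log_decay \<epsilon> t) * ennreal (1 / t) \<partial>lborel)"
    by (rule nn_integral_dt_over_t) measurable
  also have "\<dots> \<le> (\<integral>\<^sup>+t. indicator {0..1} t * ennreal (t powr (\<epsilon> - 1)) + indicator {1..} t * ennreal (t powr (- \<epsilon> - 1)) \<partial>lborel)"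
  proof (rule nn_integral_mono)
    fix t :: real
    consider "t \<le> 0" | "0 < t" "t \<le> 1" | "t > 1" by linarith
    then show "ennreal (log_decay \<epsilon> t) * ennreal (1 / t) * indicator {0<..} t
        \<le> indicator {0..1} t * ennreal (t powr (\<epsilon> - 1)) + indicator {1..} t * ennreal (t powr (- \<epsilon> - 1))"
    proof cases
      case 2
      then have "1 \<le> 1 / t" by simp
      then have "min t (1 / t) = t" using 2 by linarith
      then have "log_decay \<epsilon> t * (1 / t) = t powr (\<epsilon> - 1)"
        using 2 by (simp add: log_decay_def powr_diff)
      then have "ennreal (log_decay \<epsilon> t) * ennreal (1 / t) = ennreal (t powr (\<epsilon> - 1))"
        using 2 by (simp flip: ennreal_mult)
      then show ?thesis using 2 by (simp add: add_increasing2)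
    next
      case 3
      then have "min t (1 / t) = 1 / t" by (simp add: min_def field_simps) (use mult_strict_mono[of 1 t 1 t] in auto)
      then have "log_decay \<epsilon> t * (1 / t) = t powr (- \<epsilon> - 1)"
        using 3 by (simp add: log_decay_def powr_diff powr_minus inverse_powr divide_inverse)
      then have "ennreal (log_decay \<epsilon> t) * ennreal (1 / t) = ennreal (t powr (- \<epsilon> - 1))"
        using 3 by (simp flip: ennreal_mult)
      then show ?thesis using 3 by simp
    qed auto
  qed
  also have "\<dots> = (\<integral>\<^sup>+t. indicator {0..1} t * ennreal (t powr (\<epsilon> - 1)) \<partial>lborel) + (\<integral>\<^sup>+t. indicator {1..} t * ennreal (t powr (- \<epsilon> - 1)) \<partial>lborel)"
    by (rule nn_integral_add) measurable
  also have "(\<integral>\<^sup>+t. indicator {0..1} t * ennreal (t powr (\<epsilon> - 1)) \<partial>lborel) = ennreal (1 powr (\<epsilon> - 1 + 1) / (\<epsilon> - 1 + 1))"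
    using nn_integral_has_integral_lebesgue[OF _ has_integral_powr_from_0[of "\<epsilon> - 1" 1]] assms
    by (simp add: ennreal_mult' ennreal_indicator)
  also have "(\<integral>\<^sup>+t. indicator {1..} t * ennreal (t powr (- \<epsilon> - 1)) \<partial>lborel) = ennreal (- (1 powr (- \<epsilon> - 1 + 1)) / (- \<epsilon> - 1 + 1))"
    using nn_integral_has_integral_lebesgue[OF _ has_integral_powr_to_inf[of "- \<epsilon> - 1" 1]] assms
    by (simp add: ennreal_mult' ennreal_indicator)
  also have "ennreal (1 powr (\<epsilon> - 1 + 1) / (\<epsilon> - 1 + 1)) + ennreal (- (1 powr (- \<epsilon> - 1 + 1)) / (- \<epsilon> - 1 + 1)) < top"
    by simp
  finally show ?thesis .
qed

lemma measurable_dilate [measurable (raw)]: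
  fixes x :: "'b \<Rightarrow> real^'n::finite"
  assumes [measurable]: "\<phi> \<in> borel_measurable borel" "t \<in> borel_measurable M" "x \<in> borel_measurable M"
  shows "(\<lambda>z. dilate a \<phi> (t z) (x z)) \<in> borel_measurable M"
proof -
  have "(\<lambda>z. dilation a (inverse (t z)) (x z)) \<in> borel_measurable M" by measurable
  from measurable_compose[OF this assms(1)] show ?thesis
    unfolding dilate_def by measurable
qed

context homogeneous_group_norm
begin

abbreviation conv :: "(real^'n::{finite,linorder} \<Rightarrow> complex) \<Rightarrow> (real^'n::{finite,linorder} \<Rightarrow> complex) \<Rightarrow> real^'n::{finite,linorder} \<Rightarrow> complex"
    (infixl "\<star>" 75) where
  "F \<star> G \<equiv> convolve (\<odot>) F G"

lemma nn_integral_dilate: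
  assumes [measurable]: "H \<in> borel_measurable borel" "\<phi> \<in> borel_measurable borel" and t: "t > 0"
  shows "(\<integral>\<^sup>+x. H x * ennreal (cmod (dilate a \<phi> t x)) \<partial>lborel) = (\<integral>\<^sup>+x. H (dilation a t x) * ennreal (cmod (\<phi> x)) \<partial>lborel)"
proof -
  have "(\<integral>\<^sup>+x. H x * ennreal (cmod (dilate a \<phi> t x)) \<partial>lborel)
      = ennreal (t powr hom_dim a) * (\<integral>\<^sup>+x. H (dilation a t x) * ennreal (cmod (dilate a \<phi> t (dilation a t x))) \<partial>lborel)"
    by (rule nn_integral_dilation[OF t]) measurable
  also have "\<dots> = (\<integral>\<^sup>+x. ennreal (t powr hom_dim a) * (H (dilation a t x) * ennreal (cmod (dilate a \<phi> t (dilation a t x)))) \<partial>lborel)"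
    by (rule nn_integral_cmult[symmetric]) measurable
  also have "\<dots> = (\<integral>\<^sup>+x. H (dilation a t x) * ennreal (cmod (\<phi> x)) \<partial>lborel)"
  proof (intro nn_integral_cong)
    fix x
    have "t powr hom_dim a * cmod (dilate a \<phi> t (dilation a t x)) = cmod (\<phi> x)"
    proof -
      have "t powr hom_dim a * t powr (- hom_dim a) = 1" using t by (simp flip: powr_add)
      then show ?thesis using t by (simp add: dilate_def norm_mult dilation_inverse flip: mult.assoc)
    qed
    then have "ennreal (t powr hom_dim a) * ennreal (cmod (dilate a \<phi> t (dilation a t x))) = ennreal (cmod (\<phi> x))"
      by (simp flip: ennreal_mult)
    then show "ennreal (t powr hom_dim a) * (H (dilation a t x) * ennreal (cmod (dilate a \<phi> t (dilation a t x))))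
        = H (dilation a t x) * ennreal (cmod (\<phi> x))"
      by (simp add: mult.left_commute[of "ennreal (t powr hom_dim a)"])
  qed
  finally show ?thesis .
qed

lemma nn_integral_norm_dilate:
  assumes [measurable]: "\<phi> \<in> borel_measurable borel" and t: "t > 0"
  shows "(\<integral>\<^sup>+x. ennreal (cmod (dilate a \<phi> t x)) \<partial>lborel) = (\<integral>\<^sup>+x. ennreal (cmod (\<phi> x)) \<partial>lborel)"
  using nn_integral_dilate[of "\<lambda>_. 1" \<phi> t] t by simp

lemma integral_dilate:
  assumes [measurable]: "\<phi> \<in> borel_measurable borel" and t: "t > 0"
  shows "(LINT x|lborel. dilate a \<phi> t x) = (LINT x|lborel. \<phi> x)"
proof -
  have "(LINT x|lborel. dilate a \<phi> t x) = of_real (t powr hom_dim a) * (LINT x|lborel. dilate a \<phi> t (dilation a t x))"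
    by (rule integral_dilation[OF t]) measurable
  also have "\<dots> = (LINT x|lborel. of_real (t powr hom_dim a) * dilate a \<phi> t (dilation a t x))"
    by simp
  also have "\<dots> = (LINT x|lborel. \<phi> x)"
    using t by (intro Bochner_Integration.integral_cong)
       (auto simp: dilate_def dilation_inverse powr_minus simp flip: of_real_mult mult.assoc)
  finally show ?thesis .
qed

lemma integrable_dilate:
  assumes "integrable lborel \<phi>" and t: "t > 0"
  shows "integrable lborel (dilate a \<phi> t)"
proof (rule integrableI_bounded)
  have [measurable]: "\<phi> \<in> borel_measurable borel" using assms(1) by simp
  show "dilate a \<phi> t \<in> borel_measurable lborel" by measurable
  show "(\<integral>\<^sup>+x. ennreal (norm (dilate a \<phi> t x)) \<partial>lborel) < \<infinity>"
    using assms by (simp add: nn_integral_norm_dilate integrable_iff_bounded)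
qed

lemma measurable_conv [measurable (raw)]:
  assumes [measurable]: "F \<in> borel_measurable borel" "G \<in> borel_measurable borel" "x \<in> borel_measurable M"
  shows "(\<lambda>z. (F \<star> G) (x z)) \<in> borel_measurable M"
proof -
  have "F \<star> G \<in> borel_measurable borel"
    unfolding convolve_def by (rule lborel.borel_measurable_lebesgue_integral) measurable
  from measurable_compose[OF assms(3) this] show ?thesis .
qed

lemma measurable_conv_dilate [measurable (raw)]:
  assumes [measurable]: "F \<in> borel_measurable borel" "\<phi> \<in> borel_measurable borel"
    "t \<in> borel_measurable M" "x \<in> borel_measurable M"
  shows "(\<lambda>z. (F \<star> dilate a \<phi> (t z)) (x z)) \<in> borel_measurable M"
  unfolding convolve_def by (rule lborel.borel_measurable_lebesgue_integral) measurable

lemma conv_le_nn_integral: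
  "ennreal (cmod ((F \<star> G) x)) \<le> (\<integral>\<^sup>+y. ennreal (cmod (F (x \<odot> (- y)))) * ennreal (cmod (G y)) \<partial>lborel)"
  unfolding convolve_def
  using norm_integral_le_nn_integral[of lborel "\<lambda>y. F (x \<odot> (- y)) * G y"]
  by (simp add: norm_mult ennreal_mult)

lemma conv_bound:
  assumes F: "\<And>x. cmod (F x) \<le> B" and [measurable]: "G \<in> borel_measurable borel"
  shows "ennreal (cmod ((F \<star> G) x)) \<le> ennreal B * (\<integral>\<^sup>+y. ennreal (cmod (G y)) \<partial>lborel)"
proof -
  have "ennreal (cmod ((F \<star> G) x)) \<le> (\<integral>\<^sup>+y. ennreal B * ennreal (cmod (G y)) \<partial>lborel)"
    by (rule order.trans[OF conv_le_nn_integral]) (intro nn_integral_mono mult_right_mono ennreal_leI F, simp)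
  also have "\<dots> = ennreal B * (\<integral>\<^sup>+y. ennreal (cmod (G y)) \<partial>lborel)"
    by (rule nn_integral_cmult) measurable
  finally show ?thesis .
qed

lemma nn_integral_conv_le:
  assumes [measurable]: "F \<in> borel_measurable borel" "G \<in> borel_measurable borel"
  shows "(\<integral>\<^sup>+x. \<integral>\<^sup>+y. ennreal (cmod (F (x \<odot> (- y)))) * ennreal (cmod (G y)) \<partial>lborel \<partial>lborel)
      = (\<integral>\<^sup>+x. ennreal (cmod (F x)) \<partial>lborel) * (\<integral>\<^sup>+y. ennreal (cmod (G y)) \<partial>lborel)"
proof -
  have "(\<integral>\<^sup>+x. \<integral>\<^sup>+y. ennreal (cmod (F (x \<odot> (- y)))) * ennreal (cmod (G y)) \<partial>lborel \<partial>lborel)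
      = (\<integral>\<^sup>+y. \<integral>\<^sup>+x. ennreal (cmod (F (x \<odot> (- y)))) * ennreal (cmod (G y)) \<partial>lborel \<partial>lborel)"
    by (rule lborel_pair.Fubini') measurable
  also have "\<dots> = (\<integral>\<^sup>+y. (\<integral>\<^sup>+x. ennreal (cmod (F x)) \<partial>lborel) * ennreal (cmod (G y)) \<partial>lborel)"
  proof (intro nn_integral_cong)
    fix y
    have "(\<integral>\<^sup>+x. ennreal (cmod (F (x \<odot> (- y)))) * ennreal (cmod (G y)) \<partial>lborel) = (\<integral>\<^sup>+x. ennreal (cmod (F (x \<odot> (- y)))) \<partial>lborel) * ennreal (cmod (G y))"
      by (rule nn_integral_multc) measurable
    also have "(\<integral>\<^sup>+x. ennreal (cmod (F (x \<odot> (- y)))) \<partial>lborel) = (\<integral>\<^sup>+x. ennreal (cmod (F x)) \<partial>lborel)"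
      by (rule nn_integral_right_translate) measurable
    finally show "(\<integral>\<^sup>+x. ennreal (cmod (F (x \<odot> (- y)))) * ennreal (cmod (G y)) \<partial>lborel) = (\<integral>\<^sup>+x. ennreal (cmod (F x)) \<partial>lborel) * ennreal (cmod (G y))" .
  qed
  also have "\<dots> = (\<integral>\<^sup>+x. ennreal (cmod (F x)) \<partial>lborel) * (\<integral>\<^sup>+y. ennreal (cmod (G y)) \<partial>lborel)"
    by (rule nn_integral_cmult) measurable
  finally show ?thesis .
qed

lemma nn_integral_norm_conv_le:
  assumes [measurable]: "F \<in> borel_measurable borel" "G \<in> borel_measurable borel"
  shows "(\<integral>\<^sup>+x. ennreal (cmod ((F \<star> G) x)) \<partial>lborel)
      \<le> (\<integral>\<^sup>+x. ennreal (cmod (F x)) \<partial>lborel) * (\<integral>\<^sup>+y. ennreal (cmod (G y)) \<partial>lborel)"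
  unfolding nn_integral_conv_le[OF assms, symmetric] by (intro nn_integral_mono conv_le_nn_integral)

lemma conv_assoc:
  assumes F [measurable]: "F \<in> borel_measurable borel" and B: "\<And>x. cmod (F x) \<le> B"
    and G: "integrable lborel G" and H: "integrable lborel H"
  shows "((F \<star> G) \<star> H) x = (F \<star> (G \<star> H)) x"
proof -
  have [measurable]: "G \<in> borel_measurable borel" "H \<in> borel_measurable borel"
    using G H by auto
  have "B \<ge> 0" using order.trans[OF norm_ge_zero B[of 0]] .
  have "((F \<star> G) \<star> H) x = (LINT z|lborel. LINT y|lborel. F (x \<odot> (- y)) * (G (y \<odot> (- z)) * H z))"
    unfolding convolve_def[of _ "convolve (\<odot>) F G"]
  proof (intro Bochner_Integration.integral_cong refl)
    fix z
    have "(F \<star> G) (x \<odot> (- z)) = (LINT y|lborel. (\<lambda>y. F ((x \<odot> (- z)) \<odot> (- y)) * G y) (y \<odot> (- z)))"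
      unfolding convolve_def by (rule integral_right_translate[symmetric]) measurable
    also have "\<dots> = (LINT y|lborel. F (x \<odot> (- y)) * G (y \<odot> (- z)))"
    proof (intro Bochner_Integration.integral_cong refl)
      fix y
      have "(x \<odot> (- z)) \<odot> (- (y \<odot> (- z))) = x \<odot> (- y)"
        unfolding minus_mul by (metis assoc left_inverse left_neutral)
      then show "F ((x \<odot> (- z)) \<odot> (- (y \<odot> (- z)))) * G (y \<odot> (- z)) = F (x \<odot> (- y)) * G (y \<odot> (- z))"
        by simp
    qed
    finally show "(F \<star> G) (x \<odot> (- z)) * H z = (LINT y|lborel. F (x \<odot> (- y)) * (G (y \<odot> (- z)) * H z))"
      by (simp add: mult.assoc flip: integral_mult_left_zero)
  qed
  also have "\<dots> = (LINT y|lborel. LINT z|lborel. F (x \<odot> (- y)) * (G (y \<odot> (- z)) * H z))"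
  proof (rule lborel_pair.Fubini_integral)
    show "integrable (lborel \<Otimes>\<^sub>M lborel) (\<lambda>(y, z). F (x \<odot> (- y)) * (G (y \<odot> (- z)) * H z))"
    proof (rule integrableI_bounded)
      show "(\<lambda>(y, z). F (x \<odot> (- y)) * (G (y \<odot> (- z)) * H z)) \<in> borel_measurable (lborel \<Otimes>\<^sub>M lborel)"
        by measurable
      have "(\<integral>\<^sup>+p. ennreal (norm (case p of (y, z) \<Rightarrow> F (x \<odot> (- y)) * (G (y \<odot> (- z)) * H z))) \<partial>(lborel \<Otimes>\<^sub>M lborel))
        = (\<integral>\<^sup>+y. \<integral>\<^sup>+z. ennreal (norm (F (x \<odot> (- y)) * (G (y \<odot> (- z)) * H z))) \<partial>lborel \<partial>lborel)"
        by (subst lborel.nn_integral_fst[symmetric]) (simp_all add: split_beta')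
      also have "\<dots> \<le> (\<integral>\<^sup>+y. \<integral>\<^sup>+z. ennreal B * (ennreal (cmod (G (y \<odot> (- z)))) * ennreal (cmod (H z))) \<partial>lborel \<partial>lborel)"
      proof (intro nn_integral_mono)
        fix y z
        have "norm (F (x \<odot> (- y)) * (G (y \<odot> (- z)) * H z)) \<le> B * (cmod (G (y \<odot> (- z))) * cmod (H z))"
          unfolding norm_mult by (intro mult_right_mono B) auto
        then show "ennreal (norm (F (x \<odot> (- y)) * (G (y \<odot> (- z)) * H z))) \<le> ennreal B * (ennreal (cmod (G (y \<odot> (- z)))) * ennreal (cmod (H z)))"
          using \<open>B \<ge> 0\<close> by (simp add: ennreal_leI flip: ennreal_mult)
      qed
      also have "\<dots> = ennreal B * (\<integral>\<^sup>+y. \<integral>\<^sup>+z. ennreal (cmod (G (y \<odot> (- z)))) * ennreal (cmod (H z)) \<partial>lborel \<partial>lborel)"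
        by (subst nn_integral_cmult[symmetric], measurable, subst nn_integral_cmult, measurable)
      also have "\<dots> < \<infinity>"
        using G H by (simp add: nn_integral_conv_le integrable_iff_bounded ennreal_mult_less_top)
      finally show "(\<integral>\<^sup>+p. ennreal (norm (case p of (y, z) \<Rightarrow> F (x \<odot> (- y)) * (G (y \<odot> (- z)) * H z))) \<partial>(lborel \<Otimes>\<^sub>M lborel)) < \<infinity>" .
    qed
  qed
  also have "\<dots> = (F \<star> (G \<star> H)) x"
    unfolding convolve_def by simp
  finally show ?thesis .
qed

text \<open>Only the ratio of the scales matters, up to a common dilation.\<close>

lemma conv_dilate_dilate:
  assumes [measurable]: "\<eta> \<in> borel_measurable borel" "\<psi> \<in> borel_measurable borel" and t: "t > 0" "s > 0"
  shows "(dilate a \<eta> t \<star> dilate a \<psi> s) v = dilate a (\<eta> \<star> dilate a \<psi> (s / t)) t v"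
proof -
  have "(dilate a \<eta> t \<star> dilate a \<psi> s) v
      = of_real (t powr hom_dim a) * (LINT y|lborel. dilate a \<eta> t (v \<odot> (- dilation a t y)) * dilate a \<psi> s (dilation a t y))"
    unfolding convolve_def by (rule integral_dilation[OF t(1)]) measurable
  also have "\<dots> = (LINT y|lborel. of_real (t powr hom_dim a) * (dilate a \<eta> t (v \<odot> (- dilation a t y)) * dilate a \<psi> s (dilation a t y)))"
    by simp
  also have "\<dots> = (LINT y|lborel. of_real (t powr (- hom_dim a)) * (\<eta> (dilation a (inverse t) v \<odot> (- y)) * dilate a \<psi> (s / t) y))"
  proof (intro Bochner_Integration.integral_cong refl)
    fix y
    have 1: "dilation a (inverse t) (v \<odot> (- dilation a t y)) = dilation a (inverse t) v \<odot> (- y)"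
      using t by (simp add: dilation_mult dilation_minus dilation_inverse)
    have 2: "dilation a (inverse s) (dilation a t y) = dilation a (inverse (s / t)) y"
      using t by (simp add: dilation_mult_params field_simps)
    have 3: "s powr (- hom_dim a) = t powr (- hom_dim a) * (s / t) powr (- hom_dim a)"
      using t by (simp flip: powr_mult)
    have 4: "t powr hom_dim a * t powr (- hom_dim a) = 1" using t by (simp flip: powr_add)
    have "of_real (t powr hom_dim a) * (dilate a \<eta> t (v \<odot> (- dilation a t y)) * dilate a \<psi> s (dilation a t y))
       = of_real (t powr hom_dim a * t powr (- hom_dim a)) * of_real (t powr (- hom_dim a)) * (\<eta> (dilation a (inverse t) v \<odot> (- y)) * dilate a \<psi> (s / t) y)"
      unfolding dilate_def 1 2 3 by (simp add: mult_ac)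
    then show "of_real (t powr hom_dim a) * (dilate a \<eta> t (v \<odot> (- dilation a t y)) * dilate a \<psi> s (dilation a t y))
       = of_real (t powr (- hom_dim a)) * (\<eta> (dilation a (inverse t) v \<odot> (- y)) * dilate a \<psi> (s / t) y)"
      unfolding 4 by simp
  qed
  also have "\<dots> = dilate a (\<eta> \<star> dilate a \<psi> (s / t)) t v"
    unfolding dilate_def[of _ "\<eta> \<star> dilate a \<psi> (s / t)"] convolve_def by simp
  finally show ?thesis .
qed

lemma nn_integral_conv_dilate_moment:
  assumes [measurable]: "\<eta> \<in> borel_measurable borel" "\<psi> \<in> borel_measurable borel" and t: "t > 0" "s > 0"
  shows "(\<integral>\<^sup>+v. ennreal ((1 + \<rho> v / t) powr L) * ennreal (cmod ((dilate a \<eta> t \<star> dilate a \<psi> s) v)) \<partial>lborel)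
      = conv_moment (\<odot>) a \<rho> \<eta> \<psi> (s / t) L"
proof -
  have "(\<integral>\<^sup>+v. ennreal ((1 + \<rho> v / t) powr L) * ennreal (cmod ((dilate a \<eta> t \<star> dilate a \<psi> s) v)) \<partial>lborel)
      = (\<integral>\<^sup>+v. ennreal ((1 + \<rho> (dilation a t v) / t) powr L) * ennreal (cmod ((\<eta> \<star> dilate a \<psi> (s / t)) v)) \<partial>lborel)"
    unfolding conv_dilate_dilate[OF assms] by (rule nn_integral_dilate[OF _ _ t(1)]) measurable
  then show ?thesis
    using t by (simp add: conv_moment_def rho_dilation ennreal_mult)
qed

lemma schwartz_measurable: "f \<in> schwartz \<Longrightarrow> f \<in> borel_measurable borel"
  by (rule rapid_measurable[OF schwartz_rapid])

lemma schwartz_integrable: "(f :: real^'n::{finite,linorder} \<Rightarrow> complex) \<in> schwartz \<Longrightarrow> integrable lborel f"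
  by (rule rapid_integrable[OF schwartz_rapid])

lemma schwartz_bounded:
  assumes "(f :: real^'n::{finite,linorder} \<Rightarrow> complex) \<in> schwartz"
  shows "\<exists>B>0. \<forall>x. cmod (f x) \<le> B"
proof -
  obtain B where "B \<ge> 0" "\<And>x. cmod (f x) \<le> B"
    using rapid_bounded[OF schwartz_rapid[OF assms]] by blast
  then have "B + 1 > 0" "\<And>x. cmod (f x) \<le> B + 1" by (auto intro: add_increasing2)
  then show ?thesis by blast
qed

lemma nn_integral_translate_reflect:
  assumes [measurable]: "f \<in> borel_measurable borel"
  shows "(\<integral>\<^sup>+y. ennreal (cmod (f (x \<odot> (- y)))) \<partial>lborel) = (\<integral>\<^sup>+y. ennreal (cmod (f y)) \<partial>lborel)"
proof -
  have "(\<integral>\<^sup>+y. ennreal (cmod (f (x \<odot> (- y)))) \<partial>lborel) = (\<integral>\<^sup>+y. ennreal (cmod (f (x \<odot> y))) \<partial>lborel)"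
    by (rule nn_integral_uminus[of "\<lambda>y. ennreal (cmod (f (x \<odot> y)))"]) measurable
  also have "\<dots> = (\<integral>\<^sup>+y. ennreal (cmod (f y)) \<partial>lborel)"
    by (rule nn_integral_left_translate) measurable
  finally show ?thesis .
qed

text \<open>Since \<open>\<psi>\<close> has mean zero, only differences of \<open>\<eta>\<close> enter.\<close>

lemma conv_dilate_mean_zero:
  assumes \<eta>: "\<eta> \<in> schwartz" and \<psi>: "\<psi> \<in> schwartz" "(LINT x|lborel. \<psi> x) = 0" and u: "u > 0"
  shows "ennreal (cmod ((\<eta> \<star> dilate a \<psi> u) x)) \<le>
    (\<integral>\<^sup>+y. ennreal (cmod (\<eta> (x \<odot> (- y)) - \<eta> x)) * ennreal (cmod (dilate a \<psi> u y)) \<partial>lborel)"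
proof -
  note [measurable] = schwartz_measurable[OF \<eta>] schwartz_measurable[OF \<psi>(1)]
  obtain B where B: "B > 0" "\<And>x. cmod (\<eta> x) \<le> B" using schwartz_bounded[OF \<eta>] by blast
  have int: "integrable lborel (dilate a \<psi> u)"
    by (rule integrable_dilate[OF schwartz_integrable[OF \<psi>(1)] u])
  have "integrable lborel (\<lambda>y. \<eta> (x \<odot> (- y)) * dilate a \<psi> u y)"
  proof (rule Bochner_Integration.integrable_bound)
    show "integrable lborel (\<lambda>y. of_real B * dilate a \<psi> u y)" using int by simp
    show "AE y in lborel. norm (\<eta> (x \<odot> (- y)) * dilate a \<psi> u y) \<le> norm (of_real B * dilate a \<psi> u y)"
      using B by (auto simp: norm_mult intro!: mult_right_mono)
  qed measurable
  moreover have "(LINT y|lborel. \<eta> x * dilate a \<psi> u y) = 0"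
    using integral_dilate[of \<psi> u] u \<psi> by simp
  ultimately have "(\<eta> \<star> dilate a \<psi> u) x = (LINT y|lborel. (\<eta> (x \<odot> (- y)) - \<eta> x) * dilate a \<psi> u y)"
    using int by (simp add: convolve_def left_diff_distrib)
  then show ?thesis
    using norm_integral_le_nn_integral[of lborel "\<lambda>y. (\<eta> (x \<odot> (- y)) - \<eta> x) * dilate a \<psi> u y"]
    by (simp add: norm_mult ennreal_mult)
qed

lemma one_plus_rho_mul_le: "1 + \<rho> (x \<odot> y) / t \<le> c0 * ((1 + \<rho> x / t) * (1 + \<rho> y / t))" if "t > 0"
proof -
  have "\<rho> (x \<odot> y) / t \<le> c0 * (\<rho> x + \<rho> y) / t"
    using c0(2)[of x y] that by (intro divide_right_mono) auto
  then have "1 + \<rho> (x \<odot> y) / t \<le> c0 * 1 + c0 * (\<rho> x / t + \<rho> y / t) + c0 * (\<rho> x / t * (\<rho> y / t))"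
    using c0(1) that by (simp add: add_divide_distrib[symmetric] add_increasing2)
  then show ?thesis by (simp add: algebra_simps)
qed

lemma left_gradient_size_rapid:
  assumes "f \<in> schwartz"
  shows "rapid (\<lambda>z. of_real (left_gradient_size f z))"
  unfolding rapid_def
proof (intro conjI allI)
  have r: "rapid (left_deriv (\<odot>) j f)" for j by (rule left_deriv_path(1)[OF assms])
  then have "continuous_on UNIV (left_deriv (\<odot>) j f)" for j by (simp add: rapid_def)
  then show "continuous_on UNIV (\<lambda>z. complex_of_real (left_gradient_size f z))"
    unfolding left_gradient_size_def by (intro continuous_intros)
  fix k :: nat
  have "\<forall>j. \<exists>C. \<forall>x. (1 + norm x) ^ k * cmod (left_deriv (\<odot>) j f x) \<le> C"
    using r unfolding rapid_def by blast
  from choice[OF this] obtain C where C: "\<And>j x. (1 + norm x) ^ k * cmod (left_deriv (\<odot>) j f x) \<le> C j" by blast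
  have "(1 + norm x) ^ k * cmod (of_real (left_gradient_size f x)) \<le> (\<Sum>j\<in>UNIV. C j)" for x
  proof -
    have "left_gradient_size f x \<ge> 0" by (simp add: left_gradient_size_def sum_nonneg)
    then have "cmod (of_real (left_gradient_size f x)) = left_gradient_size f x" by simp
    then have "(1 + norm x) ^ k * cmod (of_real (left_gradient_size f x)) = (\<Sum>j\<in>UNIV. (1 + norm x) ^ k * cmod (left_deriv (\<odot>) j f x))"
      by (simp only: left_gradient_size_def sum_distrib_left)
    also have "\<dots> \<le> (\<Sum>j\<in>UNIV. C j)" by (intro sum_mono C)
    finally show ?thesis .
  qed
  then show "\<exists>C. \<forall>x. (1 + norm x) ^ k * cmod (complex_of_real (left_gradient_size f x)) \<le> C" by blast
qed

lemma left_gradient_size_nonneg [simp]: "left_gradient_size f z \<ge> 0"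
  by (simp add: left_gradient_size_def sum_nonneg)

lemma left_gradient_size_measurable:
  assumes "f \<in> schwartz"
  shows "left_gradient_size f \<in> borel_measurable borel"
  using measurable_compose[OF rapid_measurable[OF left_gradient_size_rapid[OF assms]] borel_measurable_Re] by simp

text \<open>Mean zero of \<open>\<psi>\<close> gives first order decay of the moments as the scale \<open>u\<close> tends to \<open>0\<close>: only
  differences of \<open>\<eta>\<close> along dilated points \<open>A\<^sub>u y\<close> enter, and \<open>|A\<^sub>u y| \<le> u |y|\<close> for \<open>u \<le> 1\<close>.\<close>

lemma conv_moment_small:
  assumes \<eta>: "\<eta> \<in> schwartz" and \<psi>: "\<psi> \<in> schwartz" "(LINT x|lborel. \<psi> x) = 0" and L: "L \<ge> 0"
  shows "\<exists>C\<ge>0. \<forall>u. 0 < u \<longrightarrow> u \<le> 1 \<longrightarrow> conv_moment (\<odot>) a \<rho> \<eta> \<psi> u L \<le> ennreal (C * u)"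
proof -
  note [measurable] = schwartz_measurable[OF \<eta>] schwartz_measurable[OF \<psi>(1)] left_gradient_size_measurable[OF \<eta>]
  let ?G = "left_gradient_size \<eta>"
  obtain C1 m where C1: "C1 \<ge> 1" "\<And>x. 1 + \<rho> x \<le> C1 * (1 + norm x) ^ m" using rho_growth by blast
  define k where "k = nat \<lceil>real m * L\<rceil>"
  define C2 where "C2 = (c0 * C1) powr L"
  have C2: "C2 \<ge> 0" by (simp add: C2_def)
  \<comment> \<open>Translation by \<open>s y\<close> changes the weight by at most a power of \<open>1 + |y|\<close>, which the decay of \<open>\<psi>\<close>
    absorbs.\<close>
  have weight: "(1 + \<rho> (x \<odot> (s *\<^sub>R y))) powr L \<le> C2 * (1 + norm y) ^ k * (1 + \<rho> x) powr L" if "0 \<le> s" "s \<le> 1" for x y s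
  proof -
    have pos: "1 + norm y > 0" by (simp add: add_pos_nonneg)
    have "1 + \<rho> (s *\<^sub>R y) \<le> C1 * (1 + norm (s *\<^sub>R y)) ^ m" by (rule C1)
    also have "\<dots> \<le> C1 * (1 + norm y) ^ m"
      using that C1 by (intro mult_left_mono power_mono) (auto simp: mult_left_le_one_le)
    finally have s: "1 + \<rho> (s *\<^sub>R y) \<le> C1 * (1 + norm y) ^ m" .
    have "1 + \<rho> (x \<odot> (s *\<^sub>R y)) \<le> c0 * ((1 + \<rho> x) * (1 + \<rho> (s *\<^sub>R y)))"
      using one_plus_rho_mul_le[of 1 x "s *\<^sub>R y"] by simp
    also have "\<dots> \<le> c0 * ((1 + \<rho> x) * (C1 * (1 + norm y) ^ m))"
      using c0(1) s by (intro mult_left_mono) auto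
    also have "\<dots> = (c0 * C1) * (1 + norm y) ^ m * (1 + \<rho> x)" by simp
    finally have "(1 + \<rho> (x \<odot> (s *\<^sub>R y))) powr L \<le> ((c0 * C1) * (1 + norm y) ^ m * (1 + \<rho> x)) powr L"
      using L by (intro powr_mono2) auto
    also have "\<dots> = C2 * (1 + norm y) powr (real m * L) * (1 + \<rho> x) powr L"
      using pos by (simp add: C2_def powr_mult powr_powr flip: powr_realpow)
    also have "\<dots> \<le> C2 * (1 + norm y) powr (real k) * (1 + \<rho> x) powr L"
      using C2 by (intro mult_right_mono mult_left_mono powr_mono) (auto simp: k_def real_nat_ceiling_ge)
    finally show ?thesis using pos by (simp add: powr_realpow)
  qed
  have "(\<integral>\<^sup>+x. ennreal ((1 + norm x) ^ 0 * (1 + \<rho> x) powr L * cmod (of_real (?G x))) \<partial>lborel) < top"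
    by (rule rapid_nn_integral[OF left_gradient_size_rapid[OF \<eta>] L])
  then obtain \<Gamma> where \<Gamma>: "(\<integral>\<^sup>+x. ennreal ((1 + \<rho> x) powr L * ?G x) \<partial>lborel) = ennreal \<Gamma>" "\<Gamma> \<ge> 0"
    by (cases "\<integral>\<^sup>+x. ennreal ((1 + \<rho> x) powr L * ?G x) \<partial>lborel") auto
  have "(\<integral>\<^sup>+x. ennreal ((1 + norm x) ^ (k + 1) * (1 + \<rho> x) powr 0 * cmod (\<psi> x)) \<partial>lborel) < top"
    by (rule rapid_nn_integral[OF schwartz_rapid[OF \<psi>(1)]]) simp
  moreover have "1 + \<rho> x \<noteq> 0" for x using rho_nonneg[of x] by linarith
  ultimately obtain \<Delta> where \<Delta>: "(\<integral>\<^sup>+x. ennreal ((1 + norm x) ^ (k + 1) * cmod (\<psi> x)) \<partial>lborel) = ennreal \<Delta>" "\<Delta> \<ge> 0"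
    by (cases "\<integral>\<^sup>+x. ennreal ((1 + norm x) ^ (k + 1) * cmod (\<psi> x)) \<partial>lborel") auto
  show ?thesis
  proof (intro exI[of _ "C2 * \<Gamma> * \<Delta>"] conjI allI impI)
    show "C2 * \<Gamma> * \<Delta> \<ge> 0" using C2 \<Gamma> \<Delta> by simp
    fix u :: real assume u: "0 < u" "u \<le> 1"
    let ?\<psi> = "dilate a \<psi> u"
    let ?W = "\<lambda>x. ennreal ((1 + \<rho> x) powr L)"
    have inner: "(\<integral>\<^sup>+x. ?W x * (\<integral>\<^sup>+s\<in>{0..1}. ennreal (?G (x \<odot> (s *\<^sub>R (- y)))) \<partial>lborel) \<partial>lborel)
        \<le> ennreal (C2 * (1 + norm y) ^ k * \<Gamma>)" for y
    proof -
      have "(\<integral>\<^sup>+x. ?W x * (\<integral>\<^sup>+s\<in>{0..1}. ennreal (?G (x \<odot> (s *\<^sub>R (- y)))) \<partial>lborel) \<partial>lborel)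
         = (\<integral>\<^sup>+x. (\<integral>\<^sup>+s. ?W x * (ennreal (?G (x \<odot> (s *\<^sub>R (- y)))) * indicator {0..1} s) \<partial>lborel) \<partial>lborel)"
        by (intro nn_integral_cong nn_integral_cmult[symmetric]) measurable
      also have "\<dots> = (\<integral>\<^sup>+s. (\<integral>\<^sup>+x. ?W x * (ennreal (?G (x \<odot> (s *\<^sub>R (- y)))) * indicator {0..1} s) \<partial>lborel) \<partial>lborel)"
        by (rule lborel_pair.Fubini') measurable
      also have "\<dots> \<le> (\<integral>\<^sup>+s. ennreal (C2 * (1 + norm y) ^ k * \<Gamma>) * indicator {0..1} s \<partial>(lborel :: real measure))"
      proof (rule nn_integral_mono)
        fix s :: real
        show "(\<integral>\<^sup>+x. ?W x * (ennreal (?G (x \<odot> (s *\<^sub>R (- y)))) * indicator {0..1} s) \<partial>lborel)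
            \<le> ennreal (C2 * (1 + norm y) ^ k * \<Gamma>) * indicator {0..1} s"
        proof (cases "s \<in> {0..1}")
          case True
          have "(\<integral>\<^sup>+x. ?W x * (ennreal (?G (x \<odot> (s *\<^sub>R (- y)))) * indicator {0..1} s) \<partial>lborel)
            = (\<integral>\<^sup>+x. ?W x * ennreal (?G (x \<odot> (s *\<^sub>R (- y)))) \<partial>lborel)" using True by simp
          also have "\<dots> = (\<integral>\<^sup>+x. ?W (x \<odot> (s *\<^sub>R y)) * ennreal (?G ((x \<odot> (s *\<^sub>R y)) \<odot> (s *\<^sub>R (- y)))) \<partial>lborel)"
            by (rule nn_integral_right_translate[symmetric]) measurable
          also have "\<dots> = (\<integral>\<^sup>+x. ?W (x \<odot> (s *\<^sub>R y)) * ennreal (?G x) \<partial>lborel)"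
            by (simp add: assoc)
          also have "\<dots> \<le> (\<integral>\<^sup>+x. ennreal (C2 * (1 + norm y) ^ k) * ennreal ((1 + \<rho> x) powr L * ?G x) \<partial>lborel)"
          proof (rule nn_integral_mono)
            fix x
            have "(1 + \<rho> (x \<odot> (s *\<^sub>R y))) powr L * ?G x \<le> (C2 * (1 + norm y) ^ k * (1 + \<rho> x) powr L) * ?G x"
              using weight[of s x y] True by (intro mult_right_mono) auto
            then show "?W (x \<odot> (s *\<^sub>R y)) * ennreal (?G x) \<le> ennreal (C2 * (1 + norm y) ^ k) * ennreal ((1 + \<rho> x) powr L * ?G x)"
              using C2 by (simp add: ennreal_leI mult.assoc flip: ennreal_mult)
          qed
          also have "\<dots> = ennreal (C2 * (1 + norm y) ^ k) * ennreal \<Gamma>"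
            unfolding \<Gamma>(1)[symmetric] by (rule nn_integral_cmult) measurable
          finally show ?thesis using True C2 \<Gamma> by (simp add: ennreal_mult)
        qed simp
      qed
      also have "\<dots> = ennreal (C2 * (1 + norm y) ^ k * \<Gamma>)" by (simp add: nn_integral_cmult_indicator)
      finally show ?thesis .
    qed
    have "conv_moment (\<odot>) a \<rho> \<eta> \<psi> u L \<le> (\<integral>\<^sup>+x. (\<integral>\<^sup>+y. ?W x * (ennreal (norm y) *
        (\<integral>\<^sup>+s\<in>{0..1}. ennreal (?G (x \<odot> (s *\<^sub>R (- y)))) \<partial>lborel) * ennreal (cmod (?\<psi> y))) \<partial>lborel) \<partial>lborel)"
      unfolding conv_moment_def
    proof (rule nn_integral_mono)
      fix x
      have "ennreal (cmod ((\<eta> \<star> ?\<psi>) x)) \<le> (\<integral>\<^sup>+y. ennreal (cmod (\<eta> (x \<odot> (- y)) - \<eta> x)) * ennreal (cmod (?\<psi> y)) \<partial>lborel)"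
        by (rule conv_dilate_mean_zero[OF \<eta> \<psi> u(1)])
      also have "\<dots> \<le> (\<integral>\<^sup>+y. ennreal (norm y) * (\<integral>\<^sup>+s\<in>{0..1}. ennreal (?G (x \<odot> (s *\<^sub>R (- y)))) \<partial>lborel) * ennreal (cmod (?\<psi> y)) \<partial>lborel)"
        using left_difference_le[OF \<eta>, of x "- _"] by (intro nn_integral_mono mult_right_mono) auto
      finally have "?W x * ennreal (cmod ((\<eta> \<star> ?\<psi>) x)) \<le> ?W x * \<dots>"
        by (rule mult_left_mono) simp
      also have "\<dots> = (\<integral>\<^sup>+y. ?W x * (ennreal (norm y) *
          (\<integral>\<^sup>+s\<in>{0..1}. ennreal (?G (x \<odot> (s *\<^sub>R (- y)))) \<partial>lborel) * ennreal (cmod (?\<psi> y))) \<partial>lborel)"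
        by (rule nn_integral_cmult[symmetric]) measurable
      finally show "ennreal ((1 + \<rho> x) powr L * cmod ((\<eta> \<star> ?\<psi>) x)) \<le> \<dots>"
        by (simp add: ennreal_mult)
    qed
    also have "\<dots> = (\<integral>\<^sup>+y. (\<integral>\<^sup>+x. ?W x * (ennreal (norm y) *
        (\<integral>\<^sup>+s\<in>{0..1}. ennreal (?G (x \<odot> (s *\<^sub>R (- y)))) \<partial>lborel) * ennreal (cmod (?\<psi> y))) \<partial>lborel) \<partial>lborel)"
      by (rule lborel_pair.Fubini'[symmetric]) measurable
    also have "\<dots> = (\<integral>\<^sup>+y. ennreal (norm y) * (\<integral>\<^sup>+x. ?W x *
        (\<integral>\<^sup>+s\<in>{0..1}. ennreal (?G (x \<odot> (s *\<^sub>R (- y)))) \<partial>lborel) \<partial>lborel) * ennreal (cmod (?\<psi> y)) \<partial>lborel)"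
    proof (intro nn_integral_cong)
      fix y
      have "(\<integral>\<^sup>+x. ?W x * (ennreal (norm y) * (\<integral>\<^sup>+s\<in>{0..1}. ennreal (?G (x \<odot> (s *\<^sub>R (- y)))) \<partial>lborel) * ennreal (cmod (?\<psi> y))) \<partial>lborel)
        = (\<integral>\<^sup>+x. (ennreal (norm y) * ennreal (cmod (?\<psi> y))) * (?W x * (\<integral>\<^sup>+s\<in>{0..1}. ennreal (?G (x \<odot> (s *\<^sub>R (- y)))) \<partial>lborel)) \<partial>lborel)"
        by (simp add: mult_ac)
      also have "\<dots> = (ennreal (norm y) * ennreal (cmod (?\<psi> y))) * (\<integral>\<^sup>+x. ?W x * (\<integral>\<^sup>+s\<in>{0..1}. ennreal (?G (x \<odot> (s *\<^sub>R (- y)))) \<partial>lborel) \<partial>lborel)"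
        by (rule nn_integral_cmult) measurable
      finally show "(\<integral>\<^sup>+x. ?W x * (ennreal (norm y) * (\<integral>\<^sup>+s\<in>{0..1}. ennreal (?G (x \<odot> (s *\<^sub>R (- y)))) \<partial>lborel) * ennreal (cmod (?\<psi> y))) \<partial>lborel)
        = ennreal (norm y) * (\<integral>\<^sup>+x. ?W x * (\<integral>\<^sup>+s\<in>{0..1}. ennreal (?G (x \<odot> (s *\<^sub>R (- y)))) \<partial>lborel) \<partial>lborel) * ennreal (cmod (?\<psi> y))"
        by (simp add: mult_ac)
    qed
    also have "\<dots> \<le> (\<integral>\<^sup>+y. (ennreal (norm y) * ennreal (C2 * (1 + norm y) ^ k * \<Gamma>)) * ennreal (cmod (?\<psi> y)) \<partial>lborel)"
      by (intro nn_integral_mono mult_right_mono mult_left_mono inner) auto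
    also have "\<dots> = (\<integral>\<^sup>+y. (ennreal (norm (dilation a u y)) * ennreal (C2 * (1 + norm (dilation a u y)) ^ k * \<Gamma>)) * ennreal (cmod (\<psi> y)) \<partial>lborel)"
      by (rule nn_integral_dilate[OF _ _ u(1)]) measurable
    also have "\<dots> \<le> (\<integral>\<^sup>+y. ennreal (C2 * \<Gamma> * u) * ennreal ((1 + norm y) ^ (k + 1) * cmod (\<psi> y)) \<partial>lborel)"
    proof (rule nn_integral_mono)
      fix y
      have le: "norm (dilation a u y) \<le> u * norm y" by (rule norm_dilation_le[OF u])
      also have "u * norm y \<le> norm y" using u by (simp add: mult_left_le_one_le)
      finally have le': "norm (dilation a u y) \<le> norm y" .
      have "norm (dilation a u y) * (C2 * (1 + norm (dilation a u y)) ^ k * \<Gamma>) \<le> (u * (1 + norm y)) * (C2 * (1 + norm y) ^ k * \<Gamma>)"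
        using u C2 \<Gamma> order.trans[OF le, of "u * (1 + norm y)"]
        by (intro mult_mono mult_right_mono mult_left_mono power_mono) (auto intro!: le' add_left_mono)
      also have "\<dots> = C2 * \<Gamma> * u * (1 + norm y) ^ (k + 1)" by simp
      finally have "norm (dilation a u y) * (C2 * (1 + norm (dilation a u y)) ^ k * \<Gamma>) * cmod (\<psi> y) \<le> C2 * \<Gamma> * u * (1 + norm y) ^ (k + 1) * cmod (\<psi> y)"
        by (rule mult_right_mono) simp
      then show "(ennreal (norm (dilation a u y)) * ennreal (C2 * (1 + norm (dilation a u y)) ^ k * \<Gamma>)) * ennreal (cmod (\<psi> y))
          \<le> ennreal (C2 * \<Gamma> * u) * ennreal ((1 + norm y) ^ (k + 1) * cmod (\<psi> y))"
        using C2 \<Gamma> u by (simp add: ennreal_leI mult.assoc flip: ennreal_mult)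
    qed
    also have "\<dots> = ennreal (C2 * \<Gamma> * u) * ennreal \<Delta>"
      unfolding \<Delta>(1)[symmetric] by (rule nn_integral_cmult) measurable
    also have "\<dots> = ennreal (C2 * \<Gamma> * \<Delta> * u)"
      using C2 \<Gamma> \<Delta> u by (simp add: mult_ac flip: ennreal_mult)
    finally show "conv_moment (\<odot>) a \<rho> \<eta> \<psi> u L \<le> ennreal (C2 * \<Gamma> * \<Delta> * u)" .
  qed
qed

end

lemma log_decay_le_1: "0 < u \<Longrightarrow> u \<le> 1 \<Longrightarrow> log_decay \<epsilon> u = u powr \<epsilon>"
proof -
  assume u: "0 < u" "u \<le> 1"
  then have "1 \<le> 1 / u" by simp
  then have "u \<le> 1 / u" using u by linarith
  then show "log_decay \<epsilon> u = u powr \<epsilon>" using u unfolding log_decay_def by (subst min_absorb1) auto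
qed

lemma log_decay_ge_1: "1 \<le> u \<Longrightarrow> log_decay \<epsilon> u = u powr (- \<epsilon>)"
proof -
  assume u: "1 \<le> u"
  then have "1 / u \<le> 1" by simp
  then have "1 / u \<le> u" using u by linarith
  then show "log_decay \<epsilon> u = u powr (- \<epsilon>)"
    using u unfolding log_decay_def by (subst min_absorb2) (auto simp: powr_minus inverse_powr divide_inverse)
qed

context homogeneous_group_norm
begin

text \<open>The two ranges of \<open>u\<close> rest on different facts: for \<open>u \<ge> 1\<close> the factor \<open>u\<^sup>N\<close> is covered by the
  exponent \<open>N + \<epsilon>\<close> of the class, for \<open>u \<le> 1\<close> the mean zero of \<open>\<psi>\<close> gives a first power of \<open>u\<close>.\<close>

lemma conv_moment_decay:
  assumes C1: "(\<eta>, \<psi>) \<in> class_C1 (\<odot>) a \<rho> (N + \<epsilon>) N" and "\<epsilon> > 0" "N \<ge> 0"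
    and mean: "(LINT x|lborel. \<psi> x) = 0"
  shows "\<exists>C\<ge>0. \<forall>u>0. ennreal (max 1 u powr N) * conv_moment (\<odot>) a \<rho> \<eta> \<psi> u N \<le> ennreal (C * log_decay (min \<epsilon> 1) u)"
proof -
  have S: "\<eta> \<in> schwartz" "\<psi> \<in> schwartz"
    and fin: "(SUP t\<in>{1..}. ennreal (t powr (N + \<epsilon>)) * conv_moment (\<odot>) a \<rho> \<eta> \<psi> t N) < \<infinity>"
    using C1 by (auto simp: class_C1_def)
  obtain c where c: "c \<ge> 0" "\<And>u. 0 < u \<Longrightarrow> u \<le> 1 \<Longrightarrow> conv_moment (\<odot>) a \<rho> \<eta> \<psi> u N \<le> ennreal (c * u)"
    using conv_moment_small[OF S mean assms(3)] by blast
  obtain b where b: "(SUP t\<in>{1..}. ennreal (t powr (N + \<epsilon>)) * conv_moment (\<odot>) a \<rho> \<eta> \<psi> t N) = ennreal b" "b \<ge> 0"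
    using fin by (cases "SUP t\<in>{1..}. ennreal (t powr (N + \<epsilon>)) * conv_moment (\<odot>) a \<rho> \<eta> \<psi> t N") auto
  show ?thesis
  proof (intro exI[of _ "max b c"] conjI allI impI)
    show "max b c \<ge> 0" using b by simp
    fix u :: real assume u: "u > 0"
    show "ennreal (max 1 u powr N) * conv_moment (\<odot>) a \<rho> \<eta> \<psi> u N \<le> ennreal (max b c * log_decay (min \<epsilon> 1) u)"
    proof (cases "u \<le> 1")
      case True
      have ld: "log_decay (min \<epsilon> 1) u = u powr (min \<epsilon> 1)" using True u by (rule log_decay_le_1[rotated])
      have "u powr 1 \<le> u powr (min \<epsilon> 1)" using True u assms by (intro powr_mono') auto
      then have "c * u \<le> max b c * log_decay (min \<epsilon> 1) u"
        unfolding ld using c(1) u by (intro mult_mono) auto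
      then show ?thesis using c(2)[OF u True] True by (auto intro: order.trans ennreal_leI)
    next
      case False
      then have ld: "log_decay (min \<epsilon> 1) u = u powr (- min \<epsilon> 1)"
        by (intro log_decay_ge_1) simp
      have le: "ennreal (u powr (N + \<epsilon>)) * conv_moment (\<odot>) a \<rho> \<eta> \<psi> u N \<le> ennreal b"
        unfolding b(1)[symmetric] using False by (intro SUP_upper) auto
      have "ennreal (u powr N) * conv_moment (\<odot>) a \<rho> \<eta> \<psi> u N
          = ennreal (u powr (- \<epsilon>)) * (ennreal (u powr (N + \<epsilon>)) * conv_moment (\<odot>) a \<rho> \<eta> \<psi> u N)"
        using u by (simp flip: mult.assoc ennreal_mult powr_add)
      also have "\<dots> \<le> ennreal (u powr (- \<epsilon>)) * ennreal b"
        by (intro mult_left_mono le) auto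
      also have "\<dots> = ennreal (b * u powr (- \<epsilon>))"
        using b by (simp add: mult.commute flip: ennreal_mult)
      also have "\<dots> \<le> ennreal (max b c * log_decay (min \<epsilon> 1) u)"
      proof (intro ennreal_leI)
        have "u powr (- \<epsilon>) \<le> u powr (- min \<epsilon> 1)" using False by (intro powr_mono) auto
        then show "b * u powr (- \<epsilon>) \<le> max b c * log_decay (min \<epsilon> 1) u"
          unfolding ld using b by (intro mult_mono) auto
      qed
      finally show ?thesis using False by simp
    qed
  qed
qed

text \<open>For small \<open>t\<close> the mean zero of \<open>\<phi>\<close> brings in differences of \<open>f\<close>. For large \<open>t\<close> the crude bound
  by the integral of \<open>|f|\<close> times the supremum of \<open>\<phi>\<^sub>t\<close> decays like \<open>t\<close> to the power \<open>-\<gamma>\<close>, and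
  \<open>\<gamma> \<ge> 1\<close>.\<close>

lemma conv_dilate_uniform_bound:
  assumes f: "f \<in> schwartz" and \<phi>: "\<phi> \<in> schwartz" "(LINT x|lborel. \<phi> x) = 0"
  shows "\<exists>C\<ge>0. \<forall>t>0. \<forall>x. cmod ((f \<star> dilate a \<phi> t) x) \<le> C * log_decay 1 t"
proof -
  note [measurable] = schwartz_measurable[OF f] schwartz_measurable[OF \<phi>(1)]
  obtain B where B: "B \<ge> 0" "\<And>z. left_gradient_size f z \<le> B"
    using rapid_bounded[OF left_gradient_size_rapid[OF f]] by auto
  obtain B' where B': "B' > 0" "\<And>z. cmod (\<phi> z) \<le> B'"
    using schwartz_bounded[OF \<phi>(1)] by blast
  have "(\<integral>\<^sup>+x. ennreal ((1 + norm x) ^ 1 * (1 + \<rho> x) powr 0 * cmod (\<phi> x)) \<partial>lborel) < top"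
    by (rule rapid_nn_integral[OF schwartz_rapid[OF \<phi>(1)]]) simp
  moreover have "1 + \<rho> x \<noteq> 0" for x using rho_nonneg[of x] by linarith
  ultimately obtain \<Delta> where \<Delta>: "(\<integral>\<^sup>+x. ennreal ((1 + norm x) * cmod (\<phi> x)) \<partial>lborel) = ennreal \<Delta>" "\<Delta> \<ge> 0"
    by (cases "\<integral>\<^sup>+x. ennreal ((1 + norm x) * cmod (\<phi> x)) \<partial>lborel") auto
  have "(\<integral>\<^sup>+x. ennreal (cmod (f x)) \<partial>lborel) < top"
    using schwartz_integrable[OF f] by (simp add: integrable_iff_bounded)
  then obtain I where I: "(\<integral>\<^sup>+x. ennreal (cmod (f x)) \<partial>lborel) = ennreal I" "I \<ge> 0"
    by (cases "\<integral>\<^sup>+x. ennreal (cmod (f x)) \<partial>lborel") auto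
  show ?thesis
  proof (intro exI[of _ "max (B * \<Delta>) (I * B')"] conjI allI impI)
    show "0 \<le> max (B * \<Delta>) (I * B')" using B \<Delta> by (simp add: le_max_iff_disj)
    fix t :: real and x assume t: "t > 0"
    show "cmod ((f \<star> dilate a \<phi> t) x) \<le> max (B * \<Delta>) (I * B') * log_decay 1 t"
    proof (cases "t \<le> 1")
      case True
      have ld: "log_decay 1 t = t" using True t by (simp add: log_decay_le_1)
      have diff: "ennreal (cmod (f (x \<odot> (- y)) - f x)) \<le> ennreal (norm y * B)" for y
      proof -
        have "ennreal (cmod (f (x \<odot> (- y)) - f x)) \<le> ennreal (norm (- y)) *
          (\<integral>\<^sup>+s\<in>{0..1}. ennreal (left_gradient_size f (x \<odot> (s *\<^sub>R (- y)))) \<partial>lborel)"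
          by (rule left_difference_le[OF f])
        also have "\<dots> \<le> ennreal (norm (- y)) * (\<integral>\<^sup>+s. ennreal B * indicator {0..1} s \<partial>(lborel :: real measure))"
          by (intro mult_left_mono nn_integral_mono mult_right_mono ennreal_leI B) auto
        also have "\<dots> = ennreal (norm y * B)"
          using B by (simp add: nn_integral_cmult_indicator ennreal_mult)
        finally show ?thesis .
      qed
      have "ennreal (cmod ((f \<star> dilate a \<phi> t) x)) \<le>
        (\<integral>\<^sup>+y. ennreal (cmod (f (x \<odot> (- y)) - f x)) * ennreal (cmod (dilate a \<phi> t y)) \<partial>lborel)"
        by (rule conv_dilate_mean_zero[OF f \<phi> t])
      also have "\<dots> \<le> (\<integral>\<^sup>+y. ennreal (norm y * B) * ennreal (cmod (dilate a \<phi> t y)) \<partial>lborel)"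
        by (intro nn_integral_mono mult_right_mono diff) auto
      also have "\<dots> = (\<integral>\<^sup>+y. ennreal (norm (dilation a t y) * B) * ennreal (cmod (\<phi> y)) \<partial>lborel)"
        by (rule nn_integral_dilate[OF _ _ t]) measurable
      also have "\<dots> \<le> (\<integral>\<^sup>+y. ennreal (t * B) * ennreal ((1 + norm y) * cmod (\<phi> y)) \<partial>lborel)"
      proof (rule nn_integral_mono)
        fix y
        have "norm (dilation a t y) \<le> t * (1 + norm y)"
          using norm_dilation_le[OF t True, of y] t by (simp add: distrib_left)
        then have "norm (dilation a t y) * B * cmod (\<phi> y) \<le> (t * (1 + norm y)) * B * cmod (\<phi> y)"
          using B by (intro mult_right_mono) auto
        also have "\<dots> = (t * B) * ((1 + norm y) * cmod (\<phi> y))" by simp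
        finally show "ennreal (norm (dilation a t y) * B) * ennreal (cmod (\<phi> y)) \<le> ennreal (t * B) * ennreal ((1 + norm y) * cmod (\<phi> y))"
          using B t by (simp add: ennreal_leI flip: ennreal_mult)
      qed
      also have "\<dots> = ennreal (t * B) * ennreal \<Delta>"
        unfolding \<Delta>(1)[symmetric] by (rule nn_integral_cmult) measurable
      also have "\<dots> = ennreal (B * \<Delta> * t)"
        using B \<Delta> t by (simp add: mult_ac flip: ennreal_mult)
      finally have "cmod ((f \<star> dilate a \<phi> t) x) \<le> B * \<Delta> * t"
        using B \<Delta> t by simp
      also have "\<dots> \<le> max (B * \<Delta>) (I * B') * t" using t by (intro mult_right_mono) auto
      finally show ?thesis by (simp add: ld)
    next
      case False
      then have ld: "log_decay 1 t = 1 / t" using t by (simp add: log_decay_ge_1 powr_minus divide_inverse)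
      have bd: "cmod (dilate a \<phi> t y) \<le> B' * (1 / t)" for y
      proof -
        have "t powr (- hom_dim a) \<le> t powr (- 1)" using False hom_dim_ge_2 by (intro powr_mono) auto
        then have "t powr (- hom_dim a) * cmod (\<phi> (dilation a (inverse t) y)) \<le> t powr (- 1) * B'"
          using B' by (intro mult_mono) auto
        also have "t powr (- 1) * B' = B' * (1 / t)" using t by (simp add: powr_minus divide_inverse)
        finally show ?thesis by (simp add: dilate_def norm_mult)
      qed
      have "ennreal (cmod ((f \<star> dilate a \<phi> t) x)) \<le> (\<integral>\<^sup>+y. ennreal (cmod (f (x \<odot> (- y)))) * ennreal (cmod (dilate a \<phi> t y)) \<partial>lborel)"
        by (rule conv_le_nn_integral)
      also have "\<dots> \<le> (\<integral>\<^sup>+y. ennreal (cmod (f (x \<odot> (- y)))) * ennreal (B' * (1 / t)) \<partial>lborel)"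
        by (intro nn_integral_mono mult_left_mono ennreal_leI bd) auto
      also have "\<dots> = ennreal I * ennreal (B' * (1 / t))"
        unfolding I(1)[symmetric] by (subst nn_integral_multc) (auto simp: nn_integral_translate_reflect)
      also have "\<dots> = ennreal (I * B' * (1 / t))"
        using I B' t by (simp flip: ennreal_mult)
      finally have "cmod ((f \<star> dilate a \<phi> t) x) \<le> I * B' * (1 / t)"
        using I B' t by simp
      also have "\<dots> \<le> max (B * \<Delta>) (I * B') * (1 / t)" using t by (intro mult_right_mono) auto
      finally show ?thesis by (simp add: ld)
    qed
  qed
qed

lemma measurable_conv_conv [measurable (raw)]:
  assumes [measurable]: "F \<in> borel_measurable borel" "\<phi> \<in> borel_measurable borel" "\<eta> \<in> borel_measurable borel"
    "t \<in> borel_measurable M" "x \<in> borel_measurable M"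
  shows "(\<lambda>z. ((F \<star> dilate a \<phi> (t z)) \<star> dilate a \<eta> (t z)) (x z)) \<in> borel_measurable M"
  unfolding convolve_def[of _ "convolve (\<odot>) F (dilate a \<phi> (t _))"]
  by (rule lborel.borel_measurable_lebesgue_integral) measurable

lemma schwartz_nn_integral_finite:
  assumes "(f :: real^'n::{finite,linorder} \<Rightarrow> complex) \<in> schwartz"
  obtains I where "I \<ge> 0" "(\<integral>\<^sup>+x. ennreal (cmod (f x)) \<partial>lborel) = ennreal I"
proof -
  have "(\<integral>\<^sup>+x. ennreal (cmod (f x)) \<partial>lborel) < top"
    using schwartz_integrable[OF assms] by (simp add: integrable_iff_bounded)
  then show ?thesis using that by (cases "\<integral>\<^sup>+x. ennreal (cmod (f x)) \<partial>lborel") auto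
qed

lemma conv_conv_uniform_bound:
  assumes f: "f \<in> schwartz" and \<phi>: "\<phi> \<in> schwartz" "(LINT x|lborel. \<phi> x) = 0" and \<eta>: "\<eta> \<in> schwartz"
  shows "\<exists>C\<ge>0. \<forall>t>0. \<forall>x. cmod (((f \<star> dilate a \<phi> t) \<star> dilate a \<eta> t) x) \<le> C * log_decay 1 t"
proof -
  note [measurable] = schwartz_measurable[OF \<eta>]
  obtain C where C: "C \<ge> 0" "\<And>t x. t > 0 \<Longrightarrow> cmod ((f \<star> dilate a \<phi> t) x) \<le> C * log_decay 1 t"
    using conv_dilate_uniform_bound[OF f \<phi>] by blast
  obtain I where I: "I \<ge> 0" "(\<integral>\<^sup>+x. ennreal (cmod (\<eta> x)) \<partial>lborel) = ennreal I"
    using schwartz_nn_integral_finite[OF \<eta>] .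
  have "cmod (((f \<star> dilate a \<phi> t) \<star> dilate a \<eta> t) x) \<le> (C * I) * log_decay 1 t" if t: "t > 0" for t x
  proof -
    have "ennreal (cmod (((f \<star> dilate a \<phi> t) \<star> dilate a \<eta> t) x)) \<le> ennreal (C * log_decay 1 t) * ennreal I"
      using conv_bound[of "f \<star> dilate a \<phi> t" "C * log_decay 1 t" "dilate a \<eta> t" x] C t I
      by (simp add: nn_integral_norm_dilate)
    also have "\<dots> = ennreal (C * I * log_decay 1 t)"
      using C I by (simp add: mult_ac flip: ennreal_mult)
    finally show ?thesis using C I by simp
  qed
  then show ?thesis using C I by (intro exI[of _ "C * I"]) auto
qed

lemma integrable_conv_conv:
  assumes f: "f \<in> schwartz" and \<phi>: "\<phi> \<in> schwartz" "(LINT x|lborel. \<phi> x) = 0" and \<eta>: "\<eta> \<in> schwartz"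
  shows "integrable dt_over_t (\<lambda>t. ((f \<star> dilate a \<phi> t) \<star> dilate a \<eta> t) x)"
proof (rule integrableI_bounded)
  note [measurable] = schwartz_measurable[OF f] schwartz_measurable[OF \<phi>(1)] schwartz_measurable[OF \<eta>]
  show "(\<lambda>t. ((f \<star> dilate a \<phi> t) \<star> dilate a \<eta> t) x) \<in> borel_measurable dt_over_t" by measurable
  obtain C where C: "C \<ge> 0" "\<And>t x. t > 0 \<Longrightarrow> cmod (((f \<star> dilate a \<phi> t) \<star> dilate a \<eta> t) x) \<le> C * log_decay 1 t"
    using conv_conv_uniform_bound[OF f \<phi> \<eta>] by blast
  have "(\<integral>\<^sup>+t. ennreal (norm (((f \<star> dilate a \<phi> t) \<star> dilate a \<eta> t) x)) \<partial>dt_over_t)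
      \<le> (\<integral>\<^sup>+t. ennreal C * ennreal (log_decay 1 t) \<partial>dt_over_t)"
    by (rule nn_integral_mono_AE) (use AE_dt_over_t_pos in eventually_elim,
        use C in \<open>simp add: ennreal_leI flip: ennreal_mult\<close>)
  also have "\<dots> = ennreal C * (\<integral>\<^sup>+t. ennreal (log_decay 1 t) \<partial>dt_over_t)"
    by (rule nn_integral_cmult) measurable
  also have "\<dots> < \<infinity>"
    using nn_integral_log_decay[of 1] by (simp add: ennreal_mult_less_top)
  finally show "(\<integral>\<^sup>+t. ennreal (norm (((f \<star> dilate a \<phi> t) \<star> dilate a \<eta> t) x)) \<partial>dt_over_t) < \<infinity>" .
qed

text \<open>Testing the truncated kernel against \<open>y \<mapsto> f (x y\<^sup>-\<^sup>1)\<close> turns it into a convolution of \<open>f\<close>.\<close>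

lemma pairing_truncated:
  assumes f: "f \<in> schwartz" and \<phi>: "\<phi> \<in> schwartz" and \<eta>: "\<eta> \<in> schwartz" and \<epsilon>: "0 < \<epsilon>"
  shows "integrable lborel (\<lambda>y. (LINT t:{\<epsilon>..B}|lborel. (1 / t) *\<^sub>R (dilate a \<phi> t \<star> dilate a \<eta> t) y) * f (x \<odot> (- y)))"
    and "(LINT y|lborel. (LINT t:{\<epsilon>..B}|lborel. (1 / t) *\<^sub>R (dilate a \<phi> t \<star> dilate a \<eta> t) y) * f (x \<odot> (- y)))
      = (LINT t:{\<epsilon>..B}|lborel. (1 / t) *\<^sub>R ((f \<star> dilate a \<phi> t) \<star> dilate a \<eta> t) x)"
proof -
  note [measurable] = schwartz_measurable[OF f] schwartz_measurable[OF \<phi>] schwartz_measurable[OF \<eta>]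
  obtain b where b: "b > 0" "\<And>x. cmod (f x) \<le> b" using schwartz_bounded[OF f] by blast
  obtain I1 where I1: "I1 \<ge> 0" "(\<integral>\<^sup>+x. ennreal (cmod (\<phi> x)) \<partial>lborel) = ennreal I1"
    using schwartz_nn_integral_finite[OF \<phi>] .
  obtain I2 where I2: "I2 \<ge> 0" "(\<integral>\<^sup>+x. ennreal (cmod (\<eta> x)) \<partial>lborel) = ennreal I2"
    using schwartz_nn_integral_finite[OF \<eta>] .
  define h where "h y t = indicator {\<epsilon>..B} t *\<^sub>R ((1 / t) *\<^sub>R (dilate a \<phi> t \<star> dilate a \<eta> t) y) * f (x \<odot> (- y))" for y t
  have [measurable]: "(\<lambda>(y, t). (dilate a \<phi> t \<star> dilate a \<eta> t) y) \<in> borel_measurable (lborel \<Otimes>\<^sub>M lborel)"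
    unfolding convolve_def split_beta' by (rule lborel.borel_measurable_lebesgue_integral) measurable
  have h_meas: "(\<lambda>(y, t). h y t) \<in> borel_measurable (lborel \<Otimes>\<^sub>M lborel)"
    unfolding h_def by measurable
  have int: "integrable (lborel \<Otimes>\<^sub>M lborel) (\<lambda>(y, t). h y t)"
  proof (rule integrableI_bounded[OF h_meas])
    have "(\<integral>\<^sup>+p. ennreal (norm (case p of (y, t) \<Rightarrow> h y t)) \<partial>(lborel \<Otimes>\<^sub>M lborel))
      = (\<integral>\<^sup>+t. \<integral>\<^sup>+y. ennreal (norm (h y t)) \<partial>lborel \<partial>lborel)"
      using h_meas by (subst lborel_pair.nn_integral_snd[symmetric]) (simp_all add: split_beta')
    also have "\<dots> \<le> (\<integral>\<^sup>+t. ennreal (1 / \<epsilon> * b * (I1 * I2)) * indicator {\<epsilon>..B} t \<partial>lborel)"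
    proof (rule nn_integral_mono)
      fix t :: real
      show "(\<integral>\<^sup>+y. ennreal (norm (h y t)) \<partial>lborel) \<le> ennreal (1 / \<epsilon> * b * (I1 * I2)) * indicator {\<epsilon>..B} t"
      proof (cases "t \<in> {\<epsilon>..B}")
        case True
        then have t: "t > 0" "1 / t \<le> 1 / \<epsilon>" using \<epsilon> by (auto intro!: divide_left_mono)
        have "(\<integral>\<^sup>+y. ennreal (norm (h y t)) \<partial>lborel) \<le> (\<integral>\<^sup>+y. ennreal (1 / \<epsilon> * b) * ennreal (cmod ((dilate a \<phi> t \<star> dilate a \<eta> t) y)) \<partial>lborel)"
        proof (rule nn_integral_mono)
          fix y
          have "norm (h y t) = (1 / t) * cmod (f (x \<odot> (- y))) * cmod ((dilate a \<phi> t \<star> dilate a \<eta> t) y)"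
            using True t by (simp add: h_def norm_mult)
          also have "\<dots> \<le> (1 / \<epsilon> * b) * cmod ((dilate a \<phi> t \<star> dilate a \<eta> t) y)"
            using t b \<epsilon> by (intro mult_right_mono mult_mono) auto
          finally show "ennreal (norm (h y t)) \<le> ennreal (1 / \<epsilon> * b) * ennreal (cmod ((dilate a \<phi> t \<star> dilate a \<eta> t) y))"
            using b \<epsilon> by (simp add: ennreal_leI flip: ennreal_mult)
        qed
        also have "\<dots> = ennreal (1 / \<epsilon> * b) * (\<integral>\<^sup>+y. ennreal (cmod ((dilate a \<phi> t \<star> dilate a \<eta> t) y)) \<partial>lborel)"
          by (rule nn_integral_cmult) measurable
        also have "\<dots> \<le> ennreal (1 / \<epsilon> * b) * (ennreal I1 * ennreal I2)"
          using nn_integral_norm_conv_le[of "dilate a \<phi> t" "dilate a \<eta> t"] t I1 I2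
          by (intro mult_left_mono) (simp_all add: nn_integral_norm_dilate)
        also have "\<dots> = ennreal (1 / \<epsilon> * b * (I1 * I2))"
          using b \<epsilon> I1 I2 by (simp flip: ennreal_mult)
        finally show ?thesis using True by simp
      qed (simp add: h_def)
    qed
    also have "\<dots> < \<infinity>"
      by (cases "\<epsilon> \<le> B") (auto simp: nn_integral_cmult_indicator ennreal_mult_less_top)
    finally show "(\<integral>\<^sup>+p. ennreal (norm (case p of (y, t) \<Rightarrow> h y t)) \<partial>(lborel \<Otimes>\<^sub>M lborel)) < \<infinity>" .
  qed
  have eq: "(LINT t:{\<epsilon>..B}|lborel. (1 / t) *\<^sub>R (dilate a \<phi> t \<star> dilate a \<eta> t) y) * f (x \<odot> (- y)) = (LINT t|lborel. h y t)" for y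
    by (simp only: set_lebesgue_integral_def h_def integral_mult_left_zero)
  show "integrable lborel (\<lambda>y. (LINT t:{\<epsilon>..B}|lborel. (1 / t) *\<^sub>R (dilate a \<phi> t \<star> dilate a \<eta> t) y) * f (x \<odot> (- y)))"
    unfolding eq by (rule lborel_pair.integrable_fst[OF int])
  have "(LINT y|lborel. LINT t|lborel. h y t) = (LINT t|lborel. LINT y|lborel. h y t)"
    by (rule lborel_pair.Fubini_integral[OF int, symmetric])
  also have "\<dots> = (LINT t:{\<epsilon>..B}|lborel. (1 / t) *\<^sub>R ((f \<star> dilate a \<phi> t) \<star> dilate a \<eta> t) x)"
    unfolding set_lebesgue_integral_def
  proof (intro Bochner_Integration.integral_cong refl)
    fix t :: real
    show "(LINT y|lborel. h y t) = indicator {\<epsilon>..B} t *\<^sub>R ((1 / t) *\<^sub>R ((f \<star> dilate a \<phi> t) \<star> dilate a \<eta> t) x)"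
    proof (cases "t \<in> {\<epsilon>..B}")
      case True
      then have t: "t > 0" using \<epsilon> by auto
      have "(LINT y|lborel. h y t) = (LINT y|lborel. of_real (1 / t) * (f (x \<odot> (- y)) * (dilate a \<phi> t \<star> dilate a \<eta> t) y))"
        using True by (simp add: h_def scaleR_conv_of_real mult_ac)
      also have "\<dots> = of_real (1 / t) * (f \<star> (dilate a \<phi> t \<star> dilate a \<eta> t)) x"
        unfolding convolve_def[of _ f] by (rule integral_mult_right_zero)
      also have "(f \<star> (dilate a \<phi> t \<star> dilate a \<eta> t)) x = ((f \<star> dilate a \<phi> t) \<star> dilate a \<eta> t) x"
        by (rule conv_assoc[OF _ b(2) integrable_dilate[OF schwartz_integrable[OF \<phi>] t]
              integrable_dilate[OF schwartz_integrable[OF \<eta>] t], symmetric]) measurable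
      finally show ?thesis using True by (simp add: scaleR_conv_of_real)
    qed (simp add: h_def)
  qed
  finally show "(LINT y|lborel. (LINT t:{\<epsilon>..B}|lborel. (1 / t) *\<^sub>R (dilate a \<phi> t \<star> dilate a \<eta> t) y) * f (x \<odot> (- y)))
      = (LINT t:{\<epsilon>..B}|lborel. (1 / t) *\<^sub>R ((f \<star> dilate a \<phi> t) \<star> dilate a \<eta> t) x)"
    unfolding eq .
qed

text \<open>The distributional identity is tested along one sequence of truncations, on which dominated
  convergence turns the truncated integrals into an absolutely convergent one.\<close>

lemma reproducing_formula:
  fixes \<phi> \<eta> :: "nat \<Rightarrow> real^'n::{finite,linorder} \<Rightarrow> complex"
  assumes \<phi>: "\<And>l. l \<in> {1..M} \<Longrightarrow> \<phi> l \<in> schwartz \<and> (LINT x|lborel. \<phi> l x) = 0"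
    and \<eta>: "\<And>l. l \<in> {1..M} \<Longrightarrow> \<eta> l \<in> schwartz"
    and lim: "tendsto_tempered
           (\<lambda>(\<epsilon>, B). function_distr (\<lambda>x. \<Sum>l=1..M. LINT t:{\<epsilon>..B}|lborel.
              (1 / t) *\<^sub>R convolve (\<odot>) (dilate a (\<phi> l) t) (dilate a (\<eta> l) t) x))
           dirac_delta (at_right 0 \<times>\<^sub>F at_top)"
    and f: "f \<in> schwartz"
  shows "f x = (\<Sum>l=1..M. LINT t|dt_over_t. ((f \<star> dilate a (\<phi> l) t) \<star> dilate a (\<eta> l) t) x)"
proof -
  define e b where "e n = inverse (real (Suc n))" and "b n = real (Suc n)" for n
  have e: "e n > 0" for n by (simp add: e_def)
  have seq: "filterlim (\<lambda>n. (e n, b n)) (at_right 0 \<times>\<^sub>F at_top) sequentially"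
  proof (rule filterlim_Pair)
    show "filterlim e (at_right 0) sequentially"
      unfolding filterlim_at e_def using LIMSEQ_inverse_real_of_nat by auto
    show "filterlim b at_top sequentially"
      unfolding b_def by (rule filterlim_compose[OF filterlim_real_sequentially filterlim_Suc])
  qed
  define g where "g l t = ((f \<star> dilate a (\<phi> l) t) \<star> dilate a (\<eta> l) t) x" for l t
  have [measurable]: "g l \<in> borel_measurable borel" if "l \<in> {1..M}" for l
    unfolding g_def using schwartz_measurable[OF f] schwartz_measurable \<phi>[OF that] schwartz_measurable[OF \<eta>[OF that]]
    by (intro measurable_conv_conv) auto
  have pair: "function_distr (\<lambda>x. \<Sum>l=1..M. LINT t:{e n..b n}|lborel.
      (1 / t) *\<^sub>R convolve (\<odot>) (dilate a (\<phi> l) t) (dilate a (\<eta> l) t) x) (\<lambda>y. f (x \<odot> (- y)))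
    = (\<Sum>l=1..M. LINT t:{e n..b n}|lborel. (1 / t) *\<^sub>R g l t)" for n
  proof -
    have "function_distr (\<lambda>x. \<Sum>l=1..M. LINT t:{e n..b n}|lborel.
      (1 / t) *\<^sub>R convolve (\<odot>) (dilate a (\<phi> l) t) (dilate a (\<eta> l) t) x) (\<lambda>y. f (x \<odot> (- y)))
      = (LINT y|lborel. (\<Sum>l=1..M. (LINT t:{e n..b n}|lborel. (1 / t) *\<^sub>R (dilate a (\<phi> l) t \<star> dilate a (\<eta> l) t) y) * f (x \<odot> (- y))))"
      by (simp add: function_distr_def sum_distrib_right)
    also have "\<dots> = (\<Sum>l=1..M. LINT y|lborel. (LINT t:{e n..b n}|lborel. (1 / t) *\<^sub>R (dilate a (\<phi> l) t \<star> dilate a (\<eta> l) t) y) * f (x \<odot> (- y)))"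
      by (rule Bochner_Integration.integral_sum) (use pairing_truncated(1)[OF f _ _ e] \<phi> \<eta> in auto)
    also have "\<dots> = (\<Sum>l=1..M. LINT t:{e n..b n}|lborel. (1 / t) *\<^sub>R g l t)"
      unfolding g_def by (intro sum.cong refl pairing_truncated(2)[OF f _ _ e]) (use \<phi> \<eta> in auto)
    finally show ?thesis .
  qed
  have "((\<lambda>p. (case p of (\<epsilon>, B) \<Rightarrow> function_distr (\<lambda>x. \<Sum>l=1..M. LINT t:{\<epsilon>..B}|lborel.
              (1 / t) *\<^sub>R convolve (\<odot>) (dilate a (\<phi> l) t) (dilate a (\<eta> l) t) x)) (\<lambda>y. f (x \<odot> (- y))))
      \<longlongrightarrow> dirac_delta (\<lambda>y. f (x \<odot> (- y)))) (at_right 0 \<times>\<^sub>F at_top)"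
    using lim schwartz_translate_reflect[OF f, of x] unfolding tendsto_tempered_def by blast
  from filterlim_compose[OF this seq]
  have "(\<lambda>n. \<Sum>l=1..M. LINT t:{e n..b n}|lborel. (1 / t) *\<^sub>R g l t) \<longlonglongrightarrow> f x"
    by (simp only: prod.case pair dirac_delta_def minus_zero right_neutral)
  moreover have "(\<lambda>n. \<Sum>l=1..M. LINT t:{e n..b n}|lborel. (1 / t) *\<^sub>R g l t) \<longlonglongrightarrow> (\<Sum>l=1..M. LINT t|dt_over_t. g l t)"
  proof (rule tendsto_sum)
    fix l assume l: "l \<in> {1..M}"
    note [measurable] = \<open>l \<in> {1..M} \<Longrightarrow> g l \<in> borel_measurable borel\<close>[OF l]
    have dens: "(LINT t|dt_over_t. g l t) = (LINT t|lborel. (indicator {0<..} t / t) *\<^sub>R g l t)"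
      unfolding dt_over_t_def by (rule integral_density) (auto simp: indicator_div_pos)
    have "integrable dt_over_t (g l)"
      unfolding g_def using \<phi>[OF l] \<eta>[OF l] f by (intro integrable_conv_conv) auto
    then have int: "integrable lborel (\<lambda>t. (indicator {0<..} t / t) *\<^sub>R g l t)"
      unfolding dt_over_t_def by (subst (asm) integrable_density) (auto simp: indicator_div_pos)
    have "(\<lambda>n. LINT t|lborel. indicator {e n..b n} t *\<^sub>R ((1 / t) *\<^sub>R g l t)) \<longlonglongrightarrow> (LINT t|lborel. (indicator {0<..} t / t) *\<^sub>R g l t)"
    proof (rule integral_dominated_convergence)
      show "integrable lborel (\<lambda>t. norm ((indicator {0<..} t / t) *\<^sub>R g l t))"
        by (rule integrable_norm[OF int])
      show "AE t in lborel. (\<lambda>n. indicator {e n..b n} t *\<^sub>R ((1 / t) *\<^sub>R g l t)) \<longlonglongrightarrow> (indicator {0<..} t / t) *\<^sub>R g l t"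
      proof (rule AE_I2)
        fix t :: real
        show "(\<lambda>n. indicator {e n..b n} t *\<^sub>R ((1 / t) *\<^sub>R g l t)) \<longlonglongrightarrow> (indicator {0<..} t / t) *\<^sub>R g l t"
        proof (cases "t > 0")
          case True
          obtain k :: nat where k: "max t (1 / t) < real k" using reals_Archimedean2 by blast
          have "t \<in> {e n..b n}" if "n \<ge> k" for n
          proof -
            have "max t (1 / t) < real (Suc n)" using k that by linarith
            then have "t < real (Suc n)" "1 / t < real (Suc n)" by auto
            then have "t \<le> b n" "1 < real (Suc n) * t"
              using True by (auto simp: b_def pos_divide_less_eq)
            then have "e n \<le> t" unfolding e_def by (simp add: inverse_eq_divide pos_divide_le_eq mult.commute)
            then show ?thesis using \<open>t \<le> b n\<close> by simp
          qed
          then have "eventually (\<lambda>n. indicator {e n..b n} t *\<^sub>R ((1 / t) *\<^sub>R g l t) = (indicator {0<..} t / t) *\<^sub>R g l t) sequentially"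
            using True by (auto simp: eventually_sequentially intro!: exI[of _ k])
          then show ?thesis by (rule tendsto_eventually)
        next
          case False
          then have "t \<notin> {e n..b n}" for n using e[of n] by auto
          then show ?thesis using False by simp
        qed
      qed
      show "AE t in lborel. norm (indicator {e n..b n} t *\<^sub>R ((1 / t) *\<^sub>R g l t)) \<le> norm ((indicator {0<..} t / t) *\<^sub>R g l t)" for n
      proof (rule AE_I2)
        fix t :: real
        have "t > 0" if "t \<in> {e n..b n}" using that e[of n] by auto
        then show "norm (indicator {e n..b n} t *\<^sub>R ((1 / t) *\<^sub>R g l t)) \<le> norm ((indicator {0<..} t / t) *\<^sub>R g l t)"
          by (auto split: split_indicator)
      qed
    qed measurable
    then show "(\<lambda>n. LINT t:{e n..b n}|lborel. (1 / t) *\<^sub>R g l t) \<longlonglongrightarrow> (LINT t|dt_over_t. g l t)"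
      unfolding dens set_lebesgue_integral_def .
  qed
  ultimately show ?thesis unfolding g_def by (rule LIMSEQ_unique)
qed

text \<open>Associativity and Fubini's theorem move the convolution with \<open>\<psi>\<^sub>s\<close> inside the reproducing
  formula.\<close>

lemma conv_le_reproducing:
  fixes \<phi> \<eta> :: "nat \<Rightarrow> real^'n::{finite,linorder} \<Rightarrow> complex"
  assumes \<phi>: "\<And>l. l \<in> {1..M} \<Longrightarrow> \<phi> l \<in> schwartz \<and> (LINT x|lborel. \<phi> l x) = 0"
    and \<eta>: "\<And>l. l \<in> {1..M} \<Longrightarrow> \<eta> l \<in> schwartz"
    and rep: "\<And>x. f x = (\<Sum>l=1..M. LINT t|dt_over_t. ((f \<star> dilate a (\<phi> l) t) \<star> dilate a (\<eta> l) t) x)"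
    and f: "f \<in> schwartz" and \<psi>: "rapid \<psi>" and s: "s > 0"
  shows "ennreal (cmod ((f \<star> dilate a \<psi> s) x)) \<le> (\<Sum>l=1..M. \<integral>\<^sup>+t. \<integral>\<^sup>+v.
    ennreal (cmod ((f \<star> dilate a (\<phi> l) t) (x \<odot> (- v)))) * ennreal (cmod ((dilate a (\<eta> l) t \<star> dilate a \<psi> s) v)) \<partial>lborel \<partial>dt_over_t)"
proof -
  interpret pair_sigma_finite "lborel :: (real^'n::{finite,linorder}) measure" dt_over_t ..
  define g where "g l t u = ((f \<star> dilate a (\<phi> l) t) \<star> dilate a (\<eta> l) t) u" for l t u
  note [measurable] = schwartz_measurable[OF f] rapid_measurable[OF \<psi>]
  have \<psi>s: "integrable lborel (dilate a \<psi> s)" by (rule integrable_dilate[OF rapid_integrable[OF \<psi>] s])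
  then have \<psi>fin: "(\<integral>\<^sup>+z. ennreal (cmod (dilate a \<psi> s z)) \<partial>lborel) < top"
    by (simp add: integrable_iff_bounded)
  have int: "integrable (lborel \<Otimes>\<^sub>M dt_over_t) (\<lambda>(z, t). g l t (x \<odot> (- z)) * dilate a \<psi> s z)" if l: "l \<in> {1..M}" for l
  proof (rule integrableI_bounded)
    note [measurable] = schwartz_measurable[of "\<phi> l"] schwartz_measurable[OF \<eta>[OF l]]
    have [measurable]: "\<phi> l \<in> borel_measurable borel" using \<phi>[OF l] schwartz_measurable by blast
    obtain C where C: "C \<ge> 0" "\<And>t u. t > 0 \<Longrightarrow> cmod (g l t u) \<le> C * log_decay 1 t"
      using conv_conv_uniform_bound[OF f, of "\<phi> l" "\<eta> l"] \<phi>[OF l] \<eta>[OF l] unfolding g_def by blast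
    show meas: "(\<lambda>(z, t). g l t (x \<odot> (- z)) * dilate a \<psi> s z) \<in> borel_measurable (lborel \<Otimes>\<^sub>M dt_over_t)"
      unfolding g_def by measurable
    have "(\<integral>\<^sup>+p. ennreal (norm (case p of (z, t) \<Rightarrow> g l t (x \<odot> (- z)) * dilate a \<psi> s z)) \<partial>(lborel \<Otimes>\<^sub>M dt_over_t))
       = (\<integral>\<^sup>+z. \<integral>\<^sup>+t. ennreal (norm (g l t (x \<odot> (- z)) * dilate a \<psi> s z)) \<partial>dt_over_t \<partial>lborel)"
      using meas by (subst dt_over_t.nn_integral_fst[symmetric]) (simp_all add: split_beta')
    also have "\<dots> \<le> (\<integral>\<^sup>+z. \<integral>\<^sup>+t. ennreal (cmod (dilate a \<psi> s z)) * (ennreal C * ennreal (log_decay 1 t)) \<partial>dt_over_t \<partial>lborel)"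
    proof (rule nn_integral_mono, rule nn_integral_mono_AE)
      fix z
      show "AE t in dt_over_t. ennreal (norm (g l t (x \<odot> (- z)) * dilate a \<psi> s z)) \<le> ennreal (cmod (dilate a \<psi> s z)) * (ennreal C * ennreal (log_decay 1 t))"
        using AE_dt_over_t_pos
      proof eventually_elim
        case (elim t)
        have "cmod (g l t (x \<odot> (- z))) * cmod (dilate a \<psi> s z) \<le> (C * log_decay 1 t) * cmod (dilate a \<psi> s z)"
          by (intro mult_right_mono C elim) simp
        then show ?case using C(1) by (simp add: norm_mult ennreal_leI mult.commute flip: ennreal_mult)
      qed
    qed
    also have "\<dots> = (\<integral>\<^sup>+z. ennreal (cmod (dilate a \<psi> s z)) \<partial>lborel) * (ennreal C * (\<integral>\<^sup>+t. ennreal (log_decay 1 t) \<partial>dt_over_t))"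
      by (simp add: nn_integral_cmult nn_integral_multc)
    also have "\<dots> < \<infinity>"
      using \<psi>fin nn_integral_log_decay[of 1] by (simp add: ennreal_mult_less_top)
    finally show "(\<integral>\<^sup>+p. ennreal (norm (case p of (z, t) \<Rightarrow> g l t (x \<odot> (- z)) * dilate a \<psi> s z)) \<partial>(lborel \<Otimes>\<^sub>M dt_over_t)) < \<infinity>" .
  qed
  have "(f \<star> dilate a \<psi> s) x = (LINT z|lborel. (\<Sum>l=1..M. LINT t|dt_over_t. g l t (x \<odot> (- z)) * dilate a \<psi> s z))"
    unfolding convolve_def[of _ f]
  proof (intro Bochner_Integration.integral_cong refl)
    fix z
    have "f (x \<odot> (- z)) * dilate a \<psi> s z = (\<Sum>l=1..M. LINT t|dt_over_t. g l t (x \<odot> (- z))) * dilate a \<psi> s z"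
      unfolding g_def by (subst rep) (rule refl)
    then show "f (x \<odot> (- z)) * dilate a \<psi> s z = (\<Sum>l=1..M. LINT t|dt_over_t. g l t (x \<odot> (- z)) * dilate a \<psi> s z)"
      by (simp add: sum_distrib_right)
  qed
  also have "\<dots> = (\<Sum>l=1..M. LINT z|lborel. LINT t|dt_over_t. g l t (x \<odot> (- z)) * dilate a \<psi> s z)"
    by (rule Bochner_Integration.integral_sum) (rule integrable_fst[OF int])
  also have "\<dots> = (\<Sum>l=1..M. LINT t|dt_over_t. LINT z|lborel. g l t (x \<odot> (- z)) * dilate a \<psi> s z)"
    by (intro sum.cong refl Fubini_integral[symmetric] int)
  finally have "ennreal (cmod ((f \<star> dilate a \<psi> s) x)) \<le> ennreal (\<Sum>l=1..M. cmod (LINT t|dt_over_t. LINT z|lborel. g l t (x \<odot> (- z)) * dilate a \<psi> s z))"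
    by (simp add: ennreal_leI norm_sum)
  also have "\<dots> = (\<Sum>l=1..M. ennreal (cmod (LINT t|dt_over_t. LINT z|lborel. g l t (x \<odot> (- z)) * dilate a \<psi> s z)))"
    by (simp add: sum_ennreal)
  also have "\<dots> \<le> (\<Sum>l=1..M. \<integral>\<^sup>+t. \<integral>\<^sup>+v.
    ennreal (cmod ((f \<star> dilate a (\<phi> l) t) (x \<odot> (- v)))) * ennreal (cmod ((dilate a (\<eta> l) t \<star> dilate a \<psi> s) v)) \<partial>lborel \<partial>dt_over_t)"
  proof (rule sum_mono)
    fix l assume l: "l \<in> {1..M}"
    obtain C where C: "C \<ge> 0" "\<And>t u. t > 0 \<Longrightarrow> cmod ((f \<star> dilate a (\<phi> l) t) u) \<le> C * log_decay 1 t"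
      using conv_dilate_uniform_bound[OF f, of "\<phi> l"] \<phi>[OF l] by blast
    have [measurable]: "\<phi> l \<in> borel_measurable borel" using \<phi>[OF l] schwartz_measurable by blast
    have "ennreal (cmod (LINT t|dt_over_t. LINT z|lborel. g l t (x \<odot> (- z)) * dilate a \<psi> s z))
      \<le> (\<integral>\<^sup>+t. ennreal (cmod (LINT z|lborel. g l t (x \<odot> (- z)) * dilate a \<psi> s z)) \<partial>dt_over_t)"
      by (rule norm_integral_le_nn_integral)
    also have "\<dots> \<le> (\<integral>\<^sup>+t. \<integral>\<^sup>+v. ennreal (cmod ((f \<star> dilate a (\<phi> l) t) (x \<odot> (- v))))
        * ennreal (cmod ((dilate a (\<eta> l) t \<star> dilate a \<psi> s) v)) \<partial>lborel \<partial>dt_over_t)"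
    proof (rule nn_integral_mono_AE, use AE_dt_over_t_pos in eventually_elim)
      fix t :: real assume t: "t > 0"
      have "(LINT z|lborel. g l t (x \<odot> (- z)) * dilate a \<psi> s z) = (((f \<star> dilate a (\<phi> l) t) \<star> dilate a (\<eta> l) t) \<star> dilate a \<psi> s) x"
        unfolding g_def convolve_def[of _ "convolve (\<odot>) (convolve (\<odot>) f (dilate a (\<phi> l) t)) (dilate a (\<eta> l) t)"] ..
      also have "\<dots> = ((f \<star> dilate a (\<phi> l) t) \<star> (dilate a (\<eta> l) t \<star> dilate a \<psi> s)) x"
        by (rule conv_assoc[OF _ C(2)[OF t] integrable_dilate[OF schwartz_integrable[OF \<eta>[OF l]] t] \<psi>s]) measurable
      finally show "ennreal (cmod (LINT z|lborel. g l t (x \<odot> (- z)) * dilate a \<psi> s z)) \<le>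
        (\<integral>\<^sup>+v. ennreal (cmod ((f \<star> dilate a (\<phi> l) t) (x \<odot> (- v)))) * ennreal (cmod ((dilate a (\<eta> l) t \<star> dilate a \<psi> s) v)) \<partial>lborel)"
        using conv_le_nn_integral[of "f \<star> dilate a (\<phi> l) t" "dilate a (\<eta> l) t \<star> dilate a \<psi> s" x] by simp
    qed
    finally show "ennreal (cmod (LINT t|dt_over_t. LINT z|lborel. g l t (x \<odot> (- z)) * dilate a \<psi> s z)) \<le> \<dots>" .
  qed
  finally show ?thesis .
qed

end

section \<open>Peetre maximal functions\<close>

lemma ex_countable_dense: "\<exists>D :: (real^'n::finite) set. countable D \<and> (\<forall>X. open X \<longrightarrow> X \<noteq> {} \<longrightarrow> (\<exists>d\<in>D. d \<in> X))"
  by (rule countable_dense_setE) blast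

definition countable_dense :: "(real^'n::finite) set" where
  "countable_dense = (SOME D. countable D \<and> (\<forall>X. open X \<longrightarrow> X \<noteq> {} \<longrightarrow> (\<exists>d\<in>D. d \<in> X)))"

lemma countable_dense:
  "countable (countable_dense :: (real^'n::finite) set)"
  "open (X :: (real^'n::finite) set) \<Longrightarrow> X \<noteq> {} \<Longrightarrow> \<exists>d\<in>countable_dense. d \<in> X"
  using someI_ex[OF ex_countable_dense] unfolding countable_dense_def[symmetric] by blast+

text \<open>A superlevel set of a continuous function is open, so it meets the dense set as soon as it is
  nonempty. A countable supremum preserves measurability.\<close>

lemma SUP_countable_dense:
  fixes g :: "real^'n::finite \<Rightarrow> real"
  assumes "continuous_on UNIV g"
  shows "(SUP y. ennreal (g y)) = (SUP y\<in>countable_dense. ennreal (g y))"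
proof (rule antisym)
  show "(SUP y\<in>countable_dense. ennreal (g y)) \<le> (SUP y. ennreal (g y))"
    by (rule SUP_subset_mono) auto
  show "(SUP y. ennreal (g y)) \<le> (SUP y\<in>countable_dense. ennreal (g y))"
  proof (rule SUP_least)
    fix y
    show "ennreal (g y) \<le> (SUP y\<in>countable_dense. ennreal (g y))"
      unfolding le_SUP_iff
    proof (intro allI impI)
      fix c assume c: "c < ennreal (g y)"
      have "open {z. c < ennreal (g z)}"
        by (intro open_Collect_less continuous_on_const continuous_on_ennreal assms)
      then obtain z where "z \<in> countable_dense" "c < ennreal (g z)"
        using countable_dense(2)[of "{z. c < ennreal (g z)}"] c by blast
      then show "\<exists>z\<in>countable_dense. c < ennreal (g z)" by blast
    qed
  qed
qed

lemma ex_dyadic_between: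
  assumes "(R :: real) > 0"
  shows "\<exists>k::int. R \<le> 2 powr k \<and> 2 powr k \<le> 2 * R"
proof (intro exI conjI)
  let ?k = "\<lceil>log 2 R\<rceil>"
  have R: "2 powr log 2 R = R" using assms by simp
  have "2 powr log 2 R \<le> 2 powr ?k" by (intro powr_mono) auto
  then show "R \<le> 2 powr ?k" using R by simp
  have "2 powr ?k \<le> 2 powr (log 2 R + 1)"
    by (intro powr_mono) (use of_int_ceiling_le_add_one[of "log 2 R"] in auto)
  then show "2 powr ?k \<le> 2 * R" using R by (simp add: powr_add)
qed

lemma log_decay_swap: "0 < s \<Longrightarrow> 0 < t \<Longrightarrow> log_decay \<epsilon> (s / t) = log_decay \<epsilon> (t / s)"
  by (simp add: log_decay_def min.commute)

text \<open>Schur's test for the kernel \<open>min(s/t, t/s)\<^sup>\<epsilon>\<close> on the multiplicative half-line: its integrals in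
  each variable are bounded by the invariance of \<open>dt/t\<close>, and Hoelder's inequality distributes the
  kernel.\<close>

lemma Schur_log_decay:
  assumes q: "q \<ge> 1" and \<epsilon>: "\<epsilon> > 0"
  shows "\<exists>C\<ge>0. \<forall>h\<in>borel_measurable borel.
    (\<integral>\<^sup>+s. epowr (\<integral>\<^sup>+t. h t * ennreal (log_decay \<epsilon> (s / t)) \<partial>dt_over_t) q \<partial>dt_over_t)
    \<le> ennreal C * (\<integral>\<^sup>+t. epowr (h t) q \<partial>dt_over_t)"
proof -
  interpret pair_sigma_finite dt_over_t dt_over_t ..
  obtain K0 where K0: "(\<integral>\<^sup>+t. ennreal (log_decay \<epsilon> t) \<partial>dt_over_t) = ennreal K0" "K0 \<ge> 0"
    using nn_integral_log_decay[OF \<epsilon>] by (cases "\<integral>\<^sup>+t. ennreal (log_decay \<epsilon> t) \<partial>dt_over_t") auto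
  define K where "K = K0 + 1"
  have K: "K > 0" "K \<ge> 0" "K \<ge> K0" using K0 by (auto simp: K_def)
  have kernel: "(\<integral>\<^sup>+t. ennreal (log_decay \<epsilon> (t / s)) \<partial>dt_over_t) \<le> ennreal K" if "s > 0" for s
    using nn_integral_dt_over_t_scale[of "\<lambda>t. ennreal (log_decay \<epsilon> t)" "1 / s"] that K0 K
    by (simp add: ennreal_leI)
  show ?thesis
  proof (intro exI[of _ "2 powr q * K powr q"] conjI ballI)
    show "0 \<le> 2 powr q * K powr q" by simp
    fix h :: "real \<Rightarrow> ennreal" assume [measurable]: "h \<in> borel_measurable borel"
    let ?k = "\<lambda>s t. ennreal (log_decay \<epsilon> (t / s))"
    have pt: "epowr (\<integral>\<^sup>+t. h t * ?k s t \<partial>dt_over_t) q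
        \<le> ennreal (2 powr q * K powr (q - 1)) * (\<integral>\<^sup>+t. epowr (h t) q * ?k s t \<partial>dt_over_t)" if s: "s > 0" for s
    proof (cases "q = 1")
      case True
      have "1 * (\<integral>\<^sup>+t. h t * ?k s t \<partial>dt_over_t) \<le> 2 * (\<integral>\<^sup>+t. h t * ?k s t \<partial>dt_over_t)"
        by (intro mult_right_mono one_le_numeral) auto
      then show ?thesis using True K by simp
    next
      case False
      then have q1: "q > 1" using q by simp
      define q' where "q' = q / (q - 1)"
      have q': "q' > 1" "1 / q + 1 / q' = 1" using conjugate_exponent[OF q1] by (auto simp: q'_def)
      have split: "h t * ?k s t = (h t * epowr (?k s t) (1 / q)) * epowr (?k s t) (1 / q')" for t
        using q'(2) by (simp only: mult.assoc epowr_add_exponent epowr_one_right)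
      have "(\<integral>\<^sup>+t. h t * ?k s t \<partial>dt_over_t)
         \<le> 2 * epowr (\<integral>\<^sup>+t. epowr (h t * epowr (?k s t) (1 / q)) q \<partial>dt_over_t) (1 / q)
             * epowr (\<integral>\<^sup>+t. epowr (epowr (?k s t) (1 / q')) q' \<partial>dt_over_t) (1 / q')"
        unfolding split by (rule Holder_nn_integral[OF q1 q']) measurable
      also have "\<dots> = 2 * epowr (\<integral>\<^sup>+t. epowr (h t) q * ?k s t \<partial>dt_over_t) (1 / q) * epowr (\<integral>\<^sup>+t. ?k s t \<partial>dt_over_t) (1 / q')"
        using q1 q'(1) unfolding epowr_epowr epowr_mult[OF order.strict_trans[OF zero_less_one q1]]
        by (simp del: epowr_ennreal)
      also have "\<dots> \<le> 2 * epowr (\<integral>\<^sup>+t. epowr (h t) q * ?k s t \<partial>dt_over_t) (1 / q) * epowr (ennreal K) (1 / q')"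
        using q' by (intro mult_left_mono epowr_mono kernel s) auto
      finally have "epowr (\<integral>\<^sup>+t. h t * ?k s t \<partial>dt_over_t) q
          \<le> epowr (2 * epowr (\<integral>\<^sup>+t. epowr (h t) q * ?k s t \<partial>dt_over_t) (1 / q) * epowr (ennreal K) (1 / q')) q"
        using q by (intro epowr_mono) auto
      also have "\<dots> = ennreal (2 powr q) * (\<integral>\<^sup>+t. epowr (h t) q * ?k s t \<partial>dt_over_t) * ennreal (K powr (q - 1))"
      proof -
        have "1 / q' * q = q - 1" using q1 by (simp add: q'_def)
        then show ?thesis
          using q1 K unfolding epowr_mult[OF order.strict_trans[OF zero_less_one q1]] epowr_epowr
          by (simp flip: ennreal_numeral)
      qed
      finally show ?thesis using K by (simp add: ennreal_mult mult_ac)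
    qed
    have "(\<integral>\<^sup>+s. epowr (\<integral>\<^sup>+t. h t * ennreal (log_decay \<epsilon> (s / t)) \<partial>dt_over_t) q \<partial>dt_over_t)
      \<le> (\<integral>\<^sup>+s. ennreal (2 powr q * K powr (q - 1)) * (\<integral>\<^sup>+t. epowr (h t) q * ?k s t \<partial>dt_over_t) \<partial>dt_over_t)"
    proof (rule nn_integral_mono_AE, use AE_dt_over_t_pos in eventually_elim)
      fix s :: real assume s: "s > 0"
      have "(\<integral>\<^sup>+t. h t * ennreal (log_decay \<epsilon> (s / t)) \<partial>dt_over_t) = (\<integral>\<^sup>+t. h t * ?k s t \<partial>dt_over_t)"
        by (rule nn_integral_cong_AE, use AE_dt_over_t_pos in eventually_elim) (simp add: log_decay_swap[OF s])
      then show "epowr (\<integral>\<^sup>+t. h t * ennreal (log_decay \<epsilon> (s / t)) \<partial>dt_over_t) q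
         \<le> ennreal (2 powr q * K powr (q - 1)) * (\<integral>\<^sup>+t. epowr (h t) q * ?k s t \<partial>dt_over_t)"
        using pt[OF s] by simp
    qed
    also have "\<dots> = ennreal (2 powr q * K powr (q - 1)) * (\<integral>\<^sup>+s. (\<integral>\<^sup>+t. epowr (h t) q * ?k s t \<partial>dt_over_t) \<partial>dt_over_t)"
      by (rule nn_integral_cmult) measurable
    also have "(\<integral>\<^sup>+s. (\<integral>\<^sup>+t. epowr (h t) q * ?k s t \<partial>dt_over_t) \<partial>dt_over_t)
       = (\<integral>\<^sup>+t. (\<integral>\<^sup>+s. epowr (h t) q * ?k s t \<partial>dt_over_t) \<partial>dt_over_t)"
      by (rule Fubini'[symmetric]) measurable
    also have "\<dots> \<le> (\<integral>\<^sup>+t. epowr (h t) q * ennreal K \<partial>dt_over_t)"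
    proof (rule nn_integral_mono_AE, use AE_dt_over_t_pos in eventually_elim)
      fix t :: real assume t: "t > 0"
      have "(\<integral>\<^sup>+s. epowr (h t) q * ?k s t \<partial>dt_over_t) = epowr (h t) q * (\<integral>\<^sup>+s. ?k s t \<partial>dt_over_t)"
        by (rule nn_integral_cmult) measurable
      also have "(\<integral>\<^sup>+s. ?k s t \<partial>dt_over_t) = (\<integral>\<^sup>+s. ennreal (log_decay \<epsilon> (s / t)) \<partial>dt_over_t)"
        by (rule nn_integral_cong_AE, use AE_dt_over_t_pos in eventually_elim) (simp add: log_decay_swap[OF t])
      also have "epowr (h t) q * \<dots> \<le> epowr (h t) q * ennreal K"
        by (intro mult_left_mono kernel t) auto
      finally show "(\<integral>\<^sup>+s. epowr (h t) q * ?k s t \<partial>dt_over_t) \<le> epowr (h t) q * ennreal K" .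
    qed
    also have "\<dots> = (\<integral>\<^sup>+t. epowr (h t) q \<partial>dt_over_t) * ennreal K"
      by (rule nn_integral_multc) measurable
    finally have "(\<integral>\<^sup>+s. epowr (\<integral>\<^sup>+t. h t * ennreal (log_decay \<epsilon> (s / t)) \<partial>dt_over_t) q \<partial>dt_over_t)
      \<le> ennreal (2 powr q * K powr (q - 1)) * ((\<integral>\<^sup>+t. epowr (h t) q \<partial>dt_over_t) * ennreal K)"
      by (simp add: mult_left_mono)
    also have "\<dots> = ennreal (2 powr q * (K powr (q - 1) * K)) * (\<integral>\<^sup>+t. epowr (h t) q \<partial>dt_over_t)"
      using K by (simp add: ennreal_mult mult_ac)
    also have "K powr (q - 1) * K = K powr q"
      using K powr_add[of K "q - 1" 1] by simp
    finally show "(\<integral>\<^sup>+s. epowr (\<integral>\<^sup>+t. h t * ennreal (log_decay \<epsilon> (s / t)) \<partial>dt_over_t) q \<partial>dt_over_t)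
      \<le> ennreal (2 powr q * K powr q) * (\<integral>\<^sup>+t. epowr (h t) q \<partial>dt_over_t)" .
  qed
qed

context homogeneous_group_norm
begin

text \<open>The Peetre maximal function of \<open>f * \<phi>\<^sub>t\<close> at scale \<open>1/t\<close>, with the supremum over a countable dense
  set, which makes measurability in \<open>t\<close> and \<open>x\<close> evident.\<close>

definition Pm :: "real \<Rightarrow> (real^'n::{finite,linorder} \<Rightarrow> complex) \<Rightarrow> (real^'n::{finite,linorder} \<Rightarrow> complex) \<Rightarrow> real \<Rightarrow> real^'n::{finite,linorder} \<Rightarrow> ennreal" where
  "Pm N f \<phi> t x = (SUP y\<in>countable_dense. ennreal (cmod ((f \<star> dilate a \<phi> t) (x \<odot> (- y))) / (1 + 1 / t * \<rho> y) powr N))"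

lemma measurable_Pm [measurable (raw)]:
  assumes [measurable]: "f \<in> borel_measurable borel" "\<phi> \<in> borel_measurable borel"
    "t \<in> borel_measurable M" "x \<in> borel_measurable M"
  shows "(\<lambda>z. Pm N f \<phi> (t z) (x z)) \<in> borel_measurable M"
  unfolding Pm_def by (rule borel_measurable_SUP[OF countable_dense(1)]) measurable

lemma continuous_conv:
  assumes f: "f \<in> schwartz" and G: "integrable lborel G"
  shows "continuous_on UNIV (f \<star> G)"
proof (rule continuous_on_sequentiallyI)
  fix u :: "nat \<Rightarrow> real^'n::{finite,linorder}" and x assume u: "u \<longlonglongrightarrow> x"
  obtain B where B: "B > 0" "\<And>x. cmod (f x) \<le> B" using schwartz_bounded[OF f] by blast
  have [measurable]: "f \<in> borel_measurable borel" "G \<in> borel_measurable borel"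
    using schwartz_measurable[OF f] G by auto
  show "(\<lambda>n. (f \<star> G) (u n)) \<longlonglongrightarrow> (f \<star> G) x"
    unfolding convolve_def
  proof (rule integral_dominated_convergence)
    show "integrable lborel (\<lambda>y. B * cmod (G y))" using G by simp
    show "AE y in lborel. (\<lambda>n. f (u n \<odot> (- y)) * G y) \<longlonglongrightarrow> f (x \<odot> (- y)) * G y"
    proof (rule AE_I2)
      fix y
      have "continuous_on UNIV (\<lambda>z. f (z \<odot> (- y)))"
        by (rule continuous_on_compose2[OF schwartz_continuous[OF f]]) (auto intro!: continuous_intros)
      then have "(\<lambda>n. f (u n \<odot> (- y))) \<longlonglongrightarrow> f (x \<odot> (- y))"
        using u by (auto simp: continuous_on_sequentially o_def)
      then show "(\<lambda>n. f (u n \<odot> (- y)) * G y) \<longlonglongrightarrow> f (x \<odot> (- y)) * G y"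
        by (intro tendsto_intros)
    qed
    show "AE y in lborel. norm (f (u n \<odot> (- y)) * G y) \<le> B * cmod (G y)" for n
      by (auto simp: norm_mult intro!: mult_right_mono B)
  qed measurable
qed

lemma one_plus_rho_pos: "t > 0 \<Longrightarrow> 1 + \<rho> y / t \<ge> 1"
  by simp

lemma Pm_eq_peetre_max:
  assumes f: "f \<in> schwartz" and \<phi>: "rapid \<phi>" and t: "t > 0"
  shows "Pm N f \<phi> t x = peetre_max (\<odot>) \<rho> N (1 / t) (f \<star> dilate a \<phi> t) x"
  unfolding Pm_def peetre_max_def
proof (rule SUP_countable_dense[symmetric])
  have "continuous_on UNIV (f \<star> dilate a \<phi> t)"
    by (intro continuous_conv f integrable_dilate rapid_integrable \<phi> t)
  then have "continuous_on UNIV (\<lambda>y. (f \<star> dilate a \<phi> t) (x \<odot> (- y)))"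
    by (rule continuous_on_compose2) (auto intro!: continuous_intros)
  moreover have "1 + 1 / t * \<rho> y \<noteq> 0" for y
    using one_plus_rho_pos[OF t, of y] by simp
  ultimately show "continuous_on UNIV (\<lambda>y. cmod ((f \<star> dilate a \<phi> t) (x \<odot> (- y))) / (1 + 1 / t * \<rho> y) powr N)"
    by (intro continuous_intros rho_continuous) auto
qed

lemma Pm_ge:
  assumes f: "f \<in> schwartz" and \<phi>: "rapid \<phi>" and t: "t > 0"
  shows "ennreal (cmod ((f \<star> dilate a \<phi> t) (x \<odot> (- y)))) \<le> Pm N f \<phi> t x * ennreal ((1 + \<rho> y / t) powr N)"
proof -
  let ?Y = "(1 + \<rho> y / t) powr N"
  have pos: "?Y > 0" using one_plus_rho_pos[OF t, of y] by simp
  have "ennreal (cmod ((f \<star> dilate a \<phi> t) (x \<odot> (- y)))) = ennreal (cmod ((f \<star> dilate a \<phi> t) (x \<odot> (- y))) / ?Y) * ennreal ?Y"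
    using pos by (simp flip: ennreal_mult)
  also have "ennreal (cmod ((f \<star> dilate a \<phi> t) (x \<odot> (- y))) / ?Y) \<le> Pm N f \<phi> t x"
    unfolding Pm_eq_peetre_max[OF assms] peetre_max_def by (rule SUP_upper2[of y]) auto
  finally show ?thesis by (simp add: mult_right_mono)
qed

lemma Pm_leI:
  assumes "\<And>y. ennreal (cmod ((f \<star> dilate a \<phi> t) (x \<odot> (- y)))) * ennreal ((1 + \<rho> y / t) powr (- N)) \<le> c"
  shows "Pm N f \<phi> t x \<le> c"
  unfolding Pm_def
proof (rule SUP_least)
  fix y
  have "ennreal (cmod ((f \<star> dilate a \<phi> t) (x \<odot> (- y))) / (1 + 1 / t * \<rho> y) powr N)
    = ennreal (cmod ((f \<star> dilate a \<phi> t) (x \<odot> (- y)))) * ennreal ((1 + \<rho> y / t) powr (- N))"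
  proof -
    have "1 / t * \<rho> y = \<rho> y / t" by simp
    then show ?thesis
      by (simp only: powr_minus divide_inverse[of "cmod _"]) (rule ennreal_mult, auto)
  qed
  then show "ennreal (cmod ((f \<star> dilate a \<phi> t) (x \<odot> (- y))) / (1 + 1 / t * \<rho> y) powr N) \<le> c"
    using assms[of y] by simp
qed

lemma measurable_dilate_conv_dilate [measurable (raw)]:
  assumes [measurable]: "\<phi> \<in> borel_measurable borel" "\<eta> \<in> borel_measurable borel"
    "t \<in> borel_measurable M" "s \<in> borel_measurable M" "x \<in> borel_measurable M"
  shows "(\<lambda>z. (dilate a \<phi> (t z) \<star> dilate a \<eta> (s z)) (x z)) \<in> borel_measurable M"
  unfolding convolve_def by (rule lborel.borel_measurable_lebesgue_integral) measurable

text \<open>Inserting the reproducing formula: \<open>f * \<psi>\<^sub>s\<close> is a superposition of the \<open>f * \<phi>\<^sub>t\<close> with kernels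
  \<open>\<eta>\<^sub>t * \<psi>\<^sub>s\<close>, whose weighted \<open>L\<^sup>1\<close> norms decay in \<open>s/t\<close>. Changing the scale in the Peetre weight from \<open>1/s\<close> to
  \<open>1/t\<close> costs \<open>max(1, s/t)\<^sup>N\<close>.\<close>

lemma Pm_le_superposition:
  fixes \<phi> \<eta> :: "nat \<Rightarrow> real^'n::{finite,linorder} \<Rightarrow> complex"
  assumes \<phi>: "\<And>l. l \<in> {1..M} \<Longrightarrow> \<phi> l \<in> schwartz \<and> (LINT x|lborel. \<phi> l x) = 0"
    and \<eta>: "\<And>l. l \<in> {1..M} \<Longrightarrow> \<eta> l \<in> schwartz"
    and rep: "\<And>x. f x = (\<Sum>l=1..M. LINT t|dt_over_t. ((f \<star> dilate a (\<phi> l) t) \<star> dilate a (\<eta> l) t) x)"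
    and f: "f \<in> schwartz" and \<psi>: "rapid \<psi>" and s: "s > 0" and N: "N \<ge> 0" and C: "C \<ge> 0"
    and moment: "\<And>l u. l \<in> {1..M} \<Longrightarrow> u > 0 \<Longrightarrow>
      ennreal (max 1 u powr N) * conv_moment (\<odot>) a \<rho> (\<eta> l) \<psi> u N \<le> ennreal (C * log_decay \<epsilon> u)"
  shows "Pm N f \<psi> s x \<le> ennreal (c0 powr N * C) * (\<Sum>l=1..M. \<integral>\<^sup>+t. Pm N f (\<phi> l) t x * ennreal (log_decay \<epsilon> (s / t)) \<partial>dt_over_t)"
proof (rule Pm_leI)
  fix y
  note [measurable] = schwartz_measurable[OF f] rapid_measurable[OF \<psi>]
  let ?w = "ennreal ((1 + \<rho> y / s) powr (- N))"
  have "ennreal (cmod ((f \<star> dilate a \<psi> s) (x \<odot> (- y)))) * ?w \<le> (\<Sum>l=1..M. \<integral>\<^sup>+t. \<integral>\<^sup>+v.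
    ennreal (cmod ((f \<star> dilate a (\<phi> l) t) ((x \<odot> (- y)) \<odot> (- v)))) * ennreal (cmod ((dilate a (\<eta> l) t \<star> dilate a \<psi> s) v)) \<partial>lborel \<partial>dt_over_t) * ?w"
    by (intro mult_right_mono conv_le_reproducing[OF \<phi> \<eta> rep f \<psi> s]) auto
  also have "\<dots> = (\<Sum>l=1..M. (\<integral>\<^sup>+t. \<integral>\<^sup>+v.
    ennreal (cmod ((f \<star> dilate a (\<phi> l) t) ((x \<odot> (- y)) \<odot> (- v)))) * ennreal (cmod ((dilate a (\<eta> l) t \<star> dilate a \<psi> s) v)) \<partial>lborel \<partial>dt_over_t) * ?w)"
    by (rule sum_distrib_right)
  also have "\<dots> \<le> (\<Sum>l=1..M. ennreal (c0 powr N * C) * (\<integral>\<^sup>+t. Pm N f (\<phi> l) t x * ennreal (log_decay \<epsilon> (s / t)) \<partial>dt_over_t))"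
  proof (rule sum_mono)
    fix l assume l: "l \<in> {1..M}"
    have \<phi>l: "\<phi> l \<in> schwartz" using \<phi>[OF l] by blast
    note [measurable] = schwartz_measurable[OF \<phi>l] schwartz_measurable[OF \<eta>[OF l]]
    let ?K = "\<lambda>t v. ennreal (cmod ((dilate a (\<eta> l) t \<star> dilate a \<psi> s) v))"
    have "(\<integral>\<^sup>+t. \<integral>\<^sup>+v. ennreal (cmod ((f \<star> dilate a (\<phi> l) t) ((x \<odot> (- y)) \<odot> (- v)))) * ?K t v \<partial>lborel \<partial>dt_over_t) * ?w
      = (\<integral>\<^sup>+t. (\<integral>\<^sup>+v. ennreal (cmod ((f \<star> dilate a (\<phi> l) t) ((x \<odot> (- y)) \<odot> (- v)))) * ?K t v \<partial>lborel) * ?w \<partial>dt_over_t)"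
      by (rule nn_integral_multc[symmetric]) measurable
    also have "\<dots> \<le> (\<integral>\<^sup>+t. ennreal (c0 powr N * C) * (Pm N f (\<phi> l) t x * ennreal (log_decay \<epsilon> (s / t))) \<partial>dt_over_t)"
    proof (rule nn_integral_mono_AE, use AE_dt_over_t_pos in eventually_elim)
      fix t :: real assume t: "t > 0"
      let ?P = "Pm N f (\<phi> l) t x" and ?Y = "1 + \<rho> y / t"
      have Y: "?Y \<ge> 1" by (rule one_plus_rho_pos[OF t])
      have "(\<integral>\<^sup>+v. ennreal (cmod ((f \<star> dilate a (\<phi> l) t) ((x \<odot> (- y)) \<odot> (- v)))) * ?K t v \<partial>lborel)
        \<le> (\<integral>\<^sup>+v. ?P * ennreal (c0 powr N * ?Y powr N) * (ennreal ((1 + \<rho> v / t) powr N) * ?K t v) \<partial>lborel)"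
      proof (rule nn_integral_mono)
        fix v
        have e: "(x \<odot> (- y)) \<odot> (- v) = x \<odot> (- (v \<odot> y))" by (simp add: minus_mul assoc)
        have "ennreal (cmod ((f \<star> dilate a (\<phi> l) t) ((x \<odot> (- y)) \<odot> (- v)))) \<le> ?P * ennreal ((1 + \<rho> (v \<odot> y) / t) powr N)"
          unfolding e by (rule Pm_ge[OF f schwartz_rapid[OF \<phi>l] t])
        also have "\<dots> \<le> ?P * ennreal (c0 powr N * ?Y powr N * (1 + \<rho> v / t) powr N)"
        proof (intro mult_left_mono ennreal_leI)
          have "(1 + \<rho> (v \<odot> y) / t) powr N \<le> (c0 * ((1 + \<rho> v / t) * ?Y)) powr N"
            using one_plus_rho_mul_le[OF t, of v y] N one_plus_rho_pos[OF t, of "v \<odot> y"] by (intro powr_mono2) auto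
          then show "(1 + \<rho> (v \<odot> y) / t) powr N \<le> c0 powr N * ?Y powr N * (1 + \<rho> v / t) powr N"
            using c0(1) t Y by (simp add: powr_mult mult_ac)
        qed auto
        finally have "ennreal (cmod ((f \<star> dilate a (\<phi> l) t) ((x \<odot> (- y)) \<odot> (- v)))) * ?K t v
           \<le> ?P * ennreal (c0 powr N * ?Y powr N * (1 + \<rho> v / t) powr N) * ?K t v"
          by (rule mult_right_mono) simp
        then show "ennreal (cmod ((f \<star> dilate a (\<phi> l) t) ((x \<odot> (- y)) \<odot> (- v)))) * ?K t v
           \<le> ?P * ennreal (c0 powr N * ?Y powr N) * (ennreal ((1 + \<rho> v / t) powr N) * ?K t v)"
          by (simp add: ennreal_mult mult.assoc)
      qed
      also have "\<dots> = ?P * ennreal (c0 powr N * ?Y powr N) * (\<integral>\<^sup>+v. ennreal ((1 + \<rho> v / t) powr N) * ?K t v \<partial>lborel)"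
        by (rule nn_integral_cmult) measurable
      also have "(\<integral>\<^sup>+v. ennreal ((1 + \<rho> v / t) powr N) * ?K t v \<partial>lborel) = conv_moment (\<odot>) a \<rho> (\<eta> l) \<psi> (s / t) N"
        by (rule nn_integral_conv_dilate_moment) (use t s in auto)
      finally have "(\<integral>\<^sup>+v. ennreal (cmod ((f \<star> dilate a (\<phi> l) t) ((x \<odot> (- y)) \<odot> (- v)))) * ?K t v \<partial>lborel) * ?w
         \<le> ?P * ennreal (c0 powr N * ?Y powr N) * conv_moment (\<odot>) a \<rho> (\<eta> l) \<psi> (s / t) N * ?w"
        by (rule mult_right_mono) simp
      also have "\<dots> = ?P * (ennreal (c0 powr N * (?Y powr N * (1 + \<rho> y / s) powr (- N))) * conv_moment (\<odot>) a \<rho> (\<eta> l) \<psi> (s / t) N)"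
        by (simp add: ennreal_mult mult_ac)
      also have "\<dots> \<le> ?P * (ennreal (c0 powr N * max 1 (s / t) powr N) * conv_moment (\<odot>) a \<rho> (\<eta> l) \<psi> (s / t) N)"
      proof (intro mult_left_mono mult_right_mono ennreal_leI)
        have "?Y \<le> max 1 (s / t) * (1 + \<rho> y / s)"
        proof -
          have "1 \<le> max 1 (s / t) * 1" by simp
          moreover have "s / t * (\<rho> y / s) \<le> max 1 (s / t) * (\<rho> y / s)"
            by (rule mult_right_mono) (use s in auto)
          moreover have "s / t * (\<rho> y / s) = \<rho> y / t" using s by simp
          ultimately show ?thesis unfolding distrib_left by linarith
        qed
        then have "?Y powr N \<le> (max 1 (s / t) * (1 + \<rho> y / s)) powr N"
          using N Y by (intro powr_mono2) auto
        also have "\<dots> = max 1 (s / t) powr N * (1 + \<rho> y / s) powr N"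
          by (rule powr_mult)
        finally have "?Y powr N * (1 + \<rho> y / s) powr (- N) \<le> max 1 (s / t) powr N * (1 + \<rho> y / s) powr N * (1 + \<rho> y / s) powr (- N)"
          by (rule mult_right_mono) simp
        also have "\<dots> = max 1 (s / t) powr N"
          using one_plus_rho_pos[OF s, of y] by (simp add: mult.assoc flip: powr_add)
        finally show "?Y powr N * (1 + \<rho> y / s) powr (- N) \<le> max 1 (s / t) powr N" .
      qed auto
      also have "\<dots> = ?P * (ennreal (c0 powr N) * (ennreal (max 1 (s / t) powr N) * conv_moment (\<odot>) a \<rho> (\<eta> l) \<psi> (s / t) N))"
        by (simp add: ennreal_mult mult.assoc)
      also have "\<dots> \<le> ?P * (ennreal (c0 powr N) * ennreal (C * log_decay \<epsilon> (s / t)))"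
        by (intro mult_left_mono moment l) (use s t in auto)
      also have "\<dots> = ennreal (c0 powr N * C) * (?P * ennreal (log_decay \<epsilon> (s / t)))"
        using C by (simp add: ennreal_mult mult_ac)
      finally show "(\<integral>\<^sup>+v. ennreal (cmod ((f \<star> dilate a (\<phi> l) t) ((x \<odot> (- y)) \<odot> (- v)))) * ?K t v \<partial>lborel) * ?w
         \<le> ennreal (c0 powr N * C) * (?P * ennreal (log_decay \<epsilon> (s / t)))" .
    qed
    also have "\<dots> = ennreal (c0 powr N * C) * (\<integral>\<^sup>+t. Pm N f (\<phi> l) t x * ennreal (log_decay \<epsilon> (s / t)) \<partial>dt_over_t)"
      by (rule nn_integral_cmult) measurable
    finally show "(\<integral>\<^sup>+t. \<integral>\<^sup>+v. ennreal (cmod ((f \<star> dilate a (\<phi> l) t) ((x \<odot> (- y)) \<odot> (- v)))) * ?K t v \<partial>lborel \<partial>dt_over_t) * ?w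
      \<le> ennreal (c0 powr N * C) * (\<integral>\<^sup>+t. Pm N f (\<phi> l) t x * ennreal (log_decay \<epsilon> (s / t)) \<partial>dt_over_t)" .
  qed
  also have "\<dots> = ennreal (c0 powr N * C) * (\<Sum>l=1..M. \<integral>\<^sup>+t. Pm N f (\<phi> l) t x * ennreal (log_decay \<epsilon> (s / t)) \<partial>dt_over_t)"
    by (rule sum_distrib_left[symmetric])
  finally show "ennreal (cmod ((f \<star> dilate a \<psi> s) (x \<odot> (- y)))) * ?w
    \<le> ennreal (c0 powr N * C) * (\<Sum>l=1..M. \<integral>\<^sup>+t. Pm N f (\<phi> l) t x * ennreal (log_decay \<epsilon> (s / t)) \<partial>dt_over_t)" .
qed

text \<open>After this substitution, differences in \<open>u\<close> fall on the second factor \<open>G\<close> alone.\<close>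

lemma conv_right_form:
  assumes [measurable]: "f \<in> borel_measurable borel" "G \<in> borel_measurable borel"
  shows "(f \<star> G) u = (LINT z|lborel. f z * G ((- z) \<odot> u))"
proof -
  have "(f \<star> G) u = (LINT y|lborel. f (u \<odot> (- (y \<odot> u))) * G (y \<odot> u))"
    unfolding convolve_def by (rule integral_right_translate[symmetric]) measurable
  also have "\<dots> = (LINT z|lborel. f (u \<odot> (- ((- z) \<odot> u))) * G ((- z) \<odot> u))"
    by (rule integral_uminus[symmetric]) measurable
  also have "(\<lambda>z. f (u \<odot> (- ((- z) \<odot> u))) * G ((- z) \<odot> u)) = (\<lambda>z. f z * G ((- z) \<odot> u))"
    by (simp add: minus_mul flip: assoc)
  finally show ?thesis .
qed

lemma integrable_mult_bounded:
  fixes f g :: "real^'n::{finite,linorder} \<Rightarrow> complex"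
  assumes f: "integrable lborel f" and [measurable]: "g \<in> borel_measurable borel" and B: "\<And>x. cmod (g x) \<le> B"
  shows "integrable lborel (\<lambda>x. f x * g x)"
proof (rule Bochner_Integration.integrable_bound)
  show "integrable lborel (\<lambda>x. of_real B * f x)" using f by simp
  have "B \<ge> 0" using order.trans[OF norm_ge_zero B[of 0]] .
  then show "AE x in lborel. norm (f x * g x) \<le> norm (of_real B * f x)"
    by (auto simp: norm_mult mult.commute[of B] intro!: mult_left_mono B)
  have [measurable]: "f \<in> borel_measurable borel" using f by simp
  show "(\<lambda>x. f x * g x) \<in> borel_measurable lborel" by measurable
qed

lemma dilate_bounded:
  assumes "rapid \<phi>" "t > 0"
  shows "\<exists>B\<ge>0. \<forall>x. cmod (dilate a \<phi> t x) \<le> B"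
proof -
  obtain B where B: "B \<ge> 0" "\<And>x. cmod (\<phi> x) \<le> B" using rapid_bounded[OF assms(1)] by blast
  have "cmod (dilate a \<phi> t x) \<le> t powr (- hom_dim a) * B" for x
    using B by (auto simp: dilate_def norm_mult intro!: mult_left_mono)
  then show ?thesis using B by (intro exI[of _ "t powr (- hom_dim a) * B"]) auto
qed

text \<open>Left-invariant derivatives commute with convolution from the left, and at scale \<open>t\<close> they act
  on \<open>\<phi>\<close>.\<close>

lemma conv_difference:
  assumes f: "f \<in> schwartz" and \<phi>: "\<phi> \<in> schwartz" and t: "t > 0"
  shows "(f \<star> dilate a \<phi> t) (u \<odot> dilation a t v) - (f \<star> dilate a \<phi> t) u
    = (LINT s|lborel. indicator {0..1} s *\<^sub>R (\<Sum>j\<in>UNIV. v $ j *\<^sub>R (f \<star> dilate a (left_deriv (\<odot>) j \<phi>) t) (u \<odot> dilation a t (s *\<^sub>R v))))"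
proof -
  define X where "X j = dilate a (left_deriv (\<odot>) j \<phi>) t" for j
  have Xr: "rapid (left_deriv (\<odot>) j \<phi>)" for j by (rule left_deriv_path(1)[OF \<phi>])
  note [measurable] = schwartz_measurable[OF f] schwartz_measurable[OF \<phi>] rapid_measurable[OF Xr]
  have [measurable]: "X j \<in> borel_measurable borel" for j unfolding X_def by measurable
  have "\<forall>j. \<exists>B\<ge>0. \<forall>x. cmod (X j x) \<le> B"
    unfolding X_def using dilate_bounded[OF Xr t] by blast
  from choice[OF this] obtain B where B: "\<And>j. B j \<ge> 0" "\<And>j x. cmod (X j x) \<le> B j" by blast
  obtain B' where B': "\<And>x. cmod (dilate a \<phi> t x) \<le> B'" using dilate_bounded[OF schwartz_rapid[OF \<phi>] t] by blast
  have d\<phi>: "dilate a \<phi> t (w \<odot> dilation a t v) - dilate a \<phi> t w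
    = (LINT s|lborel. indicator {0..1} s *\<^sub>R (\<Sum>j\<in>UNIV. v $ j *\<^sub>R X j (w \<odot> dilation a t (s *\<^sub>R v))))" for w
  proof -
    let ?w = "dilation a (inverse t) w"
    have e: "dilation a (inverse t) (w \<odot> dilation a t y) = ?w \<odot> y" for y
      using t by (simp add: dilation_mult dilation_inverse)
    have "dilate a \<phi> t (w \<odot> dilation a t v) - dilate a \<phi> t w = of_real (t powr (- hom_dim a)) * (\<phi> (?w \<odot> v) - \<phi> ?w)"
      unfolding dilate_def e by (simp add: right_diff_distrib)
    also have "\<dots> = of_real (t powr (- hom_dim a)) * (LINT s|lborel. indicator {0..1} s *\<^sub>R (\<Sum>j\<in>UNIV. v $ j *\<^sub>R left_deriv (\<odot>) j \<phi> (?w \<odot> (s *\<^sub>R v))))"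
      by (simp only: left_difference_integral(1)[OF \<phi>])
    also have "\<dots> = (LINT s|lborel. of_real (t powr (- hom_dim a)) * (indicator {0..1} s *\<^sub>R (\<Sum>j\<in>UNIV. v $ j *\<^sub>R left_deriv (\<odot>) j \<phi> (?w \<odot> (s *\<^sub>R v)))))"
      by (rule integral_mult_right_zero[symmetric])
    also have "\<dots> = (LINT s|lborel. indicator {0..1} s *\<^sub>R (\<Sum>j\<in>UNIV. v $ j *\<^sub>R X j (w \<odot> dilation a t (s *\<^sub>R v))))"
      unfolding X_def dilate_def e by (simp add: sum_distrib_left)
    finally show ?thesis .
  qed
  define h where "h s z = indicator {0..1} s *\<^sub>R (\<Sum>j\<in>UNIV. v $ j *\<^sub>R (f z * X j ((- z) \<odot> (u \<odot> dilation a t (s *\<^sub>R v)))))" for s :: real and z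
  have h_meas: "(\<lambda>(s, z). h s z) \<in> borel_measurable (lborel \<Otimes>\<^sub>M lborel)"
    unfolding h_def by measurable
  have fint: "integrable lborel f" by (rule schwartz_integrable[OF f])
  define K where "K = (\<Sum>j\<in>UNIV. \<bar>v $ j\<bar> * B j)"
  have K: "K \<ge> 0" unfolding K_def using B by (intro sum_nonneg) auto
  have int: "integrable (lborel \<Otimes>\<^sub>M lborel) (\<lambda>(s, z). h s z)"
  proof (rule integrableI_bounded[OF h_meas])
    have "(\<integral>\<^sup>+p. ennreal (norm (case p of (s, z) \<Rightarrow> h s z)) \<partial>(lborel \<Otimes>\<^sub>M lborel))
      = (\<integral>\<^sup>+s. \<integral>\<^sup>+z. ennreal (norm (h s z)) \<partial>lborel \<partial>lborel)"
      using h_meas by (subst lborel.nn_integral_fst[symmetric]) (simp_all add: split_beta')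
    also have "\<dots> \<le> (\<integral>\<^sup>+s. \<integral>\<^sup>+z. ennreal K * indicator {0..1} s * ennreal (cmod (f z)) \<partial>lborel \<partial>(lborel :: real measure))"
    proof (intro nn_integral_mono)
      fix s :: real and z :: "real^'n::{finite,linorder}"
      have "cmod (\<Sum>j\<in>UNIV. v $ j *\<^sub>R (f z * X j ((- z) \<odot> (u \<odot> dilation a t (s *\<^sub>R v))))) \<le> (\<Sum>j\<in>UNIV. \<bar>v $ j\<bar> * (cmod (f z) * B j))"
        by (rule order.trans[OF norm_sum]) (auto simp: norm_mult intro!: sum_mono mult_left_mono B)
      also have "\<dots> = K * cmod (f z)" unfolding K_def sum_distrib_right by (intro sum.cong refl) simp
      finally show "ennreal (norm (h s z)) \<le> ennreal K * indicator {0..1} s * ennreal (cmod (f z))"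
        using K by (auto simp: h_def ennreal_leI split: split_indicator simp flip: ennreal_mult)
    qed
    also have "\<dots> = (ennreal K * emeasure lborel {0..1::real}) * (\<integral>\<^sup>+z. ennreal (cmod (f z)) \<partial>lborel)"
      by (simp add: nn_integral_cmult nn_integral_multc nn_integral_cmult_indicator)
    also have "\<dots> < \<infinity>" using fint by (simp add: integrable_iff_bounded ennreal_mult_less_top)
    finally show "(\<integral>\<^sup>+p. ennreal (norm (case p of (s, z) \<Rightarrow> h s z)) \<partial>(lborel \<Otimes>\<^sub>M lborel)) < \<infinity>" .
  qed
  have "(f \<star> dilate a \<phi> t) (u \<odot> dilation a t v) - (f \<star> dilate a \<phi> t) u
    = (LINT z|lborel. f z * dilate a \<phi> t ((- z) \<odot> (u \<odot> dilation a t v))) - (LINT z|lborel. f z * dilate a \<phi> t ((- z) \<odot> u))"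
    by (subst (1 2) conv_right_form) measurable
  also have "\<dots> = (LINT z|lborel. f z * dilate a \<phi> t ((- z) \<odot> (u \<odot> dilation a t v)) - f z * dilate a \<phi> t ((- z) \<odot> u))"
    by (rule Bochner_Integration.integral_diff[symmetric]; rule integrable_mult_bounded[OF fint _ B']; measurable)
  also have "\<dots> = (LINT z|lborel. LINT s|lborel. h s z)"
  proof (intro Bochner_Integration.integral_cong refl)
    fix z
    have "f z * dilate a \<phi> t ((- z) \<odot> (u \<odot> dilation a t v)) - f z * dilate a \<phi> t ((- z) \<odot> u)
       = f z * (dilate a \<phi> t (((- z) \<odot> u) \<odot> dilation a t v) - dilate a \<phi> t ((- z) \<odot> u))"
      by (simp add: right_diff_distrib assoc)
    also have "\<dots> = (LINT s|lborel. f z * (indicator {0..1} s *\<^sub>R (\<Sum>j\<in>UNIV. v $ j *\<^sub>R X j (((- z) \<odot> u) \<odot> dilation a t (s *\<^sub>R v)))))"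
      unfolding d\<phi> by (rule integral_mult_right_zero[symmetric])
    also have "\<dots> = (LINT s|lborel. h s z)"
      unfolding h_def by (simp add: assoc sum_distrib_left)
    finally show "f z * dilate a \<phi> t ((- z) \<odot> (u \<odot> dilation a t v)) - f z * dilate a \<phi> t ((- z) \<odot> u) = (LINT s|lborel. h s z)" .
  qed
  also have "\<dots> = (LINT s|lborel. LINT z|lborel. h s z)"
    by (rule lborel_pair.Fubini_integral[OF int])
  also have "\<dots> = (LINT s|lborel. indicator {0..1} s *\<^sub>R (\<Sum>j\<in>UNIV. v $ j *\<^sub>R (f \<star> X j) (u \<odot> dilation a t (s *\<^sub>R v))))"
  proof (intro Bochner_Integration.integral_cong refl)
    fix s :: real
    have "(LINT z|lborel. h s z) = indicator {0..1} s *\<^sub>R (\<Sum>j\<in>UNIV. v $ j *\<^sub>R (LINT z|lborel. f z * X j ((- z) \<odot> (u \<odot> dilation a t (s *\<^sub>R v)))))"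
      unfolding h_def integral_scaleR_right
    proof (subst Bochner_Integration.integral_sum)
      fix j
      show "integrable lborel (\<lambda>z. v $ j *\<^sub>R (f z * X j ((- z) \<odot> (u \<odot> dilation a t (s *\<^sub>R v)))))"
        by (intro integrable_scaleR_right integrable_mult_bounded[OF fint _ B(2)]) measurable
    qed simp
    also have "(\<lambda>j. LINT z|lborel. f z * X j ((- z) \<odot> (u \<odot> dilation a t (s *\<^sub>R v)))) = (\<lambda>j. (f \<star> X j) (u \<odot> dilation a t (s *\<^sub>R v)))"
      by (subst conv_right_form) measurable
    finally show "(LINT z|lborel. h s z) = indicator {0..1} s *\<^sub>R (\<Sum>j\<in>UNIV. v $ j *\<^sub>R (f \<star> X j) (u \<odot> dilation a t (s *\<^sub>R v)))" .
  qed
  finally show ?thesis unfolding X_def .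
qed

text \<open>The mean value theorem over a displacement of size \<open>\<delta> t\<close>. All points met on the way are at
  distance at most a multiple of \<open>t\<close> from \<open>x y\<^sup>-\<^sup>1\<close>, so their Peetre weights are comparable.\<close>

lemma conv_pointwise_difference:
  assumes f: "f \<in> schwartz" and \<phi>: "\<phi> \<in> schwartz" and t: "t > 0" and N: "N \<ge> 0"
    and \<delta>: "0 < \<delta>" "\<delta> \<le> 1" and v: "\<rho> v < \<delta>"
  shows "ennreal (cmod ((f \<star> dilate a \<phi> t) (x \<odot> (- y))))
    \<le> ennreal (cmod ((f \<star> dilate a \<phi> t) ((x \<odot> (- y)) \<odot> dilation a t v)))
      + ennreal (\<delta> * ((2 * c0) powr N * (1 + \<rho> y / t) powr N)) * (\<Sum>j\<in>UNIV. Pm N f (left_deriv (\<odot>) j \<phi>) t x)"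
proof -
  let ?F = "f \<star> dilate a \<phi> t" and ?u = "x \<odot> (- y)" and ?X = "\<lambda>j. left_deriv (\<odot>) j \<phi>"
  let ?Y = "1 + \<rho> y / t" and ?c = "(2 * c0) powr N * (1 + \<rho> y / t) powr N"
  let ?D = "\<lambda>s. indicator {0..1} s *\<^sub>R (\<Sum>j\<in>UNIV. v $ j *\<^sub>R (f \<star> dilate a (?X j) t) (?u \<odot> dilation a t (s *\<^sub>R v)))"
  have Xr: "rapid (?X j)" for j by (rule left_deriv_path(1)[OF \<phi>])
  have normv: "norm v \<le> \<delta>"
  proof -
    have "\<rho> (dilation a (inverse \<delta>) v) < 1"
      using v \<delta> mult_strict_left_mono[OF v, of "inverse \<delta>"] by (simp add: rho_dilation)
    then have "norm (dilation a (inverse \<delta>) v) < 1" by (simp add: rho_less_1_iff)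
    then have "\<delta> * norm (dilation a (inverse \<delta>) v) \<le> \<delta> * 1"
      using \<delta> by (intro mult_left_mono) auto
    moreover have "norm v \<le> \<delta> * norm (dilation a (inverse \<delta>) v)"
      using norm_dilation_le[OF \<delta>, of "dilation a (inverse \<delta>) v"] \<delta> by (simp add: dilation_inverse)
    ultimately show ?thesis by linarith
  qed
  have FX: "ennreal (cmod ((f \<star> dilate a (?X j) t) (?u \<odot> dilation a t (s *\<^sub>R v)))) \<le> Pm N f (?X j) t x * ennreal ?c"
    if s: "0 \<le> s" "s \<le> 1" for j s
  proof -
    let ?w = "(- dilation a t (s *\<^sub>R v)) \<odot> y"
    have e: "?u \<odot> dilation a t (s *\<^sub>R v) = x \<odot> (- ?w)" by (simp add: minus_mul assoc)
    have "norm (s *\<^sub>R v) \<le> 1"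
      using s normv \<delta> mult_mono[of s 1 "norm v" 1] by simp
    then have "\<rho> (s *\<^sub>R v) \<le> 1" by (simp add: rho_le_1_iff)
    then have "1 + \<rho> (- dilation a t (s *\<^sub>R v)) / t \<le> 2"
      using t by (simp add: rho_inverse rho_dilation)
    then have "c0 * ((1 + \<rho> (- dilation a t (s *\<^sub>R v)) / t) * ?Y) \<le> c0 * (2 * ?Y)"
      using c0(1) t by (intro mult_left_mono mult_right_mono) auto
    then have "1 + \<rho> ?w / t \<le> 2 * c0 * ?Y"
      using one_plus_rho_mul_le[OF t, of "- dilation a t (s *\<^sub>R v)" y] by linarith
    then have "(1 + \<rho> ?w / t) powr N \<le> (2 * c0 * ?Y) powr N"
      using N t by (intro powr_mono2) auto
    also have "\<dots> = ?c" by (rule powr_mult)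
    finally have le: "(1 + \<rho> ?w / t) powr N \<le> ?c" .
    have "ennreal (cmod ((f \<star> dilate a (?X j) t) (x \<odot> (- ?w)))) \<le> Pm N f (?X j) t x * ennreal ((1 + \<rho> ?w / t) powr N)"
      by (rule Pm_ge[OF f Xr t])
    also have "\<dots> \<le> Pm N f (?X j) t x * ennreal ?c"
      by (intro mult_left_mono ennreal_leI le) auto
    finally show ?thesis unfolding e .
  qed
  have "ennreal (cmod (?F (?u \<odot> dilation a t v) - ?F ?u)) \<le> (\<integral>\<^sup>+s. ennreal (cmod (?D s)) \<partial>lborel)"
    unfolding conv_difference[OF f \<phi> t] by (rule norm_integral_le_nn_integral)
  also have "\<dots> \<le> (\<integral>\<^sup>+s. ennreal (\<delta> * ?c) * (\<Sum>j\<in>UNIV. Pm N f (?X j) t x) * indicator {0..1::real} s \<partial>lborel)"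
  proof (rule nn_integral_mono)
    fix s :: real
    show "ennreal (cmod (?D s)) \<le> ennreal (\<delta> * ?c) * (\<Sum>j\<in>UNIV. Pm N f (?X j) t x) * indicator {0..1} s"
    proof (cases "s \<in> {0..1}")
      case True
      have "ennreal (cmod (?D s)) \<le> ennreal (\<Sum>j\<in>UNIV. \<delta> * cmod ((f \<star> dilate a (?X j) t) (?u \<odot> dilation a t (s *\<^sub>R v))))"
      proof (rule ennreal_leI)
        have "cmod (?D s) \<le> (\<Sum>j\<in>UNIV. \<bar>v $ j\<bar> * cmod ((f \<star> dilate a (?X j) t) (?u \<odot> dilation a t (s *\<^sub>R v))))"
          using True by (simp add: order.trans[OF norm_sum])
        also have "\<dots> \<le> (\<Sum>j\<in>UNIV. \<delta> * cmod ((f \<star> dilate a (?X j) t) (?u \<odot> dilation a t (s *\<^sub>R v))))"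
          by (intro sum_mono mult_right_mono order.trans[OF component_le_norm_cart normv]) auto
        finally show "cmod (?D s) \<le> \<dots>" .
      qed
      also have "\<dots> = (\<Sum>j\<in>UNIV. ennreal \<delta> * ennreal (cmod ((f \<star> dilate a (?X j) t) (?u \<odot> dilation a t (s *\<^sub>R v)))))"
        using \<delta> by (simp add: ennreal_mult flip: sum_ennreal)
      also have "\<dots> \<le> (\<Sum>j\<in>UNIV. ennreal \<delta> * (Pm N f (?X j) t x * ennreal ?c))"
        using True by (intro sum_mono mult_left_mono FX) auto
      also have "\<dots> = ennreal (\<delta> * ?c) * (\<Sum>j\<in>UNIV. Pm N f (?X j) t x)"
        using \<delta> by (simp add: ennreal_mult sum_distrib_left mult_ac)
      finally show ?thesis using True by simp
    qed simp
  qed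
  also have "\<dots> = ennreal (\<delta> * ?c) * (\<Sum>j\<in>UNIV. Pm N f (?X j) t x)"
    by (simp add: nn_integral_cmult_indicator)
  finally have diff: "ennreal (cmod (?F (?u \<odot> dilation a t v) - ?F ?u)) \<le> ennreal (\<delta> * ?c) * (\<Sum>j\<in>UNIV. Pm N f (?X j) t x)" .
  have "cmod (?F ?u) \<le> cmod (?F (?u \<odot> dilation a t v)) + cmod (?F (?u \<odot> dilation a t v) - ?F ?u)"
    by (metis add.commute norm_minus_commute norm_triangle_sub)
  then have "ennreal (cmod (?F ?u)) \<le> ennreal (cmod (?F (?u \<odot> dilation a t v))) + ennreal (cmod (?F (?u \<odot> dilation a t v) - ?F ?u))"
    by (simp add: ennreal_leI flip: ennreal_plus)
  then show ?thesis using diff by (meson add_left_mono order.trans)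
qed

text \<open>The ball of radius \<open>\<delta> t\<close> around \<open>x y\<^sup>-\<^sup>1\<close> lies in a ball around \<open>x\<close> of radius comparable to
  \<open>t + \<rho> y\<close>; the ratio of their measures is the factor on the right.\<close>

lemma nn_integral_ball_le_maxop:
  assumes [measurable]: "h \<in> borel_measurable borel" and t: "t > 0" and \<delta>: "0 < \<delta>" "\<delta> \<le> 1"
  shows "(\<integral>\<^sup>+v\<in>{v. \<rho> v < \<delta>}. h ((x \<odot> (- y)) \<odot> dilation a t v) \<partial>lborel)
    \<le> maxop group_dist lborel h x * ennreal ((2 * c0) powr hom_dim a * (1 + \<rho> y / t) powr hom_dim a * \<delta> powr (- hom_dim a))
        * emeasure lborel {v. \<rho> v < \<delta>}"
proof -
  interpret homogeneous_type group_dist lborel c0 "2 powr hom_dim a" by (rule homogeneous_type)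
  let ?u = "x \<odot> (- y)" and ?g = "hom_dim a" and ?Y = "1 + \<rho> y / t"
  let ?I = "\<integral>\<^sup>+v\<in>{v. \<rho> v < \<delta>}. h (?u \<odot> dilation a t v) \<partial>lborel"
  let ?b = "emeasure lborel (ball (0 :: real^'n::{finite,linorder}) 1)"
  \<comment> \<open>By the quasi-triangle inequality the ball of radius \<open>R\<close> around \<open>x\<close> contains the small ball.\<close>
  define R where "R = c0 * (\<rho> y + t)"
  have R: "R > 0" using c0(1) t by (simp add: R_def add_nonneg_pos)
  obtain k :: int where k: "R \<le> 2 powr k" "2 powr k \<le> 2 * R" using ex_dyadic_between[OF R] by blast
  have "ennreal (t powr ?g) * ?I = (\<integral>\<^sup>+v. h (?u \<odot> v) * indicator {v. \<rho> v < \<delta> * t} v \<partial>lborel)"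
  proof -
    have "(\<integral>\<^sup>+v. h (?u \<odot> v) * indicator {v. \<rho> v < \<delta> * t} v \<partial>lborel)
      = ennreal (t powr ?g) * (\<integral>\<^sup>+v. h (?u \<odot> dilation a t v) * indicator {v. \<rho> v < \<delta> * t} (dilation a t v) \<partial>lborel)"
      by (rule nn_integral_dilation[OF t]) measurable
    also have "(\<integral>\<^sup>+v. h (?u \<odot> dilation a t v) * indicator {v. \<rho> v < \<delta> * t} (dilation a t v) \<partial>lborel) = ?I"
      using t by (intro nn_integral_cong) (auto simp: rho_dilation mult.commute[of t] split: split_indicator)
    finally show ?thesis ..
  qed
  also have "\<dots> = (\<integral>\<^sup>+z. h (?u \<odot> ((- ?u) \<odot> z)) * indicator {v. \<rho> v < \<delta> * t} ((- ?u) \<odot> z) \<partial>lborel)"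
    by (rule nn_integral_left_translate[symmetric]) measurable
  also have "\<dots> \<le> (\<integral>\<^sup>+z\<in>qball group_dist x (2 powr k). h z \<partial>lborel)"
  proof (rule nn_integral_mono)
    fix z
    have "z \<in> qball group_dist x (2 powr k)" if z: "\<rho> ((- ?u) \<odot> z) < \<delta> * t"
    proof -
      have "(- x) \<odot> z = (- y) \<odot> ((- ?u) \<odot> z)" by (simp add: minus_mul flip: assoc)
      then have "\<rho> ((- x) \<odot> z) \<le> c0 * (\<rho> y + \<rho> ((- ?u) \<odot> z))"
        using c0(2)[of "- y" "(- ?u) \<odot> z"] by (simp add: rho_inverse)
      also have "\<dots> < c0 * (\<rho> y + \<delta> * t)" using c0(1) z by simp
      also have "\<dots> \<le> R"
        unfolding R_def using c0(1) t \<delta> by (intro mult_left_mono add_left_mono) (auto simp: mult_left_le_one_le)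
      finally have "\<rho> ((- x) \<odot> z) < 2 powr k" using k by simp
      then show ?thesis using d_sym[of x z] by (simp add: qball_def)
    qed
    then show "h (?u \<odot> ((- ?u) \<odot> z)) * indicator {v. \<rho> v < \<delta> * t} ((- ?u) \<odot> z) \<le> h z * indicator (qball group_dist x (2 powr k)) z"
      by (auto simp flip: assoc split: split_indicator)
  qed
  also have "\<dots> \<le> maxop group_dist lborel h x * emeasure lborel (qball group_dist x (2 powr k))"
    by (rule average_le_maxop)
  also have "emeasure lborel (qball group_dist x (2 powr k)) = ennreal ((2 powr k) powr ?g) * ?b"
    unfolding gball_eq_qball[symmetric] by (rule emeasure_gball) simp
  also have "maxop group_dist lborel h x * (ennreal ((2 powr k) powr ?g) * ?b)
     \<le> maxop group_dist lborel h x * (ennreal (t powr ?g * ((2 * c0) powr ?g * ?Y powr ?g)) * ?b)"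
  proof (intro mult_left_mono mult_right_mono ennreal_leI)
    have "(2 powr k) powr ?g \<le> (2 * R) powr ?g"
      using k hom_dim_ge_2 by (intro powr_mono2) auto
    also have "2 * R = t * (2 * c0 * ?Y)" using t by (simp add: R_def field_simps)
    also have "\<dots> powr ?g = t powr ?g * ((2 * c0) powr ?g * ?Y powr ?g)" by (simp only: powr_mult)
    finally show "(2 powr k) powr ?g \<le> t powr ?g * ((2 * c0) powr ?g * ?Y powr ?g)" .
  qed auto
  also have "\<dots> = ennreal (t powr ?g) * (maxop group_dist lborel h x * ennreal ((2 * c0) powr ?g * ?Y powr ?g) * ?b)"
    by (simp add: ennreal_mult mult_ac)
  finally have "?I \<le> maxop group_dist lborel h x * ennreal ((2 * c0) powr ?g * ?Y powr ?g) * ?b"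
    using t by (subst (asm) ennreal_mult_le_mult_iff) auto
  also have "?b = ennreal (\<delta> powr (- ?g)) * emeasure lborel {v. \<rho> v < \<delta>}"
  proof -
    have "\<delta> powr (- ?g) * \<delta> powr ?g = 1" using \<delta> by (simp flip: powr_add)
    then show ?thesis
      unfolding emeasure_rho_ball[OF \<delta>(1)] by (simp flip: mult.assoc ennreal_mult)
  qed
  finally show ?thesis by (simp add: ennreal_mult mult.assoc)
qed

text \<open>The pointwise difference is averaged over \<open>\<rho> v < \<delta>\<close>. Since \<open>N r\<close> is the homogeneous dimension,
  the growth of the ratio of measures in \<open>y\<close> is exactly compensated by the \<open>r\<close>-th power of the
  Peetre weight.\<close>

lemma Pm_sub_mean_value:
  assumes f: "f \<in> schwartz" and \<phi>: "\<phi> \<in> schwartz" and t: "t > 0" and N: "N > 0"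
    and \<delta>: "0 < \<delta>" "\<delta> \<le> 1"
  defines "r \<equiv> hom_dim a / N"
  shows "epowr (Pm N f \<phi> t x) r \<le> ennreal (2 powr r * (2 * c0) powr hom_dim a) *
    (ennreal (\<delta> powr (- hom_dim a)) * maxop group_dist lborel (\<lambda>z. ennreal (cmod ((f \<star> dilate a \<phi> t) z) powr r)) x
      + ennreal (\<delta> powr r) * epowr (\<Sum>j\<in>UNIV. Pm N f (left_deriv (\<odot>) j \<phi>) t x) r)"
    (is "_ \<le> ?c * (?d * ?M + ?e * ?S)")
proof -
  let ?g = "hom_dim a" and ?F = "f \<star> dilate a \<phi> t"
  let ?h = "\<lambda>z. ennreal (cmod (?F z) powr r)"
  let ?V = "{v. \<rho> v < \<delta>}" and ?m = "emeasure lborel {v. \<rho> v < \<delta>}"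
  note [measurable] = schwartz_measurable[OF f] schwartz_measurable[OF \<phi>]
  have r: "r > 0" "N * r = ?g" using N hom_dim_ge_2 by (auto simp: r_def)
  have m: "?m \<noteq> 0" "?m \<noteq> top"
    using unit_ball_measure \<delta> by (auto simp: emeasure_rho_ball ennreal_mult_eq_top_iff)
  have "Pm N f \<phi> t x \<le> epowr (?c * (?d * ?M + ?e * ?S)) (1 / r)"
  proof (rule Pm_leI)
    fix y
    let ?u = "x \<odot> (- y)" and ?Y = "1 + \<rho> y / t"
    have Y: "?Y \<ge> 1" by (rule one_plus_rho_pos[OF t])
    let ?A = "(2 * c0) powr ?g * ?Y powr ?g"
    have A: "((2 * c0) powr N * ?Y powr N) powr r = ?A"
      using r by (simp add: powr_mult powr_powr)
    have pt: "ennreal (cmod (?F ?u) powr r) \<le> ennreal (2 powr r) * (?h (?u \<odot> dilation a t v) + ennreal (\<delta> powr r * ?A) * ?S)"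
      if v: "v \<in> ?V" for v
    proof -
      have "epowr (ennreal (cmod (?F ?u))) r \<le> epowr (ennreal (cmod (?F (?u \<odot> dilation a t v)))
         + ennreal (\<delta> * ((2 * c0) powr N * ?Y powr N)) * (\<Sum>j\<in>UNIV. Pm N f (left_deriv (\<odot>) j \<phi>) t x)) r"
        using v r N by (intro epowr_mono conv_pointwise_difference[OF f \<phi> t _ \<delta>]) auto
      also have "\<dots> \<le> ennreal (2 powr r) * (epowr (ennreal (cmod (?F (?u \<odot> dilation a t v)))) r
         + epowr (ennreal (\<delta> * ((2 * c0) powr N * ?Y powr N)) * (\<Sum>j\<in>UNIV. Pm N f (left_deriv (\<odot>) j \<phi>) t x)) r)"
        by (rule epowr_add_le[OF r(1)])
      also have "epowr (ennreal (\<delta> * ((2 * c0) powr N * ?Y powr N)) * (\<Sum>j\<in>UNIV. Pm N f (left_deriv (\<odot>) j \<phi>) t x)) r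
         = ennreal (\<delta> powr r * ?A) * ?S"
        using r \<delta> by (simp add: epowr_mult A powr_mult[of \<delta>])
      finally show ?thesis by simp
    qed
    have "?m * ennreal (cmod (?F ?u) powr r) = (\<integral>\<^sup>+v\<in>?V. ennreal (cmod (?F ?u) powr r) \<partial>lborel)"
      by (subst nn_integral_cmult_indicator) (auto simp: mult.commute)
    also have "\<dots> \<le> (\<integral>\<^sup>+v. ennreal (2 powr r) * (?h (?u \<odot> dilation a t v) * indicator ?V v + ennreal (\<delta> powr r * ?A) * ?S * indicator ?V v) \<partial>lborel)"
      using pt by (intro nn_integral_mono) (auto split: split_indicator)
    also have "\<dots> = ennreal (2 powr r) * ((\<integral>\<^sup>+v\<in>?V. ?h (?u \<odot> dilation a t v) \<partial>lborel) + ennreal (\<delta> powr r * ?A) * ?S * ?m)"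
      by (subst nn_integral_cmult, measurable, subst nn_integral_add, measurable) (simp add: nn_integral_cmult_indicator)
    also have "\<dots> \<le> ennreal (2 powr r) * (?M * ennreal (?A * \<delta> powr (- ?g)) * ?m + ennreal (\<delta> powr r * ?A) * ?S * ?m)"
      by (intro mult_left_mono add_right_mono nn_integral_ball_le_maxop t \<delta>) auto
    also have "\<dots> = ?m * (?c * (?d * ?M + ?e * ?S) * ennreal (?Y powr ?g))"
      by (simp add: ennreal_mult distrib_left distrib_right mult_ac)
    finally have le: "ennreal (cmod (?F ?u) powr r) \<le> ?c * (?d * ?M + ?e * ?S) * ennreal (?Y powr ?g)"
      using m by (subst (asm) ennreal_mult_le_mult_iff) auto
    have "epowr (ennreal (cmod (?F ?u)) * ennreal (?Y powr (- N))) r = ennreal (cmod (?F ?u) powr r) * ennreal (?Y powr (- ?g))"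
      using r by (simp add: epowr_mult powr_powr)
    also have "\<dots> \<le> ?c * (?d * ?M + ?e * ?S) * ennreal (?Y powr ?g) * ennreal (?Y powr (- ?g))"
      by (intro mult_right_mono le) auto
    also have "\<dots> = ?c * (?d * ?M + ?e * ?S) * (ennreal (?Y powr ?g) * ennreal (?Y powr (- ?g)))"
      by (rule mult.assoc)
    also have "ennreal (?Y powr ?g) * ennreal (?Y powr (- ?g)) = 1"
      using Y by (simp flip: ennreal_mult powr_add)
    finally show "ennreal (cmod (?F ?u)) * ennreal (?Y powr (- N)) \<le> epowr (?c * (?d * ?M + ?e * ?S)) (1 / r)"
      using r by (subst (asm) epowr_le_iff) auto
  qed
  then show ?thesis using r by (subst epowr_le_iff) auto
qed

lemma measurable_maxop_conv:
  assumes [measurable]: "f \<in> borel_measurable borel" "\<phi> \<in> borel_measurable borel"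
  shows "(\<lambda>t. maxop group_dist lborel (\<lambda>z. ennreal (cmod ((f \<star> dilate a \<phi> t) z) powr r)) x) \<in> borel_measurable borel"
    and "(\<lambda>z. maxop group_dist lborel (\<lambda>y. ennreal (cmod ((f \<star> dilate a \<phi> (snd z)) y) powr r)) (fst z)) \<in> borel_measurable (borel \<Otimes>\<^sub>M borel)"
proof -
  interpret homogeneous_type group_dist lborel c0 "2 powr hom_dim a" by (rule homogeneous_type)
  have "(\<lambda>z. ennreal (cmod ((f \<star> dilate a \<phi> (fst z)) (snd z)) powr r)) \<in> borel_measurable (borel \<Otimes>\<^sub>M borel)"
    by measurable
  from measurable_maxop_pair[OF this]
  show m: "(\<lambda>z. maxop group_dist lborel (\<lambda>y. ennreal (cmod ((f \<star> dilate a \<phi> (snd z)) y) powr r)) (fst z)) \<in> borel_measurable (borel \<Otimes>\<^sub>M borel)"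
    by (simp only: fst_conv snd_conv)
  have "(\<lambda>t :: real. (x, t)) \<in> measurable borel (borel \<Otimes>\<^sub>M borel)" by measurable
  from measurable_compose[OF this m]
  show "(\<lambda>t. maxop group_dist lborel (\<lambda>z. ennreal (cmod ((f \<star> dilate a \<phi> t) z) powr r)) x) \<in> borel_measurable borel"
    by (simp only: fst_conv snd_conv)
qed

text \<open>This is what makes the absorption of the oscillation term legitimate.\<close>

lemma Pm_finite_norm:
  assumes f: "f \<in> schwartz" and \<phi>: "\<phi> \<in> schwartz" "(LINT x|lborel. \<phi> x) = 0" and q: "q > 0" and N: "N \<ge> 0"
  shows "(\<integral>\<^sup>+t. epowr (Pm N f \<phi> t x) q \<partial>dt_over_t) < top"
proof -
  obtain C where C: "C \<ge> 0" "\<And>t x. t > 0 \<Longrightarrow> cmod ((f \<star> dilate a \<phi> t) x) \<le> C * log_decay 1 t"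
    using conv_dilate_uniform_bound[OF f \<phi>] by blast
  have "(\<integral>\<^sup>+t. epowr (Pm N f \<phi> t x) q \<partial>dt_over_t) \<le> (\<integral>\<^sup>+t. ennreal (C powr q) * ennreal (log_decay q t) \<partial>dt_over_t)"
  proof (rule nn_integral_mono_AE, use AE_dt_over_t_pos in eventually_elim)
    fix t :: real assume t: "t > 0"
    have "Pm N f \<phi> t x \<le> ennreal (C * log_decay 1 t)"
    proof (rule Pm_leI)
      fix y
      have "(1 + \<rho> y / t) powr (- N) \<le> 1 powr (- N)"
        using N one_plus_rho_pos[OF t, of y] by (intro powr_mono2') auto
      then have "cmod ((f \<star> dilate a \<phi> t) (x \<odot> (- y))) * (1 + \<rho> y / t) powr (- N) \<le> (C * log_decay 1 t) * 1"
        using C(1) by (intro mult_mono C(2)[OF t]) auto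
      then show "ennreal (cmod ((f \<star> dilate a \<phi> t) (x \<odot> (- y)))) * ennreal ((1 + \<rho> y / t) powr (- N)) \<le> ennreal (C * log_decay 1 t)"
        by (simp add: ennreal_leI flip: ennreal_mult)
    qed
    then have "epowr (Pm N f \<phi> t x) q \<le> epowr (ennreal (C * log_decay 1 t)) q"
      using q by (intro epowr_mono) auto
    also have "\<dots> = ennreal (C powr q) * ennreal (log_decay q t)"
      using C(1) t by (simp add: powr_mult log_decay_def powr_powr flip: ennreal_mult)
    finally show "epowr (Pm N f \<phi> t x) q \<le> ennreal (C powr q) * ennreal (log_decay q t)" .
  qed
  also have "\<dots> = ennreal (C powr q) * (\<integral>\<^sup>+t. ennreal (log_decay q t) \<partial>dt_over_t)"
    by (rule nn_integral_cmult) measurable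
  also have "\<dots> < top"
    using nn_integral_log_decay[OF q] by (simp add: ennreal_mult_less_top)
  finally show ?thesis .
qed

text \<open>The pointwise superposition estimate followed by Schur's test.\<close>

lemma Pm_norm_le_superposition:
  fixes \<phi> \<eta> :: "nat \<Rightarrow> real^'n::{finite,linorder} \<Rightarrow> complex"
  assumes \<phi>: "\<And>l. l \<in> {1..M} \<Longrightarrow> \<phi> l \<in> schwartz \<and> (LINT x|lborel. \<phi> l x) = 0"
    and \<eta>: "\<And>l. l \<in> {1..M} \<Longrightarrow> \<eta> l \<in> schwartz"
    and rep: "\<And>f x. f \<in> schwartz \<Longrightarrow> f x = (\<Sum>l=1..M. LINT t|dt_over_t. ((f \<star> dilate a (\<phi> l) t) \<star> dilate a (\<eta> l) t) x)"
    and \<psi>: "rapid \<psi>" "(LINT x|lborel. \<psi> x) = 0" and N: "N > 0" and \<epsilon>: "\<epsilon> > 0" and q: "q \<ge> 1"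
    and C1: "\<And>l. l \<in> {1..M} \<Longrightarrow> (\<eta> l, \<psi>) \<in> class_C1 (\<odot>) a \<rho> (N + \<epsilon>) N"
  shows "\<exists>C\<ge>0. \<forall>f\<in>schwartz. \<forall>x. (\<integral>\<^sup>+s. epowr (Pm N f \<psi> s x) q \<partial>dt_over_t)
    \<le> ennreal C * (\<Sum>l=1..M. \<integral>\<^sup>+t. epowr (Pm N f (\<phi> l) t x) q \<partial>dt_over_t)"
proof -
  let ?e = "min \<epsilon> 1"
  have e: "?e > 0" using \<epsilon> by simp
  have "\<forall>l\<in>{1..M}. \<exists>C\<ge>0. \<forall>u>0. ennreal (max 1 u powr N) * conv_moment (\<odot>) a \<rho> (\<eta> l) \<psi> u N \<le> ennreal (C * log_decay ?e u)"
    using conv_moment_decay[OF C1 \<epsilon> _ \<psi>(2)] N by auto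
  then obtain c where c: "\<And>l. l \<in> {1..M} \<Longrightarrow> c l \<ge> 0"
    "\<And>l u. l \<in> {1..M} \<Longrightarrow> u > 0 \<Longrightarrow> ennreal (max 1 u powr N) * conv_moment (\<odot>) a \<rho> (\<eta> l) \<psi> u N \<le> ennreal (c l * log_decay ?e u)"
    using bchoice[of "{1..M}" "\<lambda>l C. C \<ge> 0 \<and> (\<forall>u>0. ennreal (max 1 u powr N) * conv_moment (\<odot>) a \<rho> (\<eta> l) \<psi> u N \<le> ennreal (C * log_decay ?e u))"]
    by blast
  define C where "C = (\<Sum>l=1..M. c l)"
  have C: "C \<ge> 0" unfolding C_def using c(1) by (intro sum_nonneg) auto
  have cC: "c l \<le> C" if "l \<in> {1..M}" for l
    unfolding C_def using that c(1) by (intro member_le_sum) auto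
  have moment: "ennreal (max 1 u powr N) * conv_moment (\<odot>) a \<rho> (\<eta> l) \<psi> u N \<le> ennreal (C * log_decay ?e u)"
    if "l \<in> {1..M}" "u > 0" for l u
    by (rule order.trans[OF c(2)[OF that]]) (intro ennreal_leI mult_right_mono cC that, simp)
  obtain C2 where C2: "C2 \<ge> 0" "\<And>h. h \<in> borel_measurable borel \<Longrightarrow>
    (\<integral>\<^sup>+s. epowr (\<integral>\<^sup>+t. h t * ennreal (log_decay ?e (s / t)) \<partial>dt_over_t) q \<partial>dt_over_t)
    \<le> ennreal C2 * (\<integral>\<^sup>+t. epowr (h t) q \<partial>dt_over_t)"
    using Schur_log_decay[OF q e] by blast
  define A where "A = c0 powr N * C"
  have A: "A \<ge> 0" using C by (simp add: A_def)
  show ?thesis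
  proof (intro exI[of _ "A powr q * real M powr q * C2"] conjI ballI allI)
    show "0 \<le> A powr q * real M powr q * C2" using C2 by simp
    fix f :: "real^'n::{finite,linorder} \<Rightarrow> complex" and x assume f: "f \<in> schwartz"
    note [measurable] = schwartz_measurable[OF f]
    have meas: "(\<lambda>t. Pm N f (\<phi> l) t x) \<in> borel_measurable borel" if "l \<in> {1..M}" for l
      using \<phi>[OF that] schwartz_measurable by (intro measurable_Pm) auto
    let ?H = "\<lambda>l s. \<integral>\<^sup>+t. Pm N f (\<phi> l) t x * ennreal (log_decay ?e (s / t)) \<partial>dt_over_t"
    have Hmeas: "(\<lambda>s. epowr (?H l s) q) \<in> borel_measurable borel" if "l \<in> {1..M}" for l
    proof -
      note [measurable] = meas[OF that]
      show ?thesis by measurable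
    qed
    have "(\<integral>\<^sup>+s. epowr (Pm N f \<psi> s x) q \<partial>dt_over_t) \<le> (\<integral>\<^sup>+s. (\<Sum>l=1..M. ennreal (A powr q * real M powr q) * epowr (?H l s) q) \<partial>dt_over_t)"
    proof (rule nn_integral_mono_AE, use AE_dt_over_t_pos in eventually_elim)
      fix s :: real assume s: "s > 0"
      have "Pm N f \<psi> s x \<le> ennreal A * (\<Sum>l=1..M. ?H l s)"
        unfolding A_def
        by (rule Pm_le_superposition[OF \<phi> \<eta> rep[OF f] f \<psi>(1) s _ C moment]) (use N in auto)
      then have "epowr (Pm N f \<psi> s x) q \<le> epowr (ennreal A * (\<Sum>l=1..M. ?H l s)) q"
        using q by (intro epowr_mono) auto
      also have "\<dots> = ennreal (A powr q) * epowr (\<Sum>l=1..M. ?H l s) q"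
        using q A by (simp add: epowr_mult)
      also have "\<dots> \<le> ennreal (A powr q) * (ennreal (real M powr q) * (\<Sum>l=1..M. epowr (?H l s) q))"
        using epowr_sum_le[of "{1..M}" q "\<lambda>l. ?H l s"] q by (intro mult_left_mono) auto
      also have "\<dots> = (\<Sum>l=1..M. ennreal (A powr q * real M powr q) * epowr (?H l s) q)"
        by (simp add: ennreal_mult sum_distrib_left mult.assoc)
      finally show "epowr (Pm N f \<psi> s x) q \<le> (\<Sum>l=1..M. ennreal (A powr q * real M powr q) * epowr (?H l s) q)" .
    qed
    also have "\<dots> = (\<Sum>l=1..M. \<integral>\<^sup>+s. ennreal (A powr q * real M powr q) * epowr (?H l s) q \<partial>dt_over_t)"
      using Hmeas by (intro nn_integral_sum) auto
    also have "\<dots> = (\<Sum>l=1..M. ennreal (A powr q * real M powr q) * (\<integral>\<^sup>+s. epowr (?H l s) q \<partial>dt_over_t))"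
      using Hmeas by (intro sum.cong refl nn_integral_cmult) auto
    also have "\<dots> \<le> (\<Sum>l=1..M. ennreal (A powr q * real M powr q) * (ennreal C2 * (\<integral>\<^sup>+t. epowr (Pm N f (\<phi> l) t x) q \<partial>dt_over_t)))"
      by (intro sum_mono mult_left_mono C2(2) meas) auto
    also have "\<dots> = ennreal (A powr q * real M powr q * C2) * (\<Sum>l=1..M. \<integral>\<^sup>+t. epowr (Pm N f (\<phi> l) t x) q \<partial>dt_over_t)"
      using C2 by (simp add: ennreal_mult sum_distrib_left mult.assoc)
    finally show "(\<integral>\<^sup>+s. epowr (Pm N f \<psi> s x) q \<partial>dt_over_t) \<le> \<dots>" .
  qed
qed

text \<open>Left-invariant derivatives have mean zero, by invariance of the integral under right translation.\<close>

lemma integral_left_deriv: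
  assumes \<phi>: "\<phi> \<in> schwartz"
  shows "(LINT x|lborel. left_deriv (\<odot>) k \<phi> x) = 0"
proof -
  let ?X = "left_deriv (\<odot>) k \<phi>" and ?e = "axis k 1 :: real^'n::{finite,linorder}"
  have Xr: "rapid ?X" by (rule left_deriv_path(1)[OF \<phi>])
  note [measurable] = schwartz_measurable[OF \<phi>] rapid_measurable[OF Xr]
  have sum: "(\<Sum>j\<in>UNIV. ?e $ j *\<^sub>R left_deriv (\<odot>) j \<phi> z) = ?X z" for z
    by (simp add: axis_def if_distrib if_distribR cong: if_cong)
  define h where "h s x = indicator {0..1} s *\<^sub>R ?X (x \<odot> (s *\<^sub>R ?e))" for s :: real and x
  have h_meas: "(\<lambda>(s, x). h s x) \<in> borel_measurable (lborel \<Otimes>\<^sub>M lborel)"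
    unfolding h_def by measurable
  have fin: "(\<integral>\<^sup>+x. ennreal (cmod (?X x)) \<partial>lborel) < top"
    using rapid_integrable[OF Xr] by (simp add: integrable_iff_bounded)
  have int: "integrable (lborel \<Otimes>\<^sub>M lborel) (\<lambda>(s, x). h s x)"
  proof (rule integrableI_bounded[OF h_meas])
    have "(\<integral>\<^sup>+p. ennreal (norm (case p of (s, x) \<Rightarrow> h s x)) \<partial>(lborel \<Otimes>\<^sub>M lborel))
      = (\<integral>\<^sup>+s. \<integral>\<^sup>+x. ennreal (norm (h s x)) \<partial>lborel \<partial>lborel)"
      using h_meas by (subst lborel.nn_integral_fst[symmetric]) (simp_all add: split_beta')
    also have "\<dots> = (\<integral>\<^sup>+s. (\<integral>\<^sup>+x. ennreal (cmod (?X x)) \<partial>lborel) * indicator {0..1::real} s \<partial>lborel)"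
    proof (intro nn_integral_cong)
      fix s :: real
      have "(\<integral>\<^sup>+x. ennreal (cmod (?X (x \<odot> (s *\<^sub>R ?e)))) \<partial>lborel) = (\<integral>\<^sup>+x. ennreal (cmod (?X x)) \<partial>lborel)"
        by (rule nn_integral_right_translate) measurable
      then show "(\<integral>\<^sup>+x. ennreal (norm (h s x)) \<partial>lborel) = (\<integral>\<^sup>+x. ennreal (cmod (?X x)) \<partial>lborel) * indicator {0..1} s"
        by (cases "s \<in> {0..1}") (auto simp: h_def)
    qed
    also have "\<dots> < \<infinity>" using fin by (simp add: nn_integral_cmult_indicator ennreal_mult_less_top)
    finally show "(\<integral>\<^sup>+p. ennreal (norm (case p of (s, x) \<Rightarrow> h s x)) \<partial>(lborel \<Otimes>\<^sub>M lborel)) < \<infinity>" .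
  qed
  have \<phi>i: "integrable lborel \<phi>" by (rule schwartz_integrable[OF \<phi>])
  have tr: "(LINT x|lborel. \<phi> (x \<odot> ?e)) = (LINT x|lborel. \<phi> x)"
    by (rule integral_right_translate) measurable
  have \<phi>t: "integrable lborel (\<lambda>x. \<phi> (x \<odot> ?e))"
  proof (rule integrableI_bounded)
    have "(\<integral>\<^sup>+x. ennreal (norm (\<phi> (x \<odot> ?e))) \<partial>lborel) = (\<integral>\<^sup>+x. ennreal (norm (\<phi> x)) \<partial>lborel)"
      by (rule nn_integral_right_translate) measurable
    then show "(\<integral>\<^sup>+x. ennreal (norm (\<phi> (x \<odot> ?e))) \<partial>lborel) < \<infinity>"
      using \<phi>i by (simp add: integrable_iff_bounded)
  qed measurable
  have "0 = (LINT x|lborel. \<phi> (x \<odot> ?e) - \<phi> x)"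
    using tr \<phi>i \<phi>t by simp
  also have "\<dots> = (LINT x|lborel. LINT s|lborel. h s x)"
    unfolding left_difference_integral(1)[OF \<phi>, symmetric] sum h_def ..
  also have "\<dots> = (LINT s|lborel. LINT x|lborel. h s x)"
    by (rule lborel_pair.Fubini_integral[OF int])
  also have "\<dots> = (LINT s|lborel. indicator {0..1::real} s *\<^sub>R (LINT x|lborel. ?X x))"
  proof (intro Bochner_Integration.integral_cong refl)
    fix s :: real
    have "(LINT x|lborel. ?X (x \<odot> (s *\<^sub>R ?e))) = (LINT x|lborel. ?X x)"
      by (rule integral_right_translate) measurable
    then show "(LINT x|lborel. h s x) = indicator {0..1} s *\<^sub>R (LINT x|lborel. ?X x)"
      by (simp add: h_def)
  qed
  also have "\<dots> = (LINT x|lborel. ?X x)"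
    by simp
  finally show ?thesis ..
qed

text \<open>Applying the sub-mean-value inequality to each \<open>\<phi>\<^sup>l\<close> and the superposition estimate to its
  derivatives produces the left-hand side again with a factor \<open>\<delta>\<^sup>q\<close>. For a fixed Schwartz function it
  is finite at every point, so it can be absorbed.\<close>

lemma Pm_norm_le_maxop:
  fixes \<phi> \<eta> :: "nat \<Rightarrow> real^'n::{finite,linorder} \<Rightarrow> complex"
  assumes \<phi>: "\<And>l. l \<in> {1..M} \<Longrightarrow> \<phi> l \<in> schwartz \<and> (LINT x|lborel. \<phi> l x) = 0"
    and \<eta>: "\<And>l. l \<in> {1..M} \<Longrightarrow> \<eta> l \<in> schwartz"
    and rep: "\<And>f x. f \<in> schwartz \<Longrightarrow> f x = (\<Sum>l=1..M. LINT t|dt_over_t. ((f \<star> dilate a (\<phi> l) t) \<star> dilate a (\<eta> l) t) x)"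
    and N: "N > 0" and \<epsilon>: "\<epsilon> > 0" and q: "q \<ge> 1"
    and C1: "\<And>k l m. l \<in> {1..M} \<Longrightarrow> m \<in> {1..M} \<Longrightarrow> (\<eta> m, left_deriv (\<odot>) k (\<phi> l)) \<in> class_C1 (\<odot>) a \<rho> (N + \<epsilon>) N"
  defines "r \<equiv> hom_dim a / N"
  shows "\<exists>C\<ge>0. \<forall>f\<in>schwartz. \<forall>x. (\<Sum>l=1..M. \<integral>\<^sup>+t. epowr (Pm N f (\<phi> l) t x) q \<partial>dt_over_t)
    \<le> ennreal C * (\<Sum>l=1..M. \<integral>\<^sup>+t. epowr (maxop group_dist lborel (\<lambda>z. ennreal (cmod ((f \<star> dilate a (\<phi> l) t) z) powr r)) x) (q / r) \<partial>dt_over_t)"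
proof -
  let ?n = "real CARD('n)" and ?g = "hom_dim a"
  have r: "r > 0" using N hom_dim_ge_2 by (simp add: r_def)
  define bound where "bound k l C \<longleftrightarrow> C \<ge> 0 \<and> (\<forall>f\<in>schwartz. \<forall>x. (\<integral>\<^sup>+s. epowr (Pm N f (left_deriv (\<odot>) k (\<phi> l)) s x) q \<partial>dt_over_t)
    \<le> ennreal C * (\<Sum>l=1..M. \<integral>\<^sup>+t. epowr (Pm N f (\<phi> l) t x) q \<partial>dt_over_t))" for k l C
  have bound: "\<exists>C. bound k l C" if l: "l \<in> {1..M}" for k l
    unfolding bound_def
  proof (rule Pm_norm_le_superposition[where \<eta> = \<eta>])
    have \<phi>l: "\<phi> l \<in> schwartz" using \<phi>[OF l] by blast
    show "rapid (left_deriv (\<odot>) k (\<phi> l))" by (rule left_deriv_path(1)[OF \<phi>l])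
    show "(LINT x|lborel. left_deriv (\<odot>) k (\<phi> l) x) = 0" by (rule integral_left_deriv[OF \<phi>l])
    show "(\<eta> m, left_deriv (\<odot>) k (\<phi> l)) \<in> class_C1 (\<odot>) a \<rho> (N + \<epsilon>) N" if "m \<in> {1..M}" for m
      by (rule C1[OF l that])
  qed (fact \<phi> \<eta> rep N \<epsilon> q)+
  \<comment> \<open>Finitely many constants, chosen at once so that they can be added up.\<close>
  define B where "B k l = (SOME C. bound k l C)" for k l
  have "bound k l (B k l)" if "l \<in> {1..M}" for k l
    unfolding B_def by (rule someI_ex[OF bound[OF that]])
  then have B: "B k l \<ge> 0"
    "f \<in> schwartz \<Longrightarrow> (\<integral>\<^sup>+s. epowr (Pm N f (left_deriv (\<odot>) k (\<phi> l)) s x) q \<partial>dt_over_t)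
      \<le> ennreal (B k l) * (\<Sum>l=1..M. \<integral>\<^sup>+t. epowr (Pm N f (\<phi> l) t x) q \<partial>dt_over_t)"
    if "l \<in> {1..M}" for k l f x
    using that unfolding bound_def by blast+
  define B1 where "B1 = (\<Sum>l=1..M. \<Sum>k\<in>UNIV. B k l)"
  have B1: "B1 \<ge> 0" unfolding B1_def using B(1) by (intro sum_nonneg) auto
  define c where "c = (2 powr r * (2 * c0) powr ?g) powr (q / r) * 2 powr (q / r)"
  have c: "c \<ge> 0" by (simp add: c_def)
  define c2 where "c2 = c * ?n powr q * B1"
  have c2: "c2 \<ge> 0" using c B1 by (simp add: c2_def)
  \<comment> \<open>Small enough for the derivative terms to carry the factor \<open>1/2\<close>.\<close>
  define \<delta> where "\<delta> = min 1 ((1 / (2 * (c2 + 1))) powr (1 / q))"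
  have \<delta>: "0 < \<delta>" "\<delta> \<le> 1" using c2 by (auto simp: \<delta>_def)
  have \<delta>q: "c2 * \<delta> powr q \<le> 1 / 2"
  proof -
    have "\<delta> powr q \<le> ((1 / (2 * (c2 + 1))) powr (1 / q)) powr q"
      using \<delta> q by (intro powr_mono2) (auto simp: \<delta>_def)
    also have "\<dots> = 1 / (2 * (c2 + 1))" using q c2 by (simp add: powr_powr)
    finally have "c2 * \<delta> powr q \<le> c2 * (1 / (2 * (c2 + 1)))" using c2 by (rule mult_left_mono)
    also have "\<dots> \<le> 1 / 2" using c2 by (simp add: field_simps)
    finally show ?thesis .
  qed
  define D where "D = c * \<delta> powr (- ?g * (q / r))"
  have D: "D \<ge> 0" using c by (simp add: D_def)
  show ?thesis
  proof (intro exI[of _ "2 * D + 1"] conjI ballI allI)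
    show "0 \<le> 2 * D + 1" using D by simp
    fix f :: "real^'n::{finite,linorder} \<Rightarrow> complex" and x assume f: "f \<in> schwartz"
    note [measurable] = schwartz_measurable[OF f]
    define T where "T l = (\<integral>\<^sup>+t. epowr (Pm N f (\<phi> l) t x) q \<partial>dt_over_t)" for l
    define Y where "Y l = (\<integral>\<^sup>+t. epowr (maxop group_dist lborel (\<lambda>z. ennreal (cmod ((f \<star> dilate a (\<phi> l) t) z) powr r)) x) (q / r) \<partial>dt_over_t)" for l
    have T_le: "T l \<le> ennreal D * Y l + ennreal (c * \<delta> powr q * ?n powr q) * (ennreal (\<Sum>k\<in>UNIV. B k l) * (\<Sum>l=1..M. T l))"
      if l: "l \<in> {1..M}" for l
    proof -
      have \<phi>l: "\<phi> l \<in> schwartz" using \<phi>[OF l] by blast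
      have Xr: "rapid (left_deriv (\<odot>) k (\<phi> l))" for k by (rule left_deriv_path(1)[OF \<phi>l])
      note [measurable] = schwartz_measurable[OF \<phi>l] rapid_measurable[OF Xr] measurable_maxop_conv(1)[of f "\<phi> l" r x]
      let ?M = "\<lambda>t. maxop group_dist lborel (\<lambda>z. ennreal (cmod ((f \<star> dilate a (\<phi> l) t) z) powr r)) x"
      let ?P = "\<lambda>k t. Pm N f (left_deriv (\<odot>) k (\<phi> l)) t x"
      have [measurable]: "?M \<in> borel_measurable borel" by (rule measurable_maxop_conv(1)) measurable
      have "T l \<le> (\<integral>\<^sup>+t. ennreal D * epowr (?M t) (q / r) + ennreal (c * \<delta> powr q * ?n powr q) * (\<Sum>k\<in>UNIV. epowr (?P k t) q) \<partial>dt_over_t)"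
        unfolding T_def
      proof (rule nn_integral_mono_AE, use AE_dt_over_t_pos in eventually_elim)
        fix t :: real assume t: "t > 0"
        have "epowr (Pm N f (\<phi> l) t x) q = epowr (epowr (Pm N f (\<phi> l) t x) r) (q / r)"
          using r by simp
        also have "\<dots> \<le> epowr (ennreal (2 powr r * (2 * c0) powr ?g) *
            (ennreal (\<delta> powr (- ?g)) * ?M t + ennreal (\<delta> powr r) * epowr (\<Sum>k\<in>UNIV. ?P k t) r)) (q / r)"
          by (rule epowr_mono[OF Pm_sub_mean_value[OF f \<phi>l t N \<delta>, of x, folded r_def]]) (use r q in simp)
        also have "\<dots> \<le> ennreal ((2 powr r * (2 * c0) powr ?g) powr (q / r)) * (ennreal (2 powr (q / r)) *
            (epowr (ennreal (\<delta> powr (- ?g)) * ?M t) (q / r) + epowr (ennreal (\<delta> powr r) * epowr (\<Sum>k\<in>UNIV. ?P k t) r) (q / r)))"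
          using r q by (subst epowr_mult) (auto intro!: mult_left_mono epowr_add_le)
        also have "epowr (ennreal (\<delta> powr (- ?g)) * ?M t) (q / r) = ennreal (\<delta> powr (- ?g * (q / r))) * epowr (?M t) (q / r)"
          using r q by (simp add: epowr_mult powr_powr)
        also have "epowr (ennreal (\<delta> powr r) * epowr (\<Sum>k\<in>UNIV. ?P k t) r) (q / r) = ennreal (\<delta> powr q) * epowr (\<Sum>k\<in>UNIV. ?P k t) q"
          using r q by (simp add: epowr_mult powr_powr)
        also have "ennreal ((2 powr r * (2 * c0) powr ?g) powr (q / r)) * (ennreal (2 powr (q / r)) *
            (ennreal (\<delta> powr (- ?g * (q / r))) * epowr (?M t) (q / r) + ennreal (\<delta> powr q) * epowr (\<Sum>k\<in>UNIV. ?P k t) q))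
          = ennreal D * epowr (?M t) (q / r) + ennreal (c * \<delta> powr q) * epowr (\<Sum>k\<in>UNIV. ?P k t) q"
          unfolding D_def c_def by (simp add: ennreal_mult distrib_left mult.assoc)
        also have "\<dots> \<le> ennreal D * epowr (?M t) (q / r) + ennreal (c * \<delta> powr q) * (ennreal (?n powr q) * (\<Sum>k\<in>UNIV. epowr (?P k t) q))"
          using epowr_sum_le[of "UNIV :: 'n set" q "\<lambda>k. ?P k t"] q by (intro add_left_mono mult_left_mono) auto
        also have "\<dots> = ennreal D * epowr (?M t) (q / r) + ennreal (c * \<delta> powr q * ?n powr q) * (\<Sum>k\<in>UNIV. epowr (?P k t) q)"
          using c by (simp add: ennreal_mult mult.assoc)
        finally show "epowr (Pm N f (\<phi> l) t x) q \<le> \<dots>" .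
      qed
      also have "\<dots> = ennreal D * Y l + ennreal (c * \<delta> powr q * ?n powr q) * (\<Sum>k\<in>UNIV. \<integral>\<^sup>+t. epowr (?P k t) q \<partial>dt_over_t)"
        unfolding Y_def by (simp add: nn_integral_add nn_integral_cmult nn_integral_sum)
      also have "\<dots> \<le> ennreal D * Y l + ennreal (c * \<delta> powr q * ?n powr q) * (\<Sum>k\<in>UNIV. ennreal (B k l) * (\<Sum>l=1..M. T l))"
        unfolding T_def by (intro add_left_mono mult_left_mono sum_mono B(2)[OF l f]) auto
      also have "(\<Sum>k\<in>UNIV. ennreal (B k l) * (\<Sum>l=1..M. T l)) = ennreal (\<Sum>k\<in>UNIV. B k l) * (\<Sum>l=1..M. T l)"
        using B(1) l by (simp add: sum_distrib_right[symmetric] sum_ennreal)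
      finally show ?thesis .
    qed
    let ?T = "\<Sum>l=1..M. T l" and ?Y = "\<Sum>l=1..M. Y l"
    have "?T \<le> (\<Sum>l=1..M. ennreal D * Y l + ennreal (c * \<delta> powr q * ?n powr q) * (ennreal (\<Sum>k\<in>UNIV. B k l) * ?T))"
      by (intro sum_mono T_le)
    also have "\<dots> = ennreal D * ?Y + ennreal (c * \<delta> powr q * ?n powr q) * ((\<Sum>l=1..M. ennreal (\<Sum>k\<in>UNIV. B k l)) * ?T)"
      by (simp only: sum.distrib flip: sum_distrib_left sum_distrib_right)
    also have "(\<Sum>l=1..M. ennreal (\<Sum>k\<in>UNIV. B k l)) = ennreal B1"
      unfolding B1_def using B(1) by (intro sum_ennreal sum_nonneg) auto
    also have "ennreal (c * \<delta> powr q * ?n powr q) * (ennreal B1 * ?T) = ennreal (c2 * \<delta> powr q) * ?T"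
    proof -
      have e: "c2 * \<delta> powr q = c * \<delta> powr q * ?n powr q * B1" by (simp add: c2_def)
      show ?thesis unfolding e using c B1 by (simp add: ennreal_mult mult.assoc)
    qed
    also have "ennreal D * ?Y + ennreal (c2 * \<delta> powr q) * ?T \<le> ennreal D * ?Y + ennreal (1 / 2) * ?T"
      by (intro add_left_mono mult_right_mono ennreal_leI \<delta>q) auto
    finally have main: "?T \<le> ennreal D * ?Y + ennreal (1 / 2) * ?T" .
    have "T l < top" if "l \<in> {1..M}" for l
      unfolding T_def using \<phi>[OF that] q N by (intro Pm_finite_norm[OF f]) auto
    then have "?T < top" by (simp add: ennreal_sum_less_top)
    then obtain \<tau> where \<tau>: "?T = ennreal \<tau>" "\<tau> \<ge> 0" by (cases ?T) auto
    have "?T \<le> ennreal (2 * D + 1) * ?Y"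
    proof (cases "?Y = top")
      case True
      have "ennreal (2 * D + 1) * ?Y = top" unfolding True using D by (simp add: ennreal_mult_eq_top_iff)
      then show ?thesis by simp
    next
      case False
      then obtain y where y: "?Y = ennreal y" "y \<ge> 0" by (cases ?Y) auto
      have "ennreal (D * y + 1 / 2 * \<tau>) = ennreal (D * y) + ennreal (1 / 2 * \<tau>)"
        by (rule ennreal_plus) (use \<tau> y D in auto)
      also have "ennreal (D * y) = ennreal D * ennreal y" by (rule ennreal_mult) (use y D in auto)
      also have "ennreal (1 / 2 * \<tau>) = ennreal (1 / 2) * ennreal \<tau>" by (rule ennreal_mult) (use \<tau> in auto)
      finally have "ennreal \<tau> \<le> ennreal (D * y + 1 / 2 * \<tau>)"
        using main unfolding \<tau>(1) y(1) by (simp only:)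
      then have "\<tau> \<le> D * y + 1 / 2 * \<tau>" using \<tau> y D by (subst (asm) ennreal_le_iff) auto
      then have "\<tau> \<le> (2 * D + 1) * y" using y D by (simp add: distrib_right)
      then have "ennreal \<tau> \<le> ennreal ((2 * D + 1) * y)" by (rule ennreal_leI)
      also have "\<dots> = ennreal (2 * D + 1) * ennreal y" by (rule ennreal_mult) (use y D in auto)
      finally show ?thesis unfolding \<tau>(1) y(1) .
    qed
    then show "(\<Sum>l=1..M. \<integral>\<^sup>+t. epowr (Pm N f (\<phi> l) t x) q \<partial>dt_over_t)
      \<le> ennreal (2 * D + 1) * (\<Sum>l=1..M. \<integral>\<^sup>+t. epowr (maxop group_dist lborel (\<lambda>z. ennreal (cmod ((f \<star> dilate a (\<phi> l) t) z) powr r)) x) (q / r) \<partial>dt_over_t)"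
      unfolding T_def Y_def .
  qed
qed

end

section \<open>Weighted norm inequalities\<close>

lemma Lp_weighted_eq_lborel:
  assumes "AE x in lborel. w x = w' x"
  shows "Lp_weighted p w g = epowr (\<integral>\<^sup>+x. epowr (g x) p * ennreal (w' x) \<partial>lborel) (1 / p)"
proof -
  have "(\<integral>\<^sup>+x. epowr (g x) p * ennreal (w x) \<partial>lborel) = (\<integral>\<^sup>+x. epowr (g x) p * ennreal (w' x) \<partial>lborel)"
    by (rule nn_integral_cong_AE) (use assms in eventually_elim, simp)
  then show ?thesis by (simp add: Lp_weighted_def nn_integral_completion)
qed

lemma Lq_dt_over_t_eq:
  assumes [measurable]: "h \<in> borel_measurable borel" and eq: "\<And>t. t > 0 \<Longrightarrow> g t = h t"
  shows "Lq_dt_over_t q g = epowr (\<integral>\<^sup>+t. epowr (h t) q \<partial>dt_over_t) (1 / q)"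
proof -
  have "(\<integral>\<^sup>+t\<in>{0<..}. epowr (g t) q * ennreal (1 / t) \<partial>lborel) = (\<integral>\<^sup>+t\<in>{0<..}. epowr (h t) q * ennreal (1 / t) \<partial>lborel)"
    by (intro nn_integral_cong) (auto simp: eq split: split_indicator)
  also have "\<dots> = (\<integral>\<^sup>+t. epowr (h t) q \<partial>dt_over_t)"
    by (rule nn_integral_dt_over_t[symmetric]) measurable
  finally show ?thesis by (simp add: Lq_dt_over_t_def)
qed

context homogeneous_group_norm
begin

lemma gball_subset_compact: "\<exists>S. compact S \<and> gball (\<odot>) \<rho> x t \<subseteq> S"
proof (intro exI conjI)
  \<comment> \<open>The ball of \<open>\<rho>\<close> of radius \<open>s\<close> is a dilate of the Euclidean unit ball.\<close>
  define s where "s = max 1 (c0 * (\<rho> x + t))"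
  let ?S = "dilation a s ` cball 0 1"
  show "compact ?S"
    unfolding dilation_def by (intro compact_continuous_image continuous_intros compact_cball)
  show "gball (\<odot>) \<rho> x t \<subseteq> ?S"
  proof
    fix y assume "y \<in> gball (\<odot>) \<rho> x t"
    then have "\<rho> ((- y) \<odot> x) < t" by (simp add: gball_def)
    moreover have "\<rho> ((- y) \<odot> x) = \<rho> ((- x) \<odot> y)"
      using rho_inverse[of "(- y) \<odot> x"] by (simp add: minus_mul)
    moreover have "\<rho> y \<le> c0 * (\<rho> x + \<rho> ((- x) \<odot> y))"
      using c0(2)[of x "(- x) \<odot> y"] by (simp flip: assoc)
    ultimately have "\<rho> y \<le> c0 * (\<rho> x + t)"
      using c0(1) mult_left_mono[of "\<rho> x + \<rho> ((- x) \<odot> y)" "\<rho> x + t" c0] by linarith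
    then have s: "\<rho> y \<le> s" "s > 0" by (simp_all add: s_def)
    then have "\<rho> (dilation a (inverse s) y) \<le> 1"
      by (simp add: rho_dilation field_simps)
    then have "dilation a (inverse s) y \<in> cball 0 1" by (simp add: rho_le_1_iff)
    moreover have "y = dilation a s (dilation a (inverse s) y)"
      using s by (simp add: dilation_mult_params)
    ultimately show "y \<in> ?S" by (rule rev_image_eqI)
  qed
qed

text \<open>If the weight is neither zero almost everywhere nor positive almost everywhere, then a large
  ball meets both its zero set and the complement in positive measure, and there the product of
  averages is \<open>\<infinity>\<close>. A positive weight agrees almost everywhere with a positive Borel function.\<close>

lemma muckenhoupt_cases:
  assumes w: "w \<in> muckenhoupt (\<odot>) \<rho> P" and P: "P > 1"
  obtains "AE x in lborel. w x = 0"
  | w' K where "AE x in lborel. w x = w' x" "K \<ge> 0" "homogeneous_type.Ap group_dist lborel P K w'"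
proof -
  interpret homogeneous_type group_dist lborel c0 "2 powr hom_dim a" by (rule homogeneous_type)
  let ?S = "SUP B\<in>{gball (\<odot>) \<rho> x t | x t. t > 0}. average B (\<lambda>x. ennreal (w x)) *
        epowr (average B (\<lambda>x. inverse (ennreal (w x powr (1 / (P - 1)))))) (P - 1)"
  have weight: "weight w" and S: "?S < top" using w by (auto simp: muckenhoupt_def)
  obtain K where K: "?S = ennreal K" "K \<ge> 0" using S by (cases ?S) auto
  have "w \<in> borel_measurable (completion lborel)" using weight by (simp add: weight_def)
  from completion_ex_borel_measurable_real[OF this] obtain v where
    v: "v \<in> borel_measurable lborel" "AE x in lborel. w x = v x" by blast
  \<comment> \<open>Only almost everywhere is the Borel version \<open>v\<close> of the weight nonnegative.\<close>
  define u where "u x = max 0 (v x)" for x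
  have [measurable]: "u \<in> borel_measurable borel" using v(1) by (simp add: u_def[abs_def])
  have u: "u x \<ge> 0" for x by (simp add: u_def)
  have wu: "AE x in lborel. w x = u x"
  proof (rule eventually_mono[OF v(2)])
    show "w x = u x" if "w x = v x" for x
      using weight that unfolding weight_def u_def by (metis max.absorb2)
  qed
  define A where "A x t = (\<integral>\<^sup>+y\<in>qball group_dist x t. ennreal (u y) \<partial>lborel)" for x t
  define V where "V x t = (\<integral>\<^sup>+y\<in>qball group_dist x t. inverse (ennreal (u y powr (1 / (P - 1)))) \<partial>lborel)" for x t
  have ball: "emeasure lborel (qball group_dist x t) \<noteq> 0" "emeasure lborel (qball group_dist x t) < top" if "t > 0" for x t
    using that unit_ball_measure unfolding gball_eq_qball[symmetric]
    by (auto simp: emeasure_gball ennreal_mult_less_top less_top)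
  have AV: "A x t * epowr (V x t) (P - 1) \<le> ennreal K * epowr (emeasure lborel (qball group_dist x t)) P" if t: "t > 0" for x t
  proof -
    let ?B = "qball group_dist x t"
    have em: "emeasure lebesgue ?B = emeasure lborel ?B"
      using nn_integral_completion[of lborel "indicator ?B :: _ \<Rightarrow> ennreal"] by simp
    obtain \<beta> where \<beta>: "emeasure lborel ?B = ennreal \<beta>" "\<beta> > 0"
      using ball[OF t, of x] by (cases "emeasure lborel ?B") (auto simp: order_less_le)
    define i where "i = 1 / \<beta>"
    have i: "i > 0" using \<beta>(2) by (simp add: i_def)
    have "average ?B (\<lambda>x. ennreal (w x)) = A x t / ennreal \<beta>"
      unfolding average_def A_def nn_integral_completion em \<beta>(1)
      by (intro arg_cong2[where f = "(/)"] nn_integral_cong_AE refl) (use wu in eventually_elim, simp)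
    moreover have "average ?B (\<lambda>x. inverse (ennreal (w x powr (1 / (P - 1))))) = V x t / ennreal \<beta>"
      unfolding average_def V_def nn_integral_completion em \<beta>(1)
      by (intro arg_cong2[where f = "(/)"] nn_integral_cong_AE refl) (use wu in eventually_elim, simp)
    moreover have "average ?B (\<lambda>x. ennreal (w x)) * epowr (average ?B (\<lambda>x. inverse (ennreal (w x powr (1 / (P - 1)))))) (P - 1) \<le> ?S"
      by (rule SUP_upper) (use t in \<open>auto simp flip: gball_eq_qball\<close>)
    ultimately have "A x t / ennreal \<beta> * epowr (V x t / ennreal \<beta>) (P - 1) \<le> ennreal K"
      unfolding K(1) by simp
    moreover have "A x t / ennreal \<beta> * epowr (V x t / ennreal \<beta>) (P - 1) = A x t * epowr (V x t) (P - 1) * ennreal (i powr P)"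
    proof -
      have "u / ennreal \<beta> = u * ennreal i" for u
        using \<beta>(2) by (simp add: divide_ennreal_def inverse_ennreal i_def inverse_eq_divide)
      then have "A x t / ennreal \<beta> * epowr (V x t / ennreal \<beta>) (P - 1) = A x t * epowr (V x t) (P - 1) * (ennreal i * ennreal (i powr (P - 1)))"
        using i P by (simp add: epowr_mult mult_ac)
      also have "ennreal i * ennreal (i powr (P - 1)) = ennreal (i powr P)"
        using i by (simp add: powr_mult_base flip: ennreal_mult)
      finally show ?thesis .
    qed
    ultimately have "A x t * epowr (V x t) (P - 1) * ennreal (i powr P) * ennreal (\<beta> powr P) \<le> ennreal K * ennreal (\<beta> powr P)"
      by (intro mult_right_mono) auto
    moreover have "ennreal (i powr P) * ennreal (\<beta> powr P) = 1"
      using \<beta>(2) by (simp add: i_def flip: ennreal_mult powr_mult)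
    ultimately show ?thesis using \<beta> by (simp add: mult.assoc)
  qed
  have cover: "\<exists>n::nat. x \<in> qball group_dist 0 (real (Suc n))" for x
  proof -
    obtain n where "\<rho> (- x) < real n" using reals_Archimedean2 by blast
    then show ?thesis using d_sym[of 0 x] by (intro exI[of _ n]) (auto simp: qball_def)
  qed
  have mono: "qball group_dist 0 s \<subseteq> qball group_dist 0 t" if "s \<le> t" for s t
    using that by (rule qball_mono)
  have dich: "(AE x in lborel. u x = 0) \<or> (AE x in lborel. u x > 0)"
  proof (rule ccontr)
    assume not: "\<not> ?thesis"
    have "\<exists>n. A 0 (real (Suc n)) \<noteq> 0"
    proof (rule ccontr)
      assume "\<not> ?thesis"
      then have "\<forall>n. AE x in lborel. ennreal (u x) * indicator (qball group_dist 0 (real (Suc n))) x = 0"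
        by (simp add: A_def nn_integral_0_iff_AE)
      then have "AE x in lborel. \<forall>n. ennreal (u x) * indicator (qball group_dist 0 (real (Suc n))) x = 0"
        by (subst AE_all_countable)
      then have "AE x in lborel. u x = 0"
      proof eventually_elim
        case (elim x)
        obtain n where "x \<in> qball group_dist 0 (real (Suc n))" using cover by blast
        then show ?case using elim[rule_format, of n] u[of x] by (simp add: ennreal_eq_0_iff)
      qed
      then show False using not by simp
    qed
    then obtain n where n: "A 0 (real (Suc n)) \<noteq> 0" by blast
    have "\<exists>k. V 0 (real (Suc k)) = top"
    proof (rule ccontr)
      assume fin: "\<not> ?thesis"
      have "AE x in lborel. inverse (ennreal (u x powr (1 / (P - 1)))) * indicator (qball group_dist 0 (real (Suc k))) x \<noteq> \<infinity>" for k
        using fin by (intro nn_integral_PInf_AE) (auto simp: V_def)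
      then have "AE x in lborel. \<forall>k. inverse (ennreal (u x powr (1 / (P - 1)))) * indicator (qball group_dist 0 (real (Suc k))) x \<noteq> \<infinity>"
        by (subst AE_all_countable) blast
      then have "AE x in lborel. u x > 0"
      proof eventually_elim
        case (elim x)
        obtain k where "x \<in> qball group_dist 0 (real (Suc k))" using cover by blast
        then show ?case using elim[rule_format, of k] u[of x] by (cases "u x = 0") auto
      qed
      then show False using not by simp
    qed
    then obtain k where k: "V 0 (real (Suc k)) = top" by blast
    let ?m = "real (Suc (max n k))"
    have "A 0 (real (Suc n)) \<le> A 0 ?m"
      unfolding A_def using mono[of "real (Suc n)" ?m] by (intro nn_integral_mono) (auto split: split_indicator)
    then have "A 0 ?m \<noteq> 0" using n by auto
    moreover have "V 0 (real (Suc k)) \<le> V 0 ?m"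
      unfolding V_def using mono[of "real (Suc k)" ?m] by (intro nn_integral_mono) (auto split: split_indicator)
    then have "V 0 ?m = top" using k by (simp add: top_unique)
    ultimately have "A 0 ?m * epowr (V 0 ?m) (P - 1) = top" by (simp add: ennreal_mult_top)
    moreover have "ennreal K * epowr (emeasure lborel (qball group_dist 0 ?m)) P < top"
      using ball(2)[of ?m 0] by (simp add: ennreal_mult_less_top)
    ultimately show False using AV[of ?m 0] by (simp add: top_unique)
  qed
  show thesis
  proof (cases "AE x in lborel. u x = 0")
    case True
    then have "AE x in lborel. w x = 0" using wu by eventually_elim simp
    then show thesis by (rule that(1))
  next
    case False
    then have pos: "AE x in lborel. u x > 0" using dich by blast
    define w' where "w' x = (if u x > 0 then u x else 1)" for x
    have [measurable]: "w' \<in> borel_measurable borel" by (simp add: w'_def[abs_def])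
    have w'_pos: "w' x > 0" for x by (simp add: w'_def)
    have uw': "AE x in lborel. u x = w' x"
      using pos by eventually_elim (simp add: w'_def)
    have A: "ball_mass w' x t = A x t" for x t
      unfolding A_def by (rule nn_integral_cong_AE) (use uw' in eventually_elim, simp)
    have V: "ball_mass (dual_weight P w') x t = V x t" for x t
      unfolding V_def
    proof (rule nn_integral_cong_AE, use uw' in eventually_elim)
      fix y assume "u y = w' y"
      then show "ennreal (dual_weight P w' y) * indicator (qball group_dist x t) y
        = inverse (ennreal (u y powr (1 / (P - 1)))) * indicator (qball group_dist x t) y"
        using w'_pos[of y] by (simp add: dual_weight_def inverse_ennreal powr_minus flip: minus_divide_left)
    qed
    have "Ap P K w'"
      unfolding Ap_def
    proof (intro conjI allI impI)
      fix x and t :: real assume t: "t > 0"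
      let ?B = "qball group_dist x t"
      obtain S where S: "compact S" "?B \<subseteq> S"
        using gball_subset_compact unfolding gball_eq_qball by blast
      have "set_integrable lebesgue S w" using weight S by (simp add: weight_def)
      then have "(\<integral>\<^sup>+y. ennreal (norm (indicator S y *\<^sub>R w y)) \<partial>lebesgue) < top"
        by (simp add: set_integrable_def integrable_iff_bounded)
      then have fin: "(\<integral>\<^sup>+y. ennreal (norm (indicator S y *\<^sub>R w y)) \<partial>lborel) < top"
        by (simp add: nn_integral_completion)
      have "A x t \<le> (\<integral>\<^sup>+y. ennreal (norm (indicator S y *\<^sub>R w y)) \<partial>lborel)"
        unfolding A_def
        by (rule nn_integral_mono_AE, use wu in eventually_elim) (use S(2) u in \<open>auto split: split_indicator\<close>)
      then have Afin: "A x t < top" using fin by (rule order.strict_trans1)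
      then show "ball_mass w' x t \<noteq> top" by (simp add: A)
      have "A x t \<noteq> 0"
      proof
        assume "A x t = 0"
        then have "AE y in lborel. ennreal (w' y) * indicator ?B y = 0"
          by (simp add: A[symmetric] nn_integral_0_iff_AE)
        then have "AE y in lborel. y \<notin> ?B"
        proof eventually_elim
          case (elim y)
          then show ?case using w'_pos[of y] by (auto simp: ennreal_eq_0_iff split: split_indicator_asm)
        qed
        then have "emeasure lborel ?B = 0" by (simp add: AE_iff_measurable[OF _ refl] )
        then show False using ball(1)[OF t] by simp
      qed
      moreover have "ennreal K * epowr (emeasure lborel ?B) P < top"
        using ball(2)[OF t] by (simp add: ennreal_mult_less_top)
      ultimately have "V x t \<noteq> top" using AV[OF t, of x] by (auto simp: ennreal_mult_top top_unique)
      then show "ball_mass (dual_weight P w') x t \<noteq> top" by (simp add: V)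
      show "ball_mass w' x t * epowr (ball_mass (dual_weight P w') x t) (P - 1) \<le> ennreal K * epowr (emeasure lborel ?B) P"
        unfolding A V by (rule AV[OF t])
    qed (use w'_pos in auto)
    moreover have "AE x in lborel. w x = w' x" using wu uw' by eventually_elim simp
    ultimately show thesis using K(2) that(2) by blast
  qed
qed

text \<open>The pointwise estimates reduce the inequality to the vector-valued maximal inequality for
  \<open>|f * \<phi>\<^sup>l\<^sub>t|\<^sup>r\<close> with exponents \<open>p/r\<close> and \<open>q/r\<close>.\<close>

lemma Pm_norm_weighted:
  fixes \<phi> \<eta> :: "nat \<Rightarrow> real^'n::{finite,linorder} \<Rightarrow> complex"
  assumes \<phi>: "\<And>l. l \<in> {1..M} \<Longrightarrow> \<phi> l \<in> schwartz \<and> (LINT x|lborel. \<phi> l x) = 0"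
    and \<eta>: "\<And>l. l \<in> {1..M} \<Longrightarrow> \<eta> l \<in> schwartz"
    and rep: "\<And>f x. f \<in> schwartz \<Longrightarrow> f x = (\<Sum>l=1..M. LINT t|dt_over_t. ((f \<star> dilate a (\<phi> l) t) \<star> dilate a (\<eta> l) t) x)"
    and N: "N > 0" and p: "hom_dim a / N < p" and q: "hom_dim a / N < q" "q \<ge> 1"
    and \<epsilon>: "\<epsilon> > 0" and C1: "\<And>k l m. l \<in> {1..M} \<Longrightarrow> m \<in> {1..M} \<Longrightarrow> (\<eta> m, left_deriv (\<odot>) k (\<phi> l)) \<in> class_C1 (\<odot>) a \<rho> (N + \<epsilon>) N"
    and \<psi>: "rapid \<psi>" "(LINT x|lborel. \<psi> x) = 0"
    and \<epsilon>': "\<epsilon>' > 0" and C1': "\<And>l. l \<in> {1..M} \<Longrightarrow> (\<eta> l, \<psi>) \<in> class_C1 (\<odot>) a \<rho> (N + \<epsilon>') N"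
    and w: "homogeneous_type.Ap group_dist lborel (p * N / hom_dim a) K w" and K: "K \<ge> 0"
  shows "\<exists>C\<ge>0. \<forall>f\<in>schwartz.
    (\<integral>\<^sup>+x. epowr (\<integral>\<^sup>+t. epowr (Pm N f \<psi> t x) q \<partial>dt_over_t) (p / q) * ennreal (w x) \<partial>lborel)
    \<le> ennreal C * (\<Sum>l=1..M. \<integral>\<^sup>+x. epowr (\<integral>\<^sup>+t. epowr (ennreal (cmod ((f \<star> dilate a (\<phi> l) t) x))) q \<partial>dt_over_t) (p / q) * ennreal (w x) \<partial>lborel)"
proof -
  interpret homogeneous_type group_dist lborel c0 "2 powr hom_dim a" by (rule homogeneous_type)
  define r where "r = hom_dim a / N"
  have r: "r > 0" using N hom_dim_ge_2 by (simp add: r_def)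
  have pq: "p > 0" "q > 0" using p q r by (auto simp: r_def)
  have P: "p / r > 1" "q / r > 1" "p * N / hom_dim a = p / r" "(p / r) / (q / r) = p / q"
    using p[folded r_def] q(1)[folded r_def] r by auto (simp_all add: r_def)
  note [measurable] = ApD(1)[OF w]
  obtain D1 where D1: "D1 \<ge> 0" "\<And>f x. f \<in> schwartz \<Longrightarrow> (\<integral>\<^sup>+s. epowr (Pm N f \<psi> s x) q \<partial>dt_over_t)
    \<le> ennreal D1 * (\<Sum>l=1..M. \<integral>\<^sup>+t. epowr (Pm N f (\<phi> l) t x) q \<partial>dt_over_t)"
    using Pm_norm_le_superposition[where \<eta> = \<eta>, OF \<phi> \<eta> rep \<psi> N \<epsilon>' q(2) C1'] by blast
  obtain D2 where D2: "D2 \<ge> 0" "\<And>f x. f \<in> schwartz \<Longrightarrow> (\<Sum>l=1..M. \<integral>\<^sup>+t. epowr (Pm N f (\<phi> l) t x) q \<partial>dt_over_t)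
    \<le> ennreal D2 * (\<Sum>l=1..M. \<integral>\<^sup>+t. epowr (maxop group_dist lborel (\<lambda>z. ennreal (cmod ((f \<star> dilate a (\<phi> l) t) z) powr r)) x) (q / r) \<partial>dt_over_t)"
    using Pm_norm_le_maxop[where \<eta> = \<eta>, OF \<phi> \<eta> rep N \<epsilon> q(2) C1] unfolding r_def by blast
  obtain D3 where D3: "D3 \<ge> 0" "\<And>G. G \<in> borel_measurable (dt_over_t \<Otimes>\<^sub>M borel) \<Longrightarrow>
    (\<integral>\<^sup>+x. epowr (\<integral>\<^sup>+t. epowr (maxop group_dist lborel (\<lambda>y. G (t, y)) x) (q / r) \<partial>dt_over_t) (p / q) * ennreal (w x) \<partial>lborel)
    \<le> ennreal D3 * (\<integral>\<^sup>+x. epowr (\<integral>\<^sup>+t. epowr (G (t, x)) (q / r) \<partial>dt_over_t) (p / q) * ennreal (w x) \<partial>lborel)"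
    using Fefferman_Stein_weighted[OF P(1) K P(2) w[unfolded P(3)] sigma_finite_dt_over_t] unfolding P(4) by blast
  define c where "c = (D1 * D2) powr (p / q) * real M powr (p / q)"
  have c: "c \<ge> 0" by (simp add: c_def)
  show ?thesis
  proof (intro exI[of _ "c * D3"] conjI ballI)
    show "0 \<le> c * D3" using c D3 by simp
    fix f :: "real^'n::{finite,linorder} \<Rightarrow> complex" assume f: "f \<in> schwartz"
    note [measurable] = schwartz_measurable[OF f]
    define Y where "Y l x = (\<integral>\<^sup>+t. epowr (maxop group_dist lborel (\<lambda>z. ennreal (cmod ((f \<star> dilate a (\<phi> l) t) z) powr r)) x) (q / r) \<partial>dt_over_t)" for l x
    have Y_meas: "(\<lambda>x. epowr (Y l x) (p / q) * ennreal (w x)) \<in> borel_measurable lborel" if "l \<in> {1..M}" for l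
    proof -
      have [measurable]: "\<phi> l \<in> borel_measurable borel" using \<phi>[OF that] schwartz_measurable by blast
      have "(\<lambda>(x, t). epowr (maxop group_dist lborel (\<lambda>y. ennreal (cmod ((f \<star> dilate a (\<phi> l) t) y) powr r)) x) (q / r)) \<in> borel_measurable (borel \<Otimes>\<^sub>M dt_over_t)"
        using measurable_epowr[OF measurable_maxop_conv(2)[of f "\<phi> l" r], of "q / r"]
        by (simp add: split_beta' cong: measurable_cong_sets sets_pair_measure_cong)
      then have [measurable]: "Y l \<in> borel_measurable borel"
        unfolding Y_def[abs_def] by (rule sigma_finite_measure.borel_measurable_nn_integral[OF sigma_finite_dt_over_t])
      show ?thesis by measurable
    qed
    have FS: "(\<integral>\<^sup>+x. epowr (Y l x) (p / q) * ennreal (w x) \<partial>lborel)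
      \<le> ennreal D3 * (\<integral>\<^sup>+x. epowr (\<integral>\<^sup>+t. epowr (ennreal (cmod ((f \<star> dilate a (\<phi> l) t) x))) q \<partial>dt_over_t) (p / q) * ennreal (w x) \<partial>lborel)"
      if "l \<in> {1..M}" for l
    proof -
      have [measurable]: "\<phi> l \<in> borel_measurable borel" using \<phi>[OF that] schwartz_measurable by blast
      have "(\<lambda>z. ennreal (cmod ((f \<star> dilate a (\<phi> l) (fst z)) (snd z)) powr r)) \<in> borel_measurable (dt_over_t \<Otimes>\<^sub>M borel)"
        by measurable
      from D3(2)[OF this] show ?thesis
        unfolding Y_def using r by (simp add: powr_powr)
    qed
    have "(\<integral>\<^sup>+x. epowr (\<integral>\<^sup>+t. epowr (Pm N f \<psi> t x) q \<partial>dt_over_t) (p / q) * ennreal (w x) \<partial>lborel)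
      \<le> (\<integral>\<^sup>+x. (\<Sum>l=1..M. ennreal c * (epowr (Y l x) (p / q) * ennreal (w x))) \<partial>lborel)"
    proof (rule nn_integral_mono)
      fix x
      have "(\<integral>\<^sup>+t. epowr (Pm N f \<psi> t x) q \<partial>dt_over_t) \<le> ennreal D1 * (ennreal D2 * (\<Sum>l=1..M. Y l x))"
        unfolding Y_def by (rule order.trans[OF D1(2)[OF f] mult_left_mono[OF D2(2)[OF f]]]) simp
      then have "epowr (\<integral>\<^sup>+t. epowr (Pm N f \<psi> t x) q \<partial>dt_over_t) (p / q) \<le> epowr (ennreal (D1 * D2) * (\<Sum>l=1..M. Y l x)) (p / q)"
        using pq D1(1) D2(1) by (intro epowr_mono) (auto simp: ennreal_mult mult.assoc)
      also have "\<dots> = ennreal ((D1 * D2) powr (p / q)) * epowr (\<Sum>l=1..M. Y l x) (p / q)"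
        using pq D1(1) D2(1) by (simp add: epowr_mult)
      also have "\<dots> \<le> ennreal ((D1 * D2) powr (p / q)) * (ennreal (real M powr (p / q)) * (\<Sum>l=1..M. epowr (Y l x) (p / q)))"
        using epowr_sum_le[of "{1..M}" "p / q" "\<lambda>l. Y l x"] pq by (intro mult_left_mono) auto
      also have "\<dots> = ennreal c * (\<Sum>l=1..M. epowr (Y l x) (p / q))"
        by (simp add: c_def ennreal_mult mult.assoc)
      finally have "epowr (\<integral>\<^sup>+t. epowr (Pm N f \<psi> t x) q \<partial>dt_over_t) (p / q) * ennreal (w x)
         \<le> ennreal c * (\<Sum>l=1..M. epowr (Y l x) (p / q)) * ennreal (w x)"
        by (rule mult_right_mono) simp
      then show "epowr (\<integral>\<^sup>+t. epowr (Pm N f \<psi> t x) q \<partial>dt_over_t) (p / q) * ennreal (w x)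
         \<le> (\<Sum>l=1..M. ennreal c * (epowr (Y l x) (p / q) * ennreal (w x)))"
        by (simp add: sum_distrib_left sum_distrib_right mult.assoc)
    qed
    also have "\<dots> = (\<Sum>l=1..M. \<integral>\<^sup>+x. ennreal c * (epowr (Y l x) (p / q) * ennreal (w x)) \<partial>lborel)"
      by (intro nn_integral_sum borel_measurable_times_ennreal[OF borel_measurable_const] Y_meas)
    also have "\<dots> = (\<Sum>l=1..M. ennreal c * (\<integral>\<^sup>+x. epowr (Y l x) (p / q) * ennreal (w x) \<partial>lborel))"
      by (intro sum.cong refl nn_integral_cmult Y_meas)
    also have "\<dots> \<le> (\<Sum>l=1..M. ennreal c * (ennreal D3 *
       (\<integral>\<^sup>+x. epowr (\<integral>\<^sup>+t. epowr (ennreal (cmod ((f \<star> dilate a (\<phi> l) t) x))) q \<partial>dt_over_t) (p / q) * ennreal (w x) \<partial>lborel)))"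
      by (intro sum_mono mult_left_mono FS) auto
    finally show "(\<integral>\<^sup>+x. epowr (\<integral>\<^sup>+t. epowr (Pm N f \<psi> t x) q \<partial>dt_over_t) (p / q) * ennreal (w x) \<partial>lborel)
      \<le> ennreal (c * D3) * (\<Sum>l=1..M. \<integral>\<^sup>+x. epowr (\<integral>\<^sup>+t. epowr (ennreal (cmod ((f \<star> dilate a (\<phi> l) t) x))) q \<partial>dt_over_t) (p / q) * ennreal (w x) \<partial>lborel)"
      using c D3(1) by (simp add: ennreal_mult sum_distrib_left mult.assoc)
  qed
qed

lemma peetre_max_norm_weighted:
  fixes \<phi> \<eta> :: "nat \<Rightarrow> real^'n::{finite,linorder} \<Rightarrow> complex"
  assumes N: "N > 0" and p: "hom_dim a / N < p" and q: "hom_dim a / N < q" "q \<ge> 1"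
    and w: "w \<in> muckenhoupt (\<odot>) \<rho> (p * N / hom_dim a)"
    and \<phi>: "\<And>l. l \<in> {1..M} \<Longrightarrow> \<phi> l \<in> schwartz \<and> (LINT x|lborel. \<phi> l x) = 0"
    and \<eta>: "\<And>l. l \<in> {1..M} \<Longrightarrow> \<eta> l \<in> schwartz"
    and rep: "\<And>f x. f \<in> schwartz \<Longrightarrow> f x = (\<Sum>l=1..M. LINT t|dt_over_t. ((f \<star> dilate a (\<phi> l) t) \<star> dilate a (\<eta> l) t) x)"
    and \<epsilon>: "\<epsilon> > 0" and C1: "\<And>k l m. l \<in> {1..M} \<Longrightarrow> m \<in> {1..M} \<Longrightarrow> (\<eta> m, left_deriv (\<odot>) k (\<phi> l)) \<in> class_C1 (\<odot>) a \<rho> (N + \<epsilon>) N"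
    and \<psi>: "rapid \<psi>" "(LINT x|lborel. \<psi> x) = 0"
    and \<epsilon>': "\<epsilon>' > 0" and C1': "\<And>l. l \<in> {1..M} \<Longrightarrow> (\<eta> l, \<psi>) \<in> class_C1 (\<odot>) a \<rho> (N + \<epsilon>') N"
  shows "\<exists>C>0. \<forall>f\<in>schwartz.
    Lp_weighted p w (\<lambda>x. Lq_dt_over_t q (\<lambda>t. peetre_max (\<odot>) \<rho> N (1 / t) (f \<star> dilate a \<psi> t) x))
    \<le> ennreal C * (\<Sum>l=1..M. Lp_weighted p w (\<lambda>x. Lq_dt_over_t q (\<lambda>t. ennreal (cmod ((f \<star> dilate a (\<phi> l) t) x)))))"
proof -
  have r: "hom_dim a / N > 0" using N hom_dim_ge_2 by simp
  have pq: "p > 0" "q > 0" using p q r by auto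
  have P: "p * N / hom_dim a > 1" using p N hom_dim_ge_2 by (simp add: field_simps)
  show ?thesis
  proof (rule muckenhoupt_cases[OF w P])
    assume w0: "AE x in lborel. w x = 0"
    have "Lp_weighted p w g = 0" for g
      unfolding Lp_weighted_eq_lborel[OF w0] by simp
    then show ?thesis by (intro exI[of _ 1]) simp
  next
    fix w' K assume w': "AE x in lborel. w x = w' x" "K \<ge> 0"
      "homogeneous_type.Ap group_dist lborel (p * N / hom_dim a) K w'"
    obtain C where C: "C \<ge> 0" "\<And>f. f \<in> schwartz \<Longrightarrow>
      (\<integral>\<^sup>+x. epowr (\<integral>\<^sup>+t. epowr (Pm N f \<psi> t x) q \<partial>dt_over_t) (p / q) * ennreal (w' x) \<partial>lborel)
      \<le> ennreal C * (\<Sum>l=1..M. \<integral>\<^sup>+x. epowr (\<integral>\<^sup>+t. epowr (ennreal (cmod ((f \<star> dilate a (\<phi> l) t) x))) q \<partial>dt_over_t) (p / q) * ennreal (w' x) \<partial>lborel)"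
      using Pm_norm_weighted[where \<eta> = \<eta>, OF \<phi> \<eta> rep N p q \<epsilon> C1 \<psi> \<epsilon>' C1' w'(3,2)] by blast
    define c where "c = C powr (1 / p) * real M powr (1 / p)"
    have c: "c \<ge> 0" by (simp add: c_def)
    have "Lp_weighted p w (\<lambda>x. Lq_dt_over_t q (\<lambda>t. peetre_max (\<odot>) \<rho> N (1 / t) (f \<star> dilate a \<psi> t) x))
      \<le> ennreal (c + 1) * (\<Sum>l=1..M. Lp_weighted p w (\<lambda>x. Lq_dt_over_t q (\<lambda>t. ennreal (cmod ((f \<star> dilate a (\<phi> l) t) x)))))"
      if f: "f \<in> schwartz" for f
    proof -
      note [measurable] = schwartz_measurable[OF f] rapid_measurable[OF \<psi>(1)]
      define J where "J l = (\<integral>\<^sup>+x. epowr (\<integral>\<^sup>+t. epowr (ennreal (cmod ((f \<star> dilate a (\<phi> l) t) x))) q \<partial>dt_over_t) (p / q) * ennreal (w' x) \<partial>lborel)" for l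
      have J: "Lp_weighted p w (\<lambda>x. Lq_dt_over_t q (\<lambda>t. ennreal (cmod ((f \<star> dilate a (\<phi> l) t) x)))) = epowr (J l) (1 / p)"
        if "l \<in> {1..M}" for l
      proof -
        have [measurable]: "\<phi> l \<in> borel_measurable borel" using \<phi>[OF that] schwartz_measurable by blast
        have "Lq_dt_over_t q (\<lambda>t. ennreal (cmod ((f \<star> dilate a (\<phi> l) t) x)))
          = epowr (\<integral>\<^sup>+t. epowr (ennreal (cmod ((f \<star> dilate a (\<phi> l) t) x))) q \<partial>dt_over_t) (1 / q)" for x
          by (rule Lq_dt_over_t_eq[OF _ refl]) measurable
        then show ?thesis by (simp add: Lp_weighted_eq_lborel[OF w'(1)] J_def del: epowr_ennreal)
      qed
      have "Lq_dt_over_t q (\<lambda>t. peetre_max (\<odot>) \<rho> N (1 / t) (f \<star> dilate a \<psi> t) x)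
        = epowr (\<integral>\<^sup>+t. epowr (Pm N f \<psi> t x) q \<partial>dt_over_t) (1 / q)" for x
        by (rule Lq_dt_over_t_eq) (auto simp: Pm_eq_peetre_max[OF f \<psi>(1)] intro!: measurable_Pm)
      then have "Lp_weighted p w (\<lambda>x. Lq_dt_over_t q (\<lambda>t. peetre_max (\<odot>) \<rho> N (1 / t) (f \<star> dilate a \<psi> t) x))
        = epowr (\<integral>\<^sup>+x. epowr (\<integral>\<^sup>+t. epowr (Pm N f \<psi> t x) q \<partial>dt_over_t) (p / q) * ennreal (w' x) \<partial>lborel) (1 / p)"
        by (simp add: Lp_weighted_eq_lborel[OF w'(1)])
      also have "\<dots> \<le> epowr (ennreal C * (\<Sum>l=1..M. J l)) (1 / p)"
        using pq unfolding J_def by (intro epowr_mono C(2) f) auto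
      also have "\<dots> = ennreal (C powr (1 / p)) * epowr (\<Sum>l=1..M. J l) (1 / p)"
        using pq C(1) by (simp add: epowr_mult)
      also have "\<dots> \<le> ennreal (C powr (1 / p)) * (ennreal (real M powr (1 / p)) * (\<Sum>l=1..M. epowr (J l) (1 / p)))"
        using epowr_sum_le[of "{1..M}" "1 / p" J] pq by (intro mult_left_mono) auto
      also have "\<dots> = ennreal c * (\<Sum>l=1..M. epowr (J l) (1 / p))"
        by (simp add: c_def ennreal_mult mult.assoc)
      also have "\<dots> \<le> ennreal (c + 1) * (\<Sum>l=1..M. epowr (J l) (1 / p))"
        by (intro mult_right_mono ennreal_leI) auto
      finally show ?thesis by (simp add: J)
    qed
    then show ?thesis using c by (intro exI[of _ "c + 1"]) auto
  qed
qed

end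

theorem theorem4p6:
  fixes mul :: "real^'n::{finite,linorder} \<Rightarrow> real^'n::{finite,linorder} \<Rightarrow> real^'n::{finite,linorder}"
    and a :: "'n \<Rightarrow> real" and \<rho> :: "real^'n::{finite,linorder} \<Rightarrow> real"
    and N p q :: real and w :: "real^'n::{finite,linorder} \<Rightarrow> real" and M :: nat
    and \<phi> \<eta> :: "nat \<Rightarrow> real^'n::{finite,linorder} \<Rightarrow> complex" and \<psi> :: "real^'n::{finite,linorder} \<Rightarrow> complex"
  assumes "homogeneous_group_norm mul a \<rho>"
    and "N > 0" and "hom_dim a / N < p" and "hom_dim a / N < q" and "q \<ge> 1"
    and "w \<in> muckenhoupt mul \<rho> (p * N / hom_dim a)"
    and "\<And>l. l \<in> {1..M} \<Longrightarrow> \<phi> l \<in> schwartz \<and> (LINT x|lborel. \<phi> l x) = 0"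
    and "\<And>l. l \<in> {1..M} \<Longrightarrow> \<eta> l \<in> schwartz"
    and "tendsto_tempered
           (\<lambda>(\<epsilon>, B). function_distr (\<lambda>x. \<Sum>l=1..M. LINT t:{\<epsilon>..B}|lborel.
              (1 / t) *\<^sub>R convolve mul (dilate a (\<phi> l) t) (dilate a (\<eta> l) t) x))
           dirac_delta (at_right 0 \<times>\<^sub>F at_top)"
    and "\<exists>\<epsilon>>0. \<forall>k. \<forall>l\<in>{1..M}. \<forall>m\<in>{1..M}.
           (\<eta> m, left_deriv mul k (\<phi> l)) \<in> class_C1 mul a \<rho> (N + \<epsilon>) N"
    and "\<psi> \<in> schwartz" and "(LINT x|lborel. \<psi> x) = 0"
    and "\<exists>\<epsilon>>0. \<forall>l\<in>{1..M}. (\<eta> l, \<psi>) \<in> class_C1 mul a \<rho> (N + \<epsilon>) N"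
  shows "\<exists>C>0. \<forall>f\<in>schwartz.
    Lp_weighted p w (\<lambda>x. Lq_dt_over_t q (\<lambda>t. peetre_max mul \<rho> N (1 / t) (convolve mul f (dilate a \<psi> t)) x))
    \<le> ennreal C * (\<Sum>l=1..M.
        Lp_weighted p w (\<lambda>x. Lq_dt_over_t q (\<lambda>t. ennreal (cmod (convolve mul f (dilate a (\<phi> l) t) x)))))"
proof -
  interpret homogeneous_group_norm mul a \<rho> by fact
  from assms(10) obtain \<epsilon> where \<epsilon>: "\<epsilon> > 0"
    "\<And>k l m. l \<in> {1..M} \<Longrightarrow> m \<in> {1..M} \<Longrightarrow> (\<eta> m, left_deriv mul k (\<phi> l)) \<in> class_C1 mul a \<rho> (N + \<epsilon>) N"
    by blast
  from assms(13) obtain \<epsilon>' where \<epsilon>': "\<epsilon>' > 0"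
    "\<And>l. l \<in> {1..M} \<Longrightarrow> (\<eta> l, \<psi>) \<in> class_C1 mul a \<rho> (N + \<epsilon>') N"
    by blast
  show ?thesis
    by (rule peetre_max_norm_weighted[OF assms(2-8) reproducing_formula[OF assms(7-9)] \<epsilon> schwartz_rapid[OF assms(11)] assms(12) \<epsilon>'])
qed

end
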